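(* Let $F=\mathbb{R}((X))((Y))$, and define the quaternion algebras $D_1=\left(\frac{X,-1}{F}\right)$ and $D_2=\left(\frac{-X,Y}{F}\right)$. Let $D$ be the biquaternion algebra $D_1\otimes_F D_2$. Then $D$ is a non-cyclic division algebra of dimension $16$ over $F$ and of dp-rank $16$.
   Context: $\mathbb{R}((X))((Y))$ is the field of Laurent series in $Y$ over the field $\mathbb{R}((X))$ of Laurent series in $X$ over the reals, considered as a structure in the language of rings. Quaternion algebras: for a field $F$ of characteristic not $2$ and $u,v\in F^\times$, $\left(\frac{u,v}{F}\right)$ is the $4$-dimensional $F$-algebra with basis $1,i,j,ij$ and multiplication determined by $i^2=u$, $j^2=v$, $ij=-ji$. Cyclic algebras: Let $K/F$ be a cyclic (Galois) field extension of degree $n$, $\sigma_0$ a generator of $\mathrm{Gal}(K/F)$ and $\alpha\in F\setminus\{0\}$. The cyclic algebra $(K/F,\sigma_0,\alpha)$ is the $K$-vector space $K\cdot 1\oplus K\cdot Z\oplus\cdots\oplus K\cdot Z^{n-1}$ with multiplication determined by $Z^n=\alpha$ and $Z\cdot b=\sigma_0(b)Z$ for all $b\in K$, extended by distributivity; it is an $F$-algebra of dimension $n^2$ with center $F$. An algebra with center $F$ is non-cyclic if it is not isomorphic as an $F$-algebra to any cyclic algebra $(K/F,\sigma_0,\alpha)$. dp-rank: Let $S$ be a definable set in a structure $M$ (with parameters). An ict-pattern of depth $\kappa$ in $S$ consists of formulas $\varphi_i(x,y_i)$ ($i<\kappa$) and parameters $(b_{i,j})_{i<\kappa,\,j<\omega}$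 in an elementary extension of $M$ such that for every $\eta:\kappa\to\omega$ the set $\{x\in S\}\cup\{\varphi_i(x,b_{i,\eta(i)}) : i<\kappa\}\cup\{\neg\varphi_i(x,b_{i,j}) : i<\kappa,\ j\neq\eta(i)\}$ is consistent. The dp-rank of $S$ is the supremum of the depths of ict-patterns in $S$. A finite-dimensional $F$-algebra $D$ with $\dim_F D=m$ is identified, via the choice of an $F$-basis, with the set $F^m$ equipped with a ring structure definable (with parameters) in the field $F$; the dp-rank of $D$ is the dp-rank of this definable structure. *)

theory Defs
  imports
    "HOL-Algebra.Algebra"
    "HOL-Algebra.Algebraic_Closure_Type"
    "HOL-Computational_Algebra.Formal_Laurent_Series"
    "HOL-Library.Extended_Nat"
begin

section \<open>Associative algebras\<close>

text \<open>An \<open>F\<close>-algebra is a (not necessarily commutative) ring that is also an \<open>F\<close>-module, the two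
  structures being compatible. The library locale for algebras requires commutativity.\<close>

definition assoc_algebra :: "('a, 'b) ring_scheme \<Rightarrow> ('a, 'v, 'c) module_scheme \<Rightarrow> bool" where
  "assoc_algebra F A \<longleftrightarrow> module F A \<and> ring A \<and>
     (\<forall>c\<in>carrier F. \<forall>x\<in>carrier A. \<forall>y\<in>carrier A.
        (c \<odot>\<^bsub>A\<^esub> x) \<otimes>\<^bsub>A\<^esub> y = c \<odot>\<^bsub>A\<^esub> (x \<otimes>\<^bsub>A\<^esub> y) \<and>
        x \<otimes>\<^bsub>A\<^esub> (c \<odot>\<^bsub>A\<^esub> y) = c \<odot>\<^bsub>A\<^esub> (x \<otimes>\<^bsub>A\<^esub> y))"

definition algebra_iso ::
  "('a, 'b) ring_scheme \<Rightarrow> ('a, 'v, 'c) module_scheme \<Rightarrow> ('a, 'w, 'd) module_scheme \<Rightarrow> ('v \<Rightarrow> 'w) set"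
  where
  "algebra_iso F A B =
     {h \<in> ring_iso A B. \<forall>c\<in>carrier F. \<forall>x\<in>carrier A. h (c \<odot>\<^bsub>A\<^esub> x) = c \<odot>\<^bsub>B\<^esub> h x}"

text \<open>The copy \<open>F \<cdot> 1\<close> of \<open>F\<close> inside an \<open>F\<close>-algebra. As \<open>c \<odot> x = (c \<odot> \<one>) \<otimes> x\<close>, the dimension
  \<^term>\<open>ring.dimension\<close> over this subfield is the dimension as an \<open>F\<close>-vector space.\<close>

definition scalars :: "('a, 'b) ring_scheme \<Rightarrow> ('a, 'v, 'c) module_scheme \<Rightarrow> 'v set" where
  "scalars F A = (\<lambda>c. c \<odot>\<^bsub>A\<^esub> \<one>\<^bsub>A\<^esub>) ` carrier F"

definition ring_center :: "('v, 'c) ring_scheme \<Rightarrow> 'v set" where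
  "ring_center A = {z \<in> carrier A. \<forall>x\<in>carrier A. z \<otimes>\<^bsub>A\<^esub> x = x \<otimes>\<^bsub>A\<^esub> z}"

definition division_algebra :: "('a, 'b) ring_scheme \<Rightarrow> ('a, 'v, 'c) module_scheme \<Rightarrow> bool" where
  "division_algebra F A \<longleftrightarrow>
     assoc_algebra F A \<and> \<one>\<^bsub>A\<^esub> \<noteq> \<zero>\<^bsub>A\<^esub> \<and> Units A = carrier A - {\<zero>\<^bsub>A\<^esub>}"


section \<open>Cyclic algebras\<close>

text \<open>\<open>K/F\<close> is a Galois extension of degree \<open>n\<close> (the field fixed by all \<open>F\<close>-automorphisms is \<open>F\<close>)
  whose Galois group is generated by \<open>\<sigma>\<close>. Functions on \<open>K\<close> matter only on the carrier of \<open>K\<close>;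
  the group being finite, nonnegative powers of \<open>\<sigma>\<close> suffice.\<close>

definition cyclic_extension ::
  "('a, 'b) ring_scheme \<Rightarrow> ('a, 'k, 'c) module_scheme \<Rightarrow> nat \<Rightarrow> ('k \<Rightarrow> 'k) \<Rightarrow> bool" where
  "cyclic_extension F K n \<sigma> \<longleftrightarrow>
     field F \<and> field K \<and> assoc_algebra F K \<and>
     ring.dimension K n (scalars F K) (carrier K) \<and>
     (\<forall>x\<in>carrier K. (\<forall>\<tau>\<in>algebra_iso F K K. \<tau> x = x) \<longrightarrow> x \<in> scalars F K) \<and>
     \<sigma> \<in> algebra_iso F K K \<and>
     (\<forall>\<tau>\<in>algebra_iso F K K. \<exists>k. \<forall>x\<in>carrier K. \<tau> x = (\<sigma> ^^ k) x)"

text \<open>The tuple \<open>f\<close> stands for \<open>\<Sum>i<n. f i \<cdot> Z\<^sup>i\<close>; the product comes from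
  \<open>b Z\<^sup>i \<cdot> c Z\<^sup>j = b \<sigma>\<^sup>i(c) Z\<^sup>i\<^sup>+\<^sup>j\<close> and \<open>Z\<^sup>n = \<alpha>\<close>.\<close>

definition cyclic_algebra ::
  "('a, 'k, 'c) module_scheme \<Rightarrow> nat \<Rightarrow> ('k \<Rightarrow> 'k) \<Rightarrow> 'a \<Rightarrow> ('a, nat \<Rightarrow> 'k) module" where
  "cyclic_algebra K n \<sigma> \<alpha> =
     \<lparr>carrier = {..<n} \<rightarrow>\<^sub>E carrier K,
      monoid.mult = (\<lambda>f g. \<lambda>k\<in>{..<n}.
        \<Oplus>\<^bsub>K\<^esub>i\<in>{..<n}.
          (if i \<le> k then f i \<otimes>\<^bsub>K\<^esub> (\<sigma> ^^ i) (g (k - i))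
           else \<alpha> \<odot>\<^bsub>K\<^esub> (f i \<otimes>\<^bsub>K\<^esub> (\<sigma> ^^ i) (g (n + k - i))))),
      one = (\<lambda>k\<in>{..<n}. if k = 0 then \<one>\<^bsub>K\<^esub> else \<zero>\<^bsub>K\<^esub>),
      ring.zero = (\<lambda>k\<in>{..<n}. \<zero>\<^bsub>K\<^esub>),
      add = (\<lambda>f g. \<lambda>k\<in>{..<n}. f k \<oplus>\<^bsub>K\<^esub> g k),
      module.smult = (\<lambda>c f. \<lambda>k\<in>{..<n}. c \<odot>\<^bsub>K\<^esub> f k)\<rparr>"

text \<open>The type argument is the type carrying the fields \<open>K\<close>. Results about it are meant to be stated
  for an arbitrary type \<open>'k\<close>, so that all extensions \<open>K/F\<close> are covered.\<close>

definition is_cyclic_algebra ::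
  "'k itself \<Rightarrow> ('a, 'b) ring_scheme \<Rightarrow> ('a, 'v, 'c) module_scheme \<Rightarrow> bool" where
  "is_cyclic_algebra T F A \<longleftrightarrow>
     (\<exists>(K :: ('a, 'k) module) n \<sigma> \<alpha>.
        cyclic_extension F K n \<sigma> \<and> \<alpha> \<in> carrier F - {\<zero>\<^bsub>F\<^esub>} \<and>
        algebra_iso F A (cyclic_algebra K n \<sigma> \<alpha>) \<noteq> {})"

definition noncyclic_algebra ::
  "'k itself \<Rightarrow> ('a, 'b) ring_scheme \<Rightarrow> ('a, 'v, 'c) module_scheme \<Rightarrow> bool" where
  "noncyclic_algebra T F A \<longleftrightarrow> ring_center A = scalars F A \<and> \<not> is_cyclic_algebra T F A"


section \<open>Quaternion algebras and tensor products\<close>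

text \<open>Algebras whose underlying vector space is the coordinate space \<open>F\<^sup>I\<close>, for a finite type \<open>I\<close> and
  a field \<open>F\<close> given as a type.\<close>

definition coord_algebra ::
  "('i \<Rightarrow> 'a) \<Rightarrow> (('i \<Rightarrow> 'a) \<Rightarrow> ('i \<Rightarrow> 'a) \<Rightarrow> ('i \<Rightarrow> 'a)) \<Rightarrow> ('a::field, 'i \<Rightarrow> 'a) module" where
  "coord_algebra e m =
     \<lparr>carrier = UNIV, monoid.mult = m, one = e, ring.zero = (\<lambda>_. 0), add = (\<lambda>x y i. x i + y i),
      module.smult = (\<lambda>c x i. c * x i)\<rparr>"

definition unit_vec :: "'i \<Rightarrow> 'i \<Rightarrow> 'a::field" where
  "unit_vec i = (\<lambda>k. if k = i then 1 else 0)"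

datatype quat_basis = Q1 | QI | QJ | QIJ

lemma UNIV_quat_basis: "UNIV = {Q1, QI, QJ, QIJ}"
  by (auto intro: quat_basis.exhaust)

instance quat_basis :: finite
  by standard (simp add: UNIV_quat_basis)

definition quaternion_algebra :: "'a \<Rightarrow> 'a \<Rightarrow> ('a::field, quat_basis \<Rightarrow> 'a) module" where
  "quaternion_algebra u v = coord_algebra (unit_vec Q1) (\<lambda>x y q. case q of
       Q1 \<Rightarrow> x Q1 * y Q1 + u * x QI * y QI + v * x QJ * y QJ - u * v * x QIJ * y QIJ
     | QI \<Rightarrow> x Q1 * y QI + x QI * y Q1 - v * x QJ * y QIJ + v * x QIJ * y QJ
     | QJ \<Rightarrow> x Q1 * y QJ + x QJ * y Q1 + u * x QI * y QIJ - u * x QIJ * y QI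
     | QIJ \<Rightarrow> x Q1 * y QIJ + x QIJ * y Q1 + x QI * y QJ - x QJ * y QI)"

text \<open>The tensor product of two coordinate algebras has the basis \<open>e\<^sub>i \<otimes> e\<^sub>j\<close>, with
  \<open>(e\<^sub>i \<otimes> e\<^sub>j) \<cdot> (e\<^sub>i\<^sub>' \<otimes> e\<^sub>j\<^sub>') = e\<^sub>i e\<^sub>i\<^sub>' \<otimes> e\<^sub>j e\<^sub>j\<^sub>'\<close>. The lemmas below show that it is the usual one: it has the
  universal property for bilinear maps, and \<open>(a \<otimes> b) \<cdot> (a' \<otimes> b') = a a' \<otimes> b b'\<close> for all elements.\<close>

definition pure_tensor :: "('i \<Rightarrow> 'a) \<Rightarrow> ('j \<Rightarrow> 'a) \<Rightarrow> ('i \<times> 'j \<Rightarrow> 'a::field)" where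
  "pure_tensor a b = (\<lambda>(i, j). a i * b j)"

definition tensor_algebra ::
  "('a::field, 'i::finite \<Rightarrow> 'a) module \<Rightarrow> ('a, 'j::finite \<Rightarrow> 'a) module \<Rightarrow> ('a, 'i \<times> 'j \<Rightarrow> 'a) module"
  where
  "tensor_algebra A B = coord_algebra (pure_tensor \<one>\<^bsub>A\<^esub> \<one>\<^bsub>B\<^esub>)
     (\<lambda>x y k. \<Sum>(i, j)\<in>UNIV. \<Sum>(i', j')\<in>UNIV.
        x (i, j) * y (i', j') *
        pure_tensor (unit_vec i \<otimes>\<^bsub>A\<^esub> unit_vec i') (unit_vec j \<otimes>\<^bsub>B\<^esub> unit_vec j') k)"

subsection \<open>Sanity checks\<close>

abbreviation type_field :: "'a::field ring" where
  "type_field \<equiv> ring_of_type_algebra"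

lemma module_coord_algebra: "module type_field (coord_algebra e m)"
proof (rule moduleI)
  show "cring (type_field :: 'a ring)" by (rule cring_from_type_algebra)
  have "\<exists>y. \<forall>i. y i + x i = 0" for x :: "'i \<Rightarrow> 'a"
    by (rule exI[of _ "\<lambda>i. - x i"]) simp
  then show "abelian_group (coord_algebra e m)"
    by (intro abelian_groupI)
      (auto simp: coord_algebra_def fun_eq_iff algebra_simps)
qed (auto simp: coord_algebra_def ring_of_type_algebra_def algebra_simps)

lemma assoc_algebra_quaternion: "assoc_algebra type_field (quaternion_algebra u v)"
proof -
  interpret module type_field "quaternion_algebra u v"
    unfolding quaternion_algebra_def by (rule module_coord_algebra)
  have "ring (quaternion_algebra u v)"
    by (intro ringI M.abelian_group_axioms monoidI)
       (auto simp: quaternion_algebra_def coord_algebra_def unit_vec_def fun_eq_iff algebra_simps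
             split: quat_basis.splits)
  then show ?thesis
    unfolding assoc_algebra_def using module_axioms
    by (auto simp: quaternion_algebra_def coord_algebra_def fun_eq_iff algebra_simps
             split: quat_basis.splits)
qed

lemma quaternion_relations:
  fixes u v :: "'a::field"
  defines "Q \<equiv> quaternion_algebra u v"
  shows "unit_vec QI \<otimes>\<^bsub>Q\<^esub> unit_vec QI = u \<odot>\<^bsub>Q\<^esub> \<one>\<^bsub>Q\<^esub>"
    and "unit_vec QJ \<otimes>\<^bsub>Q\<^esub> unit_vec QJ = v \<odot>\<^bsub>Q\<^esub> \<one>\<^bsub>Q\<^esub>"
    and "unit_vec QI \<otimes>\<^bsub>Q\<^esub> unit_vec QJ = unit_vec QIJ"
    and "unit_vec QJ \<otimes>\<^bsub>Q\<^esub> unit_vec QI = \<ominus>\<^bsub>Q\<^esub> unit_vec QIJ"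
    and "\<one>\<^bsub>Q\<^esub> = unit_vec Q1"
proof -
  interpret module type_field Q
    unfolding Q_def quaternion_algebra_def by (rule module_coord_algebra)
  have neg: "\<ominus>\<^bsub>Q\<^esub> x = (\<lambda>i. - x i)" for x
    by (rule M.minus_equality)
       (auto simp: Q_def quaternion_algebra_def coord_algebra_def)
  note d = Q_def quaternion_algebra_def coord_algebra_def unit_vec_def fun_eq_iff
  show "unit_vec QI \<otimes>\<^bsub>Q\<^esub> unit_vec QI = u \<odot>\<^bsub>Q\<^esub> \<one>\<^bsub>Q\<^esub>"
    "unit_vec QJ \<otimes>\<^bsub>Q\<^esub> unit_vec QJ = v \<odot>\<^bsub>Q\<^esub> \<one>\<^bsub>Q\<^esub>"
    "unit_vec QI \<otimes>\<^bsub>Q\<^esub> unit_vec QJ = unit_vec QIJ"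
    "\<one>\<^bsub>Q\<^esub> = unit_vec Q1"
    by (auto simp: d split: quat_basis.splits)
  show "unit_vec QJ \<otimes>\<^bsub>Q\<^esub> unit_vec QI = \<ominus>\<^bsub>Q\<^esub> unit_vec QIJ"
    unfolding neg by (auto simp: d split: quat_basis.splits)
qed

lemma sum_unit_vec: "(\<lambda>k. \<Sum>i\<in>UNIV. a i * unit_vec i k) = (a :: 'i::finite \<Rightarrow> 'a::field)"
  by (simp add: unit_vec_def fun_eq_iff if_distrib sum.delta' cong: if_cong)

lemma linear_coord_expand:
  fixes f :: "('i::finite \<Rightarrow> 'a::field) \<Rightarrow> 'k \<Rightarrow> 'a"
  assumes add: "\<And>x y. f (\<lambda>i. x i + y i) = (\<lambda>k. f x k + f y k)"
    and scale: "\<And>c x. f (\<lambda>i. c * x i) = (\<lambda>k. c * f x k)"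
  shows "f a k = (\<Sum>i\<in>UNIV. a i * f (unit_vec i) k)"
proof -
  have "f (\<lambda>k. \<Sum>i\<in>S. a i * unit_vec i k) = (\<lambda>k. \<Sum>i\<in>S. a i * f (unit_vec i) k)"
    if "finite S" for S
    using that
  proof induction
    case empty
    have "f (\<lambda>_. 0) = (\<lambda>_. 0)"
      using scale[of 0 "\<lambda>_. 0"] by simp
    then show ?case by simp
  next
    case (insert i S)
    then show ?case
      using add[of "\<lambda>k. a i * unit_vec i k" "\<lambda>k. \<Sum>i\<in>S. a i * unit_vec i k"]
      by (simp add: scale)
  qed
  from this[of UNIV] show ?thesis
    by (simp add: sum_unit_vec fun_eq_iff)
qed

lemma coord_algebra_mult_expand:
  fixes A :: "('a::field, 'i::finite \<Rightarrow> 'a) module"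
  assumes A: "assoc_algebra type_field A" "A = coord_algebra e m"
  shows "(a \<otimes>\<^bsub>A\<^esub> b) k =
    (\<Sum>i\<in>UNIV. \<Sum>i'\<in>UNIV. a i * b i' * (unit_vec i \<otimes>\<^bsub>A\<^esub> unit_vec i') k)"
proof -
  interpret ring A using A(1) by (simp add: assoc_algebra_def)
  have carr: "carrier A = UNIV" and add: "add A = (\<lambda>x y i. x i + y i)"
    and sm: "module.smult A = (\<lambda>c x i. c * x i)"
    by (simp_all add: A(2) coord_algebra_def)
  have hom: "(\<lambda>i. c * x i) \<otimes>\<^bsub>A\<^esub> y = (\<lambda>i. c * (x \<otimes>\<^bsub>A\<^esub> y) i)"
            "x \<otimes>\<^bsub>A\<^esub> (\<lambda>i. c * y i) = (\<lambda>i. c * (x \<otimes>\<^bsub>A\<^esub> y) i)" for c x y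
    using A(1) by (auto simp: assoc_algebra_def carr sm ring_of_type_algebra_def)
  have l: "(a \<otimes>\<^bsub>A\<^esub> b) k = (\<Sum>i\<in>UNIV. a i * (unit_vec i \<otimes>\<^bsub>A\<^esub> b) k)"
    by (rule linear_coord_expand[of "\<lambda>a. a \<otimes>\<^bsub>A\<^esub> b"])
       (use l_distr hom in \<open>auto simp: carr add\<close>)
  have r: "(x \<otimes>\<^bsub>A\<^esub> b) k = (\<Sum>i\<in>UNIV. b i * (x \<otimes>\<^bsub>A\<^esub> unit_vec i) k)" for x
    by (rule linear_coord_expand[of "\<lambda>b. x \<otimes>\<^bsub>A\<^esub> b"])
       (use r_distr hom in \<open>auto simp: carr add\<close>)
  show ?thesis
    unfolding l r[of "unit_vec _"] by (simp add: sum_distrib_left mult.assoc)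
qed

lemma pure_tensor_mult:
  fixes A :: "('a::field, 'i::finite \<Rightarrow> 'a) module" and B :: "('a, 'j::finite \<Rightarrow> 'a) module"
  assumes A: "assoc_algebra type_field A" "A = coord_algebra e m"
    and B: "assoc_algebra type_field B" "B = coord_algebra e' m'"
  shows "pure_tensor a b \<otimes>\<^bsub>tensor_algebra A B\<^esub> pure_tensor a' b' =
           pure_tensor (a \<otimes>\<^bsub>A\<^esub> a') (b \<otimes>\<^bsub>B\<^esub> b')"
proof (rule ext, clarify)
  fix k l
  let ?c = "\<lambda>i i'. (unit_vec i \<otimes>\<^bsub>A\<^esub> unit_vec i') k"
  let ?d = "\<lambda>j j'. (unit_vec j \<otimes>\<^bsub>B\<^esub> unit_vec j') l"
  have "(pure_tensor a b \<otimes>\<^bsub>tensor_algebra A B\<^esub> pure_tensor a' b') (k, l) =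
      (\<Sum>(i, j)\<in>UNIV. \<Sum>(i', j')\<in>UNIV. (a i * a' i' * ?c i i') * (b j * b' j' * ?d j j'))"
    by (simp add: tensor_algebra_def coord_algebra_def pure_tensor_def case_prod_beta mult_ac)
  also have "\<dots> = (\<Sum>i\<in>UNIV. \<Sum>j\<in>UNIV. \<Sum>i'\<in>UNIV. \<Sum>j'\<in>UNIV.
      (a i * a' i' * ?c i i') * (b j * b' j' * ?d j j'))"
    by (simp only: UNIV_Times_UNIV[symmetric] sum.cartesian_product[symmetric])
  also have "\<dots> = (\<Sum>i\<in>UNIV. \<Sum>i'\<in>UNIV. \<Sum>j\<in>UNIV. \<Sum>j'\<in>UNIV.
      (a i * a' i' * ?c i i') * (b j * b' j' * ?d j j'))"
    by (intro sum.cong refl sum.swap)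
  also have "\<dots> = (a \<otimes>\<^bsub>A\<^esub> a') k * (b \<otimes>\<^bsub>B\<^esub> b') l"
    unfolding coord_algebra_mult_expand[OF A, of a] coord_algebra_mult_expand[OF B, of b]
    by (simp only: sum_distrib_right) (simp only: sum_distrib_left)
  finally show "(pure_tensor a b \<otimes>\<^bsub>tensor_algebra A B\<^esub> pure_tensor a' b') (k, l) =
      pure_tensor (a \<otimes>\<^bsub>A\<^esub> a') (b \<otimes>\<^bsub>B\<^esub> b') (k, l)"
    by (simp add: pure_tensor_def)
qed

lemma pure_tensor_unit_vec: "pure_tensor (unit_vec i) (unit_vec j) = unit_vec (i, j)"
  by (auto simp: pure_tensor_def unit_vec_def fun_eq_iff)

lemma tensor_universal:
  fixes M :: "('a::field, 'w) module" and \<beta> :: "('i::finite \<Rightarrow> 'a) \<Rightarrow> ('j::finite \<Rightarrow> 'a) \<Rightarrow> 'w"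
  assumes M: "module type_field M"
    and closed: "\<And>a b. \<beta> a b \<in> carrier M"
    and add1: "\<And>a a' b. \<beta> (\<lambda>i. a i + a' i) b = \<beta> a b \<oplus>\<^bsub>M\<^esub> \<beta> a' b"
    and add2: "\<And>a b b'. \<beta> a (\<lambda>j. b j + b' j) = \<beta> a b \<oplus>\<^bsub>M\<^esub> \<beta> a b'"
    and smult1: "\<And>c a b. \<beta> (\<lambda>i. c * a i) b = c \<odot>\<^bsub>M\<^esub> \<beta> a b"
    and smult2: "\<And>c a b. \<beta> a (\<lambda>j. c * b j) = c \<odot>\<^bsub>M\<^esub> \<beta> a b"
  shows "\<exists>!g. (\<forall>t. g t \<in> carrier M) \<and> (\<forall>s t. g (\<lambda>k. s k + t k) = g s \<oplus>\<^bsub>M\<^esub> g t) \<and>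
           (\<forall>c t. g (\<lambda>k. c * t k) = c \<odot>\<^bsub>M\<^esub> g t) \<and> (\<forall>a b. g (pure_tensor a b) = \<beta> a b)"
proof -
  interpret module type_field M by fact
  have [simp]: "c \<odot>\<^bsub>M\<^esub> x \<in> carrier M" if "x \<in> carrier M" for c x
    using smult_closed[of c x] that by (simp add: ring_of_type_algebra_def)
  have sm: "c \<odot>\<^bsub>M\<^esub> (x \<oplus>\<^bsub>M\<^esub> y) = c \<odot>\<^bsub>M\<^esub> x \<oplus>\<^bsub>M\<^esub> c \<odot>\<^bsub>M\<^esub> y"
    if "x \<in> carrier M" "y \<in> carrier M" for c x y
    using that smult_r_distr[of c x y] by (simp add: ring_of_type_algebra_def)
  have sm': "(c + d) \<odot>\<^bsub>M\<^esub> x = c \<odot>\<^bsub>M\<^esub> x \<oplus>\<^bsub>M\<^esub> d \<odot>\<^bsub>M\<^esub> x" "(c * d) \<odot>\<^bsub>M\<^esub> x = c \<odot>\<^bsub>M\<^esub> (d \<odot>\<^bsub>M\<^esub> x)"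
    if "x \<in> carrier M" for c d x
    using that smult_l_distr[of c d x] smult_assoc1[of c d x]
    by (simp_all add: ring_of_type_algebra_def)
  have sm0: "0 \<odot>\<^bsub>M\<^esub> x = \<zero>\<^bsub>M\<^esub>" if "x \<in> carrier M" for x
    using smult_l_null[OF that] by (simp add: ring_of_type_algebra_def)
  have expand: "f t = (\<Oplus>\<^bsub>M\<^esub>k\<in>UNIV. t k \<odot>\<^bsub>M\<^esub> f (unit_vec k))"
    if f: "\<And>t. f t \<in> carrier M" "\<And>s t. f (\<lambda>k. s k + t k) = f s \<oplus>\<^bsub>M\<^esub> f t"
      "\<And>c t. f (\<lambda>k. c * t k) = c \<odot>\<^bsub>M\<^esub> f t"
    for f :: "('l::finite \<Rightarrow> 'a) \<Rightarrow> 'w" and t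
  proof -
    have "f (\<lambda>k. \<Sum>i\<in>S. t i * unit_vec i k) = (\<Oplus>\<^bsub>M\<^esub>k\<in>S. t k \<odot>\<^bsub>M\<^esub> f (unit_vec k))"
      if "finite S" for S
      using that
    proof induction
      case empty
      have "f (\<lambda>_. 0) = \<zero>\<^bsub>M\<^esub>"
        using f(3)[of 0 "\<lambda>_. 0"] sm0[OF f(1)] by simp
      then show ?case by simp
    next
      case (insert i S)
      then show ?case
        using f(2)[of "\<lambda>k. t i * unit_vec i k" "\<lambda>k. \<Sum>i\<in>S. t i * unit_vec i k"]
        by (simp add: f Pi_def)
    qed
    from this[of UNIV] show ?thesis by (simp add: sum_unit_vec)
  qed
  define g where "g t = (\<Oplus>\<^bsub>M\<^esub>k\<in>UNIV. t k \<odot>\<^bsub>M\<^esub> \<beta> (unit_vec (fst k)) (unit_vec (snd k)))" for t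
  have g_closed: "g t \<in> carrier M" for t
    unfolding g_def using closed by (intro M.finsum_closed) simp
  have g_add: "g (\<lambda>k. s k + t k) = g s \<oplus>\<^bsub>M\<^esub> g t" for s t
    unfolding g_def using closed by (subst M.finsum_addf[symmetric]) (simp_all add: sm'(1))
  have g_smult: "g (\<lambda>k. c * t k) = c \<odot>\<^bsub>M\<^esub> g t" for c t
    unfolding g_def using closed
    by (subst finsum_smult_ldistr) (simp_all add: sm'(2), simp_all add: ring_of_type_algebra_def)
  note g = g_closed g_add g_smult
  have gu: "g (unit_vec (i, j)) = \<beta> (unit_vec i) (unit_vec j)" for i j
  proof -
    have "g (unit_vec (i, j)) = (\<Oplus>\<^bsub>M\<^esub>k\<in>UNIV. if (i, j) = k
        then \<beta> (unit_vec (fst k)) (unit_vec (snd k)) else \<zero>\<^bsub>M\<^esub>)"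
      unfolding g_def using closed smult_one sm0
      by (intro M.finsum_cong') (auto simp: unit_vec_def ring_of_type_algebra_def)
    also have "\<dots> = \<beta> (unit_vec i) (unit_vec j)"
      using M.finsum_singleton[of "(i, j)" UNIV "\<lambda>k. \<beta> (unit_vec (fst k)) (unit_vec (snd k))"]
      by (simp add: closed)
    finally show ?thesis .
  qed
  have gp: "g (pure_tensor a b) = \<beta> a b" for a b
  proof -
    have pt: "pure_tensor (\<lambda>i. x i + y i) b = (\<lambda>k. pure_tensor x b k + pure_tensor y b k)"
      "pure_tensor (\<lambda>i. c * x i) b = (\<lambda>k. c * pure_tensor x b k)"
      for c x y and b :: "'j \<Rightarrow> 'a"
      by (auto simp: pure_tensor_def fun_eq_iff algebra_simps)
    have pt': "pure_tensor a (\<lambda>i. x i + y i) = (\<lambda>k. pure_tensor a x k + pure_tensor a y k)"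
      "pure_tensor a (\<lambda>i. c * x i) = (\<lambda>k. c * pure_tensor a x k)"
      for c x y and a :: "'i \<Rightarrow> 'a"
      by (auto simp: pure_tensor_def fun_eq_iff algebra_simps)
    have u: "g (pure_tensor (unit_vec i) b) = \<beta> (unit_vec i) b" for i
      using expand[of "\<lambda>b. g (pure_tensor (unit_vec i) b)" b] expand[of "\<beta> (unit_vec i)" b]
      by (simp add: g pt' closed add2 smult2 pure_tensor_unit_vec gu)
    show ?thesis
      using expand[of "\<lambda>a. g (pure_tensor a b)" a] expand[of "\<lambda>a. \<beta> a b" a]
      by (simp add: g pt closed add1 smult1 u)
  qed
  show ?thesis
  proof (rule ex1I[of _ g])
    fix h
    assume h: "(\<forall>t. h t \<in> carrier M) \<and> (\<forall>s t. h (\<lambda>k. s k + t k) = h s \<oplus>\<^bsub>M\<^esub> h t) \<and>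
      (\<forall>c t. h (\<lambda>k. c * t k) = c \<odot>\<^bsub>M\<^esub> h t) \<and> (\<forall>a b. h (pure_tensor a b) = \<beta> a b)"
    have eq: "h (unit_vec k) = g (unit_vec k)" for k
      using h gp by (cases k) (metis pure_tensor_unit_vec)
    show "h = g"
    proof
      fix t
      have "h t = (\<Oplus>\<^bsub>M\<^esub>k\<in>UNIV. t k \<odot>\<^bsub>M\<^esub> h (unit_vec k))"
        by (rule expand) (use h in blast)+
      also have "\<dots> = (\<Oplus>\<^bsub>M\<^esub>k\<in>UNIV. t k \<odot>\<^bsub>M\<^esub> g (unit_vec k))"
        by (simp only: eq)
      also have "\<dots> = g t"
        by (rule expand[symmetric]) (rule g)+
      finally show "h t = g t" .
    qed
  qed (use g gp in auto)
qed


section \<open>First-order logic in the language of rings\<close>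

datatype ring_term =
    Var nat | Zero | One | Minus ring_term | Plus ring_term ring_term | Times ring_term ring_term

datatype ring_formula =
    Eq ring_term ring_term | Not ring_formula | And ring_formula ring_formula
  | Ex nat ring_formula

primrec eval_term :: "('a, 'b) ring_scheme \<Rightarrow> (nat \<Rightarrow> 'a) \<Rightarrow> ring_term \<Rightarrow> 'a" where
  "eval_term M e (Var k) = e k"
| "eval_term M e Zero = \<zero>\<^bsub>M\<^esub>"
| "eval_term M e One = \<one>\<^bsub>M\<^esub>"
| "eval_term M e (Minus s) = \<ominus>\<^bsub>M\<^esub> eval_term M e s"
| "eval_term M e (Plus s t) = eval_term M e s \<oplus>\<^bsub>M\<^esub> eval_term M e t"
| "eval_term M e (Times s t) = eval_term M e s \<otimes>\<^bsub>M\<^esub> eval_term M e t"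

primrec sat :: "('a, 'b) ring_scheme \<Rightarrow> (nat \<Rightarrow> 'a) \<Rightarrow> ring_formula \<Rightarrow> bool" where
  "sat M e (Eq s t) \<longleftrightarrow> eval_term M e s = eval_term M e t"
| "sat M e (Not \<phi>) \<longleftrightarrow> \<not> sat M e \<phi>"
| "sat M e (And \<phi> \<psi>) \<longleftrightarrow> sat M e \<phi> \<and> sat M e \<psi>"
| "sat M e (Ex k \<phi>) \<longleftrightarrow> (\<exists>a\<in>carrier M. sat M (e(k := a)) \<phi>)"

text \<open>Elementary extensions \<open>N\<close> of \<open>M\<close>, with the elements of \<open>M\<close> tagged by \<^term>\<open>Inl\<close> and the
  remaining ones taken from an arbitrary further type \<open>'n\<close>: up to renaming the new elements, every
  elementary extension has this form for a suitable \<open>'n\<close>.\<close>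

definition elementary_extension :: "'a ring \<Rightarrow> ('a + 'n) ring \<Rightarrow> bool" where
  "elementary_extension M N \<longleftrightarrow> ring N \<and> Inl ` carrier M \<subseteq> carrier N \<and>
     (\<forall>\<phi> e. (\<forall>k. e k \<in> carrier M) \<longrightarrow> (sat M e \<phi> \<longleftrightarrow> sat N (Inl \<circ> e) \<phi>))"


section \<open>The dp-rank\<close>

text \<open>In a formula \<open>\<phi>(x, y)\<close> with \<open>x = (x\<^sub>0, \<dots>, x\<^bsub>m-1\<^esub>)\<close>, variables below \<open>m\<close> form the tuple \<open>x\<close>,
  all others form \<open>y\<close>. Parameter tuples are written as sequences, of which any formula uses only
  finitely many entries.\<close>

definition join_env :: "nat \<Rightarrow> (nat \<Rightarrow> 'a) \<Rightarrow> (nat \<Rightarrow> 'a) \<Rightarrow> nat \<Rightarrow> 'a" where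
  "join_env m x b = (\<lambda>k. if k < m then x k else b (k - m))"

text \<open>A set of formulas in \<open>x\<close> with parameters from \<open>N\<close> is consistent (with the elementary diagram of
  \<open>N\<close>) if all its finite subsets are satisfied in \<open>N\<close>.\<close>

definition consistent :: "'a ring \<Rightarrow> nat \<Rightarrow> (ring_formula \<times> (nat \<Rightarrow> 'a)) set \<Rightarrow> bool" where
  "consistent N m \<Sigma> \<longleftrightarrow>
     (\<forall>\<Sigma>0. finite \<Sigma>0 \<and> \<Sigma>0 \<subseteq> \<Sigma> \<longrightarrow>
        (\<exists>x\<in>{..<m} \<rightarrow> carrier N. \<forall>(\<psi>, p)\<in>\<Sigma>0. sat N (join_env m x p) \<psi>))"

text \<open>An ict-pattern of depth \<open>\<kappa>\<close> in the definable set
  \<open>S = {x \<in> M\<^sup>m. M \<Turnstile> \<theta>(x, c)}\<close>, with parameters in \<open>N\<close>.\<close>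

definition ict_pattern ::
  "'a ring \<Rightarrow> nat \<Rightarrow> ring_formula \<Rightarrow> (nat \<Rightarrow> 'a) \<Rightarrow> ('a + 'n) ring \<Rightarrow> enat \<Rightarrow>
   (nat \<Rightarrow> ring_formula) \<Rightarrow> (nat \<Rightarrow> nat \<Rightarrow> nat \<Rightarrow> 'a + 'n) \<Rightarrow> bool" where
  "ict_pattern M m \<theta> c N \<kappa> \<phi> b \<longleftrightarrow>
     elementary_extension M N \<and> (\<forall>i j k. b i j k \<in> carrier N) \<and>
     (\<forall>\<eta> :: nat \<Rightarrow> nat. consistent N m
        ({(\<theta>, Inl \<circ> c)} \<union>
         {(\<phi> i, b i (\<eta> i)) | i. enat i < \<kappa>} \<union>
         {(Not (\<phi> i), b i j) | i j. enat i < \<kappa> \<and> j \<noteq> \<eta> i}))"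

text \<open>Depths beyond \<open>\<omega>\<close> are not distinguished: a supremum of depths that is not a natural number is
  rendered as \<open>\<infinity>\<close>.\<close>

definition dp_rank :: "'n itself \<Rightarrow> 'a ring \<Rightarrow> nat \<Rightarrow> ring_formula \<Rightarrow> (nat \<Rightarrow> 'a) \<Rightarrow> enat" where
  "dp_rank T M m \<theta> c = Sup {\<kappa>. \<exists>(N :: ('a + 'n) ring) \<phi> b. ict_pattern M m \<theta> c N \<kappa> \<phi> b}"

text \<open>A choice of \<open>F\<close>-basis identifies an \<open>F\<close>-algebra of dimension \<open>m\<close> with the set \<open>F\<^sup>m\<close> (defined by
  \<open>0 = 0\<close>), carrying a ring structure definable in \<open>F\<close>; the dp-rank of the algebra is that of this
  definable set in the field \<open>F\<close>.\<close>

definition algebra_dp_rank :: "'n itself \<Rightarrow> 'a ring \<Rightarrow> ('a, 'v, 'c) module_scheme \<Rightarrow> enat" where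
  "algebra_dp_rank T F A =
     dp_rank T F (ring.dim A (scalars F A) (carrier A)) (Eq Zero Zero) (\<lambda>_. \<zero>\<^bsub>F\<^esub>)"

end

theory Submission
  imports Defs "HOL-Library.Ramsey"
begin

text \<open>
  The field \<open>F\<close> is ordered by the sign of the leading coefficient and carries a valuation with values
  in \<open>\<int> \<times> \<int>\<close> and residue field \<open>\<real>\<close>.

  Quantifier elimination: definable sets are Boolean combinations of conditions on the sign of
  \<open>p(x)\<close> and on its valuation modulo some \<open>n\<close>, for polynomials \<open>p\<close>. In one variable such a set depends
  only on finitely many Dedekind cuts and on the classes of \<open>x - c\<close> modulo \<open>n\<close>-th powers of positive
  elements, for finitely many definable \<open>c\<close>. For the upper bound on the dp-rank, start from Ramsey's
  theorem, which makes any number of rows of parameters mutually homogeneous. Adjoining one element of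
  \<open>F\<close> spoils the homogeneity of at most one row. A pattern of depth \<open>17\<close> in \<open>F\<^sup>1\<^sup>6\<close> would thus keep a
  homogeneous row after all sixteen coordinates of a realization have been adjoined, which is
  absurd. The formulas \<open>x\<^sub>i = y\<close> give the lower bound.

  \<open>D\<close> arises from \<open>D\<^sub>1\<close> by adjoining first \<open>i\<^sub>2\<close> and then \<open>j\<^sub>2\<close>. If \<open>S\<close> is a division ring and \<open>u\<close>
  induces an involution \<open>\<sigma>\<close> on \<open>S\<close>, then \<open>S + S u\<close> is a division ring as soon as \<open>u\<^sup>2 \<in> S\<close> is not of
  the form \<open>c \<sigma>(c)\<close>; here this is excluded by comparing signs and valuations.

  If \<open>D\<close> were cyclic, it would contain a cyclic extension of \<open>F\<close> of degree four. There is
  none, because \<open>F\<close> is pythagorean.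
\<close>

text \<open>Zeros of polynomials have to vary definably with the coefficients. They are therefore
  sought relative to zeros of derivatives: at a scale where none of these intervenes, the residue
  polynomial has no critical point on (0, 1], so Rolle's theorem, the intermediate value theorem and
  Hensel's lemma decide from signs and valuations whether there is a zero, and show that it is
  unique. Induction on the degree yields finitely many root functions. Away from the zeros of all
  derivatives a polynomial is, up to a positive unit, a monomial in the distance to one of them, and
  an existential quantifier reduces to finitely many test points in the value group. Conditions v(f)
  <= v(g) need no atoms of their own: they are parities of the valuation of
  \<open>f^2 + X g^2\<close>. Saturated models are avoided: a pattern of any finite width descends
  to F by one formula, and besides one row each coordinate costs a number of columns that is known
  in advance. That \<sigma> has order four in a cyclic presentation is read off from D: the fourth
  power is trivial by associativity, the square is not because the centre is F.\<close>

unbundle fps_syntax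

section \<open>The valuation on iterated Laurent series\<close>

type_synonym rxy = "real fls fls"

text \<open>The condition v(f) >= (a, b), phrased through coefficients: in this form it is additive
  at sight and needs no exception for f = 0.\<close>

definition ltail :: "rxy \<Rightarrow> int \<Rightarrow> int \<Rightarrow> bool" where
  "ltail f a b \<longleftrightarrow> (\<forall>i<a. f $$ i = 0) \<and> (\<forall>j<b. f $$ a $$ j = 0)"

text \<open>All three functions are 0 at f = 0, so the valuation alone does not tell 0 from a unit;
  only \<open>lc\<close> does.\<close>

definition vy :: "rxy \<Rightarrow> int" where "vy f = fls_subdegree f"
definition vx :: "rxy \<Rightarrow> int" where "vx f = fls_subdegree (f $$ fls_subdegree f)"
definition lc :: "rxy \<Rightarrow> real" where "lc f = f $$ vy f $$ vx f"

text \<open>The type \<^typ>\<open>int poly\<close> is an ordered ring in which the variable is infinitely large, so its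
  linear polynomials are a copy of \<open>\<int> \<times> \<int>\<close> with the lexicographic order.\<close>

definition vv :: "rxy \<Rightarrow> int poly" where "vv f = [:vx f, vy f:]"

lemma lin_less_iff: "[:b, a:] < [:b', a' :: int:] \<longleftrightarrow> a < a' \<or> a = a' \<and> b < b'"
  by (auto simp: less_poly_def pos_poly_pCons)

lemma lin_le_iff: "[:b, a:] \<le> [:b', a' :: int:] \<longleftrightarrow> a < a' \<or> a = a' \<and> b \<le> b'"
  by (auto simp: less_eq_poly_def pos_poly_pCons)

lemma lc_0 [simp]: "lc 0 = 0" by (simp add: lc_def)
lemma vx_0 [simp]: "vx 0 = 0" by (simp add: vx_def)
lemma vy_0 [simp]: "vy 0 = 0" by (simp add: vy_def)
lemma vv_0 [simp]: "vv 0 = 0" by (simp add: vv_def)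

lemma lc_eq_0_iff [simp]: "lc f = 0 \<longleftrightarrow> f = 0"
proof
  assume "lc f = 0"
  then have "f $$ fls_subdegree f = 0"
    using nth_fls_subdegree_nonzero[of "f $$ fls_subdegree f"] by (auto simp: lc_def vx_def vy_def)
  then show "f = 0" using nth_fls_subdegree_nonzero[of f] by auto
qed simp

lemma ltail_self: "ltail f (vy f) (vx f)"
  by (auto simp: ltail_def vy_def vx_def)

lemma lead_unique:
  assumes "ltail f a b" "f $$ a $$ b \<noteq> 0"
  shows "vy f = a" "vx f = b" "lc f = f $$ a $$ b"
proof -
  have a: "fls_subdegree f = a"
    using assms by (intro fls_subdegree_eqI) (auto simp: ltail_def)
  have b: "fls_subdegree (f $$ a) = b"
    using assms by (intro fls_subdegree_eqI) (auto simp: ltail_def)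
  show "vy f = a" "vx f = b" "lc f = f $$ a $$ b"
    by (simp_all add: vy_def vx_def lc_def a b)
qed

lemma ltail_iff: "ltail f a b \<longleftrightarrow> f = 0 \<or> [:b, a:] \<le> vv f"
proof
  assume t: "ltail f a b"
  show "f = 0 \<or> [:b, a:] \<le> vv f"
  proof (cases "f = 0")
    case False
    then have nz: "f $$ vy f $$ vx f \<noteq> 0" by (metis lc_def lc_eq_0_iff)
    have "\<not> vy f < a" using t nz by (auto simp: ltail_def)
    moreover have "\<not> (vy f = a \<and> vx f < b)" using t nz by (auto simp: ltail_def)
    ultimately show ?thesis by (auto simp: vv_def lin_le_iff)
  qed simp
next
  assume "f = 0 \<or> [:b, a:] \<le> vv f"
  then show "ltail f a b"
    using ltail_self[of f] by (auto simp: ltail_def vv_def lin_le_iff)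
qed

lemma ltail_add: "ltail f a b \<Longrightarrow> ltail g a b \<Longrightarrow> ltail (f + g) a b"
  by (simp add: ltail_def)

lemma ltail_nth0: "[:b, a:] < vv f \<Longrightarrow> f $$ a $$ b = 0"
  using ltail_self[of f] by (auto simp: ltail_def vv_def lin_less_iff)

lemma add_same:
  assumes "vv f = vv g" "lc f + lc g \<noteq> 0"
  shows "vv (f + g) = vv f" "lc (f + g) = lc f + lc g" "f + g \<noteq> 0"
proof -
  have g: "vy g = vy f" "vx g = vx f" using assms(1) by (auto simp: vv_def)
  have t: "ltail (f + g) (vy f) (vx f)"
    using ltail_add[OF ltail_self[of f]] ltail_self[of g] g by simp
  have n: "(f + g) $$ vy f $$ vx f = lc f + lc g" using g by (simp add: lc_def)
  show "vv (f + g) = vv f" "lc (f + g) = lc f + lc g"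
    using lead_unique[OF t] n assms(2) by (auto simp: vv_def)
  then show "f + g \<noteq> 0" using assms(2) by auto
qed

lemma add_less:
  assumes "f \<noteq> 0" "g = 0 \<or> vv f < vv g"
  shows "vv (f + g) = vv f" "lc (f + g) = lc f" "f + g \<noteq> 0"
proof -
  have t: "ltail (f + g) (vy f) (vx f)"
    using ltail_add[OF ltail_self[of f]] ltail_iff[of g "vy f" "vx f"] assms(2)
    by (auto simp: vv_def less_imp_le)
  have n: "(f + g) $$ vy f $$ vx f = lc f"
    using assms(2) ltail_nth0[of "vx f" "vy f" g] by (auto simp: lc_def vv_def)
  show "vv (f + g) = vv f" "lc (f + g) = lc f"
    using lead_unique[OF t] n assms(1) by (auto simp: vv_def)
  then show "f + g \<noteq> 0" using assms(1) by auto
qed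

text \<open>The bound is given as the value of some \<open>h\<close>, since \<open>ltail_iff\<close>
  speaks of linear polynomials and not of arbitrary elements of \<open>int poly\<close>.\<close>

lemma vv_add_ge:
  assumes "f = 0 \<or> vv h \<le> vv f" "g = 0 \<or> vv h \<le> vv g"
  shows "f + g = 0 \<or> vv h \<le> vv (f + g)"
  using ltail_add[of f "vy h" "vx h" g] assms unfolding ltail_iff by (simp add: vv_def)

lemma
  assumes "f \<noteq> 0" "g \<noteq> 0"
  shows vv_mult: "vv (f * g) = vv f + vv g" and lc_mult': "lc (f * g) = lc f * lc g"
proof -
  have y: "vy (f * g) = vy f + vy g" using assms by (simp add: vy_def)
  have top: "(f * g) $$ (fls_subdegree f + fls_subdegree g) = f $$ fls_subdegree f * g $$ fls_subdegree g"
    by (simp add: fls_times_base)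
  have x: "vx (f * g) = vx f + vx g"
    using assms top by (simp add: vx_def)
  show "vv (f * g) = vv f + vv g" by (simp add: vv_def x y)
  show "lc (f * g) = lc f * lc g"
    using assms top x by (simp add: lc_def y) (simp add: vx_def vy_def fls_times_base)
qed

lemma lc_mult [simp]: "lc (f * g) = lc f * lc g"
  by (cases "f = 0 \<or> g = 0") (auto simp: lc_mult')

lemma vx_mult: "f \<noteq> 0 \<Longrightarrow> g \<noteq> 0 \<Longrightarrow> vx (f * g) = vx f + vx g"
  and vy_mult: "f \<noteq> 0 \<Longrightarrow> g \<noteq> 0 \<Longrightarrow> vy (f * g) = vy f + vy g"
  using vv_mult[of f g] by (auto simp: vv_def)

lemma lc_uminus [simp]: "lc (- f) = - lc f"
  and vv_uminus [simp]: "vv (- f) = vv f"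
  and vx_uminus [simp]: "vx (- f) = vx f"
  and vy_uminus [simp]: "vy (- f) = vy f"
  by (auto simp: lc_def vx_def vy_def vv_def)

abbreviation cst :: "real \<Rightarrow> rxy" where "cst r \<equiv> fls_const (fls_const r)"

lemma cst_simps [simp]: "lc (cst r) = r" "vv (cst r) = 0" "vx (cst r) = 0" "vy (cst r) = 0"
  by (simp_all add: lc_def vv_def vx_def vy_def)

lemma one_simps [simp]: "lc 1 = 1" "vv 1 = 0" "vx 1 = 0" "vy 1 = 0"
  using cst_simps[of 1] by (simp_all add: fls_const_1)

definition fX :: rxy where "fX = fls_const fls_X"
definition fY :: rxy where "fY = fls_X"

lemma fX_simps [simp]: "lc fX = 1" "vx fX = 1" "vy fX = 0" "fX \<noteq> 0"
  by (simp_all add: lc_def vx_def vy_def fX_def)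
lemma fY_simps [simp]: "lc fY = 1" "vx fY = 0" "vy fY = 1" "fY \<noteq> 0"
  by (simp_all add: lc_def vx_def vy_def fY_def)

lemma vv_fX: "vv fX = [:1, 0:]" and vv_fY: "vv fY = [:0, 1:]"
  by (simp_all add: vv_def)

lemma vv_power: "f \<noteq> 0 \<Longrightarrow> vv (f ^ n) = of_nat n * vv f"
  by (induction n) (auto simp: vv_mult algebra_simps)

lemma lc_power [simp]: "lc (f ^ n) = lc f ^ n"
  by (induction n) auto

lemma inverse_simps: "f \<noteq> 0 \<Longrightarrow> vv (inverse f) = - vv f"
    "lc (inverse f) = inverse (lc f)"
    "f \<noteq> 0 \<Longrightarrow> vx (inverse f) = - vx f" "f \<noteq> 0 \<Longrightarrow> vy (inverse f) = - vy f"
proof -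
  show v: "f \<noteq> 0 \<Longrightarrow> vv (inverse f) = - vv f"
    using vv_mult[of f "inverse f"] by (simp add: eq_neg_iff_add_eq_0 add.commute)
  show "f \<noteq> 0 \<Longrightarrow> vx (inverse f) = - vx f" "f \<noteq> 0 \<Longrightarrow> vy (inverse f) = - vy f"
    using v by (auto simp: vv_def)
  show "lc (inverse f) = inverse (lc f)"
    using lc_mult[of f "inverse f"] by (cases "f = 0") (auto simp: field_simps)
qed

lemma vv_divide: "f \<noteq> 0 \<Longrightarrow> g \<noteq> 0 \<Longrightarrow> vv (f / g) = vv f - vv g"
  by (simp add: divide_inverse vv_mult inverse_simps)

lemma lc_divide: "lc (f / g) = lc f / lc g"
  by (simp add: divide_inverse inverse_simps)

text \<open>The monomial \<open>Y^a X^b\<close>: a section of the valuation by elements with leading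
  coefficient 1, used where a valuation has to be divided by an integer.\<close>

definition mon :: "int \<Rightarrow> int \<Rightarrow> rxy" where
  "mon a b = fls_shift (- a) (fls_const (fls_shift (- b) 1))"

lemma mon_simps [simp]: "lc (mon a b) = 1" "vx (mon a b) = b" "vy (mon a b) = a" "mon a b \<noteq> 0"
proof -
  have "ltail (mon a b) a b" "mon a b $$ a $$ b = 1"
    by (auto simp: ltail_def mon_def)
  from lead_unique[OF this(1)] this(2)
  show "lc (mon a b) = 1" "vx (mon a b) = b" "vy (mon a b) = a" by auto
  then show "mon a b \<noteq> 0" by auto
qed

lemma vv_mon: "vv (mon a b) = [:b, a:]" by (simp add: vv_def)


subsection \<open>The valuation ring and its residue map\<close>

text \<open>Instantiated twice: for power series inside the Laurent series over any field, and for
  the valuation ring of rank two inside F. Hensel's lemma for the second is composed from two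
  applications of Hensel's lemma for the first.\<close>

locale residue_map =
  fixes R :: "'a::idom set" and \<rho> :: "'a \<Rightarrow> 'b::idom"
  assumes R0: "0 \<in> R" and R1: "1 \<in> R"
    and R_add: "x \<in> R \<Longrightarrow> y \<in> R \<Longrightarrow> x + y \<in> R" and R_mult: "x \<in> R \<Longrightarrow> y \<in> R \<Longrightarrow> x * y \<in> R"
    and \<rho>0: "\<rho> 0 = 0" and \<rho>1: "\<rho> 1 = 1"
    and \<rho>_add: "x \<in> R \<Longrightarrow> y \<in> R \<Longrightarrow> \<rho> (x + y) = \<rho> x + \<rho> y"
    and \<rho>_mult: "x \<in> R \<Longrightarrow> y \<in> R \<Longrightarrow> \<rho> (x * y) = \<rho> x * \<rho> y"
begin

lemma R_of_nat: "of_nat n \<in> R" and \<rho>_of_nat: "\<rho> (of_nat n) = of_nat n"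
proof -
  have "of_nat n \<in> R \<and> \<rho> (of_nat n) = of_nat n"
    by (induction n) (auto simp: R0 R1 \<rho>0 \<rho>1 R_add \<rho>_add)
  then show "of_nat n \<in> R" "\<rho> (of_nat n) = of_nat n" by auto
qed

lemma poly_in: "(\<And>i. coeff p i \<in> R) \<Longrightarrow> w \<in> R \<Longrightarrow> poly p w \<in> R"
proof (induction p)
  case (pCons a p)
  have "a \<in> R" using pCons.prems(1)[of 0] by simp
  moreover have "coeff p i \<in> R" for i using pCons.prems(1)[of "Suc i"] by simp
  ultimately show ?case using pCons by (auto intro: R_add R_mult)
qed (simp add: R0)

lemma poly_residue:
  "(\<And>i. coeff p i \<in> R) \<Longrightarrow> w \<in> R \<Longrightarrow> \<rho> (poly p w) = poly (map_poly \<rho> p) (\<rho> w)"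
proof (induction p)
  case (pCons a p)
  have a: "a \<in> R" using pCons.prems(1)[of 0] by simp
  have c: "coeff p i \<in> R" for i using pCons.prems(1)[of "Suc i"] by simp
  show ?case using pCons c a poly_in[OF c]
    by (simp add: map_poly_pCons[of \<rho>, OF \<rho>0] \<rho>_add \<rho>_mult R_mult)
qed (simp add: \<rho>0)

lemma pderiv_in: "(\<And>i. coeff p i \<in> R) \<Longrightarrow> coeff (pderiv p) i \<in> R"
  unfolding coeff_pderiv by (intro R_mult R_of_nat)

lemma pderiv_residue: "(\<And>i. coeff p i \<in> R) \<Longrightarrow> map_poly \<rho> (pderiv p) = pderiv (map_poly \<rho> p)"
  by (rule poly_eqI, simp only: coeff_pderiv coeff_map_poly[of \<rho>, OF \<rho>0])
    (simp only: \<rho>_mult R_of_nat \<rho>_of_nat)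

text \<open>A Newton step needs only that the quadratic remainder stays in the ring; induction on p
  gives this without dividing by factorials.\<close>

lemma taylor2: "(\<And>i. coeff p i \<in> R) \<Longrightarrow> a \<in> R \<Longrightarrow> h \<in> R \<Longrightarrow>
  \<exists>q\<in>R. poly p (a + h) = poly p a + poly (pderiv p) a * h + h ^ 2 * q"
proof (induction p)
  case 0
  then show ?case by (intro bexI[of _ 0]) (auto simp: R0)
next
  case (pCons c p)
  have c: "coeff p i \<in> R" for i using pCons.prems(1)[of "Suc i"] by simp
  obtain q where q: "q \<in> R" "poly p (a + h) = poly p a + poly (pderiv p) a * h + h ^ 2 * q"
    using pCons c by blast
  have "poly (pderiv p) a \<in> R" by (intro poly_in pderiv_in c pCons)
  then have "poly (pderiv p) a + (a + h) * q \<in> R" using q pCons by (auto intro: R_add R_mult)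
  moreover have "poly (pCons c p) (a + h) = poly (pCons c p) a + poly (pderiv (pCons c p)) a * h
      + h ^ 2 * (poly (pderiv p) a + (a + h) * q)"
    by (simp add: q(2) pderiv_pCons algebra_simps power2_eq_square)
  ultimately show ?case by blast
qed

end

section \<open>Hensel's lemma for one Laurent variable, then for two\<close>

definition fls_int :: "int \<Rightarrow> 'a::field fls set" where
  "fls_int n = {f. \<forall>i<n. f $$ i = 0}"

lemma fls_int_iff: "f \<in> fls_int n \<longleftrightarrow> f = 0 \<or> n \<le> fls_subdegree f"
  using nth_fls_subdegree_nonzero[of f] by (force simp: fls_int_def intro: fls_subdegree_geI)

lemma fls_int_mult: "f \<in> fls_int m \<Longrightarrow> g \<in> fls_int n \<Longrightarrow> f * g \<in> fls_int (m + n)"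
  unfolding fls_int_iff by auto

lemma fls_int_add: "f \<in> fls_int n \<Longrightarrow> g \<in> fls_int n \<Longrightarrow> f + g \<in> fls_int n"
  and fls_int_diff: "f \<in> fls_int n \<Longrightarrow> g \<in> fls_int n \<Longrightarrow> f - g \<in> fls_int n"
  by (auto simp: fls_int_def)

lemma fls_int_mono: "m \<le> n \<Longrightarrow> fls_int n \<subseteq> fls_int m"
  by (auto simp: fls_int_def)

lemma fls_nth0_mult:
  assumes "f \<in> fls_int 0" "g \<in> fls_int 0"
  shows "(f * g) $$ 0 = f $$ 0 * g $$ 0"
proof (cases "f = 0 \<or> g = 0")
  case False
  then have s: "0 \<le> fls_subdegree f" "0 \<le> fls_subdegree g" using assms by (auto simp: fls_int_iff)
  show ?thesis
  proof (cases "fls_subdegree f = 0 \<and> fls_subdegree g = 0")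
    case True then show ?thesis using fls_times_base[of f g] by simp
  next
    case False
    then have "0 < fls_subdegree (f * g)" using s \<open>\<not> (f = 0 \<or> g = 0)\<close> by auto
    moreover have "f $$ 0 = 0 \<or> g $$ 0 = 0" using False s by auto
    ultimately show ?thesis by auto
  qed
qed auto

interpretation fls_res: residue_map "fls_int 0 :: 'a::field fls set" "\<lambda>f. f $$ 0"
proof
  show "0 \<in> fls_int 0" "1 \<in> (fls_int 0 :: 'a fls set)" by (auto simp: fls_int_def)
  fix x y :: "'a fls" assume xy: "x \<in> fls_int 0" "y \<in> fls_int 0"
  show "x + y \<in> fls_int 0" by (rule fls_int_add[OF xy])
  show "x * y \<in> fls_int 0" using fls_int_mult[OF xy] by simp
  show "(x * y) $$ 0 = x $$ 0 * y $$ 0" by (rule fls_nth0_mult[OF xy])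
qed auto

text \<open>Newton iteration, one coefficient at a time. The derivative is invertible at every
  approximation, because its constant term is the nonzero residue derivative at
  \<open>k\<close>.\<close>

theorem fls_hensel:
  fixes p :: "'a::field fls poly"
  assumes p: "\<And>i. coeff p i \<in> fls_int 0"
    and root: "poly (map_poly (\<lambda>f. f $$ 0) p) k = 0"
    and simple: "poly (pderiv (map_poly (\<lambda>f. f $$ 0) p)) k \<noteq> 0"
  shows "\<exists>w\<in>fls_int 0. w $$ 0 = k \<and> poly p w = 0"
proof -
  define good where "good n a \<longleftrightarrow> a \<in> fls_int 0 \<and> a $$ 0 = k \<and> poly p a \<in> fls_int (int n + 1)" for n a
  have step: "\<exists>b. good (Suc n) b \<and> b - a \<in> fls_int (int n + 1)" if a: "good n a" for n a
  proof -
    let ?d = "poly (pderiv p) a"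
    have d: "?d \<in> fls_int 0" using a by (auto simp: good_def intro!: fls_res.poly_in fls_res.pderiv_in p)
    have d0: "?d $$ 0 = poly (pderiv (map_poly (\<lambda>f. f $$ 0) p)) k"
      using a by (subst fls_res.poly_residue) (auto simp: good_def fls_res.pderiv_residue p fls_res.pderiv_in)
    \<comment> \<open>Adding \<open>c Y^(n+1)\<close> to a changes the coefficient of index n + 1 of
      the value by c times the residue derivative; this c cancels it.\<close>
    define c where "c = - (poly p a $$ (int n + 1)) / ?d $$ 0"
    define h where "h = fls_shift (- (int n + 1)) (fls_const c)"
    have h: "h \<in> fls_int (int n + 1)" by (auto simp: h_def fls_int_def)
    then have h0: "h \<in> fls_int 0" using fls_int_mono[of 0 "int n + 1"] by auto
    obtain q where q: "q \<in> fls_int 0" "poly p (a + h) = poly p a + ?d * h + h ^ 2 * q"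
      using fls_res.taylor2[of p a h] p a h0 by (auto simp: good_def)
    have hh: "h ^ 2 * q \<in> fls_int (int n + 2)"
      using fls_int_mult[OF fls_int_mult[OF h h] q(1)] fls_int_mono[of "int n + 2" "int n + 1 + (int n + 1) + 0"]
      by (auto simp: power2_eq_square)
    have dh: "?d * h = fls_shift (- (int n + 1)) (fls_const c * ?d)"
      by (simp add: h_def fls_shifted_times_simps mult.commute)
    have "poly p a + ?d * h \<in> fls_int (int n + 2)"
    proof -
      have "(poly p a + ?d * h) $$ i = 0" if "i < int n + 2" for i
      proof (cases "i = int n + 1")
        case True
        then show ?thesis unfolding dh using simple d0 by (simp add: c_def)
      next
        case False
        then have "i < int n + 1" using that by simp
        then show ?thesis using a d unfolding dh by (simp add: good_def fls_int_def)
      qed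
      then show ?thesis by (simp add: fls_int_def)
    qed
    then have "poly p (a + h) \<in> fls_int (int (Suc n) + 1)"
      using fls_int_add[OF _ hh, of "poly p a + ?d * h"] q(2) by (simp add: add.commute)
    moreover have "(a + h) $$ 0 = k" using a h by (simp add: good_def fls_int_def)
    moreover have "a + h \<in> fls_int 0" using a h0 by (auto simp: good_def intro: fls_int_add)
    ultimately show ?thesis using h by (intro exI[of _ "a + h"]) (auto simp: good_def)
  qed
  have base: "good 0 (fls_const k)"
  proof -
    have 1: "fls_const k \<in> fls_int 0" by (auto simp: fls_int_def)
    then have "poly p (fls_const k) \<in> fls_int 0" by (intro fls_res.poly_in p)
    moreover have "poly p (fls_const k) $$ 0 = 0"
      using root 1 by (subst fls_res.poly_residue) (auto simp: p)
    ultimately have "poly p (fls_const k) \<in> fls_int (int 0 + 1)"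
      unfolding fls_int_def using zless_add1_eq[of _ "0::int"] by fastforce
    then show ?thesis using 1 by (simp add: good_def)
  qed
  obtain s where s: "\<And>n. good n (s n)" "\<And>n. s (Suc n) - s n \<in> fls_int (int n + 1)"
    using dependent_nat_choice[of good "\<lambda>n a b. b - a \<in> fls_int (int n + 1)"] base step by metis
  have stab: "s (n + m) - s n \<in> fls_int (int n + 1)" for n m
  proof (induction m)
    case (Suc m)
    have "s (Suc (n + m)) - s (n + m) \<in> fls_int (int n + 1)"
      using s(2)[of "n + m"] fls_int_mono[of "int n + 1" "int (n + m) + 1"] by auto
    from fls_int_add[OF this Suc] show ?case by simp
  qed (simp add: fls_int_def)
  \<comment> \<open>The limit, read off diagonally: the coefficient of index i no longer changes
    from the approximation \<open>s i\<close> on.\<close>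
  define w where "w = fps_to_fls (Abs_fps (\<lambda>n. s n $$ int n))"
  have w: "w $$ i = (if i < 0 then 0 else s (nat i) $$ i)" for i
    by (simp add: w_def)
  have close: "w - s n \<in> fls_int (int n + 1)" for n
    unfolding fls_int_def
  proof (clarify)
    fix i assume i: "i < int n + 1"
    show "(w - s n) $$ i = 0"
    proof (cases "i < 0")
      case True
      then show ?thesis using s(1)[of n] by (simp add: w good_def fls_int_def)
    next
      case False
      then have "(s (nat i + (n - nat i)) - s (nat i)) $$ i = 0"
        using stab[of "nat i" "n - nat i"] by (simp add: fls_int_def)
      then show ?thesis using False i by (simp add: w)
    qed
  qed
  have w0: "w \<in> fls_int 0" by (simp add: fls_int_def w)
  have "poly p w $$ i = 0" for i
  proof -
    define n where "n = nat i"
    have h: "w - s n \<in> fls_int 0" using close[of n] fls_int_mono[of 0 "int n + 1"] by auto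
    have sn: "s n \<in> fls_int 0" using s(1)[of n] by (simp add: good_def)
    obtain q where q: "q \<in> fls_int 0"
      "poly p (s n + (w - s n)) = poly p (s n) + poly (pderiv p) (s n) * (w - s n) + (w - s n) ^ 2 * q"
      using fls_res.taylor2[OF p sn h] by blast
    have "poly (pderiv p) (s n) \<in> fls_int 0" by (intro fls_res.poly_in fls_res.pderiv_in p sn)
    then have 1: "poly (pderiv p) (s n) * (w - s n) \<in> fls_int (int n + 1)"
      using fls_int_mult close by fastforce
    have 2: "(w - s n) ^ 2 * q \<in> fls_int (int n + 1)"
      using fls_int_mult[OF fls_int_mult[OF close[of n] h] q(1)] by (simp add: power2_eq_square)
    have 3: "poly p (s n) \<in> fls_int (int n + 1)" using s(1)[of n] by (simp add: good_def)
    have "poly p w \<in> fls_int (int n + 1)"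
      using q(2) fls_int_add[OF fls_int_add[OF 3 1] 2] by simp
    moreover have "i < int n + 1" by (simp add: n_def)
    ultimately show ?thesis by (simp add: fls_int_def)
  qed
  then have "poly p w = 0" by (intro fls_eqI) simp
  moreover have "w $$ 0 = k" using s(1)[of 0] by (simp add: w good_def)
  ultimately show ?thesis using w0 by blast
qed

definition O2 :: "rxy set" where "O2 = {f. f = 0 \<or> 0 \<le> vv f}"
definition res :: "rxy \<Rightarrow> real" where "res f = f $$ 0 $$ 0"

lemma O2_iff: "f \<in> O2 \<longleftrightarrow> f \<in> fls_int 0 \<and> f $$ 0 \<in> fls_int 0"
  using ltail_iff[of f 0 0] by (auto simp: O2_def ltail_def fls_int_def)

lemma O2_int: "f \<in> O2 \<Longrightarrow> f \<in> fls_int 0" "f \<in> O2 \<Longrightarrow> f $$ 0 \<in> fls_int 0"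
  by (auto simp: O2_iff)

interpretation res: residue_map O2 res
proof
  show "0 \<in> O2" "1 \<in> O2" by (auto simp: O2_def)
  show "res 0 = 0" "res 1 = 1" by (auto simp: res_def)
  fix x y assume "x \<in> O2" "y \<in> O2"
  note xy = O2_int[OF this(1)] O2_int[OF this(2)]
  show "x + y \<in> O2" "res (x + y) = res x + res y"
    using xy by (auto simp: O2_iff res_def fls_int_add)
  show "x * y \<in> O2" "res (x * y) = res x * res y"
    using xy fls_int_mult[of x 0 y 0] fls_int_mult[of "x $$ 0" 0 "y $$ 0" 0]
    by (auto simp: O2_iff res_def fls_nth0_mult)
qed

lemma res_eq: "f \<in> O2 \<Longrightarrow> res f = (if vv f = 0 then lc f else 0)"
  using ltail_nth0[of 0 0 f]
  by (cases "f = 0") (auto simp: O2_def res_def vv_def lc_def less_le)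

text \<open>The residue map is a composite. The root is lifted from the reals to the Laurent series
  in X, for the polynomial of constant terms in Y, and from there to F; the first lift is again a
  simple root since the residue of the derivative is nonzero.\<close>

theorem hensel:
  assumes p: "\<And>i. coeff p i \<in> O2"
    and root: "poly (map_poly res p) k = 0" and simple: "poly (pderiv (map_poly res p)) k \<noteq> 0"
  shows "\<exists>w\<in>O2. res w = k \<and> poly p w = 0"
proof -
  define p1 where "p1 = map_poly (\<lambda>f :: rxy. f $$ 0) p"
  have p1: "coeff p1 i \<in> fls_int 0" for i using p[of i] by (simp add: p1_def coeff_map_poly O2_iff)
  have m: "map_poly (\<lambda>f. f $$ 0) p1 = map_poly res p"
    by (simp add: p1_def map_poly_map_poly o_def res_def[abs_def])
  obtain k1 where k1: "k1 \<in> fls_int 0" "k1 $$ 0 = k" "poly p1 k1 = 0"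
    using fls_hensel[of p1 k] p1 root simple m by auto
  have "poly (pderiv p1) k1 $$ 0 = poly (pderiv (map_poly res p)) k"
    using k1 p1 by (subst fls_res.poly_residue) (auto simp: fls_res.pderiv_residue fls_res.pderiv_in m)
  then have "poly (pderiv p1) k1 \<noteq> 0" using simple by auto
  then obtain w where "w \<in> fls_int 0" "w $$ 0 = k1" "poly p w = 0"
    using fls_hensel[of p k1] k1 O2_int(1)[OF p] by (auto simp: p1_def)
  then show ?thesis using k1 by (auto simp: O2_iff res_def)
qed

section \<open>Locating points relative to the roots of derivatives\<close>

text \<open>For nonzero elements: the quotient is a positive unit of the valuation ring. Signs and
  valuations cannot separate such elements, so values of polynomials are computed only up to this
  relation.\<close>

definition ssim :: "rxy \<Rightarrow> rxy \<Rightarrow> bool" where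
  "ssim f g \<longleftrightarrow> vv f = vv g \<and> sgn (lc f) = sgn (lc g)"

lemma ssim_refl [simp]: "ssim f f" by (simp add: ssim_def)
lemma ssim_0: "ssim f g \<Longrightarrow> f = 0 \<longleftrightarrow> g = 0"
  by (metis ssim_def lc_eq_0_iff sgn_zero_iff)

lemma ssim_mult: "ssim f g \<Longrightarrow> ssim f' g' \<Longrightarrow> ssim (f * f') (g * g')"
  using ssim_0[of f g] ssim_0[of f' g']
  by (cases "f = 0 \<or> f' = 0") (auto simp: ssim_def vv_mult sgn_mult)

lemma ssim_power: "ssim f g \<Longrightarrow> ssim (f ^ n) (g ^ n)"
  by (induction n) (auto intro: ssim_mult)

lemma lc_pos_nz [simp]: "0 < lc a \<Longrightarrow> a \<noteq> 0" by auto

text \<open>Positive leading coefficients cannot cancel. This is the compatibility of the order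
  \<open>0 < lc\<close> with the valuation, on which all comparisons below rest.\<close>

lemma pos_add:
  assumes "0 < lc a" "0 < lc b"
  shows "0 < lc (a + b)" "vv (a + b) = min (vv a) (vv b)"
proof -
  consider "vv a < vv b" | "vv b < vv a" | "vv a = vv b" by (meson linorder_neqE)
  then have "0 < lc (a + b) \<and> vv (a + b) = min (vv a) (vv b)"
  proof cases
    case 1
    then show ?thesis using add_less[of a b] assms by (auto simp: min_def)
  next
    case 2
    then show ?thesis using add_less[of b a] assms by (auto simp: min_def add.commute[of a b])
  next
    case 3
    then show ?thesis using add_same[of a b] assms by (auto simp: min_def)
  qed
  then show "0 < lc (a + b)" "vv (a + b) = min (vv a) (vv b)" by auto
qed

lemma lc_diff_total: "a = b \<or> 0 < lc (a - b) \<or> 0 < lc (b - a)"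
  using lc_uminus[of "a - b"] by (metis diff_gt_0_iff_gt lc_eq_0_iff linorder_neqE_linordered_idom
      minus_diff_eq neg_0_less_iff_less right_minus_eq)

lemma vv_diff_gt_lc:
  assumes "0 < lc a" "0 < lc b" "vv a < vv b" shows "0 < lc (a - b)" "vv (a - b) = vv a"
  using add_less[of a "- b"] assms by auto

text \<open>The starting index separates two uses: with k = 0 the zeros of P itself are included,
  with k = 1 only those of proper derivatives, which are available before the zeros of P are.
  Leaving out derivatives that vanish identically keeps the set finite.\<close>

definition droots :: "rxy poly \<Rightarrow> nat \<Rightarrow> rxy set" where
  "droots P k = {c. \<exists>i\<ge>k. (pderiv ^^ i) P \<noteq> 0 \<and> poly ((pderiv ^^ i) P) c = 0}"

lemma pderiv_funpow_0: "degree P < i \<Longrightarrow> (pderiv ^^ i) (P :: 'a::field_char_0 poly) = 0"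
proof (induction i arbitrary: P)
  case (Suc i)
  show ?case
  proof (cases "degree P = 0")
    case True
    then have "pderiv P = 0" by (simp add: pderiv_eq_0_iff)
    moreover have "(pderiv ^^ i) (0 :: 'a poly) = 0" by (induction i) auto
    ultimately show ?thesis by (simp add: funpow_swap1)
  next
    case False
    then show ?thesis using Suc by (simp add: funpow_swap1 degree_pderiv)
  qed
qed simp

lemma finite_droots: "finite (droots P k)"
proof -
  have "droots P k \<subseteq> (\<Union>i\<in>{i. i \<le> degree P \<and> (pderiv ^^ i) P \<noteq> 0}. {c. poly ((pderiv ^^ i) P) c = 0})"
    by (auto simp: droots_def) (metis pderiv_funpow_0 linorder_not_le)
  then show ?thesis
    by (rule finite_subset) (auto intro!: finite_UN_I poly_roots_finite)
qed

text \<open>P seen at the scale z and normalised by A. Points of valuation v(z) become units, and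
  the reduction to a real polynomial shows the behaviour of P at that scale.\<close>

definition scp :: "rxy poly \<Rightarrow> rxy \<Rightarrow> rxy \<Rightarrow> rxy poly" where
  "scp P z A = smult (inverse A) (pcompose P [:0, z:])"

lemma coeff_scp: "coeff (scp P z A) i = coeff P i * z ^ i / A"
  by (simp add: scp_def coeff_pcompose_linear field_simps)

lemma poly_scp: "poly (scp P z A) w = poly P (z * w) / A"
  by (simp add: scp_def poly_pcompose field_simps)

lemma pderiv_scp: "(pderiv ^^ i) (scp P z A) = smult (z ^ i) (scp ((pderiv ^^ i) P) z A)"
proof (induction i)
  case (Suc i)
  then show ?case
    by (simp add: scp_def pderiv_smult pderiv_pcompose pderiv_pCons mult_ac)
qed simp

text \<open>In characteristic 0 some derivative does not vanish at x; the one before the first such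
  derivative has a simple zero there.\<close>

lemma simple_root_of_derivative:
  fixes Q :: "real poly"
  assumes "Q \<noteq> 0" "poly Q x = 0"
  obtains i where "poly ((pderiv ^^ i) Q) x = 0" "poly ((pderiv ^^ Suc i) Q) x \<noteq> 0"
proof -
  have "\<exists>i. poly ((pderiv ^^ i) Q) x \<noteq> 0"
  proof (rule ccontr)
    assume "\<not> ?thesis"
    then have z: "poly ((pderiv ^^ i) Q) x = 0" for i by blast
    have "\<not> (\<forall>i. poly ((pderiv ^^ i) Q) x = 0)" if "Q \<noteq> 0" "degree Q = n" for n Q
      using that
    proof (induction n arbitrary: Q)
      case 0
      then show ?case by (auto elim!: degree_eq_zeroE intro!: exI[of _ 0])
    next
      case (Suc n)
      then have "pderiv Q \<noteq> 0" "degree (pderiv Q) = n" by (auto simp: pderiv_eq_0_iff degree_pderiv)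
      from Suc.IH[OF this] show ?case by (metis comp_apply funpow_Suc_right)
    qed
    then show False using z assms(1) by blast
  qed
  then obtain i where i: "poly ((pderiv ^^ i) Q) x \<noteq> 0" "\<And>j. j < i \<Longrightarrow> poly ((pderiv ^^ j) Q) x = 0"
    using exists_least_iff[of "\<lambda>i. poly ((pderiv ^^ i) Q) x \<noteq> 0"] by blast
  then have "i \<noteq> 0" using assms(2) by (intro notI) simp
  then show thesis using i that[of "i - 1"] by simp
qed

lemma pderiv_funpow_residue:
  assumes "\<And>i. coeff p i \<in> O2"
  shows "(\<forall>i. coeff ((pderiv ^^ k) p) i \<in> O2) \<and> map_poly res ((pderiv ^^ k) p) = (pderiv ^^ k) (map_poly res p)"
  by (induction k) (auto simp: assms res.pderiv_in res.pderiv_residue)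

text \<open>Hensel's lemma needs a simple zero; a multiple zero is a simple zero of a higher derivative.\<close>

lemma lift_residue_root:
  assumes p: "\<And>i. coeff (scp P z A) i \<in> O2" and q: "q = map_poly res (scp P z A)"
    and nz: "(pderiv ^^ k) q \<noteq> 0" and root: "poly ((pderiv ^^ k) q) x = 0" and A: "A \<noteq> 0" "z \<noteq> 0"
  obtains w where "w \<in> O2" "res w = x" "z * w \<in> droots P k"
proof -
  obtain i where i: "poly ((pderiv ^^ i) ((pderiv ^^ k) q)) x = 0"
    "poly ((pderiv ^^ Suc i) ((pderiv ^^ k) q)) x \<noteq> 0"
    using simple_root_of_derivative[OF nz root] .
  let ?m = "i + k"
  let ?p = "(pderiv ^^ ?m) (scp P z A)"
  have p': "coeff ?p i \<in> O2" for i using pderiv_funpow_residue[OF p] by blast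
  have m: "map_poly res ?p = (pderiv ^^ ?m) q" using pderiv_funpow_residue[OF p] q by blast
  have s: "poly (pderiv (map_poly res ?p)) x \<noteq> 0" unfolding m using i(2) by (simp add: funpow_add)
  obtain w where w: "w \<in> O2" "res w = x" "poly ?p w = 0"
    using hensel[OF p' _ s] i(1) unfolding m by (auto simp: funpow_add)
  have "poly ((pderiv ^^ ?m) P) (z * w) = 0"
    using w(3) A by (simp add: pderiv_scp poly_scp)
  moreover have "(pderiv ^^ ?m) P \<noteq> 0"
  proof
    assume "(pderiv ^^ ?m) P = 0"
    then have "?p = 0" by (simp add: pderiv_scp) (simp add: scp_def)
    then show False using s by simp
  qed
  ultimately have "z * w \<in> droots P k" by (auto simp: droots_def intro!: exI[of _ ?m])
  then show thesis using that w by blast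
qed

text \<open>Equivalently: s is positive, and for every positive d in D the quotient s/d has residue
  strictly below 1. So s lies below these d and, at their scale, is not infinitely close to any of
  them.\<close>

definition good :: "rxy \<Rightarrow> rxy set \<Rightarrow> bool" where
  "good s D \<longleftrightarrow> 0 < lc s \<and> (\<forall>d\<in>D. 0 < lc d \<longrightarrow> 0 < lc (d - s) \<and> vv (d - s) \<le> vv d)"

lemma O2_lc: "w \<in> O2 \<Longrightarrow> res w \<noteq> 0 \<Longrightarrow> w \<noteq> 0 \<and> vv w = 0 \<and> lc w = res w"
  by (auto simp: res_eq split: if_splits)

lemma O2_diff: "x \<in> O2 \<Longrightarrow> y \<in> O2 \<Longrightarrow> x - y \<in> O2 \<and> res (x - y) = res x - res y"
  using res.R_add[of x "- y"] by (simp add: O2_def res_def)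

lemma scaled_pos:
  assumes "0 < lc s" "w \<in> O2" "0 < res w"
  shows "0 < lc (s * w)" "vv (s * w) = vv s" "lc (s * w) = lc s * res w"
  using O2_lc[of w] assms by (auto simp: vv_mult)

lemma good_scaled:
  assumes "good s D" "s * w \<in> D" "w \<in> O2" "0 < res w"
  shows "1 < res w"
proof -
  have s: "0 < lc s" using assms(1) by (simp add: good_def)
  note sw = scaled_pos[OF s assms(3,4)]
  have d: "0 < lc (s * w - s)" "vv (s * w - s) \<le> vv s"
    using assms sw by (auto simp: good_def)
  have eq: "s * w - s = s * (w - 1)" by (simp add: algebra_simps)
  have l: "0 < lc (w - 1)" using d(1) s by (simp add: eq zero_less_mult_iff)
  then have "vv (w - 1) \<le> 0" using d(2) s vv_mult[of s "w - 1"] lc_pos_nz[OF l] lc_pos_nz[OF s] by (simp add: eq)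
  moreover have "w - 1 \<in> O2" "res (w - 1) = res w - 1"
    using O2_diff[of w 1] assms(3) res.R1 res.\<rho>1 by auto
  ultimately show ?thesis using l res_eq[of "w - 1"] by (auto simp: O2_def)
qed

lemma ratio_O2:
  assumes "0 < lc s" "0 < lc t" "vv s = vv t"
  shows "t / s \<in> O2" "res (t / s) = lc t / lc s" "s * (t / s) = t"
proof -
  have nz: "s \<noteq> 0" "t \<noteq> 0" using assms by auto
  then have v: "vv (t / s) = 0" using assms by (simp add: vv_divide)
  then show "t / s \<in> O2" by (simp add: O2_def)
  then show "res (t / s) = lc t / lc s" using v by (simp add: res_eq lc_divide)
  show "s * (t / s) = t" using nz by simp
qed

section \<open>The Newton polygon at a good point\<close>

definition covers :: "rxy set \<Rightarrow> rxy poly \<Rightarrow> nat \<Rightarrow> bool" where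
  "covers D P k \<longleftrightarrow> (\<forall>c\<in>droots P k. 0 < lc c \<longrightarrow> c \<in> D)"

text \<open>The first index at which a line of slope -v(s) touches the Newton polygon. Choosing the
  least index makes the residue polynomial at the scale s start with \<open>x^j\<close>, with
  coefficient 1.\<close>

definition dom :: "rxy poly \<Rightarrow> rxy \<Rightarrow> nat \<Rightarrow> bool" where
  "dom P s j \<longleftrightarrow> coeff P j \<noteq> 0 \<and>
     (\<forall>i. coeff P i \<noteq> 0 \<longrightarrow> vv (coeff P j * s ^ j) \<le> vv (coeff P i * s ^ i)) \<and>
     (\<forall>i<j. coeff P i \<noteq> 0 \<longrightarrow> vv (coeff P j * s ^ j) < vv (coeff P i * s ^ i))"

lemma dom_exists: assumes "P \<noteq> 0" obtains j where "dom P s j" "j \<le> degree P"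
proof -
  let ?f = "\<lambda>i. vv (coeff P i * s ^ i)"
  let ?I = "{i. i \<le> degree P \<and> coeff P i \<noteq> 0}"
  have "degree P \<in> ?I" using assms by simp
  then have fin: "finite ?I" "?I \<noteq> {}" by (simp, blast)
  define m where "m = Min (?f ` ?I)"
  have m: "m \<in> ?f ` ?I" "\<And>i. i \<in> ?I \<Longrightarrow> m \<le> ?f i"
    unfolding m_def using fin Min_in[of "?f ` ?I"] by (blast, simp)
  define j where "j = (LEAST j. j \<in> ?I \<and> ?f j = m)"
  obtain j0 where "j0 \<in> ?I \<and> ?f j0 = m" using m(1) by blast
  then have j: "j \<in> ?I \<and> ?f j = m" unfolding j_def by (rule LeastI)
  have "m < ?f i" if "i < j" "i \<in> ?I" for i
  proof -
    have "\<not> (i \<in> ?I \<and> ?f i = m)" using not_less_Least that(1) unfolding j_def by blast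
    then have "?f i \<noteq> m" using that(2) by blast
    then show ?thesis using m(2)[OF that(2)] by (metis order_le_less)
  qed
  moreover have "i \<in> ?I" if "coeff P i \<noteq> 0" for i using that le_degree by simp
  ultimately have "dom P s j" using j m(2) unfolding dom_def by blast
  then show thesis using that j by auto
qed

lemma dom_unique: "dom P s i \<Longrightarrow> dom P s j \<Longrightarrow> i = j"
  unfolding dom_def using linorder_neqE_nat[of i j] by (meson linorder_not_le)

lemma dom_scp:
  assumes "dom P s j" "s \<noteq> 0"
  defines "A \<equiv> coeff P j * s ^ j" and "q \<equiv> map_poly res (scp P s (coeff P j * s ^ j))"
  shows "A \<noteq> 0" "coeff (scp P s A) i \<in> O2" "coeff q j = 1" "i < j \<Longrightarrow> coeff q i = 0"
    "coeff q i = (if coeff P i \<noteq> 0 \<and> vv (coeff P i * s ^ i) = vv A then lc (coeff P i * s ^ i) / lc A else 0)"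
proof -
  show A: "A \<noteq> 0" using assms by (auto simp: A_def dom_def)
  show O: "coeff (scp P s A) i \<in> O2" for i
    using assms(1,2) A by (cases "coeff P i = 0") (auto simp: coeff_scp O2_def dom_def vv_divide A_def)
  have c: "coeff q i = (if coeff P i \<noteq> 0 \<and> vv (coeff P i * s ^ i) = vv A then lc (coeff P i * s ^ i) / lc A else 0)" for i
    using O[of i] A assms(2)
    by (cases "coeff P i = 0") (auto simp: q_def coeff_map_poly res.\<rho>0 res_eq coeff_scp A_def[symmetric] vv_divide lc_divide)
  then show "coeff q i = (if coeff P i \<noteq> 0 \<and> vv (coeff P i * s ^ i) = vv A then lc (coeff P i * s ^ i) / lc A else 0)" .
  show "coeff q j = 1" using c[of j] assms(1) A by (simp add: dom_def A_def)
  show "i < j \<Longrightarrow> coeff q i = 0" using c[of i] assms(1) by (auto simp: dom_def A_def)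
qed

lemma res_poly_scp:
  assumes "\<And>i. coeff (scp P z A) i \<in> O2" "w \<in> O2"
  shows "poly P (z * w) / A \<in> O2" "res (poly P (z * w) / A) = poly (map_poly res (scp P z A)) (res w)"
  using res.poly_in[OF assms] res.poly_residue[OF assms] by (simp_all add: poly_scp)

text \<open>The residue polynomial q at the scale s is \<open>x^j g\<close> with g(0) = 1, and it
  has no zero in (0, 1] because such a zero would lift to a point of D. So q(1) > 0 by the
  intermediate value theorem: terms of equal valuation do not cancel, and the dominant one decides
  the sign.\<close>

theorem value_at_good:
  assumes "P \<noteq> 0" and D: "covers D P 0"
    and s: "good s D" and j: "dom P s j"
  shows "ssim (poly P s) (coeff P j * s ^ j)"
proof -
  have s0: "s \<noteq> 0" "0 < lc s" using s by (auto simp: good_def)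
  define A where "A = coeff P j * s ^ j"
  define q where "q = map_poly res (scp P s A)"
  note ds = dom_scp[OF j s0(1), folded A_def, folded q_def]
  have noroot: "poly q u \<noteq> 0" if "0 < u" "u \<le> 1" for u
  proof
    assume "poly q u = 0"
    then obtain w where "w \<in> O2" "res w = u" "s * w \<in> droots P 0"
      using lift_residue_root[of P s A q 0 u] ds s0 by (metis q_def funpow_0 coeff_0 zero_neq_one)
    then show False using good_scaled[OF s _ \<open>w \<in> O2\<close>] D[unfolded covers_def] scaled_pos(1)[OF s0(2) \<open>w \<in> O2\<close>] that by force
  qed
  have "monom 1 j dvd q" using ds(4) by (simp add: monom_1_dvd_iff')
  then obtain g where g: "q = monom 1 j * g" by (elim dvdE)
  have "poly g 0 = 1" using ds(3) by (simp add: g coeff_monom_mult poly_0_coeff_0)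
  moreover have gq: "poly q u = u ^ j * poly g u" for u by (simp add: g poly_monom)
  have "0 < poly q 1"
  proof (rule ccontr)
    assume "\<not> ?thesis"
    then have "poly g 1 \<le> 0" by (simp add: gq)
    then obtain u where "0 \<le> u" "u \<le> 1" "poly g u = 0"
      using IVT2[of "poly g" 1 0 0] \<open>poly g 0 = 1\<close> by (auto intro!: continuous_intros)
    then show False using noroot[of u] gq[of u] \<open>poly g 0 = 1\<close> by (cases "u = 0") auto
  qed
  moreover have "poly P s / A \<in> O2" "res (poly P s / A) = poly q 1"
    using res_poly_scp[of P s A 1] ds(2) res.R1 res.\<rho>1 by (auto simp: q_def)
  ultimately have "poly P s / A \<noteq> 0" "vv (poly P s / A) = 0" "0 < lc (poly P s / A)"
    using O2_lc[of "poly P s / A"] by auto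
  then show ?thesis
    using ds(1) by (auto simp: ssim_def vv_divide lc_divide A_def zero_less_divide_iff)
qed

text \<open>Only the zeros of proper derivatives are known to lie in D. They keep the critical
  points of q out of (0, 1], while q(1) = 0. If the dominant index were positive, then q(0) = 0, and
  Rolle's theorem would give a critical point in between.\<close>

lemma root_residue:
  assumes D: "covers D P 1"
    and s: "good s D" and P: "P \<noteq> 0" "poly P s = 0"
  defines "q \<equiv> map_poly res (scp P s (coeff P 0))"
  shows "dom P s 0" "poly q 0 = 1" "poly q 1 = 0" "\<And>u. 0 < u \<Longrightarrow> u \<le> 1 \<Longrightarrow> poly (pderiv q) u \<noteq> 0"
    "pderiv q \<noteq> 0"
proof -
  have s0: "s \<noteq> 0" "0 < lc s" using s by (auto simp: good_def)
  obtain j where j: "dom P s j" using dom_exists[OF P(1)] .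
  define A where "A = coeff P j * s ^ j"
  define q' where "q' = map_poly res (scp P s A)"
  note ds = dom_scp[OF j s0(1), folded A_def, folded q'_def]
  have q1: "poly q' 1 = 0"
    using res_poly_scp[of P s A 1] ds(2) res.R1 res.\<rho>1 res.\<rho>0 P(2) by (auto simp: q'_def)
  have pd: "pderiv q' \<noteq> 0"
  proof
    assume "pderiv q' = 0"
    then obtain c where "q' = [:c:]" using pderiv_eq_0_iff degree_eq_zeroE by metis
    then show False using q1 ds(3) by (cases j) auto
  qed
  have crit: "1 < u" if u: "0 < u" "poly (pderiv q') u = 0" for u
  proof -
    obtain w where w: "w \<in> O2" "res w = u" "s * w \<in> droots P 1"
      using lift_residue_root[of P s A q' 1 u, OF ds(2) q'_def _ _ ds(1) s0(1)] pd u(2) by auto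
    then have "s * w \<in> D" using D u(1) scaled_pos(1)[OF s0(2) w(1)] by (simp add: covers_def)
    then show ?thesis using good_scaled[OF s _ w(1)] u(1) w(2) by simp
  qed
  have j0: "j = 0"
  proof (rule ccontr)
    assume "j \<noteq> 0"
    then have "poly q' 0 = 0" using ds(4)[of 0] by (simp add: poly_0_coeff_0)
    then obtain u where "0 < u" "u < 1" "poly (pderiv q') u = 0"
      using poly_MVT[of 0 1 q'] q1 by auto
    then show False using crit by force
  qed
  then have "q' = q" "A = coeff P 0" by (auto simp: q'_def q_def A_def)
  then show "dom P s 0" "poly q 1 = 0" "poly q 0 = 1" "pderiv q \<noteq> 0"
    "\<And>u. 0 < u \<Longrightarrow> u \<le> 1 \<Longrightarrow> poly (pderiv q) u \<noteq> 0"
    using j j0 q1 ds(3) pd crit by (auto simp: poly_0_coeff_0) force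
qed

text \<open>The edge of the Newton polygon that starts at index 0 has slope -v(s) and ends at the
  degree k of the residue polynomial. All coefficients lie on or above its line, and strictly above
  it to the right of k.\<close>

lemma root_edge:
  assumes D: "covers D P 1"
    and s: "good s D" and P: "P \<noteq> 0" "poly P s = 0"
  defines "q \<equiv> map_poly res (scp P s (coeff P 0))"
  defines "k \<equiv> degree q"
  shows "1 \<le> k" "coeff P 0 \<noteq> 0" "coeff P k \<noteq> 0" "vv (coeff P 0) - vv (coeff P k) = of_nat k * vv s"
    "\<And>j. coeff P j \<noteq> 0 \<Longrightarrow> vv (coeff P 0) - vv (coeff P j) \<le> of_nat j * vv s"
    "\<And>j. k < j \<Longrightarrow> coeff P j \<noteq> 0 \<Longrightarrow> vv (coeff P 0) - vv (coeff P j) < of_nat j * vv s"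
    "sgn (lead_coeff q) = sgn (lc (coeff P k) * lc (coeff P 0))"
proof -
  have s0: "s \<noteq> 0" "0 < lc s" using s by (auto simp: good_def)
  note rr = root_residue[OF D s P, folded q_def]
  have j: "dom P s 0" by (rule rr(1))
  have ds: "coeff q i = (if coeff P i \<noteq> 0 \<and> vv (coeff P i * s ^ i) = vv (coeff P 0)
      then lc (coeff P i * s ^ i) / lc (coeff P 0) else 0)" for i
    using dom_scp(5)[OF j s0(1), of i] by (simp add: q_def)
  have "q \<noteq> 0" using rr(2) by auto
  then have lq: "coeff q k \<noteq> 0" by (simp add: k_def)
  show "1 \<le> k" using rr(5) by (simp add: k_def pderiv_eq_0_iff)
  show c0: "coeff P 0 \<noteq> 0" using j by (simp add: dom_def)
  show ck: "coeff P k \<noteq> 0" using lq ds[of k] by (auto split: if_splits)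
  have vm: "vv (coeff P j * s ^ j) = vv (coeff P j) + of_nat j * vv s" if "coeff P j \<noteq> 0" for j
    using that s0 by (simp add: vv_mult vv_power)
  show "vv (coeff P 0) - vv (coeff P k) = of_nat k * vv s"
    using lq ds[of k] vm[OF ck] by (auto split: if_splits)
  show le: "vv (coeff P 0) - vv (coeff P j) \<le> of_nat j * vv s" if "coeff P j \<noteq> 0" for j
    using j that vm[OF that] by (auto simp: dom_def algebra_simps)
  show "vv (coeff P 0) - vv (coeff P j) < of_nat j * vv s" if "k < j" "coeff P j \<noteq> 0" for j
  proof -
    have "coeff q j = 0" using that(1) by (simp add: k_def coeff_eq_0)
    then have "vv (coeff P j * s ^ j) \<noteq> vv (coeff P 0)" using ds[of j] that(2) s0 c0 by (auto split: if_splits)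
    then show ?thesis using le[OF that(2)] vm[OF that(2)] by (auto simp: algebra_simps order_le_less)
  qed
  show "sgn (lead_coeff q) = sgn (lc (coeff P k) * lc (coeff P 0))"
    using lq ds[of k] s0 c0 by (auto simp: k_def[symmetric] sgn_mult sgn_divide split: if_splits)
qed

text \<open>Both roots belong to the first edge, so their valuations agree, and s < t may be
  assumed. If t/s has residue above 1, Rolle's theorem gives a critical residue strictly between 1
  and it, which lifts to a point of D below t, against the goodness of t. If the residue is 1, the
  zero 1 of the residue polynomial is simple and has only one lift.\<close>

theorem good_root_unique:
  assumes D: "covers D P 1"
    and P: "P \<noteq> 0" and s: "good s D" "poly P s = 0" and t: "good t D" "poly P t = 0"
  shows "s = t"
proof -
  have main: False
    if s: "good s D" "poly P s = 0" and t: "good t D" "poly P t = 0" and less: "0 < lc (t - s)" for s t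
  proof -
    have s0: "s \<noteq> 0" "0 < lc s" and t0: "t \<noteq> 0" "0 < lc t" using s t by (auto simp: good_def)
    define q where "q = map_poly res (scp P s (coeff P 0))"
    note rr = root_residue[OF D s(1) P s(2), folded q_def]
    note re = root_edge[OF D s(1) P s(2), folded q_def] and re' = root_edge[OF D t(1) P t(2)]
    have v: "vv s = vv t"
    proof (rule antisym)
      have *: "x \<le> y" if "of_nat k * x \<le> of_nat k * y" "1 \<le> k" for x y :: "int poly" and k
        using that by simp
      show "vv s \<le> vv t" using *[OF _ re(1)] re(4) re'(5)[OF re(3)] by simp
      show "vv t \<le> vv s" using *[OF _ re'(1)] re'(4) re(5)[OF re'(3)] by simp
    qed
    define w where "w = t / s"
    have w: "w \<in> O2" "res w = lc t / lc s" "s * w = t" using ratio_O2[OF s0(2) t0(2) v] by (auto simp: w_def)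
    have p: "coeff (scp P s (coeff P 0)) i \<in> O2" for i using dom_scp(2)[OF rr(1) s0(1)] by simp
    have qw: "poly q (res w) = 0"
      using res_poly_scp(2)[OF p w(1)] t(2) res.\<rho>0 by (simp add: w(3) q_def)
    have "t - s = s * (w - 1)" using w(3) by (simp add: algebra_simps)
    then have "0 < lc (w - 1)" using less s0 by (simp add: zero_less_mult_iff)
    moreover have w1: "w - 1 \<in> O2" "res (w - 1) = res w - 1" using O2_diff[of w 1] w(1) res.R1 res.\<rho>1 by auto
    ultimately have ge: "1 \<le> res w" using res_eq[OF w1(1)] by (auto split: if_splits)
    show False
    proof (cases "res w = 1")
      case False
      then obtain u where u: "1 < u" "u < res w" "poly (pderiv q) u = 0"
        using ge poly_MVT[of 1 "res w" q] rr(3) qw by auto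
      obtain w' where w': "w' \<in> O2" "res w' = u" "s * w' \<in> droots P 1"
        using lift_residue_root[of P s "coeff P 0" q 1 u] p re(2) s0 u rr(5) by (auto simp: q_def)
      have "0 < lc (s * w' - t)"
        using t(1) D[unfolded covers_def, rule_format, OF w'(3)] scaled_pos(1)[OF s0(2) w'(1)] u w' by (auto simp: good_def)
      moreover have "s * w' - t = s * (w' - w)" using w(3) by (simp add: algebra_simps)
      ultimately have "0 < lc (w' - w)" using s0 by (simp add: zero_less_mult_iff)
      then show False using O2_diff[OF w'(1) w(1)] O2_lc[of "w' - w"] u w' by auto
    next
      case True
      \<comment> \<open>Two lifts of one residue root: dividing the Taylor expansion by h forces the
        residue derivative at 1 to vanish.\<close>
      define h where "h = w - 1"
      have h: "h \<in> O2" "res h = 0" "h \<noteq> 0" using w1 True \<open>0 < lc (w - 1)\<close> by (auto simp: h_def)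
      obtain r where r: "r \<in> O2" "poly (scp P s (coeff P 0)) (1 + h) = poly (scp P s (coeff P 0)) 1
          + poly (pderiv (scp P s (coeff P 0))) 1 * h + h ^ 2 * r"
        using res.taylor2[OF p res.R1 h(1)] by blast
      have "poly (scp P s (coeff P 0)) (1 + h) = 0" "poly (scp P s (coeff P 0)) 1 = 0"
        using s t w(3) by (auto simp: poly_scp h_def)
      then have "h * (poly (pderiv (scp P s (coeff P 0))) 1 + h * r) = 0"
        using r(2) by (simp add: algebra_simps power2_eq_square)
      then have "poly (pderiv (scp P s (coeff P 0))) 1 + h * r = 0" using h(3) by simp
      moreover have "poly (pderiv (scp P s (coeff P 0))) 1 \<in> O2"
        by (intro res.poly_in res.pderiv_in p res.R1)
      ultimately have "res (poly (pderiv (scp P s (coeff P 0))) 1) = 0"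
        using res.\<rho>_add[of "poly (pderiv (scp P s (coeff P 0))) 1" "h * r"] res.\<rho>_mult[OF h(1) r(1)]
          res.R_mult[OF h(1) r(1)] h(2) res.\<rho>0 by simp
      moreover have "res (poly (pderiv (scp P s (coeff P 0))) 1) = poly (pderiv q) 1"
        using res.poly_residue[of "pderiv (scp P s (coeff P 0))" 1] res.pderiv_in[OF p] res.R1 res.\<rho>1
          res.pderiv_residue[OF p] by (simp add: q_def)
      ultimately show False using rr(4)[of 1] by simp
    qed
  qed
  then show ?thesis using s t lc_diff_total[of s t] by blast
qed


text \<open>The existence of a good root in terms of valuations and signs. The indices 0 and k span
  the first edge of the Newton polygon, and divisibility by k makes its slope a value of F. The
  final disjunction locates the sign change of the residue polynomial: it is visible at infinity if
  all positive points of D are of smaller valuation than the root, and otherwise at the least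
  positive point of D.\<close>

definition rootcond :: "rxy poly \<Rightarrow> rxy set \<Rightarrow> nat \<Rightarrow> bool" where
  "rootcond P D k \<longleftrightarrow> 1 \<le> k \<and> coeff P 0 \<noteq> 0 \<and> coeff P k \<noteq> 0 \<and>
     (\<forall>j\<ge>1. coeff P j \<noteq> 0 \<longrightarrow> of_nat k * (vv (coeff P 0) - vv (coeff P j)) \<le> of_nat j * (vv (coeff P 0) - vv (coeff P k))) \<and>
     (\<forall>j>k. coeff P j \<noteq> 0 \<longrightarrow> of_nat k * (vv (coeff P 0) - vv (coeff P j)) < of_nat j * (vv (coeff P 0) - vv (coeff P k))) \<and>
     int k dvd vx (coeff P 0) - vx (coeff P k) \<and> int k dvd vy (coeff P 0) - vy (coeff P k) \<and>
     ((\<forall>d\<in>D. 0 < lc d \<longrightarrow> of_nat k * vv d < vv (coeff P 0) - vv (coeff P k)) \<and> lc (coeff P 0) * lc (coeff P k) < 0 \<or>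
      (\<exists>d\<in>D. 0 < lc d \<and> (\<forall>d'\<in>D. 0 < lc d' \<longrightarrow> d' = d \<or> 0 < lc (d' - d)) \<and>
         of_nat k * vv d = vv (coeff P 0) - vv (coeff P k) \<and> vv (poly P d) = vv (coeff P 0) \<and> lc (poly P d) * lc (coeff P 0) < 0))"

text \<open>Falling from a positive value at 0 to the zero at 1 requires a negative derivative,
  which keeps its sign up to x in the absence of critical points.\<close>

lemma no_critical_neg:
  fixes q :: "real poly"
  assumes "poly q 1 = 0" "0 < poly q 0" "1 < x" and crit: "\<And>u. 0 < u \<Longrightarrow> u < x \<Longrightarrow> poly (pderiv q) u \<noteq> 0"
  shows "poly q x < 0"
proof (rule ccontr)
  assume n: "\<not> ?thesis"
  obtain u where u: "0 < u" "u < 1" "poly q 1 - poly q 0 = poly (pderiv q) u" using poly_MVT[of 0 1 q] by auto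
  obtain u' where u': "1 < u'" "u' < x" "poly q x - poly q 1 = (x - 1) * poly (pderiv q) u'"
    using poly_MVT[of 1 x q] assms(3) by auto
  have "poly (pderiv q) u < 0" using u assms by simp
  moreover have "0 \<le> poly (pderiv q) u'" using u' assms n mult_pos_neg[of "x - 1" "poly (pderiv q) u'"] by force
  ultimately obtain c where "u \<le> c" "c \<le> u'" "poly (pderiv q) c = 0"
    using IVT[of "poly (pderiv q)" u 0 u'] u u' by (auto intro!: continuous_intros)
  then show False using crit[of c] u u' by auto
qed

lemma ex_min_pos:
  assumes "finite D" "d \<in> D" "0 < lc d"
  obtains m where "m \<in> D" "0 < lc m" "\<And>d. d \<in> D \<Longrightarrow> 0 < lc d \<Longrightarrow> d = m \<or> 0 < lc (d - m)"
proof -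
  have "\<exists>m\<in>D. 0 < lc m \<and> (\<forall>d\<in>D. 0 < lc d \<longrightarrow> d = m \<or> 0 < lc (d - m))"
    using assms
  proof (induction D arbitrary: d rule: finite_induct)
    case (insert a D)
    show ?case
    proof (cases "\<exists>d\<in>D. 0 < lc d")
      case False
      then show ?thesis using insert.prems by auto
    next
      case True
      then obtain m where m: "m \<in> D" "0 < lc m" "\<And>d. d \<in> D \<Longrightarrow> 0 < lc d \<Longrightarrow> d = m \<or> 0 < lc (d - m)"
        using insert.IH by blast
      show ?thesis
      proof (cases "0 < lc a \<and> 0 < lc (m - a)")
        case True
        have "0 < lc (d - a)" if "d \<in> D" "0 < lc d" for d
          using m(3)[OF that] True pos_add(1)[of "d - m" "m - a"] by auto
        then show ?thesis using True by (intro bexI[of _ a]) auto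
      next
        case False
        then show ?thesis using m lc_diff_total[of a m] by (intro bexI[of _ m]) auto
      qed
    qed
  qed simp
  then show thesis using that by blast
qed

lemma pos_le_vv: "0 < lc s \<Longrightarrow> 0 < lc (d - s) \<Longrightarrow> vv d = min (vv (d - s)) (vv s)"
  using pos_add(2)[of "d - s" s] by simp

theorem good_root_iff:
  assumes D: "covers D P 1" "finite D" and P: "P \<noteq> 0"
  shows "(\<exists>s. good s D \<and> poly P s = 0) \<longleftrightarrow> (\<exists>k\<le>degree P. rootcond P D k)"
proof
  assume "\<exists>s. good s D \<and> poly P s = 0"
  then obtain s where s: "good s D" "poly P s = 0" by blast
  have s0: "0 < lc s" using s by (auto simp: good_def)
  define q where "q = map_poly res (scp P s (coeff P 0))"
  define k where "k = degree q"
  note rr = root_residue[OF D(1) s(1) P s(2), folded q_def]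
  note re = root_edge[OF D(1) s(1) P s(2), folded q_def, folded k_def]
  have p: "coeff (scp P s (coeff P 0)) i \<in> O2" for i using dom_scp(2)[OF rr(1)] s0 by simp
  have kv: "of_nat k * (vv (coeff P 0) - vv (coeff P j)) \<le> of_nat j * (vv (coeff P 0) - vv (coeff P k))"
    if "coeff P j \<noteq> 0" for j
    using mult_left_mono[OF re(5)[OF that], of "of_nat k"] re(4) by (simp add: mult_ac)
  have kv': "of_nat k * (vv (coeff P 0) - vv (coeff P j)) < of_nat j * (vv (coeff P 0) - vv (coeff P k))"
    if "j > k" "coeff P j \<noteq> 0" for j
    using mult_strict_left_mono[OF re(6)[OF that], of "of_nat k"] re(1,4) by (simp add: mult_ac)
  have dv: "int k dvd vx (coeff P 0) - vx (coeff P k)" "int k dvd vy (coeff P 0) - vy (coeff P k)"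
  proof -
    have "[:vx (coeff P 0) - vx (coeff P k), vy (coeff P 0) - vy (coeff P k):] = smult (int k) (vv s)"
      using re(4) by (simp add: vv_def of_nat_poly)
    then show "int k dvd vx (coeff P 0) - vx (coeff P k)" "int k dvd vy (coeff P 0) - vy (coeff P k)"
      by (auto simp: vv_def)
  qed
  have lk: "k \<le> degree P" using re(3) le_degree by blast
  have cr: "\<exists>w\<in>O2. res w = u \<and> s * w \<in> D \<and> 0 < lc (s * w) \<and> vv (s * w) = vv s"
    if u: "0 < u" "poly (pderiv q) u = 0" for u
  proof -
    obtain w where w: "w \<in> O2" "res w = u" "s * w \<in> droots P 1"
      using lift_residue_root[of P s "coeff P 0" q 1 u, OF p q_def _ _ re(2)] lc_pos_nz[OF s0] u(2) rr(5) by auto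
    then show ?thesis using D(1) scaled_pos[OF s0 w(1)] u(1) by (auto simp: covers_def intro!: bexI[of _ w])
  qed
  have le: "vv d \<le> vv s" if "d \<in> D" "0 < lc d" for d
    using s(1) that pos_le_vv[OF s0, of d] by (auto simp: good_def)
  show "\<exists>k\<le>degree P. rootcond P D k"
  \<comment> \<open>Without a positive point of D of the valuation of s, the residue polynomial has
    no positive critical point and stays negative beyond 1, so its leading coefficient is negative.
    Otherwise it is negative at the residue of m/s, where m is the least positive point of
    D.\<close>
  proof (cases "\<exists>d\<in>D. 0 < lc d \<and> vv d = vv s")
    case False
    have lt: "of_nat k * vv d < vv (coeff P 0) - vv (coeff P k)" if "d \<in> D" "0 < lc d" for d
    proof -
      have "vv d < vv s" using le[OF that] False that by (auto simp: order_le_less)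
      then show ?thesis using mult_strict_left_mono[of "vv d" "vv s" "of_nat k"] re(1,4) by simp
    qed
    have nc: "poly (pderiv q) u \<noteq> 0" if "0 < u" for u using cr[of u] that False by auto
    have neg: "poly q x < 0" if "1 < x" for x
      by (rule no_critical_neg) (use rr that nc in auto)
    have "\<not> 0 < lead_coeff q"
    proof
      assume "0 < lead_coeff q"
      then obtain n where n: "\<And>x. n \<le> x \<Longrightarrow> lead_coeff q \<le> poly q x" using poly_pinfty_gt_lc by blast
      have "1 < max n 2" by (simp add: less_max_iff_disj)
      then show False using n[of "max n 2"] neg[of "max n 2"] \<open>0 < lead_coeff q\<close> by auto
    qed
    moreover have "lead_coeff q \<noteq> 0" using rr(5) by auto
    ultimately have "lead_coeff q < 0" by linarith
    then have "coeff q k < 0" by (simp add: k_def)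
    then have "sgn (lc (coeff P k) * lc (coeff P 0)) = -1" unfolding re(7)[symmetric] by (rule sgn_neg)
    then have "lc (coeff P 0) * lc (coeff P k) < 0" by (simp only: sgn_1_neg mult.commute)
    then have "rootcond P D k" unfolding rootcond_def using re(1-3) kv kv' dv lt by blast
    then show ?thesis using lk by blast
  next
    case True
    then obtain d0 where d0: "d0 \<in> D" "0 < lc d0" "vv d0 = vv s" by blast
    obtain m where m: "m \<in> D" "0 < lc m" "\<And>d. d \<in> D \<Longrightarrow> 0 < lc d \<Longrightarrow> d = m \<or> 0 < lc (d - m)"
      using ex_min_pos[OF D(2) d0(1,2)] by metis
    have vm: "vv m = vv s" using m(3)[OF d0(1,2)] pos_le_vv[OF m(2), of d0] le[OF m(1,2)] d0 by auto
    define w where "w = m / s"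
    note w = ratio_O2[OF s0 m(2) vm[symmetric], folded w_def]
    have w1: "1 < res w" using good_scaled[OF s(1) _ w(1)] w m s0 by (simp add: zero_less_divide_iff)
    have nc: "poly (pderiv q) u \<noteq> 0" if u: "0 < u" "u < res w" for u
    proof
      assume "poly (pderiv q) u = 0"
      then obtain w' where w': "w' \<in> O2" "res w' = u" "s * w' \<in> D" "0 < lc (s * w')" using cr u by blast
      have "s * w' - m = s * (w' - w)" using w(3) by (simp add: algebra_simps)
      moreover have "lc (w' - w) < 0" using O2_diff[OF w'(1) w(1)] O2_lc[of "w' - w"] u w'(2) by auto
      ultimately have "lc (s * w' - m) < 0" using s0 by (simp add: mult_less_0_iff)
      then show False using m(3)[OF w'(3,4)] by auto
    qed
    have "poly q (res w) < 0" by (rule no_critical_neg) (use rr w1 nc in auto)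
    then have "res (poly P m / coeff P 0) < 0" "poly P m / coeff P 0 \<in> O2"
      using res_poly_scp[OF p w(1)] by (auto simp: q_def w(3))
    then have "poly P m / coeff P 0 \<noteq> 0 \<and> vv (poly P m / coeff P 0) = 0 \<and> lc (poly P m / coeff P 0) < 0"
      using O2_lc[of "poly P m / coeff P 0"] by auto
    then have "vv (poly P m) = vv (coeff P 0)" "lc (poly P m) * lc (coeff P 0) < 0"
      using re(2) by (auto simp: vv_divide lc_divide divide_less_0_iff mult_less_0_iff)
    moreover have "of_nat k * vv m = vv (coeff P 0) - vv (coeff P k)" using re(4) vm by simp
    ultimately have "rootcond P D k" unfolding rootcond_def using re(1-3) kv kv' dv m by blast
    then show ?thesis using lk by blast
  qed
next
  assume "\<exists>k\<le>degree P. rootcond P D k"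
  then obtain k where k: "rootcond P D k" by blast
  define a0 ak where "a0 = coeff P 0" and "ak = coeff P k"
  have k1: "1 \<le> k" and nz: "a0 \<noteq> 0" "ak \<noteq> 0" using k by (auto simp: rootcond_def a0_def ak_def)
  obtain g h where gh: "vx a0 - vx ak = int k * g" "vy a0 - vy ak = int k * h"
    using k by (auto simp: rootcond_def a0_def ak_def elim!: dvdE)
  \<comment> \<open>A scale with the valuation prescribed by the edge; the root sought is z times a
    unit.\<close>
  define z where "z = mon h g"
  have z: "z \<noteq> 0" "lc z = 1" "vv z = [:g, h:]" by (auto simp: z_def vv_mon)
  have vz: "vv a0 - vv ak = of_nat k * vv z" using gh unfolding z(3) by (simp add: vv_def of_nat_poly)
  define q where "q = map_poly res (scp P z a0)"
  have edge: "vv a0 - vv (coeff P j) \<le> of_nat j * vv z" if "coeff P j \<noteq> 0" for j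
  proof (cases "j = 0")
    case False
    then have "of_nat k * (vv a0 - vv (coeff P j)) \<le> of_nat k * (of_nat j * vv z)"
      using k that by (auto simp: rootcond_def a0_def[symmetric] ak_def[symmetric] vz mult_ac)
    then show ?thesis using k1 by simp
  qed (simp add: a0_def)
  have edge': "vv a0 - vv (coeff P j) < of_nat j * vv z" if "coeff P j \<noteq> 0" "j > k" for j
  proof -
    have "of_nat k * (vv a0 - vv (coeff P j)) < of_nat k * (of_nat j * vv z)"
      using k that by (auto simp: rootcond_def a0_def[symmetric] ak_def[symmetric] vz mult_ac)
    then show ?thesis using k1 by simp
  qed
  have vj: "vv (coeff P j * z ^ j / a0) = vv (coeff P j) + of_nat j * vv z - vv a0" if "coeff P j \<noteq> 0" for j
    using that z nz by (simp add: vv_divide vv_mult vv_power)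
  have p: "coeff (scp P z a0) i \<in> O2" for i
  proof (cases "coeff P i = 0")
    case False
    then have "0 \<le> vv (coeff P i * z ^ i / a0)" using vj[OF False] edge[OF False] by (simp add: algebra_simps)
    then show ?thesis by (simp add: coeff_scp O2_def)
  qed (simp add: coeff_scp O2_def)
  have cq: "coeff q i = res (coeff P i * z ^ i / a0)" for i
    by (simp add: q_def coeff_map_poly res.\<rho>0 coeff_scp)
  have q0: "poly q 0 = 1" using nz by (simp add: poly_0_coeff_0 cq a0_def[symmetric] res.\<rho>1)
  have qk: "coeff q k = lc ak / lc a0"
    using vj[of k] nz vz p[of k] by (simp add: cq ak_def[symmetric] res_eq coeff_scp z lc_divide algebra_simps)
  have dq: "degree q = k"
  proof (rule antisym)
    show "degree q \<le> k"
    proof (rule degree_le, clarify)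
      fix i assume "k < i"
      then show "coeff q i = 0"
        using vj[of i] edge'[of i] p[of i]
        by (cases "coeff P i = 0") (auto simp: cq res.\<rho>0 res_eq coeff_scp algebra_simps)
    qed
    show "k \<le> degree q" using qk nz by (intro le_degree) simp
  qed
  have dq0: "pderiv q \<noteq> 0" using dq k1 by (simp add: pderiv_eq_0_iff)
  have zw: "0 < lc (z * w) \<and> vv (z * w) = vv z \<and> lc (z * w) = res w" if "w \<in> O2" "0 < res w" for w
    using scaled_pos[of z w] that z by simp
  have crit: "\<exists>w\<in>O2. res w = u \<and> z * w \<in> D" if u: "0 < u" "poly (pderiv q) u = 0" for u
  proof -
    obtain w where w: "w \<in> O2" "res w = u" "z * w \<in> droots P 1"
      using lift_residue_root[of P z a0 q 1 u, OF p q_def _ _ nz(1) z(1)] u(2) dq0 by auto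
    then show ?thesis using D(1) zw[of w] u(1) by (auto simp: covers_def intro!: bexI[of _ w])
  qed
  have lift: "\<exists>s. 0 < lc s \<and> vv s = vv z \<and> lc s = x \<and> poly P s = 0"
    if x: "0 < x" "poly q x = 0" "poly (pderiv q) x \<noteq> 0" for x
  proof -
    obtain w where w: "w \<in> O2" "res w = x" "poly (scp P z a0) w = 0"
      using hensel[of "scp P z a0" x] p x by (auto simp: q_def)
    then show ?thesis using zw[of w] x nz by (auto simp: poly_scp intro!: exI[of _ "z * w"])
  qed
  consider (a) "\<And>d. d \<in> D \<Longrightarrow> 0 < lc d \<Longrightarrow> of_nat k * vv d < vv a0 - vv ak" "lc a0 * lc ak < 0"
    | (b) m where "m \<in> D" "0 < lc m" "\<And>d. d \<in> D \<Longrightarrow> 0 < lc d \<Longrightarrow> d = m \<or> 0 < lc (d - m)"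
        "of_nat k * vv m = vv a0 - vv ak" "vv (poly P m) = vv a0" "lc (poly P m) * lc a0 < 0"
    using k unfolding rootcond_def a0_def[symmetric] ak_def[symmetric] by blast
  then show "\<exists>s. good s D \<and> poly P s = 0"
  proof cases
    case a
    have small: "vv d < vv z" if "d \<in> D" "0 < lc d" for d
    proof -
      have "of_nat k * vv d < of_nat k * vv z" using a(1)[OF that] vz by simp
      then show ?thesis by (simp add: mult_less_cancel_left)
    qed
    have "lead_coeff q < 0" using a(2) by (simp add: dq qk divide_less_0_iff mult_less_0_iff) auto
    then obtain n where n: "\<And>x. n \<le> x \<Longrightarrow> lead_coeff (- q) \<le> poly (- q) x"
      using poly_pinfty_gt_lc[of "- q"] by auto
    have "0 \<le> max n 1" by (simp add: le_max_iff_disj)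
    then obtain x where x: "0 \<le> x" "poly q x = 0"
      using IVT2[of "poly q" "max n 1" 0 0] n[of "max n 1"] q0 \<open>lead_coeff q < 0\<close> by (auto intro!: continuous_intros)
    then have x0: "0 < x" using q0 by (cases "x = 0") auto
    \<comment> \<open>Any positive zero of q will do: a critical point there would lift to a point
      of D of valuation v(z), which \<open>small\<close> excludes. So the zero is simple and can be
      lifted.\<close>
    have "poly (pderiv q) x \<noteq> 0"
      using crit[OF x0] small zw x0 by (metis less_irrefl)
    then obtain s where s: "0 < lc s" "vv s = vv z" "poly P s = 0" using lift[OF x0 x(2)] by blast
    have "good s D" using s small vv_diff_gt_lc[OF _ s(1)] by (force simp: good_def)
    then show ?thesis using s by blast
  next
    case b
    have vm: "vv m = vv z" using b(4) vz k1 by simp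
    define w where "w = m / z"
    have w: "w \<in> O2" "res w = lc m" "z * w = m"
      using ratio_O2[of z m] vm z b(2) by (auto simp: w_def)
    have "poly P m \<noteq> 0" using b(6) by auto
    then have "poly P m / a0 \<in> O2" "res (poly P m / a0) < 0"
      using b(5,6) nz by (auto simp: O2_def vv_divide res_eq lc_divide divide_less_0_iff mult_less_0_iff)
    then have qm: "poly q (lc m) < 0" using res_poly_scp(2)[OF p w(1)] by (simp add: q_def w(2,3))
    obtain x where x: "0 \<le> x" "x \<le> lc m" "poly q x = 0"
      using IVT2[of "poly q" "lc m" 0 0] qm q0 b(2) by (auto intro!: continuous_intros)
    then have x0: "0 < x" "x < lc m" using q0 qm by (cases "x = 0"; cases "x = lc m"; force)+
    have below: "0 < lc (m - t) \<and> vv (m - t) = vv z" if "lc t < lc m" "0 < lc t" "vv t = vv z" for t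
      using add_same[of m "- t"] that vm by auto
    \<comment> \<open>A critical point at x would lift to a positive point of D below the least
      one.\<close>
    have "poly (pderiv q) x \<noteq> 0"
    proof
      assume "poly (pderiv q) x = 0"
      then obtain w' where w': "w' \<in> O2" "res w' = x" "z * w' \<in> D" using crit[OF x0(1)] by blast
      then have "0 < lc (m - z * w')" using below[of "z * w'"] zw[of w'] x0 by simp
      moreover have "z * w' = m \<or> 0 < lc (z * w' - m)" using b(3)[OF w'(3)] zw[of w'] w' x0 by simp
      ultimately show False using lc_uminus[of "m - z * w'"] by auto
    qed
    then obtain s where s: "0 < lc s" "vv s = vv z" "lc s = x" "poly P s = 0" using lift[OF x0(1) x(3)] by blast
    have ms: "0 < lc (m - s)" "vv (m - s) = vv s" using below[of s] s x0 by auto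
    have "0 < lc (d - s) \<and> vv (d - s) \<le> vv d" if d: "d \<in> D" "0 < lc d" for d
    proof (cases "d = m")
      case False
      then have "0 < lc (d - m)" using b(3)[OF d] by auto
      from pos_add[OF this ms(1)] have 1: "0 < lc (d - s)" "vv (d - s) \<le> vv s" using ms by auto
      then show ?thesis using pos_le_vv[OF s(1) 1(1)] by auto
    qed (use ms s vm in auto)
    then show ?thesis using s by (auto simp: good_def)
  qed
qed

lemma good_root_vv:
  assumes "covers D P 1" "P \<noteq> 0" "good s D" "poly P s = 0" "rootcond P D k"
  shows "of_nat k * vv s = vv (coeff P 0) - vv (coeff P k)"
proof -
  note re = root_edge[OF assms(1,3,2,4)]
  let ?k = "degree (map_poly res (scp P s (coeff P 0)))"
  have k: "1 \<le> k" "coeff P k \<noteq> 0" using assms(5) by (auto simp: rootcond_def)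
  have "of_nat k * (vv (coeff P 0) - vv (coeff P ?k)) \<le> of_nat ?k * (vv (coeff P 0) - vv (coeff P k))"
    using assms(5) re(1,3) unfolding rootcond_def by blast
  then have "of_nat ?k * (of_nat k * vv s) \<le> of_nat ?k * (vv (coeff P 0) - vv (coeff P k))"
    using re(4) by (simp add: mult_ac)
  then have "of_nat k * vv s \<le> vv (coeff P 0) - vv (coeff P k)" using re(1) by simp
  then show ?thesis using re(5)[OF k(2)] by simp
qed

text \<open>Choose a point of C nearest to t in valuation, and let c be the point of C on the same
  side of t that is nearest in the order. It is also nearest in valuation, so points of C beyond t
  are not infinitely close to t at the scale of t - c.\<close>

lemma locate:
  assumes "finite C" "C \<noteq> {}" "t \<notin> C"
  shows "\<exists>c\<in>C. \<exists>sg\<in>{1, -1}. good (sg * (t - c)) ((\<lambda>c'. sg * (c' - c)) ` C)"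
proof -
  define V where "V = Max ((\<lambda>c. vv (t - c)) ` C)"
  have V: "V \<in> (\<lambda>c. vv (t - c)) ` C" "\<And>c. c \<in> C \<Longrightarrow> vv (t - c) \<le> V"
    unfolding V_def using assms by (auto intro: Max_in)
  obtain c0 where c0: "c0 \<in> C" "vv (t - c0) = V" using V(1) by auto
  define sg :: rxy where "sg = (if 0 < lc (t - c0) then 1 else -1)"
  have e: "sg \<in> {1, -1}" "sg * sg = 1" "sg \<noteq> 0" "vv (sg * f) = vv f" for f by (auto simp: sg_def)
  have p0: "0 < lc (sg * (t - c0))"
    using lc_diff_total[of t c0] lc_uminus[of "t - c0"] assms c0 by (auto simp: sg_def)
  obtain m where m: "m \<in> (\<lambda>c. sg * (t - c)) ` C" "0 < lc m"
    "\<And>d. d \<in> (\<lambda>c. sg * (t - c)) ` C \<Longrightarrow> 0 < lc d \<Longrightarrow> d = m \<or> 0 < lc (d - m)"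
    using ex_min_pos[of "(\<lambda>c. sg * (t - c)) ` C" "sg * (t - c0)"] assms(1) c0 p0 by blast
  then obtain c where c: "c \<in> C" "m = sg * (t - c)" by blast
  have "V \<le> vv m"
    using m(3)[of "sg * (t - c0)"] c0 p0 pos_le_vv[OF m(2), of "sg * (t - c0)"] by (auto simp: e)
  then have vm: "vv m = V" using V(2)[OF c(1)] by (simp add: c(2) e)
  have "good m ((\<lambda>c'. sg * (c' - c)) ` C)"
    unfolding good_def
  proof (intro conjI ballI impI m(2))
    fix d assume d: "d \<in> (\<lambda>c'. sg * (c' - c)) ` C" "0 < lc d"
    then obtain c' where c': "c' \<in> C" "d = sg * (c' - c)" by blast
    have eq: "d - m = sg * (c' - t)" by (simp add: c' c algebra_simps)
    have "\<not> 0 < lc (sg * (t - c'))"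
    proof
      assume p: "0 < lc (sg * (t - c'))"
      have "sg * (t - c') - m = - d" by (simp add: c' c algebra_simps)
      then have "lc (sg * (t - c') - m) < 0" using d(2) by simp
      moreover have "sg * (t - c') = m \<or> 0 < lc (sg * (t - c') - m)"
        using m(3)[OF _ p] c'(1) by blast
      ultimately show False by auto
    qed
    moreover have "sg * (t - c') \<noteq> 0" using c'(1) assms(3) e(3) by auto
    ultimately have "lc (sg * (t - c')) < 0" using lc_eq_0_iff[of "sg * (t - c')"] by linarith
    moreover have "sg * (c' - t) = - (sg * (t - c'))" by (simp add: algebra_simps)
    ultimately have pos: "0 < lc (d - m)" unfolding eq by simp
    then show "0 < lc (d - m)" .
    have "vv (d - m) \<le> V" using V(2)[OF c'(1)] vv_uminus[of "t - c'"] by (simp add: eq e)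
    then show "vv (d - m) \<le> vv d" using pos_le_vv[OF m(2) pos] vm by simp
  qed
  then show ?thesis using c e(1) by blast
qed

text \<open>The distance to c' depends on s only if c' is c itself, or if c' lies on the opposite
  side of c and, in valuation, no farther from c than s does. In all other cases the distance is
  that of the two centres.\<close>

lemma good_diff:
  assumes g: "good s ((\<lambda>c'. sg * (c' - c)) ` C)" and "sg \<in> {1, -1}" "c' \<in> C"
  shows "ssim (c + sg * s - c') (if c' = c \<or> lc (sg * (c' - c)) < 0 \<and> vv s \<le> vv (c' - c) then sg * s else c - c')"
proof -
  have s: "0 < lc s" using g by (simp add: good_def)
  have e: "sg * sg = 1" "vv (sg * f) = vv f" "sg \<noteq> 0" "sg * (sg * f) = f" for f using assms(2) by auto
  let ?d = "sg * (c' - c)"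
  have eq: "c + sg * s - c' = sg * (s - ?d)" using e(4)[of "c' - c"] by (simp add: algebra_simps)
  have scale: "ssim f g \<Longrightarrow> ssim (sg * f) (sg * g)" for f g by (intro ssim_mult) auto
  consider "c' = c" | "0 < lc ?d" | "lc ?d < 0"
    using e(3) lc_eq_0_iff[of ?d] by (metis linorder_neqE_linordered_idom mult_eq_0_iff right_minus_eq)
  then show ?thesis
  proof cases
    case 1 then show ?thesis by simp
  next
    case 2
    then have d: "0 < lc (?d - s)" "vv (?d - s) \<le> vv ?d" using g assms(3) by (auto simp: good_def)
    have "vv (?d - s) = vv ?d" using pos_le_vv[OF s d(1)] d(2) by simp
    moreover have "vv (s - ?d) = vv (?d - s)" "lc (s - ?d) = - lc (?d - s)"
      using vv_uminus[of "?d - s"] lc_uminus[of "?d - s"] by (simp_all only: minus_diff_eq)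
    ultimately have "ssim (s - ?d) (- ?d)" using d(1) 2 unfolding ssim_def by simp
    from scale[OF this] have "ssim (c + sg * s - c') (c - c')" unfolding eq using e(4)[of "c' - c"] by simp
    then show ?thesis using 2 by auto
  next
    case 3
    then have p: "0 < lc (- ?d)" by simp
    have a: "0 < lc (s - ?d)" "vv (s - ?d) = min (vv s) (vv ?d)" using pos_add[OF s p] by (simp_all only: diff_conv_add_uminus[of s] vv_uminus)
    have "ssim (s - ?d) (if vv s \<le> vv (c' - c) then s else - ?d)"
      using a s 3 by (auto simp: ssim_def e min_def)
    moreover have "sg * - ?d = c - c'" by (metis e(4) minus_diff_eq mult_minus_right)
    moreover have "c' \<noteq> c" using 3 by auto
    ultimately show ?thesis unfolding eq using 3 scale[of "s - ?d" s] scale[of "s - ?d" "- ?d"]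
      by (cases "vv s \<le> vv (c' - c)") simp_all
  qed
qed

section \<open>Tame rings of functions\<close>

text \<open>Zero is told apart by the sign entry for every n, and \<open>cls 1\<close> carries just
  the sign; so equality and order are class conditions too.\<close>

definition cls :: "nat \<Rightarrow> rxy \<Rightarrow> real \<times> int \<times> int" where
  "cls n f = (sgn (lc f), vx f mod int n, vy f mod int n)"

definition cls_range :: "nat \<Rightarrow> (real \<times> int \<times> int) set" where
  "cls_range n = {-1, 0, 1} \<times> {0..<int n} \<times> {0..<int n}"

lemma finite_cls_range [simp]: "finite (cls_range n)" by (simp add: cls_range_def)

lemma cls_in_range: "0 < n \<Longrightarrow> cls n f \<in> cls_range n"
  by (auto simp: cls_def cls_range_def sgn_if)

lemma cls_ssim: "ssim f g \<Longrightarrow> cls n f = cls n g"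
  by (auto simp: cls_def ssim_def vv_def)

definition cmul :: "nat \<Rightarrow> real \<times> int \<times> int \<Rightarrow> real \<times> int \<times> int \<Rightarrow> real \<times> int \<times> int" where
  "cmul n = (\<lambda>(a, b, c) (a', b', c'). if a * a' = 0 then (0, 0, 0)
     else (a * a', (b + b') mod int n, (c + c') mod int n))"

lemma cls_0 [simp]: "cls n 0 = (0, 0, 0)" by (simp add: cls_def)

lemma cls_mult: "cls n (f * g) = cmul n (cls n f) (cls n g)"
  by (cases "f = 0 \<or> g = 0") (auto simp: cls_def cmul_def sgn_mult vx_mult vy_mult mod_add_eq sgn_zero_iff)

primrec cpow :: "nat \<Rightarrow> real \<times> int \<times> int \<Rightarrow> nat \<Rightarrow> real \<times> int \<times> int" where
  "cpow n k 0 = cls n 1" | "cpow n k (Suc m) = cmul n k (cpow n k m)"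

lemma cls_power: "cls n (f ^ m) = cpow n (cls n f) m"
  by (induction m) (auto simp: cls_mult)

text \<open>Comparison of valuations with v(0) counted as infinite, a convention that
  \<open>vv\<close> itself does not have.\<close>

definition vle :: "rxy \<Rightarrow> rxy \<Rightarrow> bool" where
  "vle f g \<longleftrightarrow> g = 0 \<or> f \<noteq> 0 \<and> vv f \<le> vv g"

lemma vle_ssim: "ssim f f' \<Longrightarrow> ssim g g' \<Longrightarrow> vle f g = vle f' g'"
  using ssim_0[of f f'] ssim_0[of g g'] by (auto simp: vle_def ssim_def)

lemma vle_iff: "f \<noteq> 0 \<Longrightarrow> g \<noteq> 0 \<Longrightarrow> vle f g \<longleftrightarrow> vv f \<le> vv g"
  by (simp add: vle_def)

text \<open>The value group has the least positive element v(X), so a strict inequality is a weak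
  one after multiplication by X. This exchanges the two sides of a comparison at the price of a
  negation.\<close>

lemma not_vle_iff: "\<not> vle g f \<longleftrightarrow> f \<noteq> 0 \<and> vle (fX * f) g"
proof (cases "f = 0 \<or> g = 0")
  case False
  then have "vv (fX * f) \<le> vv g \<longleftrightarrow> vv f < vv g"
    by (simp add: vv_mult vv_fX) (auto simp: vv_def lin_le_iff lin_less_iff)
  then show ?thesis using False by (auto simp: vle_def)
qed (auto simp: vle_def)

text \<open>Neither summand is negative, so the sum has the smaller one of the valuations 2 v(f) and
  2 v(g) + v(X), and it is even in both entries exactly if this is the first. As v(X) is the least
  positive value, that means v(f) <= v(g).\<close>

lemma vle_cls: "vle f g \<longleftrightarrow> f = 0 \<and> g = 0 \<or> cls 2 (f\<^sup>2 + fX * g\<^sup>2) = (1, 0, 0)"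
proof -
  have sq: "lc (h\<^sup>2) = (lc h)\<^sup>2" "h \<noteq> 0 \<Longrightarrow> vv (h\<^sup>2) = 2 * vv h" for h
    using vv_power[of h 2] by auto
  have Xg: "g \<noteq> 0 \<Longrightarrow> vv (fX * g\<^sup>2) = 2 * vv g + [:1, 0:]"
    by (simp add: vv_mult vv_fX sq add.commute)
  consider "f = 0" "g = 0" | "f \<noteq> 0" "g = 0" | "f = 0" "g \<noteq> 0" | "f \<noteq> 0" "g \<noteq> 0" by blast
  then show ?thesis
  proof cases
    case 2
    then have "(sgn (lc f))\<^sup>2 = 1" by (simp add: sgn_if)
    then show ?thesis using 2 sq(2)[of f] by (auto simp: vle_def cls_def vv_def numeral_poly)
  next
    case 3
    then show ?thesis using Xg by (auto simp: vle_def cls_def vv_def numeral_poly)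
  next
    case 4
    have lin: "vv f \<le> vv g \<longleftrightarrow> 2 * vv f < 2 * vv g + [:1, 0:]"
      by (auto simp: vv_def lin_le_iff lin_less_iff numeral_poly)
    have p: "0 < lc (f\<^sup>2)" "0 < lc (fX * g\<^sup>2)" using 4 by auto
    show ?thesis
    proof (cases "vv f \<le> vv g")
      case True
      then have "vv (f\<^sup>2 + fX * g\<^sup>2) = 2 * vv f"
        using pos_add(2)[OF p] lin by (simp add: sq Xg 4)
      then show ?thesis using True 4 pos_add(1)[OF p]
        by (auto simp: vle_def cls_def vv_def numeral_poly)
    next
      case False
      then have "vv (f\<^sup>2 + fX * g\<^sup>2) = 2 * vv g + [:1, 0:]"
        using pos_add(2)[OF p] lin by (simp add: sq Xg 4 min_def)
      then show ?thesis using False 4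
        by (auto simp: vle_def cls_def vv_def numeral_poly)
    qed
  qed (auto simp: vle_def)
qed

section \<open>Definability over an abstract Boolean algebra of parameter sets\<close>

locale bool_alg =
  fixes Q :: "'e set set"
  assumes Q_UNIV: "UNIV \<in> Q" and Q_compl: "A \<in> Q \<Longrightarrow> - A \<in> Q" and Q_int: "A \<in> Q \<Longrightarrow> B \<in> Q \<Longrightarrow> A \<inter> B \<in> Q"
begin

definition QP :: "('e \<Rightarrow> bool) \<Rightarrow> bool" where "QP C \<longleftrightarrow> {e. C e} \<in> Q"

lemma QP_conj: "QP C \<Longrightarrow> QP D \<Longrightarrow> QP (\<lambda>e. C e \<and> D e)"
  using Q_int[of "{e. C e}" "{e. D e}"] by (simp add: QP_def Collect_conj_eq)

lemma QP_not: "QP C \<Longrightarrow> QP (\<lambda>e. \<not> C e)"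
  using Q_compl[of "{e. C e}"] by (simp add: QP_def Collect_neg_eq)

lemma QP_const: "QP (\<lambda>_. b)"
  using Q_UNIV Q_compl[OF Q_UNIV] by (cases b) (auto simp: QP_def)

lemma QP_disj: "QP C \<Longrightarrow> QP D \<Longrightarrow> QP (\<lambda>e. C e \<or> D e)"
  using QP_not[OF QP_conj[OF QP_not[of C] QP_not[of D]]] by simp

lemma QP_imp: "QP C \<Longrightarrow> QP D \<Longrightarrow> QP (\<lambda>e. C e \<longrightarrow> D e)"
  using QP_disj[OF QP_not[of C], of D] by simp

lemma QP_ball: "finite I \<Longrightarrow> (\<And>i. i \<in> I \<Longrightarrow> QP (C i)) \<Longrightarrow> QP (\<lambda>e. \<forall>i\<in>I. C i e)"
  by (induction I rule: finite_induct) (auto intro: QP_const QP_conj)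

lemma QP_bex: "finite I \<Longrightarrow> (\<And>i. i \<in> I \<Longrightarrow> QP (C i)) \<Longrightarrow> QP (\<lambda>e. \<exists>i\<in>I. C i e)"
  by (induction I rule: finite_induct) (auto intro: QP_const QP_disj)

lemma QP_cong: "(\<And>e. C e = D e) \<Longrightarrow> QP D \<Longrightarrow> QP C" by (simp add: QP_def)

lemmas QP_intros = QP_conj QP_not QP_const QP_disj QP_imp

end

text \<open>Members of P are functions of a parameter e with values in F, and Q collects the
  admissible sets of parameters. Beyond being a ring with constants, P is only asked to have its
  classes decided by Q; by \<open>vle_cls\<close> this settles comparisons of valuations as
  well.\<close>

locale tring = bool_alg Q for Q :: "'e set set" +
  fixes P :: "('e \<Rightarrow> rxy) set"
  assumes P_const: "(\<lambda>_. c) \<in> P"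
    and P_add: "f \<in> P \<Longrightarrow> g \<in> P \<Longrightarrow> (\<lambda>e. f e + g e) \<in> P"
    and P_mult: "f \<in> P \<Longrightarrow> g \<in> P \<Longrightarrow> (\<lambda>e. f e * g e) \<in> P"
    and P_cls: "f \<in> P \<Longrightarrow> 0 < n \<Longrightarrow> QP (\<lambda>e. cls n (f e) = k)"
begin

lemma P_uminus: "f \<in> P \<Longrightarrow> (\<lambda>e. - f e) \<in> P"
  using P_mult[OF P_const[of "-1"], of f] by simp

lemma P_diff: "f \<in> P \<Longrightarrow> g \<in> P \<Longrightarrow> (\<lambda>e. f e - g e) \<in> P"
  using P_add[OF _ P_uminus[of g], of f] by simp

lemma P_power: "f \<in> P \<Longrightarrow> (\<lambda>e. f e ^ n) \<in> P"
  by (induction n) (auto intro: P_const P_mult)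

lemma P_sum: "finite I \<Longrightarrow> (\<And>i. i \<in> I \<Longrightarrow> f i \<in> P) \<Longrightarrow> (\<lambda>e. \<Sum>i\<in>I. f i e) \<in> P"
  by (induction I rule: finite_induct) (auto intro: P_const P_add)

lemmas P_intros = P_const P_add P_mult P_uminus P_diff P_power

lemma QP_zero: "f \<in> P \<Longrightarrow> QP (\<lambda>e. f e = 0)"
  by (rule QP_cong[OF _ P_cls[of f 1 "(0, 0, 0)"]]) (auto simp: cls_def sgn_zero_iff)

lemma QP_vle: "f \<in> P \<Longrightarrow> g \<in> P \<Longrightarrow> QP (\<lambda>e. vle (f e) (g e))"
  unfolding vle_cls
  by (intro QP_intros QP_zero P_cls P_add P_mult P_const) (auto simp: power2_eq_square intro: P_mult)

text \<open>A function of which only monomials are understood: its classes, and comparisons of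
  \<open>a \<sigma>^m\<close> with members of P. Membership in P asks for more, namely control over
  all polynomials in \<sigma>.\<close>

definition vtame :: "('e \<Rightarrow> rxy) \<Rightarrow> bool" where
  "vtame \<sigma> \<longleftrightarrow> (\<forall>n>0. \<forall>k. QP (\<lambda>e. cls n (\<sigma> e) = k)) \<and>
     (\<forall>m. \<forall>a\<in>P. \<forall>b\<in>P. QP (\<lambda>e. vle (a e * \<sigma> e ^ m) (b e)))"

lemma vtame_P: "f \<in> P \<Longrightarrow> vtame f"
  unfolding vtame_def by (auto intro!: P_cls QP_vle P_intros)

lemma vtame_cls: "vtame \<sigma> \<Longrightarrow> 0 < n \<Longrightarrow> QP (\<lambda>e. cls n (\<sigma> e) = k)"
  and vtame_vle: "vtame \<sigma> \<Longrightarrow> a \<in> P \<Longrightarrow> b \<in> P \<Longrightarrow> QP (\<lambda>e. vle (a e * \<sigma> e ^ m) (b e))"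
  unfolding vtame_def by blast+

lemma vtame_cls_rel: assumes "vtame \<sigma>" "0 < n" shows "QP (\<lambda>e. R (cls n (\<sigma> e)))"
proof (rule QP_cong)
  show "R (cls n (\<sigma> e)) \<longleftrightarrow> (\<exists>k\<in>cls_range n. R k \<and> cls n (\<sigma> e) = k)" for e
    using cls_in_range[OF assms(2)] by auto
  show "QP (\<lambda>e. \<exists>k\<in>cls_range n. R k \<and> cls n (\<sigma> e) = k)"
    by (intro QP_bex QP_conj QP_const vtame_cls assms finite_cls_range)
qed

lemma vtame_cls_rel2: assumes "vtame \<sigma>" "vtame \<tau>" "0 < n" "0 < m"
  shows "QP (\<lambda>e. R (cls n (\<sigma> e)) (cls m (\<tau> e)))"
proof (rule QP_cong)
  show "R (cls n (\<sigma> e)) (cls m (\<tau> e)) \<longleftrightarrow> (\<exists>k\<in>cls_range n. cls n (\<sigma> e) = k \<and> R k (cls m (\<tau> e)))" for e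
    using cls_in_range[OF assms(3)] by auto
  show "QP (\<lambda>e. \<exists>k\<in>cls_range n. cls n (\<sigma> e) = k \<and> R k (cls m (\<tau> e)))"
    by (intro QP_bex QP_conj vtame_cls vtame_cls_rel assms finite_cls_range)
qed

lemma vtame_pos: assumes "vtame \<sigma>" shows "QP (\<lambda>e. 0 < lc (\<sigma> e))"
  by (rule QP_cong[OF _ vtame_cls_rel[of \<sigma> 1 "\<lambda>k. fst k = 1"]]) (use assms in \<open>auto simp: cls_def sgn_1_pos\<close>)

lemma vtame_neg: assumes "vtame \<sigma>" shows "QP (\<lambda>e. lc (\<sigma> e) < 0)"
  by (rule QP_cong[OF _ vtame_cls_rel[of \<sigma> 1 "\<lambda>k. fst k = -1"]]) (use assms in \<open>auto simp: cls_def sgn_1_neg\<close>)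

lemma vtame_zero: assumes "vtame \<sigma>" shows "QP (\<lambda>e. \<sigma> e = 0)"
  by (rule QP_cong[OF _ vtame_cls_rel[of \<sigma> 1 "\<lambda>k. fst k = 0"]]) (use assms in \<open>auto simp: cls_def sgn_zero_iff\<close>)

lemma QP_pos: "f \<in> P \<Longrightarrow> QP (\<lambda>e. 0 < lc (f e))" by (rule vtame_pos[OF vtame_P])
lemma QP_neg: "f \<in> P \<Longrightarrow> QP (\<lambda>e. lc (f e) < 0)" by (rule vtame_neg[OF vtame_P])

lemma QP_eq: "f \<in> P \<Longrightarrow> g \<in> P \<Longrightarrow> QP (\<lambda>e. f e = g e)"
  using QP_zero[OF P_diff, of f g] by simp

text \<open>Tameness depends on \<sigma> only up to \<open>ssim\<close>, and finitely many pieces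
  from Q may be glued. Pieces may overlap, since the comparison function is right on each of
  them.\<close>

lemma vtame_cover:
  assumes "finite I" "\<And>i. i \<in> I \<Longrightarrow> QP (B i)" "\<And>i. i \<in> I \<Longrightarrow> vtame (\<tau> i)"
    and "\<And>e. \<exists>i\<in>I. B i e" "\<And>i e. i \<in> I \<Longrightarrow> B i e \<Longrightarrow> ssim (\<sigma> e) (\<tau> i e)"
  shows "vtame \<sigma>"
proof -
  have main: "QP (\<lambda>e. R e (\<sigma> e))" if R: "\<And>i. i \<in> I \<Longrightarrow> QP (\<lambda>e. R e (\<tau> i e))"
    "\<And>e f g. ssim f g \<Longrightarrow> R e f = R e g" for R
  proof (rule QP_cong)
    show "R e (\<sigma> e) \<longleftrightarrow> (\<exists>i\<in>I. B i e \<and> R e (\<tau> i e))" for e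
      using assms(4)[of e] assms(5)[of _ e] R(2) by blast
    show "QP (\<lambda>e. \<exists>i\<in>I. B i e \<and> R e (\<tau> i e))"
      by (intro QP_bex QP_conj assms R)
  qed
  show ?thesis unfolding vtame_def
  proof (intro allI impI ballI conjI)
    show "0 < n \<Longrightarrow> QP (\<lambda>e. cls n (\<sigma> e) = k)" for n k
      by (rule main[of "\<lambda>e f. cls n f = k"]) (auto intro: vtame_cls assms simp: cls_ssim)
    show "a \<in> P \<Longrightarrow> b \<in> P \<Longrightarrow> QP (\<lambda>e. vle (a e * \<sigma> e ^ m) (b e))" for a b m
      by (rule main[of "\<lambda>e f. vle (a e * f ^ m) (b e)"])
        (auto intro!: vtame_vle assms vle_ssim ssim_mult ssim_power)
  qed
qed

lemma vtame_ssim: "vtame \<tau> \<Longrightarrow> (\<And>e. ssim (\<sigma> e) (\<tau> e)) \<Longrightarrow> vtame \<sigma>"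
  by (rule vtame_cover[of "{()}" "\<lambda>_ _. True" "\<lambda>_. \<tau>"]) (auto intro: QP_const)

lemma vtame_glue: "QP C \<Longrightarrow> vtame \<sigma> \<Longrightarrow> vtame \<tau> \<Longrightarrow> vtame (\<lambda>e. if C e then \<sigma> e else \<tau> e)"
  by (rule vtame_cover[of "{True, False}" "\<lambda>b e. if b then C e else \<not> C e" "\<lambda>b. if b then \<sigma> else \<tau>"])
    (auto intro!: QP_intros)

lemma vtame_mult_power:
  assumes "vtame \<sigma>" "f \<in> P" shows "vtame (\<lambda>e. f e * \<sigma> e ^ j)"
  unfolding vtame_def
proof (intro allI impI ballI conjI)
  fix n :: nat and k assume n: "0 < n"
  show "QP (\<lambda>e. cls n (f e * \<sigma> e ^ j) = k)"
    unfolding cls_mult cls_power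
    by (rule vtame_cls_rel2[of f \<sigma> n n "\<lambda>x y. cmul n x (cpow n y j) = k"]) (use assms n vtame_P in auto)
next
  fix m a b assume "a \<in> P" "b \<in> P"
  then have "QP (\<lambda>e. vle ((a e * f e ^ m) * \<sigma> e ^ (j * m)) (b e))"
    by (intro vtame_vle assms P_intros)
  then show "QP (\<lambda>e. vle (a e * (f e * \<sigma> e ^ j) ^ m) (b e))"
    by (simp add: power_mult_distrib power_mult mult_ac)
qed

lemma vtame_mult: "vtame \<sigma> \<Longrightarrow> f \<in> P \<Longrightarrow> vtame (\<lambda>e. f e * \<sigma> e)"
  using vtame_mult_power[of \<sigma> f 1] by simp

lemma vtame_vle_P: "vtame \<sigma> \<Longrightarrow> b \<in> P \<Longrightarrow> QP (\<lambda>e. vle (\<sigma> e) (b e))"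
  using vtame_vle[of \<sigma> "\<lambda>_. 1" b 1] P_const by simp

lemma vtame_vle_P': assumes "vtame \<sigma>" "b \<in> P" shows "QP (\<lambda>e. vle (b e) (\<sigma> e))"
proof -
  have "QP (\<lambda>e. \<not> (\<sigma> e \<noteq> 0 \<and> vle (fX * \<sigma> e) (b e)))"
    by (intro QP_intros vtame_zero vtame_vle_P vtame_mult assms P_const)
  then show ?thesis using not_vle_iff by (auto intro: QP_cong)
qed

text \<open>A positive element is determined up to \<open>ssim\<close> by its valuation. The class
  of \<sigma> modulo n is that of f modulo kn divided by k, and comparisons with powers of \<sigma>
  become comparisons with powers of f after raising both sides to the power k.\<close>

lemma vtame_root:
  assumes k: "1 \<le> k" and f: "f \<in> P" and \<sigma>: "\<And>e. 0 < lc (\<sigma> e) \<and> f e \<noteq> 0 \<and> of_nat k * vv (\<sigma> e) = vv (f e)"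
  shows "vtame \<sigma>"
  unfolding vtame_def
proof (intro allI impI ballI conjI)
  have v: "vx (f e) = int k * vx (\<sigma> e)" "vy (f e) = int k * vy (\<sigma> e)" for e
    using \<sigma>[of e] by (auto simp: vv_def of_nat_poly mult.commute)
  fix n :: nat and \<kappa> assume n: "0 < n"
  show "QP (\<lambda>e. cls n (\<sigma> e) = \<kappa>)"
  proof (rule QP_cong)
    show "cls n (\<sigma> e) = \<kappa> \<longleftrightarrow> (\<lambda>(s, a, b). (1, a div int k, b div int k) = \<kappa>) (cls (k * n) (f e))" for e
      using k \<sigma>[of e] by (auto simp: cls_def v mult_mod_right[symmetric] of_nat_mult)
    show "QP (\<lambda>e. (\<lambda>(s, a, b). (1, a div int k, b div int k) = \<kappa>) (cls (k * n) (f e)))"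
      by (rule vtame_cls_rel) (use k n f vtame_P in auto)
  qed
next
  fix m a b assume ab: "a \<in> P" "b \<in> P"
  show "QP (\<lambda>e. vle (a e * \<sigma> e ^ m) (b e))"
  proof (rule QP_cong)
    fix e
    show "vle (a e * \<sigma> e ^ m) (b e) \<longleftrightarrow> vle (a e ^ k * f e ^ m) (b e ^ k)"
    proof (cases "a e = 0 \<or> b e = 0")
      case True then show ?thesis using k by (auto simp: vle_def)
    next
      case False
      have "of_nat k * (vv (a e) + of_nat m * vv (\<sigma> e)) \<le> of_nat k * vv (b e) \<longleftrightarrow>
          vv (a e) + of_nat m * vv (\<sigma> e) \<le> vv (b e)"
        using k by (intro mult_le_cancel_left_pos) simp
      moreover have vf: "vv (f e) = of_nat k * vv (\<sigma> e)" using \<sigma>[of e] by simp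
      have "of_nat k * (vv (a e) + of_nat m * vv (\<sigma> e)) = of_nat k * vv (a e) + of_nat m * vv (f e)"
        unfolding vf by (simp add: algebra_simps)
      ultimately show ?thesis using False \<sigma>[of e] by (simp add: vle_iff vv_mult vv_power)
    qed
  qed (intro QP_vle P_intros ab f)
qed

text \<open>The uniform bound on the degree lets evaluation, composition and vanishing be written as
  finite sums or conjunctions valid for all parameters at once.\<close>

definition PolyP :: "('e \<Rightarrow> rxy poly) \<Rightarrow> bool" where
  "PolyP p \<longleftrightarrow> (\<forall>i. (\<lambda>e. coeff (p e) i) \<in> P) \<and> (\<exists>N. \<forall>e. degree (p e) \<le> N)"

lemma PolyP_coeff: "PolyP p \<Longrightarrow> (\<lambda>e. coeff (p e) i) \<in> P" by (simp add: PolyP_def)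

lemma PolyPI: "(\<And>i. (\<lambda>e. coeff (p e) i) \<in> P) \<Longrightarrow> (\<And>e. degree (p e) \<le> N) \<Longrightarrow> PolyP p"
  by (auto simp: PolyP_def)

lemma PolyP_deg: assumes "PolyP p" obtains N where "\<forall>e. degree (p e) \<le> N"
  using assms by (auto simp: PolyP_def)

lemma PolyP_const: "f \<in> P \<Longrightarrow> PolyP (\<lambda>e. [:f e:])"
proof (rule PolyPI[of _ 0])
  assume f: "f \<in> P"
  show "(\<lambda>e. coeff [:f e:] i) \<in> P" for i using f by (cases i) (auto simp: P_const)
qed simp

lemma PolyP_fixed: "PolyP (\<lambda>e. p)"
  by (rule PolyPI[of _ "degree p"]) (auto simp: P_const)

lemma PolyP_lin: "f \<in> P \<Longrightarrow> g \<in> P \<Longrightarrow> PolyP (\<lambda>e. [:f e, g e:])"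
proof (rule PolyPI[of _ 1])
  assume f: "f \<in> P" "g \<in> P"
  show "(\<lambda>e. coeff [:f e, g e:] i) \<in> P" for i
    using f by (cases i; cases "i - 1") (auto simp: P_const)
qed simp

lemma PolyP_add: assumes "PolyP p" "PolyP q" shows "PolyP (\<lambda>e. p e + q e)"
proof -
  obtain N where N: "\<And>e. degree (p e) \<le> N" using PolyP_deg[OF assms(1)] by blast
  obtain M where M: "\<And>e. degree (q e) \<le> M" using PolyP_deg[OF assms(2)] by blast
  have "degree (p e + q e) \<le> max N M" for e
    using N[of e] M[of e] by (intro degree_add_le) (simp_all add: le_max_iff_disj)
  then show ?thesis using assms by (intro PolyPI) (auto simp: PolyP_coeff P_add)
qed

lemma PolyP_mult: assumes "PolyP p" "PolyP q" shows "PolyP (\<lambda>e. p e * q e)"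
proof -
  obtain N where N: "\<And>e. degree (p e) \<le> N" using PolyP_deg[OF assms(1)] by blast
  obtain M where M: "\<And>e. degree (q e) \<le> M" using PolyP_deg[OF assms(2)] by blast
  have "degree (p e * q e) \<le> N + M" for e
    using degree_mult_le[of "p e" "q e"] N[of e] M[of e] by linarith
  then show ?thesis using assms
    by (intro PolyPI) (auto simp: PolyP_coeff coeff_mult intro!: P_sum P_mult)
qed

lemma PolyP_smult: "f \<in> P \<Longrightarrow> PolyP p \<Longrightarrow> PolyP (\<lambda>e. smult (f e) (p e))"
  using PolyP_mult[OF PolyP_const, of f p] by simp

lemma PolyP_power: "PolyP p \<Longrightarrow> PolyP (\<lambda>e. p e ^ n)"
  by (induction n) (auto intro: PolyP_mult PolyP_fixed)

lemma PolyP_sum: "finite I \<Longrightarrow> (\<And>i. i \<in> I \<Longrightarrow> PolyP (f i)) \<Longrightarrow> PolyP (\<lambda>e. \<Sum>i\<in>I. f i e)"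
  by (induction I rule: finite_induct) (auto intro: PolyP_add PolyP_fixed)

lemma PolyP_diff: "PolyP p \<Longrightarrow> PolyP q \<Longrightarrow> PolyP (\<lambda>e. p e - q e)"
  using PolyP_add[OF _ PolyP_smult[OF P_const[of "-1"]], of p q] by simp

lemma poly_bound: "degree p \<le> N \<Longrightarrow> poly p (x :: 'a :: comm_ring_1) = (\<Sum>i\<le>N. coeff p i * x ^ i)"
  unfolding poly_altdef by (rule sum.mono_neutral_left) (auto simp: coeff_eq_0)

lemma PolyP_poly: assumes "PolyP p" "f \<in> P" shows "(\<lambda>e. poly (p e) (f e)) \<in> P"
proof -
  obtain N where N: "\<And>e. degree (p e) \<le> N" using PolyP_deg[OF assms(1)] by blast
  show ?thesis unfolding poly_bound[OF N] by (intro P_sum P_mult P_power PolyP_coeff assms finite_atMost)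
qed

lemma PolyP_pcompose: assumes "PolyP p" "PolyP q" shows "PolyP (\<lambda>e. pcompose (p e) (q e))"
proof -
  obtain N where N: "\<And>e. degree (p e) \<le> N" using PolyP_deg[OF assms(1)] by blast
  have eq: "pcompose (p e) (q e) = (\<Sum>i\<le>N. smult (coeff (p e) i) (q e ^ i))" for e
  proof -
    have "degree (map_poly (\<lambda>x. [:x:]) (p e)) \<le> N" using N[of e] by (simp add: degree_map_poly)
    then show ?thesis by (simp add: pcompose_altdef poly_bound coeff_map_poly)
  qed
  show ?thesis unfolding eq by (intro PolyP_sum PolyP_smult PolyP_power PolyP_coeff assms finite_atMost)
qed

lemma PolyP_pderiv: assumes "PolyP p" shows "PolyP (\<lambda>e. pderiv (p e))"
proof -
  obtain N where N: "\<And>e. degree (p e) \<le> N" using PolyP_deg[OF assms] by blast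
  have "degree (pderiv (p e)) \<le> N" for e using N[of e] by (simp add: degree_pderiv)
  then show ?thesis using assms by (intro PolyPI) (auto simp: coeff_pderiv intro!: P_mult PolyP_coeff P_const)
qed

lemma PolyP_pderivs: "PolyP p \<Longrightarrow> PolyP (\<lambda>e. (pderiv ^^ k) (p e))"
  by (induction k) (auto intro: PolyP_pderiv)

lemma QP_poly_zero: assumes "PolyP p" shows "QP (\<lambda>e. p e = 0)"
proof -
  obtain N where N: "\<And>e. degree (p e) \<le> N" using PolyP_deg[OF assms] by blast
  have eq: "p e = 0 \<longleftrightarrow> (\<forall>i\<in>{..N}. coeff (p e) i = 0)" for e
    using N[of e] by (metis atMost_iff coeff_0 leading_coeff_0_iff)
  show ?thesis unfolding eq by (intro QP_ball QP_zero PolyP_coeff assms finite_atMost)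
qed

end

text \<open>Maximality serves as a closure principle: a function belongs to P as soon as adjoining
  it leaves all classes decided by Q.\<close>

locale mtring = tring +
  assumes maximal: "tring Q P' \<Longrightarrow> P \<subseteq> P' \<Longrightarrow> P' = P"
begin

lemma adjoinI:
  assumes "P \<subseteq> P'"
    and "\<And>f g. f \<in> P' \<Longrightarrow> g \<in> P' \<Longrightarrow> (\<lambda>e. f e + g e) \<in> P'"
    and "\<And>f g. f \<in> P' \<Longrightarrow> g \<in> P' \<Longrightarrow> (\<lambda>e. f e * g e) \<in> P'"
    and "\<And>f n k. f \<in> P' \<Longrightarrow> 0 < n \<Longrightarrow> QP (\<lambda>e. cls n (f e) = k)"
  shows "P' = P"
proof (rule maximal)
  show "tring Q P'"
    by unfold_locales (use assms P_const in auto)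
qed fact

lemma P_glue:
  assumes C: "QP C" and "f \<in> P" "g \<in> P" shows "(\<lambda>e. if C e then f e else g e) \<in> P"
proof -
  let ?P = "{\<lambda>e. if C e then f e else g e | f g. f \<in> P \<and> g \<in> P}"
  have "?P = P"
  proof (rule adjoinI)
    show "P \<subseteq> ?P"
    proof
      fix f assume "f \<in> P"
      then show "f \<in> ?P" by (intro CollectI exI[of _ f]) auto
    qed
  next
    fix f g assume "f \<in> ?P" "g \<in> ?P"
    then obtain a b a' b' where fg: "f = (\<lambda>e. if C e then a e else b e)" "g = (\<lambda>e. if C e then a' e else b' e)"
      and P: "a \<in> P" "b \<in> P" "a' \<in> P" "b' \<in> P" by blast
    have "(\<lambda>e. f e + g e) = (\<lambda>e. if C e then a e + a' e else b e + b' e)"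
      "(\<lambda>e. f e * g e) = (\<lambda>e. if C e then a e * a' e else b e * b' e)" by (auto simp: fg)
    moreover have "(\<lambda>e. if C e then u e else w e) \<in> ?P" if "u \<in> P" "w \<in> P" for u w
      using that by blast
    ultimately show "(\<lambda>e. f e + g e) \<in> ?P" "(\<lambda>e. f e * g e) \<in> ?P"
      using P_add[OF P(1,3)] P_add[OF P(2,4)] P_mult[OF P(1,3)] P_mult[OF P(2,4)] by simp_all
  next
    fix f n k assume "f \<in> ?P" "0 < (n :: nat)"
    then obtain a b where f: "f = (\<lambda>e. if C e then a e else b e)" "a \<in> P" "b \<in> P" by blast
    then show "QP (\<lambda>e. cls n (f e) = k)"
      using vtame_cls[OF vtame_glue[OF C vtame_P vtame_P] \<open>0 < n\<close>] by simp
  qed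
  then show ?thesis using assms by blast
qed

text \<open>Fractions with nowhere vanishing denominators form an admissible extension; the
  convention that the inverse of 0 is 0 is then met by gluing.\<close>

lemma P_inverse:
  assumes "f \<in> P" shows "(\<lambda>e. inverse (f e)) \<in> P"
proof -
  let ?P = "{\<lambda>e. f e / g e | f g. f \<in> P \<and> g \<in> P \<and> (\<forall>e. g e \<noteq> 0)}"
  have "?P = P"
  proof (rule adjoinI)
    show "P \<subseteq> ?P"
    proof
      fix f assume "f \<in> P"
      then show "f \<in> ?P" using P_const[of 1] by (intro CollectI exI[of _ f] exI[of _ "\<lambda>_. 1"]) auto
    qed
  next
    fix f g assume "f \<in> ?P" "g \<in> ?P"
    then obtain a b a' b' where fg: "f = (\<lambda>e. a e / b e)" "g = (\<lambda>e. a' e / b' e)"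
      and P: "a \<in> P" "b \<in> P" "a' \<in> P" "b' \<in> P" and nz: "\<And>e. b e \<noteq> 0" "\<And>e. b' e \<noteq> 0" by blast
    have 1: "(\<lambda>e. f e + g e) = (\<lambda>e. (a e * b' e + a' e * b e) / (b e * b' e))"
      "(\<lambda>e. f e * g e) = (\<lambda>e. (a e * a' e) / (b e * b' e))"
      using nz by (auto simp: fg add_divide_eq_iff field_simps fun_eq_iff)
    have 2: "(\<lambda>e. a e * b' e + a' e * b e) \<in> P" "(\<lambda>e. a e * a' e) \<in> P" "(\<lambda>e. b e * b' e) \<in> P"
      by (intro P_intros P)+
    show "(\<lambda>e. f e + g e) \<in> ?P" unfolding 1
      using 2 nz by (intro CollectI exI[of _ "\<lambda>e. a e * b' e + a' e * b e"] exI[of _ "\<lambda>e. b e * b' e"]) auto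
    show "(\<lambda>e. f e * g e) \<in> ?P" unfolding 1
      using 2 nz by (intro CollectI exI[of _ "\<lambda>e. a e * a' e"] exI[of _ "\<lambda>e. b e * b' e"]) auto
  next
    fix f n k assume "f \<in> ?P" and n: "0 < (n :: nat)"
    then obtain a b where f: "f = (\<lambda>e. a e / b e)" "a \<in> P" "b \<in> P" and nz: "\<And>e. b e \<noteq> 0" by blast
    define ic :: "real \<times> int \<times> int \<Rightarrow> real \<times> int \<times> int" where
      "ic = (\<lambda>(s, x, y). (s, (- x) mod int n, (- y) mod int n))"
    have "cls n (f e) = cmul n (cls n (a e)) (ic (cls n (b e)))" for e
    proof -
      have "cls n (inverse (b e)) = ic (cls n (b e))"
        using nz[of e] by (auto simp: cls_def ic_def inverse_simps mod_minus_eq sgn_inverse sgn_if)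
      then show ?thesis by (simp add: f divide_inverse cls_mult)
    qed
    then show "QP (\<lambda>e. cls n (f e) = k)"
      using vtame_cls_rel2[OF vtame_P[OF f(2)] vtame_P[OF f(3)] n n, of "\<lambda>x y. cmul n x (ic y) = k"] by simp
  qed
  moreover
  let ?g = "\<lambda>e. if f e = 0 then 1 else f e" and ?h = "\<lambda>e. if f e = 0 then 0 else (1 :: rxy)"
  have "?g \<in> P" "?h \<in> P" by (intro P_glue QP_zero assms P_const)+
  then have "(\<lambda>e. ?h e / ?g e) \<in> ?P" by (intro CollectI exI[of _ ?h] exI[of _ ?g]) auto
  moreover have "(\<lambda>e. ?h e / ?g e) = (\<lambda>e. inverse (f e))" by (auto simp: divide_inverse)
  ultimately show ?thesis by simp
qed

lemma P_divide: "f \<in> P \<Longrightarrow> g \<in> P \<Longrightarrow> (\<lambda>e. f e / g e) \<in> P"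
  unfolding divide_inverse by (intro P_mult P_inverse)

lemma PolyP_glue:
  assumes "QP C" "PolyP p" "PolyP q" shows "PolyP (\<lambda>e. if C e then p e else q e)"
proof -
  obtain N where N: "\<forall>e. degree (p e) \<le> N" using PolyP_deg[OF assms(2)] by blast
  obtain M where M: "\<forall>e. degree (q e) \<le> M" using PolyP_deg[OF assms(3)] by blast
  show ?thesis
  proof (rule PolyPI)
    show "(\<lambda>e. coeff (if C e then p e else q e) i) \<in> P" for i
      using P_glue[OF assms(1) PolyP_coeff[OF assms(2), of i] PolyP_coeff[OF assms(3), of i]]
      by (simp add: if_distrib if_distribR cong: if_cong)
    show "degree (if C e then p e else q e) \<le> max N M" for e using N M by (simp add: le_max_iff_disj)
  qed
qed

end

text \<open>Inequalities between multiples of differences of valuations become divisibilities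
  between products of powers, so that every clause is a comparison \<open>vle\<close>, a sign or a
  class. The degree bound makes the quantifiers over indices finite.\<close>

lemma rootcond_iff:
  assumes "degree P \<le> N"
  shows "rootcond P D k \<longleftrightarrow> 1 \<le> k \<and> coeff P 0 \<noteq> 0 \<and> coeff P k \<noteq> 0 \<and>
    (\<forall>j\<in>{1..N}. coeff P j \<noteq> 0 \<longrightarrow> vle (coeff P 0 ^ k * coeff P k ^ j) (coeff P 0 ^ j * coeff P j ^ k)) \<and>
    (\<forall>j\<in>{k<..N}. coeff P j \<noteq> 0 \<longrightarrow> \<not> vle (coeff P 0 ^ j * coeff P j ^ k) (coeff P 0 ^ k * coeff P k ^ j)) \<and>
    snd (cls k (coeff P 0)) = snd (cls k (coeff P k)) \<and>
    ((\<forall>d\<in>D. 0 < lc d \<longrightarrow> \<not> vle (coeff P 0) (coeff P k * d ^ k)) \<and> lc (coeff P 0 * coeff P k) < 0 \<or>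
     (\<exists>d\<in>D. 0 < lc d \<and> (\<forall>d'\<in>D. 0 < lc d' \<longrightarrow> d' = d \<or> 0 < lc (d' - d)) \<and>
       vle (coeff P 0) (coeff P k * d ^ k) \<and> vle (coeff P k * d ^ k) (coeff P 0) \<and>
       vle (coeff P 0) (poly P d) \<and> vle (poly P d) (coeff P 0) \<and> lc (poly P d * coeff P 0) < 0))"
proof (cases "1 \<le> k \<and> coeff P 0 \<noteq> 0 \<and> coeff P k \<noteq> 0")
  case True
  then have k: "1 \<le> k" and a0: "coeff P 0 \<noteq> 0" and ak: "coeff P k \<noteq> 0" by auto
  have J: "(\<forall>j\<ge>1. coeff P j \<noteq> 0 \<longrightarrow> A j) \<longleftrightarrow> (\<forall>j\<in>{1..N}. coeff P j \<noteq> 0 \<longrightarrow> A j)"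
    "(\<forall>j>k. coeff P j \<noteq> 0 \<longrightarrow> A j) \<longleftrightarrow> (\<forall>j\<in>{k<..N}. coeff P j \<noteq> 0 \<longrightarrow> A j)" for A
  proof -
    have "coeff P j \<noteq> 0 \<Longrightarrow> j \<le> N" for j using le_degree[of P j] assms by simp
    then show "(\<forall>j\<ge>1. coeff P j \<noteq> 0 \<longrightarrow> A j) \<longleftrightarrow> (\<forall>j\<in>{1..N}. coeff P j \<noteq> 0 \<longrightarrow> A j)"
      "(\<forall>j>k. coeff P j \<noteq> 0 \<longrightarrow> A j) \<longleftrightarrow> (\<forall>j\<in>{k<..N}. coeff P j \<noteq> 0 \<longrightarrow> A j)"
      by (meson atLeastAtMost_iff greaterThanAtMost_iff)+
  qed
  have v: "vle (coeff P 0 ^ k * coeff P k ^ j) (coeff P 0 ^ j * coeff P j ^ k) \<longleftrightarrow>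
      of_nat k * (vv (coeff P 0) - vv (coeff P j)) \<le> of_nat j * (vv (coeff P 0) - vv (coeff P k))"
    "vle (coeff P 0 ^ j * coeff P j ^ k) (coeff P 0 ^ k * coeff P k ^ j) \<longleftrightarrow>
      \<not> of_nat k * (vv (coeff P 0) - vv (coeff P j)) < of_nat j * (vv (coeff P 0) - vv (coeff P k))"
    if "coeff P j \<noteq> 0" for j
    using that a0 ak by (auto simp: vle_iff vv_mult vv_power algebra_simps)
  have m: "int k dvd vx (coeff P 0) - vx (coeff P k) \<and> int k dvd vy (coeff P 0) - vy (coeff P k) \<longleftrightarrow>
      snd (cls k (coeff P 0)) = snd (cls k (coeff P k))"
    by (auto simp: cls_def mod_eq_dvd_iff)
  have d: "vle (coeff P 0) (coeff P k * d ^ k) \<longleftrightarrow> \<not> of_nat k * vv d < vv (coeff P 0) - vv (coeff P k)"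
    "vle (coeff P k * d ^ k) (coeff P 0) \<longleftrightarrow> of_nat k * vv d \<le> vv (coeff P 0) - vv (coeff P k)"
    if "0 < lc d" for d
    using that a0 ak by (auto simp: vle_iff vv_mult vv_power algebra_simps not_less)
  have e: "vle (coeff P 0) (poly P d) \<and> vle (poly P d) (coeff P 0) \<and> lc (poly P d * coeff P 0) < 0 \<longleftrightarrow>
      vv (poly P d) = vv (coeff P 0) \<and> lc (poly P d) * lc (coeff P 0) < 0" for d
    using a0 by (cases "poly P d = 0") (auto simp: vle_iff)
  have f: "(0 < lc d \<and> B \<and> vle (coeff P 0) (coeff P k * d ^ k) \<and> vle (coeff P k * d ^ k) (coeff P 0) \<and>
      vle (coeff P 0) (poly P d) \<and> vle (poly P d) (coeff P 0) \<and> lc (poly P d * coeff P 0) < 0) \<longleftrightarrow>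
      (0 < lc d \<and> B \<and> of_nat k * vv d = vv (coeff P 0) - vv (coeff P k) \<and>
        vv (poly P d) = vv (coeff P 0) \<and> lc (poly P d) * lc (coeff P 0) < 0)" for d B
    using d[of d] e[of d] by auto
  have g: "(0 < lc d \<longrightarrow> \<not> vle (coeff P 0) (coeff P k * d ^ k)) \<longleftrightarrow>
      (0 < lc d \<longrightarrow> of_nat k * vv d < vv (coeff P 0) - vv (coeff P k))" for d
    using d[of d] by auto
  have h: "(coeff P j \<noteq> 0 \<longrightarrow> vle (coeff P 0 ^ k * coeff P k ^ j) (coeff P 0 ^ j * coeff P j ^ k)) \<longleftrightarrow>
      (coeff P j \<noteq> 0 \<longrightarrow> of_nat k * (vv (coeff P 0) - vv (coeff P j)) \<le> of_nat j * (vv (coeff P 0) - vv (coeff P k)))"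
    "(coeff P j \<noteq> 0 \<longrightarrow> \<not> vle (coeff P 0 ^ j * coeff P j ^ k) (coeff P 0 ^ k * coeff P k ^ j)) \<longleftrightarrow>
      (coeff P j \<noteq> 0 \<longrightarrow> of_nat k * (vv (coeff P 0) - vv (coeff P j)) < of_nat j * (vv (coeff P 0) - vv (coeff P k)))" for j
    using v[of j] by auto
  show ?thesis unfolding rootcond_def J f g h m[symmetric] using True by (simp only: lc_mult conj_assoc)
next
  case False
  then show ?thesis unfolding rootcond_def by blast
qed

context mtring begin

lemma QP_rootcond:
  assumes p: "PolyP p" and I: "finite I" "\<And>i. i \<in> I \<Longrightarrow> d i \<in> P"
  shows "QP (\<lambda>e. rootcond (p e) ((\<lambda>i. d i e) ` I) k)"
proof -
  obtain N where N: "\<forall>e. degree (p e) \<le> N" using PolyP_deg[OF p] by blast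
  show ?thesis
  proof (cases "1 \<le> k")
    case True
    show ?thesis unfolding rootcond_iff[OF N[rule_format]] ball_simps bex_simps
      by (intro QP_intros QP_ball QP_bex QP_zero QP_vle QP_neg QP_pos QP_eq P_intros PolyP_coeff PolyP_poly
          p I finite_atLeastAtMost finite_greaterThanAtMost
          vtame_cls_rel2[where R = "\<lambda>x y. snd x = snd y"] vtame_P) (use True in auto)
  next
    case False
    then show ?thesis unfolding rootcond_def by (intro QP_cong[OF _ QP_const[of False]]) auto
  qed
qed

end

section \<open>Located roots as functions of the parameter\<close>

lemma pderiv_pcompose_lin:
  "(pderiv ^^ i) (pcompose P [:c, sg:]) = smult (sg ^ i) (pcompose ((pderiv ^^ i) P) [:c, sg :: rxy:])"
  by (induction i) (simp_all add: pderiv_smult pderiv_pcompose pderiv_pCons mult_ac)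

lemma covers_shift:
  assumes "droots P k \<subseteq> C" "sg \<in> {1, -1}"
  shows "covers ((\<lambda>c'. sg * (c' - c)) ` C) (pcompose P [:c, sg:]) k"
  unfolding covers_def
proof (intro ballI impI)
  fix s assume "s \<in> droots (pcompose P [:c, sg:]) k"
  then obtain i where i: "k \<le> i" "(pderiv ^^ i) (pcompose P [:c, sg:]) \<noteq> 0"
    "poly ((pderiv ^^ i) (pcompose P [:c, sg:])) s = 0" by (auto simp: droots_def)
  have "sg \<noteq> 0" using assms(2) by auto
  then have "poly ((pderiv ^^ i) P) (c + s * sg) = 0" "(pderiv ^^ i) P \<noteq> 0"
    using i(2,3) by (auto simp: pderiv_pcompose_lin poly_pcompose)
  with i(1) have "c + s * sg \<in> C" using assms(1) by (auto simp: droots_def)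
  then show "s \<in> (\<lambda>c'. sg * (c' - c)) ` C" by (rule rev_image_eqI) (use assms(2) in auto)
qed

lemma pcompose_lin_nz: "P \<noteq> 0 \<Longrightarrow> sg \<in> {1, -1 :: rxy} \<Longrightarrow> pcompose P [:c, sg:] \<noteq> 0"
  by (auto simp: pcompose_eq_0_iff)

definition vals :: "('e \<Rightarrow> rxy) set \<Rightarrow> 'e \<Rightarrow> rxy set" where "vals C e = (\<lambda>c. c e) ` C"

definition shifted :: "rxy \<Rightarrow> rxy \<Rightarrow> rxy set \<Rightarrow> rxy set" where
  "shifted c sg C = (\<lambda>c'. sg * (c' - c)) ` C"

definition proot :: "rxy poly \<Rightarrow> rxy \<Rightarrow> rxy \<Rightarrow> rxy set \<Rightarrow> rxy \<Rightarrow> bool" where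
  "proot p c sg C s \<longleftrightarrow> good s (shifted c sg C) \<and> poly p (c + sg * s) = 0"

lemma proot_iff: "proot p c sg C s \<longleftrightarrow> good s (shifted c sg C) \<and> poly (pcompose p [:c, sg:]) s = 0"
  by (simp add: proot_def poly_pcompose mult.commute)

lemma proot_unique:
  assumes "droots p 1 \<subseteq> C" "sg \<in> {1, -1}" "p \<noteq> 0" "proot p c sg C s" "proot p c sg C t"
  shows "s = t"
  using good_root_unique[OF covers_shift[OF assms(1,2), folded shifted_def] pcompose_lin_nz[OF assms(3,2)]]
    assms(4,5) unfolding proot_iff by blast

lemma good_iff_vle:
  assumes "sg \<in> {1, -1}" "finite C"
  shows "good (sg * (t - c)) (shifted c sg C) \<longleftrightarrow> 0 < lc (sg * (t - c)) \<and>
    (\<forall>c'\<in>C. 0 < lc (sg * (c' - c)) \<longrightarrow> lc (sg * (t - c')) < 0 \<and> vle (t - c') (c' - c))"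
proof -
  have "0 < lc (d - sg * (t - c)) \<and> vv (d - sg * (t - c)) \<le> vv d \<longleftrightarrow> lc (sg * (t - c')) < 0 \<and> vle (t - c') (c' - c)"
    if "d = sg * (c' - c)" "0 < lc d" for d c'
  proof -
    have eq: "d - sg * (t - c) = - (sg * (t - c'))" by (simp add: that algebra_simps)
    have ve: "vv (sg * f) = vv f" for f using assms(1) by auto
    have v: "vv (d - sg * (t - c)) = vv (t - c')" "vv d = vv (c' - c)"
      by (simp only: eq vv_uminus ve, simp only: that(1) ve)
    have nz: "c' - c \<noteq> 0" using that by auto
    show ?thesis unfolding v using nz by (auto simp: eq vle_def)
  qed
  then show ?thesis unfolding good_def shifted_def by auto
qed

context mtring begin

text \<open>Where \<open>rootcond\<close> holds with index k, k v(s) is the valuation of a quotient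
  of two coefficients of the shifted polynomial, so \<open>vtame_root\<close> applies on that piece.
  The value 1 is a harmless default where there is no root.\<close>

lemma located_root:
  assumes p: "PolyP p" "\<And>e. p e \<noteq> 0" and C: "finite C" "C \<subseteq> P" "\<And>e. droots (p e) 1 \<subseteq> vals C e"
    and c: "c \<in> P" and sg: "sg \<in> {1, -1}"
  defines "hit e \<equiv> \<exists>s. proot (p e) (c e) sg (vals C e) s"
  shows "QP hit" "vtame (\<lambda>e. if hit e then THE s. proot (p e) (c e) sg (vals C e) s else 1)"
proof -
  define p1 where "p1 e = pcompose (p e) [:c e, sg:]" for e
  have "PolyP p1" unfolding p1_def[abs_def] by (intro PolyP_pcompose PolyP_lin p c P_const)
  moreover have "p1 e \<noteq> 0" for e unfolding p1_def by (rule pcompose_lin_nz[OF p(2) sg])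
  ultimately have p1: "PolyP p1" "\<And>e. p1 e \<noteq> 0" by auto
  define d where "d = (\<lambda>c' e. sg * (c' e - c e))"
  have D: "shifted (c e) sg (vals C e) = (\<lambda>c'. d c' e) ` C" for e
    by (simp add: shifted_def vals_def d_def image_image)
  have dP: "d c' \<in> P" if "c' \<in> C" for c' unfolding d_def using that C(2) by (intro P_intros c) auto
  have cov: "covers ((\<lambda>c'. d c' e) ` C) (p1 e) 1" for e
    unfolding D[symmetric] p1_def by (rule covers_shift[OF C(3) sg, folded shifted_def])
  obtain N where N: "\<forall>e. degree (p1 e) \<le> N" using PolyP_deg[OF p1(1)] by blast
  define R where "R k e \<longleftrightarrow> rootcond (p1 e) ((\<lambda>c'. d c' e) ` C) k" for k e
  have QR: "QP (R k)" for k unfolding R_def[abs_def] by (rule QP_rootcond[OF p1(1) C(1) dP])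
  have hit: "hit e \<longleftrightarrow> (\<exists>k\<in>{..N}. R k e)" for e
  proof -
    have "(\<exists>s. good s ((\<lambda>c'. d c' e) ` C) \<and> poly (p1 e) s = 0) \<longleftrightarrow> (\<exists>k\<le>degree (p1 e). R k e)"
      unfolding R_def by (rule good_root_iff[OF cov finite_imageI[OF C(1)] p1(2)])
    moreover have "hit e \<longleftrightarrow> (\<exists>s. good s ((\<lambda>c'. d c' e) ` C) \<and> poly (p1 e) s = 0)"
      by (simp only: hit_def proot_iff D p1_def)
    ultimately have "hit e \<longleftrightarrow> (\<exists>k\<le>degree (p1 e). R k e)" by simp
    moreover have "k \<le> degree (p1 e)" if "R k e" for k
      using that unfolding R_def rootcond_def by (intro le_degree) blast
    moreover have "k \<le> N" if "k \<le> degree (p1 e)" for k using N[rule_format, of e] that by simp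
    ultimately show ?thesis unfolding Bex_def atMost_iff by blast
  qed
  show Qhit: "QP hit" by (rule QP_cong[OF hit]) (intro QP_bex QR finite_atMost)
  define s where "s e = (if hit e then THE s. proot (p e) (c e) sg (vals C e) s else 1)" for e
  have s: "proot (p e) (c e) sg (vals C e) (s e)" if "hit e" for e
  proof -
    obtain t where t: "proot (p e) (c e) sg (vals C e) t" using \<open>hit e\<close> unfolding hit_def by blast
    then have "(THE s. proot (p e) (c e) sg (vals C e) s) = t"
      using proot_unique[OF C(3) sg p(2)] by (intro the_equality)
    then show ?thesis using t that by (simp add: s_def)
  qed
  show "vtame s"
  proof (rule vtame_cover[of "insert (Suc N) {..N}" "\<lambda>k e. if k = Suc N then \<not> hit e else R k e"
      "\<lambda>k e. if k = Suc N then 1 else if R k e then s e else 1"])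
    show "QP (\<lambda>e. if k = Suc N then \<not> hit e else R k e)" for k
      by (cases "k = Suc N") (auto intro: QP_not Qhit QR)
    show "\<exists>k\<in>insert (Suc N) {..N}. if k = Suc N then \<not> hit e else R k e" for e
      using hit[of e] by force
    show "ssim (s e) (if k = Suc N then 1 else if R k e then s e else 1)"
      if "if k = Suc N then \<not> hit e else R k e" for k e
      using that by (auto simp: s_def)
    fix k assume "k \<in> insert (Suc N) {..N}"
    show "vtame (\<lambda>e. if k = Suc N then 1 else if R k e then s e else 1)"
    proof (cases "k = Suc N \<or> k = 0")
      case True
      moreover have "\<not> R 0 e" for e by (simp add: R_def rootcond_def)
      ultimately show ?thesis by (auto intro!: vtame_P P_const)
    next
      case False
      let ?f = "\<lambda>e. if R k e then coeff (p1 e) 0 / coeff (p1 e) k else 1"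
      have "vtame (\<lambda>e. if R k e then s e else 1)"
      proof (rule vtame_root[of k ?f])
        show "?f \<in> P" by (intro P_glue QR P_divide PolyP_coeff p1 P_const)
        fix e
        show "0 < lc (if R k e then s e else 1) \<and> ?f e \<noteq> 0 \<and> of_nat k * vv (if R k e then s e else 1) = vv (?f e)"
        proof (cases "R k e")
          case True
          have "k \<le> N" using False \<open>k \<in> _\<close> by simp
          then have "hit e" using hit True by auto
          then have "good (s e) ((\<lambda>c'. d c' e) ` C)" "poly (p1 e) (s e) = 0"
            using s[of e] by (auto simp: proot_iff D p1_def)
          from good_root_vv[OF cov p1(2) this True[unfolded R_def]] this(1) show ?thesis
            using True by (auto simp: good_def R_def rootcond_def vv_divide)
        qed simp
      qed (use False in auto)
      then show ?thesis using False by simp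
    qed
  qed simp
qed

text \<open>By \<open>good_diff\<close> the difference is, up to \<open>ssim\<close>, either the
  signed distance from the centre or a difference of centres, and Q decides which.\<close>

lemma located_diff:
  assumes p: "PolyP p" "\<And>e. p e \<noteq> 0" and C: "finite C" "C \<subseteq> P" "\<And>e. droots (p e) 1 \<subseteq> vals C e"
    and c: "c \<in> C" and sg: "sg \<in> {1, -1}" and c': "c' \<in> C"
  defines "hit e \<equiv> \<exists>s. proot (p e) (c e) sg (vals C e) s"
  defines "s e \<equiv> THE s. proot (p e) (c e) sg (vals C e) s"
  shows "vtame (\<lambda>e. if hit e then c e + sg * s e - c' e else 1)"
proof -
  have cP: "c \<in> P" "c' \<in> P" using c c' C(2) by auto
  note lr = located_root[OF p C cP(1) sg, folded hit_def]
  define s' where "s' e = (if hit e then s e else 1)" for e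
  have s': "vtame s'" unfolding s'_def s_def using lr(2) by simp
  have g: "good (s' e) (shifted (c e) sg (vals C e))" if "hit e" for e
  proof -
    have "proot (p e) (c e) sg (vals C e) (s e)"
    proof -
      obtain t where t: "proot (p e) (c e) sg (vals C e) t" using \<open>hit e\<close> unfolding hit_def by blast
      then have "s e = t" unfolding s_def
        using proot_unique[OF C(3) sg p(2)] by (intro the_equality)
      then show ?thesis using t by simp
    qed
    then show ?thesis using that by (simp add: s'_def proot_def)
  qed
  define B where "B e \<longleftrightarrow> c' e = c e \<or> lc (sg * (c' e - c e)) < 0 \<and> vle (s' e) (c' e - c e)" for e
  have QB: "QP B" unfolding B_def[abs_def]
    by (intro QP_intros QP_eq QP_neg vtame_vle_P P_intros cP s')
  have v: "vtame (\<lambda>e. if hit e then (if B e then sg * s' e else c e - c' e) else 1)"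
    by (intro vtame_glue lr QB vtame_mult[OF s'] vtame_P P_intros cP)
  show ?thesis
  proof (rule vtame_ssim[OF v])
    fix e
    show "ssim (if hit e then c e + sg * s e - c' e else 1) (if hit e then (if B e then sg * s' e else c e - c' e) else 1)"
    proof (cases "hit e")
      case True
      have "B e \<longleftrightarrow> c' e = c e \<or> lc (sg * (c' e - c e)) < 0 \<and> vv (s' e) \<le> vv (c' e - c e)"
        using g[OF True] by (auto simp: B_def vle_def good_def)
      then show ?thesis
        using good_diff[OF g[OF True, unfolded shifted_def] sg, of "c' e"] c' True
        by (simp add: vals_def s'_def)
    qed simp
  qed
qed

end

text \<open>Common powers of s are cancelled so that s occurs on one side only, the form in which
  \<open>vtame\<close> controls comparisons.\<close>

lemma dom_iff_vle:
  assumes "s \<noteq> 0" "degree P \<le> N"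
  shows "dom P s j \<longleftrightarrow> coeff P j \<noteq> 0 \<and> (\<forall>i\<in>{..N}. coeff P i \<noteq> 0 \<longrightarrow>
    (if i < j then \<not> vle (coeff P i) (coeff P j * s ^ (j - i)) else vle (coeff P j) (coeff P i * s ^ (i - j))))"
proof (cases "coeff P j = 0")
  case False
  have *: "(vv (coeff P j * s ^ j) \<le> vv (coeff P i * s ^ i) \<and> (i < j \<longrightarrow> vv (coeff P j * s ^ j) < vv (coeff P i * s ^ i)))
    \<longleftrightarrow> (if i < j then \<not> vle (coeff P i) (coeff P j * s ^ (j - i)) else vle (coeff P j) (coeff P i * s ^ (i - j)))"
    if "coeff P i \<noteq> 0" for i
    using that False assms(1) by (auto simp: vle_iff vv_mult vv_power of_nat_diff algebra_simps)
  have "coeff P i \<noteq> 0 \<Longrightarrow> i \<le> N" for i using le_degree[of P i] assms(2) by simp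
  then show ?thesis unfolding dom_def using False * by (meson atMost_iff)
qed (simp add: dom_def)

lemma locate_vals:
  assumes "finite C" "C \<noteq> {}" "t \<notin> vals C e"
  shows "\<exists>c\<in>C. \<exists>sg\<in>{1, -1}. good (sg * (t - c e)) (shifted (c e) sg (vals C e))"
  using locate[of "vals C e" t] assms unfolding vals_def shifted_def by blast

context mtring begin

lemma QP_dom:
  assumes p: "PolyP p" and s: "vtame s" "\<And>e. s e \<noteq> 0"
  shows "QP (\<lambda>e. dom (p e) (s e) j)"
proof -
  obtain N where N: "\<forall>e. degree (p e) \<le> N" using PolyP_deg[OF p] by blast
  have 1: "QP (\<lambda>e. if i < j then \<not> vle (coeff (p e) i) (coeff (p e) j * s e ^ (j - i))
      else vle (coeff (p e) j) (coeff (p e) i * s e ^ (i - j)))" for i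
    by (cases "i < j") (auto intro!: QP_not vtame_vle_P' vtame_mult_power s PolyP_coeff p)
  show ?thesis unfolding dom_iff_vle[OF s(2) N[rule_format]]
    by (intro QP_conj QP_ball QP_imp QP_not QP_zero PolyP_coeff p finite_atMost 1)
qed

lemma QP_good:
  assumes \<xi>: "\<And>c. c \<in> P \<Longrightarrow> vtame (\<lambda>e. \<xi> e - c e)"
    and C: "finite C" "C \<subseteq> P" and c: "c \<in> P" and sg: "sg \<in> {1, -1}"
  shows "QP (\<lambda>e. good (sg * (\<xi> e - c e)) (shifted (c e) sg (vals C e)))"
proof -
  have f: "finite (vals C e)" for e using C by (simp add: vals_def)
  have C': "c' \<in> P" if "c' \<in> C" for c' using that C by auto
  show ?thesis unfolding good_iff_vle[OF sg f] unfolding vals_def ball_simps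
    by (intro QP_conj QP_ball QP_imp vtame_pos vtame_neg vtame_mult \<xi> vtame_vle_P QP_pos P_intros C C' c)
qed

text \<open>Locate \<xi> relative to the zeros of g and its derivatives; by
  \<open>value_at_good\<close> the value of g is then a monomial in the distance. In the index set,
  j = Suc N marks the piece where \<xi> meets a centre, and \<open>None\<close> the one where g
  vanishes identically.\<close>

lemma vtame_poly:
  assumes g: "PolyP g" and C: "finite C" "C \<subseteq> P" "C \<noteq> {}" "\<And>e. droots (g e) 0 \<subseteq> vals C e"
    and \<xi>: "\<And>c. c \<in> P \<Longrightarrow> vtame (\<lambda>e. \<xi> e - c e)"
  shows "vtame (\<lambda>e. poly (g e) (\<xi> e))"
proof -
  obtain N where N: "\<forall>e. degree (g e) \<le> N" using PolyP_deg[OF g] by blast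
  define g1 where "g1 c sg e = pcompose (g e) [:c e, sg:]" for c sg e
  define s where "s c sg e = (if \<xi> e - c e = 0 then 1 else sg * (\<xi> e - c e))" for c sg e
  define I where "I = insert None (Some ` (C \<times> {1, -1 :: rxy} \<times> {..Suc N}))"
  define B where "B i e \<longleftrightarrow> (case i of None \<Rightarrow> g e = 0 | Some (c, sg, j) \<Rightarrow>
      if j = Suc N then \<xi> e - c e = 0 else g e \<noteq> 0 \<and> \<xi> e - c e \<noteq> 0 \<and>
        good (sg * (\<xi> e - c e)) (shifted (c e) sg (vals C e)) \<and> dom (g1 c sg e) (s c sg e) j)" for i e
  define \<tau> where "\<tau> i e = (case i of None \<Rightarrow> 0 | Some (c, sg, j) \<Rightarrow>
      if j = Suc N then poly (g e) (c e) else coeff (g1 c sg e) j * s c sg e ^ j)" for i e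
  have g1: "PolyP (g1 c sg)" if "c \<in> C" for c sg
    unfolding g1_def[abs_def] using that C(2) by (intro PolyP_pcompose PolyP_lin g P_const) auto
  have s: "vtame (s c sg)" if "c \<in> C" "sg \<in> {1, -1}" for c sg
    unfolding s_def[abs_def] using that C(2)
    by (intro vtame_glue vtame_zero vtame_mult \<xi> P_const vtame_P) auto
  have s0: "s c sg e \<noteq> 0" if "sg \<in> {1, -1}" for c sg e using that by (auto simp: s_def)
  show ?thesis
  proof (rule vtame_cover[of I B \<tau>])
    show "finite I" using C by (simp add: I_def)
    fix i assume i: "i \<in> I"
    consider "i = None" | c sg j where "i = Some (c, sg, j)" "c \<in> C" "sg \<in> {1, -1}"
      using i by (auto simp: I_def)
    then show "QP (B i)"
    proof cases
      case 1 then show ?thesis using QP_poly_zero[OF g] by (simp add: B_def[abs_def])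
    next
      case 2
      have "c \<in> P" using 2 C by auto
      then show ?thesis using 2 unfolding B_def[abs_def]
        by (cases "j = Suc N") (auto intro!: QP_conj QP_not QP_poly_zero g QP_good \<xi> C QP_dom g1 s s0 vtame_zero[OF \<xi>, simplified])
    qed
  next
    fix i assume i: "i \<in> I"
    consider "i = None" | c sg j where "i = Some (c, sg, j)" "c \<in> C" "sg \<in> {1, -1}"
      using i by (auto simp: I_def)
    then show "vtame (\<tau> i)"
    proof cases
      case 1 then show ?thesis using vtame_P[OF P_const[of 0]] by (simp add: \<tau>_def[abs_def])
    next
      case 2
      have cP: "c \<in> P" using 2 C by auto
      show ?thesis
      proof (cases "j = Suc N")
        case True
        then show ?thesis using vtame_P[OF PolyP_poly[OF g cP]] 2 by (simp add: \<tau>_def[abs_def])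
      next
        case False
        then show ?thesis using vtame_mult_power[OF s[OF 2(2,3)] PolyP_coeff[OF g1[OF 2(2)]]] 2
          by (simp add: \<tau>_def[abs_def])
      qed
    qed
  next
    fix e
    show "\<exists>i\<in>I. B i e"
    proof (cases "g e = 0")
      case True then show ?thesis by (auto simp: I_def B_def)
    next
      case False
      show ?thesis
      proof (cases "\<xi> e \<in> vals C e")
        case True
        then obtain c where "c \<in> C" "\<xi> e = c e" by (auto simp: vals_def)
        then show ?thesis by (intro bexI[of _ "Some (c, 1, Suc N)"]) (auto simp: I_def B_def)
      next
        case F: False
        obtain c sg where c: "c \<in> C" "sg \<in> {1, -1}"
          "good (sg * (\<xi> e - c e)) (shifted (c e) sg (vals C e))"
          using locate_vals[OF C(1,3) F] by blast
        have "g1 c sg e \<noteq> 0" unfolding g1_def by (rule pcompose_lin_nz[OF False c(2)])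
        then obtain j where j: "dom (g1 c sg e) (s c sg e) j" "j \<le> degree (g1 c sg e)" using dom_exists by blast
        have "degree (g1 c sg e) \<le> N" using N c(2) by (auto simp: g1_def degree_pcompose)
        then have "j \<le> N" using j(2) by simp
        moreover have "\<xi> e - c e \<noteq> 0" using F c(1) by (auto simp: vals_def)
        ultimately show ?thesis using c j(1) False
          by (intro bexI[of _ "Some (c, sg, j)"]) (auto simp: I_def B_def)
      qed
    qed
  next
    fix i e assume i: "i \<in> I" and B: "B i e"
    consider "i = None" | c sg j where "i = Some (c, sg, j)" "c \<in> C" "sg \<in> {1, -1}"
      using i by (auto simp: I_def)
    then show "ssim (poly (g e) (\<xi> e)) (\<tau> i e)"
    proof cases
      case 1 then show ?thesis using B by (simp add: B_def \<tau>_def)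
    next
      case 2
      show ?thesis
      proof (cases "j = Suc N")
        case True then show ?thesis using 2 B by (simp add: B_def \<tau>_def)
      next
        case False
        then have b: "g e \<noteq> 0" "s c sg e = sg * (\<xi> e - c e)" "dom (g1 c sg e) (s c sg e) j"
          "good (s c sg e) (shifted (c e) sg (vals C e))"
          using B 2 by (auto simp: B_def s_def)
        have "ssim (poly (g1 c sg e) (s c sg e)) (coeff (g1 c sg e) j * s c sg e ^ j)"
          using pcompose_lin_nz[OF b(1) 2(3)] covers_shift[OF C(4) 2(3)] b(3,4)
          by (intro value_at_good) (auto simp: g1_def shifted_def)
        moreover have "poly (g1 c sg e) (s c sg e) = poly (g e) (\<xi> e)"
          using 2(3) by (auto simp: g1_def b(2) poly_pcompose)
        ultimately show ?thesis using 2(1) False by (simp add: \<tau>_def)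
      qed
    qed
  qed
qed

text \<open>Division with remainder by a monic polynomial, removing one leading term at a time for
  all parameters simultaneously.\<close>

lemma PolyP_reduce:
  assumes p: "PolyP p" "\<And>e. degree (p e) = n" "\<And>e. coeff (p e) n = 1" "1 \<le> n" and g: "PolyP g"
  shows "\<exists>r. PolyP r \<and> (\<forall>e. degree (r e) \<le> n - 1) \<and> (\<forall>e t. poly (p e) t = 0 \<longrightarrow> poly (r e) t = poly (g e) t)"
proof -
  have "\<exists>r. PolyP r \<and> (\<forall>e. degree (r e) \<le> n - 1) \<and> (\<forall>e t. poly (p e) t = 0 \<longrightarrow> poly (r e) t = poly (g e) t)"
    if "PolyP g" "\<And>e. degree (g e) \<le> n - 1 + N" for N g
    using that
  proof (induction N arbitrary: g)
    case 0
    then show ?case by (intro exI[of _ g]) auto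
  next
    case (Suc N)
    define g' where "g' e = g e - smult (coeff (g e) (n + N)) (monom 1 N * p e)" for e
    have g': "PolyP g'"
      unfolding g'_def[abs_def] by (intro PolyP_diff PolyP_smult PolyP_mult PolyP_fixed PolyP_coeff Suc.prems p)
    have "degree (g' e) \<le> n - 1 + N" for e
    proof (rule degree_le, intro allI impI)
      fix i assume i: "n - 1 + N < i"
      show "coeff (g' e) i = 0"
      proof (cases "i = n + N")
        case True
        then show ?thesis using p by (simp add: g'_def coeff_monom_mult)
      next
        case False
        then have "n + N < i" using i by simp
        moreover have "n - 1 + Suc N = n + N" using p(4) by simp
        ultimately have "degree (g e) < i" "degree (p e) < i - N" using Suc.prems(2)[of e] p(2)[of e] by auto
        then show ?thesis using \<open>n + N < i\<close> by (simp add: g'_def coeff_monom_mult coeff_eq_0)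
      qed
    qed
    from Suc.IH[OF g' this] obtain r where "PolyP r" "\<forall>e. degree (r e) \<le> n - 1"
      "\<forall>e t. poly (p e) t = 0 \<longrightarrow> poly (r e) t = poly (g' e) t" by blast
    then show ?case by (intro exI[of _ r]) (auto simp: g'_def)
  qed
  moreover obtain N where "\<forall>e. degree (g e) \<le> N" using PolyP_deg[OF g] by blast
  then have "degree (g e) \<le> n - 1 + N" for e by (simp add: trans_le_add2)
  ultimately show ?thesis using g by blast
qed

definition rcov :: "nat \<Rightarrow> bool" where
  "rcov n \<longleftrightarrow> (\<forall>p. PolyP p \<longrightarrow> (\<forall>e. degree (p e) \<le> n) \<longrightarrow>
     (\<exists>C. finite C \<and> C \<subseteq> P \<and> (\<forall>e. p e \<noteq> 0 \<longrightarrow> (\<forall>t. poly (p e) t = 0 \<longrightarrow> t \<in> vals C e))))"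

lemma droots_cover_aux:
  assumes "rcov n" "PolyP p" "\<And>e. degree (p e) \<le> n + k"
  obtains C where "finite C" "C \<subseteq> P" "C \<noteq> {}" "\<And>e. droots (p e) k \<subseteq> vals C e"
proof -
  obtain N where N: "\<forall>e. degree (p e) \<le> N" using PolyP_deg[OF assms(2)] by blast
  have "\<exists>C. finite C \<and> C \<subseteq> P \<and> (\<forall>e. (pderiv ^^ i) (p e) \<noteq> 0 \<longrightarrow> (\<forall>t. poly ((pderiv ^^ i) (p e)) t = 0 \<longrightarrow> t \<in> vals C e))"
    if "k \<le> i" for i
  proof -
    have d: "degree ((pderiv ^^ i) (p e)) \<le> n" for e
    proof -
      have "degree ((pderiv ^^ i) q) = degree q - i" for q :: "rxy poly"
        by (induction i) (auto simp: degree_pderiv)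
      then show ?thesis using assms(3)[of e] that by simp
    qed
    show ?thesis using assms(1) PolyP_pderivs[OF assms(2), of i] d unfolding rcov_def by blast
  qed
  then obtain C where C: "\<And>i. k \<le> i \<Longrightarrow> finite (C i) \<and> C i \<subseteq> P \<and>
      (\<forall>e. (pderiv ^^ i) (p e) \<noteq> 0 \<longrightarrow> (\<forall>t. poly ((pderiv ^^ i) (p e)) t = 0 \<longrightarrow> t \<in> vals (C i) e))"
    by metis
  show thesis
  proof (rule that[of "insert (\<lambda>_. 0) (\<Union>i\<in>{k..N}. C i)"])
    have Ci: "finite (C i)" "C i \<subseteq> P" if "k \<le> i" for i using C[OF that] by blast+
    show "finite (insert (\<lambda>_. 0) (\<Union>i\<in>{k..N}. C i))" using Ci by simp
    show "insert (\<lambda>_. 0) (\<Union>i\<in>{k..N}. C i) \<subseteq> P" using Ci(2) P_const by (auto, blast)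
    show "droots (p e) k \<subseteq> vals (insert (\<lambda>_. 0) (\<Union>i\<in>{k..N}. C i)) e" for e
    proof
      fix t assume "t \<in> droots (p e) k"
      then obtain i where i: "k \<le> i" "(pderiv ^^ i) (p e) \<noteq> 0" "poly ((pderiv ^^ i) (p e)) t = 0"
        by (auto simp: droots_def)
      then have "i \<le> degree (p e)" using pderiv_funpow_0[of "p e" i] by (meson linorder_not_le)
      then have "i \<le> N" using N by (meson order_trans)
      moreover have "t \<in> vals (C i) e" using C i by blast
      moreover have "C i \<subseteq> insert (\<lambda>_. 0) (\<Union>i\<in>{k..N}. C i)" if "i \<le> N" using that i(1) by auto
      ultimately show "t \<in> vals (insert (\<lambda>_. 0) (\<Union>i\<in>{k..N}. C i)) e"
        unfolding vals_def by blast
    qed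
  qed auto
qed

text \<open>Every polynomial in \<xi> reduces modulo p to degree below n, where the zeros of all
  derivatives are already covered by P. So \<open>vtame_poly\<close> decides the classes of all
  elements of P[\<xi>], and maximality absorbs \<xi>.\<close>

lemma adjoin_root:
  assumes rc: "rcov (n - 1)" and p: "PolyP p" "\<And>e. degree (p e) = n" "\<And>e. coeff (p e) n = 1" "1 \<le> n"
    and root: "\<And>e. poly (p e) (\<xi> e) = 0" and \<xi>: "\<And>c. c \<in> P \<Longrightarrow> vtame (\<lambda>e. \<xi> e - c e)"
  shows "\<xi> \<in> P"
proof -
  let ?P = "{\<lambda>e. poly (g e) (\<xi> e) | g. PolyP g}"
  have "?P = P"
  proof (rule adjoinI)
    show "P \<subseteq> ?P"
    proof
      fix f assume "f \<in> P"
      then show "f \<in> ?P" by (intro CollectI exI[of _ "\<lambda>e. [:f e:]"]) (auto intro: PolyP_const)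
    qed
  next
    fix f g assume "f \<in> ?P" "g \<in> ?P"
    then obtain a b where ab: "f = (\<lambda>e. poly (a e) (\<xi> e))" "g = (\<lambda>e. poly (b e) (\<xi> e))" "PolyP a" "PolyP b" by blast
    show "(\<lambda>e. f e + g e) \<in> ?P"
      by (intro CollectI exI[of _ "\<lambda>e. a e + b e"] conjI PolyP_add ab) (simp add: ab)
    show "(\<lambda>e. f e * g e) \<in> ?P"
      by (intro CollectI exI[of _ "\<lambda>e. a e * b e"] conjI PolyP_mult ab) (simp add: ab)
  next
    fix f m k assume "f \<in> ?P" and m: "0 < (m :: nat)"
    then obtain a where a: "f = (\<lambda>e. poly (a e) (\<xi> e))" "PolyP a" by blast
    obtain r where r: "PolyP r" "\<forall>e. degree (r e) \<le> n - 1" "\<forall>e t. poly (p e) t = 0 \<longrightarrow> poly (r e) t = poly (a e) t"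
      using PolyP_reduce[OF p a(2)] by blast
    obtain C where C: "finite C" "C \<subseteq> P" "C \<noteq> {}" "\<And>e. droots (r e) 0 \<subseteq> vals C e"
      using droots_cover_aux[OF rc r(1), of 0] r(2) by auto
    have "vtame (\<lambda>e. poly (r e) (\<xi> e))" by (rule vtame_poly[OF r(1) C \<xi>])
    moreover have "(\<lambda>e. poly (r e) (\<xi> e)) = f" using r(3) root by (simp add: a)
    ultimately show "QP (\<lambda>e. cls m (f e) = k)" using m by (simp add: vtame_cls)
  qed
  moreover have "\<xi> \<in> ?P" by (intro CollectI exI[of _ "\<lambda>e. [:0, 1:]"]) (auto intro: PolyP_fixed)
  ultimately show ?thesis by simp
qed

text \<open>\<open>located_diff\<close> handles only those c' that belong to the set of centres. For
  another c' the set is enlarged by c' and the root is located anew relative to some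
  \<open>c1\<close> and \<open>sg1\<close>; it is recognised as the same root because it is good for
  the original c and sg.\<close>

lemma located_vtame:
  assumes p: "PolyP p" "\<And>e. p e \<noteq> 0" and C: "finite C" "C \<subseteq> P" "\<And>e. droots (p e) 1 \<subseteq> vals C e"
    and c: "c \<in> C" and sg: "sg \<in> {1, -1}" and c': "c' \<in> P"
  defines "hit e \<equiv> \<exists>s. proot (p e) (c e) sg (vals C e) s"
  defines "\<xi> e \<equiv> if hit e then c e + sg * (THE s. proot (p e) (c e) sg (vals C e) s) else c e"
  shows "vtame (\<lambda>e. \<xi> e - c' e)"
proof -
  have cP: "c \<in> P" using c C by auto
  have ee: "sg * (sg * x) = x" for x using sg by auto
  have Qhit: "QP hit" using located_root(1)[OF p C cP sg] unfolding hit_def[abs_def] .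
  define C' where "C' = insert c' C"
  have C': "finite C'" "C' \<subseteq> P" "C \<subseteq> C'" "\<And>e. droots (p e) 1 \<subseteq> vals C' e"
    using C c' by (auto simp: C'_def vals_def)
  define h where "h c1 sg1 e \<longleftrightarrow> (\<exists>s. proot (p e) (c1 e) sg1 (vals C' e) s)" for c1 sg1 e
  define \<alpha> where "\<alpha> c1 sg1 e = c1 e + sg1 * (THE s. proot (p e) (c1 e) sg1 (vals C' e) s)" for c1 sg1 e
  define \<beta> where "\<beta> c1 sg1 c2 e = (if h c1 sg1 e then \<alpha> c1 sg1 e - c2 e else 1)" for c1 sg1 c2 e
  have \<beta>: "vtame (\<beta> c1 sg1 c2)" if "c1 \<in> C'" "sg1 \<in> {1, -1}" "c2 \<in> C'" for c1 sg1 c2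
    using located_diff[OF p C'(1,2,4) that] unfolding \<beta>_def[abs_def] h_def \<alpha>_def .
  have Qh: "QP (h c1 sg1)" if "c1 \<in> C'" "sg1 \<in> {1, -1}" for c1 sg1
    using located_root(1)[OF p C'(1,2,4) _ that(2), of c1] that(1) C'(2) unfolding h_def[abs_def] by auto
  have loc: "\<xi> e = t" if "poly (p e) t = 0" "good (sg * (t - c e)) (shifted (c e) sg (vals C e))" for e t
  proof -
    have t: "proot (p e) (c e) sg (vals C e) (sg * (t - c e))" using that by (simp add: proot_def ee)
    then have "(THE s. proot (p e) (c e) sg (vals C e) s) = sg * (t - c e)"
      using proot_unique[OF C(3) sg p(2)] by (intro the_equality)
    then show ?thesis using t unfolding \<xi>_def hit_def by (auto simp: ee)
  qed
  have root: "poly (p e) (\<xi> e) = 0 \<and> good (sg * (\<xi> e - c e)) (shifted (c e) sg (vals C e))" if hit: "hit e" for e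
  proof -
    obtain s where "proot (p e) (c e) sg (vals C e) s" using hit unfolding hit_def by blast
    then have s: "good s (shifted (c e) sg (vals C e))" "poly (p e) (c e + sg * s) = 0" by (auto simp: proot_def)
    then have "\<xi> e = c e + sg * s" by (intro loc) (auto simp: ee)
    then show ?thesis using s by (simp add: ee)
  qed
  have C1: "finite (vals C e)" for e using C by (simp add: vals_def)
  \<comment> \<open>The sign 0 marks the piece where the root coincides with the centre
    \<open>c1\<close>.\<close>
  define I where "I = insert None (Some ` (C' \<times> {0, 1, -1 :: rxy}))"
  define B where "B i e \<longleftrightarrow> (case i of None \<Rightarrow> \<not> hit e | Some (c1, sg1) \<Rightarrow>
      if sg1 = 0 then hit e \<and> poly (p e) (c1 e) = 0 \<and> good (sg * (c1 e - c e)) (shifted (c e) sg (vals C e))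
      else hit e \<and> h c1 sg1 e \<and> 0 < lc (sg * \<beta> c1 sg1 c e) \<and>
        (\<forall>c2\<in>C. 0 < lc (sg * (c2 e - c e)) \<longrightarrow> lc (sg * \<beta> c1 sg1 c2 e) < 0 \<and> vle (\<beta> c1 sg1 c2 e) (c2 e - c e)))" for i e
  define \<tau> where "\<tau> i = (case i of None \<Rightarrow> (\<lambda>e. c e - c' e) | Some (c1, sg1) \<Rightarrow>
      if sg1 = 0 then (\<lambda>e. c1 e - c' e) else \<beta> c1 sg1 c')" for i
  have Bg: "B (Some (c1, sg1)) e \<longleftrightarrow> hit e \<and> h c1 sg1 e \<and> good (sg * (\<alpha> c1 sg1 e - c e)) (shifted (c e) sg (vals C e))"
    if "sg1 \<noteq> 0" for c1 sg1 e
    using that unfolding good_iff_vle[OF sg C1] by (auto simp: B_def \<beta>_def vals_def)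
  have \<alpha>: "poly (p e) (\<alpha> c1 sg1 e) = 0 \<and> (\<forall>s. proot (p e) (c1 e) sg1 (vals C' e) s \<longrightarrow> \<alpha> c1 sg1 e = c1 e + sg1 * s)"
    if h1: "h c1 sg1 e" and "sg1 \<in> {1, -1}" for c1 sg1 e
  proof -
    obtain s where s: "proot (p e) (c1 e) sg1 (vals C' e) s" using h1 unfolding h_def by blast
    have eq: "(THE s. proot (p e) (c1 e) sg1 (vals C' e) s) = s" if "proot (p e) (c1 e) sg1 (vals C' e) s" for s
      using proot_unique[OF C'(4) \<open>sg1 \<in> _\<close> p(2)] that by (intro the_equality)
    show ?thesis using s eq by (auto simp: \<alpha>_def proot_def)
  qed
  show ?thesis
  proof (rule vtame_cover[of I B \<tau>])
    show "finite I" using C' by (simp add: I_def)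
  next
    fix i assume i: "i \<in> I"
    then consider "i = None" | c1 where "i = Some (c1, 0)" "c1 \<in> C'"
      | c1 sg1 where "i = Some (c1, sg1)" "c1 \<in> C'" "sg1 \<in> {1, -1}" "sg1 \<noteq> 0"
      by (auto simp: I_def)
    then have "QP (B i) \<and> vtame (\<tau> i)"
    proof cases
      case 1 then show ?thesis using cP c' Qhit by (auto simp: B_def[abs_def] \<tau>_def intro!: QP_not vtame_P P_diff)
    next
      case 2
      have c1P: "c1 \<in> P" using 2 C' by auto
      have "QP (\<lambda>e. good (sg * (c1 e - c e)) (shifted (c e) sg (vals C e)))"
        by (rule QP_good[OF _ C(1,2) cP sg]) (intro vtame_P P_diff c1P)
      then show ?thesis using 2 c1P c' Qhit
        by (auto simp: B_def[abs_def] \<tau>_def intro!: QP_conj QP_zero PolyP_poly p vtame_P P_diff)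
    next
      case 3
      have b: "vtame (\<beta> c1 sg1 c2)" "c2 \<in> P" if "c2 \<in> C" for c2
        using \<beta>[OF 3(2,3), of c2] that C(2) C'(3) by auto
      have eq: "B i e \<longleftrightarrow> hit e \<and> h c1 sg1 e \<and> 0 < lc (sg * \<beta> c1 sg1 c e) \<and>
        (\<forall>c2\<in>C. 0 < lc (sg * (c2 e - c e)) \<longrightarrow> lc (sg * \<beta> c1 sg1 c2 e) < 0 \<and> vle (\<beta> c1 sg1 c2 e) (c2 e - c e))" for e
        by (simp only: B_def 3(1) option.case prod.case 3(4) if_False)
      have "QP (\<lambda>e. 0 < lc (sg * (c2 e - c e)) \<longrightarrow> lc (sg * \<beta> c1 sg1 c2 e) < 0 \<and> vle (\<beta> c1 sg1 c2 e) (c2 e - c e))"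
        if "c2 \<in> C" for c2
        by (intro QP_imp QP_conj QP_pos vtame_neg vtame_vle_P vtame_mult P_mult P_diff P_const cP b that)
      then have "QP (B i)"
        by (intro QP_cong[OF eq] QP_conj QP_ball Qhit Qh vtame_pos vtame_mult P_const C(1) 3(2,3) b(1) c)
      then show ?thesis using 3 \<beta>[of c1 sg1 c'] by (simp add: \<tau>_def C'_def)
    qed
    then show "QP (B i)" "vtame (\<tau> i)" by auto
  next
    fix e
    show "\<exists>i\<in>I. B i e"
    proof (cases "hit e")
      case False then show ?thesis by (auto simp: I_def B_def)
    next
      case True
      note r = root[OF True]
      show ?thesis
      proof (cases "\<xi> e \<in> vals C' e")
        case T: True
        then obtain c1 where "c1 \<in> C'" "\<xi> e = c1 e" by (auto simp: vals_def)
        then show ?thesis using r True by (intro bexI[of _ "Some (c1, 0)"]) (auto simp: I_def B_def)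
      next
        case F: False
        have "C' \<noteq> {}" by (simp add: C'_def)
        then obtain c1 sg1 where c1: "c1 \<in> C'" "sg1 \<in> {1, -1}"
          "good (sg1 * (\<xi> e - c1 e)) (shifted (c1 e) sg1 (vals C' e))"
          using locate_vals[OF C'(1) _ F] by blast
        have ee1: "sg1 * (sg1 * x) = x" "sg1 \<noteq> 0" for x using c1(2) by auto
        have pr: "proot (p e) (c1 e) sg1 (vals C' e) (sg1 * (\<xi> e - c1 e))" using c1(3) r by (simp add: proot_def ee1)
        then have h: "h c1 sg1 e" unfolding h_def by blast
        then have "\<alpha> c1 sg1 e = \<xi> e" using \<alpha>[OF h c1(2)] pr by (simp add: ee1)
        then show ?thesis using Bg[OF ee1(2), of c1 e] h r True c1
          by (intro bexI[of _ "Some (c1, sg1)"]) (auto simp: I_def)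
      qed
    qed
  next
    fix i e assume i: "i \<in> I" and B: "B i e"
    from i consider "i = None" | c1 where "i = Some (c1, 0)" "c1 \<in> C'"
      | c1 sg1 where "i = Some (c1, sg1)" "c1 \<in> C'" "sg1 \<in> {1, -1}" "sg1 \<noteq> 0"
      by (auto simp: I_def)
    then show "ssim (\<xi> e - c' e) (\<tau> i e)"
    proof cases
      case 1 then show ?thesis using B by (simp add: B_def \<tau>_def \<xi>_def)
    next
      case 2
      then have "\<xi> e = c1 e" using B by (intro loc) (auto simp: B_def)
      then show ?thesis using 2 by (simp add: \<tau>_def)
    next
      case 3
      then have b: "h c1 sg1 e" "good (sg * (\<alpha> c1 sg1 e - c e)) (shifted (c e) sg (vals C e))" using B Bg by auto
      then have "\<xi> e = \<alpha> c1 sg1 e" using \<alpha>[OF b(1) 3(3)] by (intro loc) auto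
      then show ?thesis using 3 b(1) by (simp add: \<tau>_def \<beta>_def)
    qed
  qed
qed

text \<open>Zeros of proper derivatives are available by induction and serve as centres. Every other
  zero is good for some centre and side, each of which admits at most one, and the resulting root
  functions are adjoined one by one.\<close>

theorem rcov_all: "rcov n"
proof (induction n)
  case 0
  show ?case unfolding rcov_def
  proof (intro allI impI)
    fix p assume "PolyP p" and d: "\<forall>e. degree (p e) \<le> 0"
    have "poly (p e) t \<noteq> 0" if "p e \<noteq> 0" for e t
    proof -
      obtain a where "p e = [:a:]" using d degree_eq_zeroE[of "p e"] by auto
      then show ?thesis using that by simp
    qed
    then show "\<exists>C. finite C \<and> C \<subseteq> P \<and> (\<forall>e. p e \<noteq> 0 \<longrightarrow> (\<forall>t. poly (p e) t = 0 \<longrightarrow> t \<in> vals C e))"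
      by (intro exI[of _ "{}"]) auto
  qed
next
  case (Suc n)
  show ?case unfolding rcov_def
  proof (intro allI impI)
    fix p assume p: "PolyP p" and d: "\<forall>e. degree (p e) \<le> Suc n"
    define top where "top e \<longleftrightarrow> coeff (p e) (Suc n) = 0" for e
    have Qtop: "QP top" unfolding top_def[abs_def] by (intro QP_zero PolyP_coeff p)
    \<comment> \<open>Where the top coefficient vanishes, the induction hypothesis applies to p
      itself; the constant 1 elsewhere has no zeros.\<close>
    define pl where "pl e = (if top e then p e else 1)" for e
    have pl: "PolyP pl" unfolding pl_def[abs_def] by (intro PolyP_glue Qtop p PolyP_fixed)
    have dpl: "\<forall>e. degree (pl e) \<le> n"
    proof
      fix e
      show "degree (pl e) \<le> n"
    proof (cases "top e")
      case True
      show ?thesis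
      proof (rule degree_le, intro allI impI)
        fix i assume "n < i"
        show "coeff (pl e) i = 0"
        proof (cases "i = Suc n")
          case False
          then have "degree (p e) < i" using \<open>n < i\<close> d[rule_format, of e] by linarith
          then show ?thesis using True by (simp add: pl_def coeff_eq_0)
        qed (use True in \<open>simp add: pl_def top_def\<close>)
      qed
    qed (simp add: pl_def)
    qed
    obtain Cl where Cl: "finite Cl" "Cl \<subseteq> P"
      "\<And>e t. pl e \<noteq> 0 \<Longrightarrow> poly (pl e) t = 0 \<Longrightarrow> t \<in> vals Cl e"
      using Suc[unfolded rcov_def, rule_format, OF pl dpl[rule_format]] by blast
    \<comment> \<open>Monic of degree Suc n at every parameter; on \<open>top\<close>, where the
      zeros come from \<open>pl\<close>, the monomial is a placeholder.\<close>
    define m where "m e = (if top e then monom 1 (Suc n) else smult (inverse (coeff (p e) (Suc n))) (p e))" for e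
    have m: "PolyP m" unfolding m_def[abs_def]
      by (intro PolyP_glue Qtop PolyP_fixed PolyP_smult P_inverse PolyP_coeff p)
    have m1: "coeff (m e) (Suc n) = 1" for e by (simp add: m_def top_def)
    have dm: "degree (m e) = Suc n" for e
    proof (rule antisym)
      show "degree (m e) \<le> Suc n" using d by (simp add: m_def degree_monom_le)
      show "Suc n \<le> degree (m e)" using m1[of e] by (intro le_degree) simp
    qed
    have m0: "m e \<noteq> 0" for e using m1[of e] by auto
    obtain C where C: "finite C" "C \<subseteq> P" "C \<noteq> {}" "\<And>e. droots (m e) 1 \<subseteq> vals C e"
      using droots_cover_aux[OF Suc m, of 1] dm by auto
    define hit where "hit c sg e \<longleftrightarrow> (\<exists>s. proot (m e) (c e) sg (vals C e) s)" for c sg e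
    define \<xi> where "\<xi> = (\<lambda>(c, sg) e. if hit c sg e then c e + sg * (THE s. proot (m e) (c e) sg (vals C e) s) else c e)"
    have the: "(THE s. proot (m e) (c e) sg (vals C e) s) = s" if "proot (m e) (c e) sg (vals C e) s" "sg \<in> {1, -1}" for c sg e s
      using proot_unique[OF C(4) that(2) m0] that(1) by (intro the_equality)
    have \<xi>P: "\<xi> (c, sg) \<in> P" if c: "c \<in> C" and sg: "sg \<in> {1, -1}" for c sg
    proof -
      have cP: "c \<in> P" using c C by auto
      have Qhit: "QP (hit c sg)"
        using located_root(1)[OF m m0 C(1,2,4) cP sg] unfolding hit_def[abs_def] .
      \<comment> \<open>Where no root is hit, \<xi> takes the value c, and this power makes c a zero
        of a monic polynomial of the same degree.\<close>
      define m' where "m' e = (if hit c sg e then m e else [:- c e, 1:] ^ Suc n)" for e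
      show ?thesis
      proof (rule adjoin_root[of "Suc n" m'])
        show "rcov (Suc n - 1)" using Suc by simp
        show "PolyP m'" unfolding m'_def[abs_def]
          by (intro PolyP_glue Qhit m PolyP_power PolyP_lin P_uminus cP P_const)
        show "degree (m' e) = Suc n" for e
          using dm[of e] degree_linear_power[of "- c e" "Suc n"] by (simp add: m'_def del: power_Suc)
        show "coeff (m' e) (Suc n) = 1" for e
          using m1[of e] coeff_linear_power[of "- c e" "Suc n"] by (simp add: m'_def del: power_Suc)
        show "1 \<le> Suc n" by simp
        show "poly (m' e) (\<xi> (c, sg) e) = 0" for e
        proof (cases "hit c sg e")
          case True
          then obtain s where s: "proot (m e) (c e) sg (vals C e) s" unfolding hit_def by blast
          have "\<xi> (c, sg) e = c e + sg * s" using the[of e c sg s] s sg True by (simp add: \<xi>_def)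
          then show ?thesis using s True by (simp add: m'_def proot_def)
        qed (simp add: m'_def \<xi>_def)
        show "vtame (\<lambda>e. \<xi> (c, sg) e - c' e)" if "c' \<in> P" for c'
          using located_vtame[OF m m0 C(1,2,4) c sg that] unfolding \<xi>_def hit_def by simp
      qed
    qed
    show "\<exists>C. finite C \<and> C \<subseteq> P \<and> (\<forall>e. p e \<noteq> 0 \<longrightarrow> (\<forall>t. poly (p e) t = 0 \<longrightarrow> t \<in> vals C e))"
    proof (intro exI[of _ "Cl \<union> C \<union> \<xi> ` (C \<times> {1, -1})"] conjI allI impI)
      show "finite (Cl \<union> C \<union> \<xi> ` (C \<times> {1, -1}))" using Cl C by auto
      show "Cl \<union> C \<union> \<xi> ` (C \<times> {1, -1}) \<subseteq> P" using Cl C \<xi>P by blast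
      fix e t assume nz: "p e \<noteq> 0" and t: "poly (p e) t = 0"
      show "t \<in> vals (Cl \<union> C \<union> \<xi> ` (C \<times> {1, -1})) e"
      proof (cases "top e \<or> t \<in> vals C e")
        case True
        then show ?thesis using Cl(3)[of e t] nz t by (auto simp: pl_def vals_def)
      next
        case False
        obtain c sg where c: "c \<in> C" "sg \<in> {1, -1}"
          "good (sg * (t - c e)) (shifted (c e) sg (vals C e))"
          using locate_vals[OF C(1,3), of t e] False by blast
        have ee: "sg * (sg * x) = x" for x using c(2) by auto
        have pr: "proot (m e) (c e) sg (vals C e) (sg * (t - c e))"
          using c(3) t False by (simp add: proot_def ee m_def)
        then have "\<xi> (c, sg) e = t" using the[of e c sg "sg * (t - c e)"] pr c(2) by (auto simp: \<xi>_def hit_def ee)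
        then show ?thesis using c(1,2) by (force simp: vals_def)
      qed
    qed
  qed
qed

lemma droots_cover:
  assumes "PolyP p"
  obtains C where "finite C" "C \<subseteq> P" "C \<noteq> {}" "\<And>e. droots (p e) k \<subseteq> vals C e"
proof -
  obtain N where "\<forall>e. degree (p e) \<le> N" using PolyP_deg[OF assms] by blast
  then have "degree (p e) \<le> N + k" for e by (simp add: trans_le_add1)
  then show thesis using droots_cover_aux[OF rcov_all assms, of N k] that by metis
qed

end

section \<open>Test points in the value group\<close>

lemma mod_shift: "0 < W \<Longrightarrow> (a + (x - a) mod W) mod W = x mod (W :: int)"
  by (metis add_diff_cancel_left' diff_add_cancel mod_add_right_eq add.commute)

text \<open>Cooper's test points for Presburger arithmetic, here for pairs of integers in
  lexicographic order with dominant second entry. Any point can be replaced, keeping congruences and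
  position relative to T, by one at bounded offset from its neighbour in T below or above.\<close>

lemma lex_test:
  fixes T :: "int poly set"
  assumes T: "finite T" "T \<noteq> {}" "\<forall>t\<in>T. \<exists>a b. t = [:a, b:]" and W: "0 < W"
  shows "\<exists>t\<in>T. \<exists>a b p q. t = [:a, b:] \<and> \<bar>p\<bar> \<le> 2 * W \<and> \<bar>q\<bar> \<le> 2 * W \<and>
    (a + q) mod W = g mod W \<and> (b + p) mod W = h mod W \<and> (\<forall>t\<in>T. [:g, h:] \<le> t \<longleftrightarrow> [:a + q, b + p:] \<le> t)"
proof -
  define L where "L = {t \<in> T. t < [:g, h:]}"
  define U where "U = {t \<in> T. [:g, h:] \<le> t}"
  have fin: "finite L" "finite U" "L \<subseteq> T" "U \<subseteq> T" using T by (auto simp: L_def U_def)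
  have concl: ?thesis if "t \<in> T" "t = [:a, b:]" "\<bar>p\<bar> \<le> 2 * W" "\<bar>q\<bar> \<le> 2 * W"
    "(a + q) mod W = g mod W" "(b + p) mod W = h mod W"
    "L \<noteq> {} \<Longrightarrow> Max L < [:a + q, b + p:]" "U \<noteq> {} \<Longrightarrow> [:a + q, b + p:] \<le> Min U" for t a b p q
  proof -
    have "[:g, h:] \<le> t' \<longleftrightarrow> [:a + q, b + p:] \<le> t'" if t': "t' \<in> T" for t'
    proof (cases "[:g, h:] \<le> t'")
      case True
      then have "t' \<in> U" using t' by (simp add: U_def)
      then have "[:a + q, b + p:] \<le> t'" using \<open>U \<noteq> {} \<Longrightarrow> _\<close> fin(2) Min_le[OF fin(2), of t'] by (auto intro: order_trans)
      then show ?thesis using True by blast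
    next
      case False
      then have "t' \<in> L" using t' by (simp add: L_def not_le)
      then have "t' < [:a + q, b + p:]" using \<open>L \<noteq> {} \<Longrightarrow> _\<close> fin(1) Max_ge[OF fin(1), of t'] by (auto intro: le_less_trans)
      then show ?thesis using False by (simp add: not_le)
    qed
    then show ?thesis using that(1-6) by blast
  qed
  have m: "0 \<le> x mod W" "x mod W < W" for x using W by auto
  have m2: "x mod W \<le> 2 * W" "x mod W \<le> W" "0 < x mod W + W" "x mod W + 1 \<le> 2 * W" for x using m[of x] W by linarith+
  have le: "(x - 1) mod W + 1 \<le> x" if "0 < x" for x
    using zmod_le_nonneg_dividend[of "x - 1" W] that by simp
  have le': "x mod W \<le> x" if "0 \<le> x" for x using zmod_le_nonneg_dividend[of x W] that by simp
  have cong: "(a + ((x - a - 1) mod W + 1)) mod W = x mod W" for a x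
    using mod_shift[OF W, of "a + 1" x] by (simp add: algebra_simps)
  have cong2: "(a + - ((a - x) mod W)) mod W = x mod W" for a x
    by (metis add.commute add_uminus_conv_diff diff_diff_eq2 diff_add_cancel mod_diff_right_eq)
  have cong3: "(a + ((x - a) mod W + W)) mod W = x mod W" for a x
    using mod_shift[OF W, of a x] by (simp flip: add.assoc)
  show ?thesis
  proof (cases "L = {}")
    case L: True
    then have U: "U \<noteq> {}" using T by (auto simp: L_def U_def not_less)
    then have u: "Min U \<in> U" using fin by simp
    then obtain a b where ab: "Min U = [:a, b:]" "Min U \<in> T" using T(3) fin(4) by blast
    show ?thesis
    proof (rule concl[OF ab(2,1), of "- ((b - h) mod W)" "- ((a - g) mod W)"])
      show "[:a + - ((a - g) mod W), b + - ((b - h) mod W):] \<le> Min U"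
        unfolding ab(1) lin_le_iff using m(1)[of "b - h"] m(1)[of "a - g"] by linarith
    qed (use L m2(1)[of "b - h"] m2(1)[of "a - g"] m(1)[of "b - h"] m(1)[of "a - g"] W in
        \<open>simp_all add: cong2[simplified]\<close>)
  next
    case L: False
    then have l: "Max L \<in> L" using fin by simp
    then obtain a b where ab: "Max L = [:a, b:]" "Max L \<in> T" using T(3) fin(3) by blast
    have "[:a, b:] < [:g, h:]" using l unfolding ab(1) by (simp add: L_def)
    then have lt: "b < h \<or> b = h \<and> a < g" by (simp add: lin_less_iff)
    show ?thesis
    proof (cases "U = {}")
      case U: True
      show ?thesis
      proof (rule concl[OF ab(2,1), of "(h - b) mod W" "(g - a) mod W + W"])
        show "Max L < [:a + ((g - a) mod W + W), b + (h - b) mod W:]"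
          unfolding ab(1) lin_less_iff using m(1)[of "h - b"] m(1)[of "g - a"] W by linarith
      qed (use U m2(1)[of "h - b"] m2(2)[of "g - a"] m(1)[of "h - b"] m(1)[of "g - a"] W in
          \<open>simp_all add: cong3 mod_shift[OF W]\<close>)
    next
      case U: False
      then have u: "Min U \<in> U" using fin by simp
      then obtain c d where cd: "Min U = [:c, d:]" "Min U \<in> T" using T(3) fin(4) by blast
      have "[:g, h:] \<le> [:c, d:]" using u unfolding cd(1) by (simp add: U_def)
      then have ge: "h < d \<or> h = d \<and> g \<le> c" by (simp add: lin_le_iff)
      \<comment> \<open>If the dominant entry agrees with that of a neighbour, only the other entry
        may move, and towards the given point; if it lies strictly between those of the neighbours,
        the other entry is free.\<close>
      consider "b = h" | "h = d" "b < h" | "b < h" "h < d" using lt ge by linarith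
      then show ?thesis
      proof cases
        case 1
        define q where "q = (g - a - 1) mod W + 1"
        have "a < g" using lt 1 by linarith
        then have q: "0 < q" "q \<le> 2 * W" "q \<le> g - a" "(a + q) mod W = g mod W"
          using m(1)[of "g - a - 1"] m2(4)[of "g - a - 1"] le[of "g - a"] cong[of a g] by (simp_all add: q_def)
        show ?thesis
        proof (rule concl[OF ab(2,1), of 0 q])
          show "Max L < [:a + q, b + 0:]" unfolding ab(1) lin_less_iff using q by linarith
          show "[:a + q, b + 0:] \<le> Min U" unfolding cd(1) lin_le_iff using q 1 ge by linarith
        qed (use q W 1 in simp_all)
      next
        case 2
        define q where "q = (c - g) mod W"
        have "g \<le> c" using ge 2 by linarith
        then have q: "0 \<le> q" "q \<le> 2 * W" "q \<le> c - g" "(c + - q) mod W = g mod W"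
          using m(1)[of "c - g"] m2(1)[of "c - g"] le'[of "c - g"] cong2[of c g] by (simp_all add: q_def)
        show ?thesis
        proof (rule concl[OF cd(2,1), of 0 "- q"])
          show "Max L < [:c + - q, d + 0:]" unfolding ab(1) lin_less_iff using 2 by linarith
          show "[:c + - q, d + 0:] \<le> Min U" unfolding cd(1) lin_le_iff using q by linarith
        qed (use q W 2 in simp_all)
      next
        case 3
        define p q where "p = (h - b - 1) mod W + 1" and "q = (g - a) mod W"
        have p: "0 < p" "p \<le> 2 * W" "p \<le> h - b" "(b + p) mod W = h mod W"
          using m(1)[of "h - b - 1"] m2(4)[of "h - b - 1"] le[of "h - b"] cong[of b h] 3 by (simp_all add: p_def)
        have q: "0 \<le> q" "q \<le> 2 * W" "(a + q) mod W = g mod W"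
          using m(1)[of "g - a"] m2(1)[of "g - a"] mod_shift[OF W, of a g] by (simp_all add: q_def)
        show ?thesis
        proof (rule concl[OF ab(2,1), of p q])
          show "Max L < [:a + q, b + p:]" unfolding ab(1) lin_less_iff using p by linarith
          show "[:a + q, b + p:] \<le> Min U" unfolding cd(1) lin_le_iff using p 3 by linarith
        qed (use p q W in simp_all)
      qed
    qed
  qed
qed

lemma cls_dvd:
  assumes "n dvd m" "cls m f = cls m g" shows "cls n f = cls n g"
proof -
  have "int n dvd int m" using assms(1) by simp
  then have "x mod int n = (x mod int m) mod int n" for x by (simp add: mod_mod_cancel)
  then show ?thesis using assms(2) unfolding cls_def by (metis prod.inject)
qed

context mtring begin

text \<open>The candidate test points: M-th roots, where they exist, of a monomial whose valuation
  is that of f shifted by a fixed amount.\<close>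

lemma vtame_pow_root:
  fixes p q :: int
  assumes f: "f \<in> P" "\<And>e. f e \<noteq> 0" and M: "1 \<le> M"
  defines "D e \<equiv> int M dvd vx (f e) + q \<and> int M dvd vy (f e) + p"
  shows "vtame (\<lambda>e. if D e then mon ((vy (f e) + p) div int M) ((vx (f e) + q) div int M) else 1)"
proof (rule vtame_root[OF M])
  have "QP D"
  proof (rule QP_cong)
    show "D e \<longleftrightarrow> (\<lambda>(s, x, y). int M dvd x + q \<and> int M dvd y + p) (cls M (f e))" for e
      by (simp add: D_def cls_def dvd_eq_mod_eq_0 mod_add_left_eq)
    show "QP (\<lambda>e. (\<lambda>(s, x, y). int M dvd x + q \<and> int M dvd y + p) (cls M (f e)))"
      using M f by (intro vtame_cls_rel vtame_P) auto
  qed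
  then show "(\<lambda>e. if D e then f e * mon p q else 1) \<in> P" by (intro P_glue P_mult P_const f)
  fix e
  have v: "vv (f e * mon p q) = [:vx (f e) + q, vy (f e) + p:]" using f by (simp add: vv_mult vv_mon) (simp add: vv_def)
  show "0 < lc (if D e then mon ((vy (f e) + p) div int M) ((vx (f e) + q) div int M) else 1) \<and>
    (if D e then f e * mon p q else 1) \<noteq> 0 \<and>
    of_nat M * vv (if D e then mon ((vy (f e) + p) div int M) ((vx (f e) + q) div int M) else 1) =
    vv (if D e then f e * mon p q else 1)"
    using f(2)[of e] by (auto simp: v vv_mon of_nat_poly D_def)
qed

text \<open>All cuts are brought to the form M v(s) <= v(f_i), with M the product of the positive
  exponents, and \<open>lex_test\<close> is applied to M v(s). Comparisons with exponent 0 do not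
  depend on s.\<close>

theorem test_points:
  assumes I: "finite I" and a: "\<And>i. i \<in> I \<Longrightarrow> a i \<in> P" and b: "\<And>i. i \<in> I \<Longrightarrow> b i \<in> P" and n: "0 < n"
  shows "\<exists>S. finite S \<and> (\<forall>\<sigma>\<in>S. vtame \<sigma> \<and> (\<forall>e. 0 < lc (\<sigma> e))) \<and>
    (\<forall>e s. 0 < lc s \<longrightarrow> (\<exists>\<sigma>\<in>S. cls n (\<sigma> e) = cls n s \<and>
      (\<forall>i\<in>I. vle (a i e * \<sigma> e ^ m i) (b i e) \<longleftrightarrow> vle (a i e * s ^ m i) (b i e))))"
proof -
  define J where "J = {i \<in> I. 1 \<le> m i}"
  have J: "finite J" "J \<subseteq> I" using I by (auto simp: J_def)
  define M where "M = (\<Prod>i\<in>J. m i)"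
  have "0 < M" unfolding M_def by (intro prod_pos) (simp add: J_def)
  then have M: "1 \<le> M" by simp
  have Mi: "m i dvd M" if "i \<in> J" for i unfolding M_def by (rule dvd_prodI[OF J(1) that])
  \<comment> \<open>With the modulus Mn, the replacement of M v(s) is again divisible by M, and the
    quotient agrees with v(s) modulo n.\<close>
  define W where "W = int M * int n"
  have W: "0 < W" using M n by (simp add: W_def)
  define f where "f i e = (if a i e = 0 \<or> b i e = 0 then 1 else (b i e / a i e) ^ (M div m i))" for i e
  have fP: "f i \<in> P" if "i \<in> J" for i
  proof -
    have i: "i \<in> I" using that J by blast
    have "QP (\<lambda>e. a i e = 0 \<or> b i e = 0)" by (intro QP_disj QP_zero a[OF i] b[OF i])
    moreover have "(\<lambda>e. (b i e / a i e) ^ (M div m i)) \<in> P"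
      by (rule P_power[OF P_divide[OF b[OF i] a[OF i]]])
    ultimately show ?thesis unfolding f_def[abs_def] by (intro P_glue P_const)
  qed
  have f0: "f i e \<noteq> 0" for i e by (simp add: f_def)
  define \<sigma> where "\<sigma> i p q e = (if int M dvd vx (f i e) + q \<and> int M dvd vy (f i e) + p
    then mon ((vy (f i e) + p) div int M) ((vx (f i e) + q) div int M) else 1)" for i p q e
  define S where "S = (\<lambda>(p, q) e. mon p q) ` ({0..<int n} \<times> {0..<int n}) \<union>
    (\<lambda>(i, p, q). \<sigma> i p q) ` (J \<times> {-2 * W..2 * W} \<times> {-2 * W..2 * W})"
  have cut: "vle (a i e * s ^ m i) (b i e) \<longleftrightarrow> (if a i e = 0 \<or> b i e = 0 then b i e = 0 else of_nat M * vv s \<le> vv (f i e))"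
    if "i \<in> J" "s \<noteq> 0" for i e s
  proof (cases "a i e = 0 \<or> b i e = 0")
    case True
    then show ?thesis using that by (auto simp: vle_def)
  next
    case False
    define k where "k = M div m i"
    have k: "M = k * m i" "1 \<le> k" using Mi[OF that(1)] M by (auto simp: k_def Suc_le_eq)
    have "vle (a i e * s ^ m i) (b i e) \<longleftrightarrow> of_nat (m i) * vv s \<le> vv (b i e) - vv (a i e)"
      using False that(2) by (simp add: vle_iff vv_mult vv_power algebra_simps)
    also have "\<dots> \<longleftrightarrow> of_nat k * (of_nat (m i) * vv s) \<le> of_nat k * (vv (b i e) - vv (a i e))"
      using k(2) by simp
    also have "of_nat k * (of_nat (m i) * vv s) = of_nat M * vv s" by (simp add: k(1) mult.assoc)
    also have "of_nat k * (vv (b i e) - vv (a i e)) = vv (f i e)"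
      using False by (simp add: f_def vv_power vv_divide k_def[symmetric])
    finally show ?thesis using False by simp
  qed
  have triv: "vle (a i e * s ^ m i) (b i e) \<longleftrightarrow> vle (a i e) (b i e)" if "i \<in> I - J" for i e s
  proof -
    have "m i = 0" using that by (auto simp: J_def)
    then show ?thesis by simp
  qed
  have key: "\<exists>\<tau>\<in>S. cls n (\<tau> e) = cls n s \<and> (\<forall>i\<in>J. of_nat M * vv (\<tau> e) \<le> vv (f i e) \<longleftrightarrow> of_nat M * vv s \<le> vv (f i e))"
    if s: "0 < lc s" for e s
  proof (cases "J = {}")
    case True
    have "cls n (mon (vy s mod int n) (vx s mod int n)) = cls n s" using s by (auto simp: cls_def)
    moreover have "(\<lambda>e. mon (vy s mod int n) (vx s mod int n)) \<in> S" using n by (auto simp: S_def)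
    ultimately show ?thesis using True by (intro bexI[of _ "\<lambda>e. mon (vy s mod int n) (vx s mod int n)"]) auto
  next
    case False
    define T where "T = (\<lambda>i. vv (f i e)) ` J"
    have T: "finite T" "T \<noteq> {}" "\<forall>t\<in>T. \<exists>a b. t = [:a, b:]" using J False by (auto simp: T_def vv_def)
    have Ms: "of_nat M * vv s = [:int M * vx s, int M * vy s:]" by (simp add: vv_def of_nat_poly)
    obtain t u w p q where t: "t \<in> T" "t = [:u, w:]" "\<bar>p\<bar> \<le> 2 * W" "\<bar>q\<bar> \<le> 2 * W"
      and c: "(u + q) mod W = (int M * vx s) mod W" "(w + p) mod W = (int M * vy s) mod W"
      and le: "\<forall>t\<in>T. [:int M * vx s, int M * vy s:] \<le> t \<longleftrightarrow> [:u + q, w + p:] \<le> t"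
      using lex_test[OF T W, of "int M * vx s" "int M * vy s"] by (elim bexE exE conjE)
    obtain i where i: "i \<in> J" "vv (f i e) = [:u, w:]" using t by (auto simp: T_def)
    then have uw: "vx (f i e) = u" "vy (f i e) = w" by (auto simp: vv_def)
    have div: "\<exists>z. y = int M * z \<and> z mod int n = x mod int n" if "y mod W = (int M * x) mod W" for x y
    proof -
      have "y = y div W * W + (int M * x) mod W" using div_mult_mod_eq[of y W] that by simp
      also have "(int M * x) mod W = int M * (x mod int n)" unfolding W_def by (rule mult_mod_right[symmetric])
      also have "y div W * W + int M * (x mod int n) = int M * (y div W * int n + x mod int n)"
        by (simp add: W_def algebra_simps)
      finally show ?thesis by (intro exI[of _ "y div W * int n + x mod int n"]) simp
    qed
    obtain zx where zx: "u + q = int M * zx" "zx mod int n = vx s mod int n" using div[OF c(1)] by blast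
    obtain zy where zy: "w + p = int M * zy" "zy mod int n = vy s mod int n" using div[OF c(2)] by blast
    have \<sigma>: "\<sigma> i p q e = mon zy zx" using M by (simp add: \<sigma>_def uw zx zy)
    have "cls n (\<sigma> i p q e) = cls n s" using s zx zy by (simp add: \<sigma> cls_def)
    moreover have eq: "of_nat M * vv (\<sigma> i p q e) = [:u + q, w + p:]" by (simp add: \<sigma> vv_mon of_nat_poly zx zy)
    have "\<forall>i'\<in>J. of_nat M * vv (\<sigma> i p q e) \<le> vv (f i' e) \<longleftrightarrow> of_nat M * vv s \<le> vv (f i' e)"
    proof
      fix i' assume "i' \<in> J"
      then have "vv (f i' e) \<in> T" by (simp add: T_def)
      from bspec[OF le this] show "of_nat M * vv (\<sigma> i p q e) \<le> vv (f i' e) \<longleftrightarrow> of_nat M * vv s \<le> vv (f i' e)"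
        unfolding eq Ms by (rule sym)
    qed
    moreover have "(i, p, q) \<in> J \<times> {-2 * W..2 * W} \<times> {-2 * W..2 * W}"
      using i(1) t(3,4) by (simp add: abs_le_iff)
    then have "\<sigma> i p q \<in> S" unfolding S_def by (intro UnI2) (rule image_eqI[rotated], assumption, simp)
    ultimately show ?thesis by (intro bexI[of _ "\<sigma> i p q"] conjI)
  qed
  have S: "vtame \<tau> \<and> (\<forall>e. 0 < lc (\<tau> e))" if "\<tau> \<in> S" for \<tau>
  proof -
    from that consider p q where "\<tau> = (\<lambda>e. mon p q)" | i p q where "\<tau> = \<sigma> i p q" "i \<in> J" by (auto simp: S_def)
    then show ?thesis
    proof cases
      case 1 then show ?thesis by (auto intro: vtame_P P_const)
    next
      case 2
      then show ?thesis using vtame_pow_root[OF fP[OF 2(2)] f0 M, of q p] by (simp add: \<sigma>_def[abs_def])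
    qed
  qed
  show ?thesis
  proof (intro exI[of _ S] conjI ballI allI impI)
    show "finite S" using J by (simp add: S_def)
    show "vtame \<tau>" "0 < lc (\<tau> e)" if "\<tau> \<in> S" for \<tau> e using S[OF that] by auto
    fix e s assume s: "0 < lc s"
    obtain \<tau> where \<tau>: "\<tau> \<in> S" "cls n (\<tau> e) = cls n s"
      "\<And>i. i \<in> J \<Longrightarrow> of_nat M * vv (\<tau> e) \<le> vv (f i e) \<longleftrightarrow> of_nat M * vv s \<le> vv (f i e)"
      using key[OF s, of e] by blast
    have "0 < lc (\<tau> e)" using S[OF \<tau>(1)] by blast
    then have "vle (a i e * \<tau> e ^ m i) (b i e) \<longleftrightarrow> vle (a i e * s ^ m i) (b i e)" if "i \<in> I" for i
      using that triv[of i e "\<tau> e"] triv[of i e s] cut[of i "\<tau> e" e] cut[of i s e] \<tau>(3)[of i] s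
      by (cases "i \<in> J") auto
    then show "\<exists>\<tau>\<in>S. cls n (\<tau> e) = cls n s \<and>
      (\<forall>i\<in>I. vle (a i e * \<tau> e ^ m i) (b i e) \<longleftrightarrow> vle (a i e * s ^ m i) (b i e))" using \<tau>(1,2) by blast
  qed
qed

end

text \<open>The hypothesis on valuations only makes the residue of s/d finite, whereas goodness
  wants it below 1. Multiplication by a small positive real closes the gap and changes neither
  classes nor dominant terms.\<close>

lemma good_shrink:
  assumes "finite D" "0 < lc s" "\<And>d. d \<in> D \<Longrightarrow> 0 < lc d \<Longrightarrow> vle d s"
  shows "\<exists>s'. good s' D \<and> ssim s' s"
proof -
  obtain r where r: "0 < r" "\<And>d. d \<in> D \<Longrightarrow> 0 < lc d \<Longrightarrow> r * lc s < lc d"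
  proof -
    let ?E = "insert 1 ((\<lambda>d. lc d / lc s) ` {d \<in> D. 0 < lc d})"
    have fin: "finite ?E" using assms(1) by simp
    have "0 < Min ?E" using fin assms(2) by (subst Min_gr_iff) auto
    moreover have "Min ?E / 2 * lc s < lc d" if "d \<in> D" "0 < lc d" for d
    proof -
      have "Min ?E \<le> lc d / lc s" using fin that by (intro Min_le) auto
      then have "Min ?E / 2 < lc d / lc s" using \<open>0 < Min ?E\<close> by linarith
      then show ?thesis using assms(2) by (simp add: pos_less_divide_eq)
    qed
    ultimately show thesis using that[of "Min ?E / 2"] by simp
  qed
  let ?s = "cst r * s"
  have cr: "cst r \<noteq> 0" using r(1) cst_simps(1)[of r] by (metis lc_0 less_irrefl)
  have s: "lc ?s = r * lc s" "vv ?s = vv s" "0 < lc ?s"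
    using r(1) assms(2) cr by (auto simp: vv_mult)
  have "0 < lc (d - ?s) \<and> vv (d - ?s) \<le> vv d" if d: "d \<in> D" "0 < lc d" for d
  proof (cases "vv d = vv s")
    case True
    have "lc d + lc (- ?s) \<noteq> 0" using r(2)[OF d] s by simp
    from add_same[OF _ this] show ?thesis using True s r(2)[OF d] by simp
  next
    case False
    then have "vv d < vv ?s" using assms(3)[OF d] d assms(2) s by (auto simp: vle_def)
    then show ?thesis using vv_diff_gt_lc[OF d(2) s(3)] d by simp
  qed
  then have "good ?s D" using s by (simp add: good_def)
  moreover have "ssim ?s s" using s assms(2) r(1) by (simp add: ssim_def)
  ultimately show ?thesis by blast
qed

lemma dom_ssim: "ssim s t \<Longrightarrow> dom P s j = dom P t j"
proof -
  assume st: "ssim s t"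
  have "vv (coeff P i * s ^ k) = vv (coeff P i * t ^ k)" for i k
    using ssim_mult[OF ssim_refl ssim_power[OF st], of "coeff P i" k] by (simp add: ssim_def)
  then show ?thesis by (simp add: dom_def)
qed

context mtring begin

text \<open>Elimination of one quantifier. A point t is a centre or c + sg s with s good; in the
  second case the classes of all \<open>p l\<close> at t depend only on the class of s and on its
  position among finitely many cuts, so that s may be replaced by a test point.\<close>

theorem QP_ex_cls:
  assumes L: "finite L" and p: "\<And>l. l \<in> L \<Longrightarrow> PolyP (p l)" and n: "\<And>l. l \<in> L \<Longrightarrow> 0 < n l"
  shows "QP (\<lambda>e. \<exists>t. \<forall>l\<in>L. cls (n l) (poly (p l e) t) = \<kappa> l)"
proof -
  have "\<forall>l\<in>L. \<exists>C. finite C \<and> C \<subseteq> P \<and> (\<forall>e. droots (p l e) 0 \<subseteq> vals C e)"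
    using droots_cover[OF p] by metis
  then obtain Cl where Cl: "\<And>l. l \<in> L \<Longrightarrow> finite (Cl l) \<and> Cl l \<subseteq> P \<and> (\<forall>e. droots (p l e) 0 \<subseteq> vals (Cl l) e)"
    by metis
  define C where "C = insert (\<lambda>_. 0) (\<Union>l\<in>L. Cl l)"
  have C: "finite C" "C \<subseteq> P" "C \<noteq> {}" using Cl L P_const by (auto simp: C_def)
  have cov: "droots (p l e) 0 \<subseteq> vals C e" if "l \<in> L" for l e
    using Cl[OF that] that unfolding C_def vals_def by blast
  have "\<forall>l\<in>L. \<exists>N. \<forall>e. degree (p l e) \<le> N" using PolyP_deg[OF p] by metis
  then obtain Nl where Nl: "\<And>l e. l \<in> L \<Longrightarrow> degree (p l e) \<le> Nl l" by metis
  define N where "N = (\<Sum>l\<in>L. Nl l)"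
  have N: "degree (p l e) \<le> N" if "l \<in> L" for l e
    using Nl[OF that, of e] member_le_sum[of l L Nl] that L by (simp add: N_def)
  define p1 where "p1 l c sg e = pcompose (p l e) [:c e, sg:]" for l c sg e
  have p1: "PolyP (p1 l c sg)" if "l \<in> L" "c \<in> C" for l c sg
    unfolding p1_def[abs_def] using that C(2) by (intro PolyP_pcompose PolyP_lin p P_const) auto
  have N1: "degree (p1 l c sg e) \<le> N" if "l \<in> L" "sg \<in> {1, -1}" for l c sg e
    using N[OF that(1), of e] that(2) by (auto simp: p1_def degree_pcompose)
  define n0 where "n0 = (\<Prod>l\<in>L. n l)"
  have n0: "0 < n0" "\<And>l. l \<in> L \<Longrightarrow> n l dvd n0" using n L by (auto simp: n0_def intro: prod_pos dvd_prodI)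
  let ?val = "\<lambda>l c sg e s. p l e = 0 \<and> \<kappa> l = (0, 0, 0) \<or> p l e \<noteq> 0 \<and>
    (\<exists>j\<in>{..N}. dom (p1 l c sg e) s j \<and> cls (n l) (coeff (p1 l c sg e) j * s ^ j) = \<kappa> l)"
  \<comment> \<open>Goodness is weakened to a comparison of valuations, which test points preserve;
    \<open>good_shrink\<close> restores it afterwards.\<close>
  define \<Phi> where "\<Phi> c sg e s \<longleftrightarrow> (\<forall>c'\<in>C. 0 < lc (sg * (c' e - c e)) \<longrightarrow> vle (sg * (c' e - c e)) s) \<and>
     (\<forall>l\<in>L. ?val l c sg e s)" for c sg e s
  have val_at: "cls (n l) (poly (p l e) (c e + sg * s)) = \<kappa> l \<longleftrightarrow> ?val l c sg e s"
    if "l \<in> L" "sg \<in> {1, -1}" "good s (shifted (c e) sg (vals C e))" for l c sg e s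
  proof (cases "p l e = 0")
    case False
    have nz: "p1 l c sg e \<noteq> 0" unfolding p1_def by (rule pcompose_lin_nz[OF False that(2)])
    obtain j where j: "dom (p1 l c sg e) s j" "j \<le> degree (p1 l c sg e)" using dom_exists[OF nz] by blast
    have "ssim (poly (p1 l c sg e) s) (coeff (p1 l c sg e) j * s ^ j)"
      using value_at_good[OF nz _ that(3) j(1)] covers_shift[OF cov[OF that(1)] that(2)]
      by (simp add: p1_def shifted_def)
    moreover have "poly (p1 l c sg e) s = poly (p l e) (c e + sg * s)" by (simp add: p1_def poly_pcompose mult.commute)
    ultimately have "cls (n l) (poly (p l e) (c e + sg * s)) = cls (n l) (coeff (p1 l c sg e) j * s ^ j)"
      using cls_ssim by metis
    moreover have "j \<in> {..N}" using j(2) N1[OF that(1,2), of c e] by simp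
    ultimately show ?thesis using False j(1) dom_unique by metis
  qed auto
  have main: "(\<exists>t. \<forall>l\<in>L. cls (n l) (poly (p l e) t) = \<kappa> l) \<longleftrightarrow>
      (\<exists>c\<in>C. \<forall>l\<in>L. cls (n l) (poly (p l e) (c e)) = \<kappa> l) \<or>
      (\<exists>c\<in>C. \<exists>sg\<in>{1, -1}. \<exists>s. 0 < lc s \<and> \<Phi> c sg e s)"
    (is "_ \<longleftrightarrow> ?rhs e") for e
  proof (intro iffI)
    assume "\<exists>t. \<forall>l\<in>L. cls (n l) (poly (p l e) t) = \<kappa> l"
    then obtain t where t: "\<And>l. l \<in> L \<Longrightarrow> cls (n l) (poly (p l e) t) = \<kappa> l" by blast
    show "?rhs e"
    proof (cases "t \<in> vals C e")
      case True
      then show ?thesis using t by (auto simp: vals_def)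
    next
      case False
      then obtain c sg where c: "c \<in> C" "sg \<in> {1, -1}" "good (sg * (t - c e)) (shifted (c e) sg (vals C e))"
        using locate_vals[OF C(1,3)] by blast
      let ?s = "sg * (t - c e)"
      have ts: "c e + sg * ?s = t" using c(2) by auto
      have s: "0 < lc ?s" using c(3) by (simp add: good_def)
      have "vle (sg * (c' e - c e)) ?s" if "c' \<in> C" "0 < lc (sg * (c' e - c e))" for c'
      proof -
        have "0 < lc (sg * (c' e - c e) - ?s)"
          using c(3) that unfolding good_def shifted_def vals_def by blast
        from pos_le_vv[OF s this] show ?thesis using that(2) s by (auto simp: vle_def)
      qed
      moreover have "?val l c sg e ?s" if "l \<in> L" for l
        using val_at[where l = l and c = c and sg = sg and e = e and s = ?s] c(2,3) t[OF that] that unfolding ts by blast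
      ultimately have "\<Phi> c sg e ?s" unfolding \<Phi>_def by blast
      then show ?thesis using c s by blast
    qed
  next
    assume "?rhs e"
    then consider c where "c \<in> C" "\<forall>l\<in>L. cls (n l) (poly (p l e) (c e)) = \<kappa> l"
      | c sg s where "c \<in> C" "sg \<in> {1, -1}" "0 < lc s" "\<Phi> c sg e s" by blast
    then show "\<exists>t. \<forall>l\<in>L. cls (n l) (poly (p l e) t) = \<kappa> l"
    proof cases
      case 1 then show ?thesis by blast
    next
      case 2
      have "finite (shifted (c e) sg (vals C e))" using C by (simp add: shifted_def vals_def)
      moreover have "vle d s" if "d \<in> shifted (c e) sg (vals C e)" "0 < lc d" for d
        using 2(4) that unfolding \<Phi>_def shifted_def vals_def by blast
      ultimately obtain s' where s': "good s' (shifted (c e) sg (vals C e))" "ssim s' s"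
        using good_shrink[OF _ 2(3)] by metis
      have eq: "cls (n l) (coeff (p1 l c sg e) j * s' ^ j) = cls (n l) (coeff (p1 l c sg e) j * s ^ j)" for l j
        by (intro cls_ssim ssim_mult ssim_power s' ssim_refl)
      have "cls (n l) (poly (p l e) (c e + sg * s')) = \<kappa> l" if "l \<in> L" for l
        using val_at[where l = l and c = c and sg = sg and e = e and s = s'] that 2(2) s'(1) 2(4)
        unfolding eq dom_ssim[OF s'(2)] \<Phi>_def by blast
      then show ?thesis by blast
    qed
  qed
  have second: "QP (\<lambda>e. \<exists>s. 0 < lc s \<and> \<Phi> c sg e s)" if c: "c \<in> C" and sg: "sg \<in> {1, -1}" for c sg
  proof -
    define I2 where "I2 = Inl ` C \<union> Inr ` (L \<times> {..N} \<times> {..N})"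
    \<comment> \<open>\<open>test_points\<close> handles comparisons with the power of s on the
      left, while here it is on the right. By \<open>not_vle_iff\<close> the factor
      \<open>fX\<close> turns the negations of these comparisons into the required form.\<close>
    define a where "a i e = (case i of Inl c' \<Rightarrow> fX | Inr (l, i, j) \<Rightarrow> fX * coeff (p1 l c sg e) j)" for i :: "('a \<Rightarrow> rxy) + 'b \<times> nat \<times> nat" and e
    define b where "b i e = (case i of Inl c' \<Rightarrow> sg * (c' e - c e) | Inr (l, i, j) \<Rightarrow> coeff (p1 l c sg e) i)" for i :: "('a \<Rightarrow> rxy) + 'b \<times> nat \<times> nat" and e
    define m where "m i = (case i of Inl c' \<Rightarrow> 1 | Inr (l, i, j) \<Rightarrow> j - i)" for i :: "('a \<Rightarrow> rxy) + 'b \<times> nat \<times> nat"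
    have fin: "finite I2" using C L by (simp add: I2_def)
    have cP: "c' \<in> P" if "c' \<in> C" for c' using that C by auto
    have aP: "a i \<in> P" if "i \<in> I2" for i
      using that unfolding I2_def a_def[abs_def] by (auto intro!: P_const P_mult PolyP_coeff p1 c)
    have bP: "b i \<in> P" if "i \<in> I2" for i
      using that unfolding I2_def b_def[abs_def] by (auto intro!: P_const P_mult P_diff PolyP_coeff p1 c simp: cP cP[OF c])
    obtain S where S: "finite S" "\<And>\<sigma>. \<sigma> \<in> S \<Longrightarrow> vtame \<sigma>" "\<And>\<sigma> e. \<sigma> \<in> S \<Longrightarrow> 0 < lc (\<sigma> e)"
      and St: "\<And>e s. 0 < lc s \<Longrightarrow> \<exists>\<sigma>\<in>S. cls n0 (\<sigma> e) = cls n0 s \<and>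
        (\<forall>i\<in>I2. vle (a i e * \<sigma> e ^ m i) (b i e) \<longleftrightarrow> vle (a i e * s ^ m i) (b i e))"
      using test_points[where I = I2 and a = a and b = b and n = n0 and m = m, OF fin aP bP n0(1)] by metis
    have eq: "(\<exists>s. 0 < lc s \<and> \<Phi> c sg e s) \<longleftrightarrow> (\<exists>\<sigma>\<in>S. \<Phi> c sg e (\<sigma> e))" for e
    proof
      assume "\<exists>s. 0 < lc s \<and> \<Phi> c sg e s"
      then obtain s where s: "0 < lc s" "\<Phi> c sg e s" by blast
      obtain \<sigma> where \<sigma>: "\<sigma> \<in> S" "cls n0 (\<sigma> e) = cls n0 s"
        "\<And>i. i \<in> I2 \<Longrightarrow> vle (a i e * \<sigma> e ^ m i) (b i e) \<longleftrightarrow> vle (a i e * s ^ m i) (b i e)" using St[OF s(1)] by blast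
      have s0: "s \<noteq> 0" "\<sigma> e \<noteq> 0" using s(1) S(3)[OF \<sigma>(1)] by (auto intro: lc_pos_nz)
      have v1: "vle (sg * (c' e - c e)) (\<sigma> e) \<longleftrightarrow> vle (sg * (c' e - c e)) s" if "c' \<in> C" for c'
      proof -
        have "Inl c' \<in> I2" using that by (simp add: I2_def)
        from \<sigma>(3)[OF this] show ?thesis using not_vle_iff[of "sg * (c' e - c e)" "\<sigma> e"] not_vle_iff[of "sg * (c' e - c e)" s] s0
          by (auto simp: a_def b_def m_def)
      qed
      have v2: "vle (coeff (p1 l c sg e) i) (coeff (p1 l c sg e) j * \<sigma> e ^ (j - i)) \<longleftrightarrow>
          vle (coeff (p1 l c sg e) i) (coeff (p1 l c sg e) j * s ^ (j - i))" if "l \<in> L" "i \<le> N" "j \<le> N" for l i j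
      proof -
        have "Inr (l, i, j) \<in> I2" using that by (simp add: I2_def)
        from \<sigma>(3)[OF this] show ?thesis
          using not_vle_iff[of "coeff (p1 l c sg e) i" "coeff (p1 l c sg e) j * \<sigma> e ^ (j - i)"]
            not_vle_iff[of "coeff (p1 l c sg e) i" "coeff (p1 l c sg e) j * s ^ (j - i)"] s0
          by (auto simp: a_def b_def m_def mult.assoc)
      qed
      have v3: "dom (p1 l c sg e) (\<sigma> e) j \<longleftrightarrow> dom (p1 l c sg e) s j" if "l \<in> L" "j \<le> N" for l j
        unfolding dom_iff_vle[OF s0(1) N1[OF that(1) sg]] dom_iff_vle[OF s0(2) N1[OF that(1) sg]]
        using v2[OF that(1)] that(2) by (auto cong: ball_cong)
      have v4: "cls (n l) (coeff (p1 l c sg e) j * \<sigma> e ^ j) = cls (n l) (coeff (p1 l c sg e) j * s ^ j)" if "l \<in> L" for l j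
        using cls_dvd[OF n0(2)[OF that] \<sigma>(2)] by (simp add: cls_mult cls_power)
      have "(\<exists>j\<in>{..N}. dom (p1 l c sg e) (\<sigma> e) j \<and> cls (n l) (coeff (p1 l c sg e) j * \<sigma> e ^ j) = \<kappa> l) \<longleftrightarrow>
        (\<exists>j\<in>{..N}. dom (p1 l c sg e) s j \<and> cls (n l) (coeff (p1 l c sg e) j * s ^ j) = \<kappa> l)"
        if "l \<in> L" for l
        by (intro bex_cong refl) (simp add: v3 v4 that)
      then have "\<Phi> c sg e (\<sigma> e)" using s(2) v1 unfolding \<Phi>_def by blast
      then show "\<exists>\<sigma>\<in>S. \<Phi> c sg e (\<sigma> e)" using \<sigma>(1) by blast
    qed (use S(3) in blast)
    have "QP (\<lambda>e. \<Phi> c sg e (\<sigma> e))" if \<sigma>: "\<sigma> \<in> S" for \<sigma>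
    proof -
      have \<sigma>0: "\<sigma> e \<noteq> 0" for e using S(3)[OF \<sigma>, of e] by (rule lc_pos_nz)
      have "QP (\<lambda>e. 0 < lc (sg * (c' e - c e)) \<longrightarrow> vle (sg * (c' e - c e)) (\<sigma> e))" if "c' \<in> C" for c'
        by (intro QP_imp QP_pos vtame_vle_P' S(2)[OF \<sigma>] P_mult P_diff P_const cP that c)
      moreover have "QP (\<lambda>e. \<exists>j\<in>{..N}. dom (p1 l c sg e) (\<sigma> e) j \<and>
          cls (n l) (coeff (p1 l c sg e) j * \<sigma> e ^ j) = \<kappa> l)" if "l \<in> L" for l
        by (intro QP_bex finite_atMost QP_conj QP_dom p1 that c S(2)[OF \<sigma>] \<sigma>0 vtame_cls vtame_mult_power PolyP_coeff n)
      ultimately show ?thesis unfolding \<Phi>_def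
        by (intro QP_conj QP_ball C(1) L QP_disj QP_not QP_const QP_poly_zero p)
    qed
    then show ?thesis by (intro QP_cong[OF eq] QP_bex S(1))
  qed
  have "QP (\<lambda>e. \<forall>l\<in>L. cls (n l) (poly (p l e) (c e)) = \<kappa> l)" if "c \<in> C" for c
    using that C(2) by (intro QP_ball L P_cls PolyP_poly p n) auto
  then show ?thesis
    by (intro QP_cong[OF main] QP_disj QP_bex C(1) second) auto
qed

end

section \<open>Quantifier elimination\<close>

inductive_set Pol :: "(('v \<Rightarrow> rxy) \<Rightarrow> rxy) set" where
  Pol_const: "(\<lambda>_. c) \<in> Pol"
| Pol_var: "(\<lambda>e. e x) \<in> Pol"
| Pol_add: "f \<in> Pol \<Longrightarrow> g \<in> Pol \<Longrightarrow> (\<lambda>e. f e + g e) \<in> Pol"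
| Pol_mult: "f \<in> Pol \<Longrightarrow> g \<in> Pol \<Longrightarrow> (\<lambda>e. f e * g e) \<in> Pol"

text \<open>Class conditions already express equations, the order and comparisons of valuations, so
  they are the only atoms.\<close>

inductive_set Qset :: "('v \<Rightarrow> rxy) set set" where
  Q_atom: "p \<in> Pol \<Longrightarrow> 0 < n \<Longrightarrow> {e. cls n (p e) = k} \<in> Qset"
| Q_not: "A \<in> Qset \<Longrightarrow> - A \<in> Qset"
| Q_and: "A \<in> Qset \<Longrightarrow> B \<in> Qset \<Longrightarrow> A \<inter> B \<in> Qset"

interpretation qs: bool_alg "Qset :: ('v \<Rightarrow> rxy) set set"
proof
  have "{e :: 'v \<Rightarrow> rxy. cls 1 0 = (0, 0, 0)} \<in> Qset" by (rule Q_atom[OF Pol_const]) simp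
  then show "UNIV \<in> (Qset :: ('v \<Rightarrow> rxy) set set)" by simp
qed (auto intro: Q_not Q_and)

interpretation pol: tring "Qset :: ('v \<Rightarrow> rxy) set set" Pol
  by standard (auto simp: qs.QP_def intro: Pol.intros Q_atom)

abbreviation dfp :: "(('v \<Rightarrow> rxy) \<Rightarrow> bool) \<Rightarrow> bool" where "dfp \<equiv> qs.QP"

text \<open>Root functions on \<open>F\<^sup>n\<close> are defined piecewise and are not unique. Working in a maximal ring of
  functions whose classes are definable makes them available as elements of a ring.\<close>

lemma max_tring: "\<exists>M. mtring (Qset :: ('v \<Rightarrow> rxy) set set) M \<and> Pol \<subseteq> M"
proof -
  define A where "A = {P. tring (Qset :: ('v \<Rightarrow> rxy) set set) P \<and> Pol \<subseteq> P}"
  have "\<exists>M\<in>A. \<forall>Z\<in>A. M \<subseteq> Z \<longrightarrow> Z = M"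
  proof (rule subset_Zorn_nonempty)
    have "Pol \<in> A" using pol.tring_axioms by (simp add: A_def)
    then show "A \<noteq> {}" by blast
    fix C assume C: "C \<noteq> {}" "subset.chain A C"
    then have sub: "C \<subseteq> A" and chain: "\<And>Z Z2. Z \<in> C \<Longrightarrow> Z2 \<in> C \<Longrightarrow> Z \<subseteq> Z2 \<or> Z2 \<subseteq> Z"
      unfolding subset.chain_def by auto
    have t: "tring Qset Z" if "Z \<in> C" for Z using that sub unfolding A_def by auto
    obtain Z0 where Z0: "Z0 \<in> C" using C by blast
    have two: "\<exists>Z\<in>C. f \<in> Z \<and> g \<in> Z" if fg: "f \<in> \<Union>C" "g \<in> \<Union>C" for f g
    proof -
      obtain Z1 Z2 where Z: "Z1 \<in> C" "f \<in> Z1" "Z2 \<in> C" "g \<in> Z2" using fg by blast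
      from chain[OF Z(1,3)] show ?thesis
      proof
        assume "Z1 \<subseteq> Z2" then show ?thesis using Z by (intro bexI[of _ Z2]) auto
      next
        assume "Z2 \<subseteq> Z1" then show ?thesis using Z by (intro bexI[of _ Z1]) auto
      qed
    qed
    have "tring Qset (\<Union>C)"
    proof unfold_locales
      show "(\<lambda>_. c) \<in> \<Union>C" for c by (rule UnionI[OF Z0 tring.P_const[OF t[OF Z0]]])
      fix f g assume fg: "f \<in> \<Union>C" "g \<in> \<Union>C"
      obtain Z where Z: "Z \<in> C" "f \<in> Z" "g \<in> Z" using two[OF fg] by (elim bexE conjE)
      show "(\<lambda>e. f e + g e) \<in> \<Union>C" by (rule UnionI[OF Z(1) tring.P_add[OF t[OF Z(1)] Z(2,3)]])
      show "(\<lambda>e. f e * g e) \<in> \<Union>C" by (rule UnionI[OF Z(1) tring.P_mult[OF t[OF Z(1)] Z(2,3)]])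
    next
      fix f n k assume f: "f \<in> \<Union>C" "0 < (n :: nat)"
      then obtain Z where Z: "Z \<in> C" "f \<in> Z" by blast
      show "qs.QP (\<lambda>e. cls n (f e) = k)" by (rule tring.P_cls[OF t[OF Z(1)] Z(2) f(2)])
    qed
    moreover have "Pol \<subseteq> \<Union>C" using Z0 sub unfolding A_def by blast
    ultimately show "\<Union>C \<in> A" by (simp add: A_def)
  qed
  then obtain M where M: "M \<in> A" "\<And>Z. Z \<in> A \<Longrightarrow> M \<subseteq> Z \<Longrightarrow> Z = M" by blast
  have M1: "tring Qset M" "Pol \<subseteq> M" using M(1) by (simp_all add: A_def)
  have "mtring Qset M"
  proof (intro mtring.intro mtring_axioms.intro M1)
    fix P' assume P': "tring (Qset :: ('v \<Rightarrow> rxy) set set) P'" "M \<subseteq> P'"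
    then have "P' \<in> A" using M1(2) by (auto simp: A_def)
    then show "P' = M" using M(2) P'(2) by simp
  qed
  then show ?thesis using M1(2) by blast
qed

text \<open>A substitute for a disjunctive normal form: membership depends on finitely many classes,
  each with finitely many values.\<close>

lemma Qset_nf:
  "S \<in> Qset \<Longrightarrow> \<exists>L. finite L \<and> (\<forall>(p, n)\<in>L. p \<in> Pol \<and> 0 < n) \<and>
    (\<forall>e e'. (\<forall>(p, n)\<in>L. cls n (p e) = cls n (p e')) \<longrightarrow> (e \<in> S \<longleftrightarrow> e' \<in> S))"
proof (induction rule: Qset.induct)
  case (Q_atom p n k)
  then show ?case by (intro exI[of _ "{(p, n)}"]) auto
next
  case (Q_not A)
  then obtain L where L: "finite L" "\<forall>(p, n)\<in>L. p \<in> Pol \<and> 0 < n"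
    "\<forall>e e'. (\<forall>(p, n)\<in>L. cls n (p e) = cls n (p e')) \<longrightarrow> (e \<in> A \<longleftrightarrow> e' \<in> A)" by blast
  show ?case by (intro exI[of _ L]) (use L in simp)
next
  case (Q_and A B)
  then obtain L M where L: "finite L" "\<forall>(p, n)\<in>L. p \<in> Pol \<and> 0 < n"
    "\<forall>e e'. (\<forall>(p, n)\<in>L. cls n (p e) = cls n (p e')) \<longrightarrow> (e \<in> A \<longleftrightarrow> e' \<in> A)"
    and M: "finite M" "\<forall>(p, n)\<in>M. p \<in> Pol \<and> 0 < n"
    "\<forall>e e'. (\<forall>(p, n)\<in>M. cls n (p e) = cls n (p e')) \<longrightarrow> (e \<in> B \<longleftrightarrow> e' \<in> B)" by blast
  show ?case
  proof (intro exI[of _ "L \<union> M"] conjI allI impI)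
    fix e e' assume h: "\<forall>(p, n)\<in>L \<union> M. cls n (p e) = cls n (p e')"
    then have "\<forall>(p, n)\<in>L. cls n (p e) = cls n (p e')" "\<forall>(p, n)\<in>M. cls n (p e) = cls n (p e')" by blast+
    then have "e \<in> A \<longleftrightarrow> e' \<in> A" "e \<in> B \<longleftrightarrow> e' \<in> B" using L(3) M(3) by blast+
    then show "e \<in> A \<inter> B \<longleftrightarrow> e' \<in> A \<inter> B" by simp
  qed (use L M in \<open>auto simp: ball_Un\<close>)
qed

lemma Pol_as_poly:
  assumes "p \<in> Pol"
  shows "\<exists>q. pol.PolyP q \<and> (\<forall>e t. p (e(x := t)) = poly (q e) t) \<and> (\<forall>e t. q (e(x := t)) = q e)"
  using assms
proof (induction rule: Pol.induct)
  case (Pol_const c)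
  then show ?case by (intro exI[of _ "\<lambda>_. [:c:]"]) (auto intro: pol.PolyP_fixed)
next
  case (Pol_var y)
  show ?case
  proof (cases "y = x")
    case True
    then show ?thesis by (intro exI[of _ "\<lambda>_. [:0, 1:]"]) (auto intro: pol.PolyP_fixed)
  next
    case False
    then show ?thesis by (intro exI[of _ "\<lambda>e. [:e y:]"]) (auto intro!: pol.PolyP_const Pol.Pol_var)
  qed
next
  case (Pol_add f g)
  then obtain a b where "pol.PolyP a" "\<forall>e t. f (e(x := t)) = poly (a e) t" "\<forall>e t. a (e(x := t)) = a e"
    "pol.PolyP b" "\<forall>e t. g (e(x := t)) = poly (b e) t" "\<forall>e t. b (e(x := t)) = b e" by blast
  note h = this
  show ?case
  proof (intro exI[of _ "\<lambda>e. a e + b e"] conjI allI)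
    show "pol.PolyP (\<lambda>e. a e + b e)" using h by (intro pol.PolyP_add)
  qed (simp_all only: h poly_add)
next
  case (Pol_mult f g)
  then obtain a b where "pol.PolyP a" "\<forall>e t. f (e(x := t)) = poly (a e) t" "\<forall>e t. a (e(x := t)) = a e"
    "pol.PolyP b" "\<forall>e t. g (e(x := t)) = poly (b e) t" "\<forall>e t. b (e(x := t)) = b e" by blast
  note h = this
  show ?case
  proof (intro exI[of _ "\<lambda>e. a e * b e"] conjI allI)
    show "pol.PolyP (\<lambda>e. a e * b e)" using h by (intro pol.PolyP_mult)
  qed (simp_all only: h poly_mult)
qed

lemma dfp_nf:
  assumes "dfp C"
  obtains L :: "nat set" and q n where "finite L" "\<forall>l\<in>L. pol.PolyP (q l)" "\<forall>l\<in>L. 0 < n l"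
    "\<forall>l\<in>L. \<forall>e t. q l (e(x := t)) = q l e"
    "\<forall>e e'. (\<forall>l\<in>L. cls (n l) (poly (q l e) (e x)) = cls (n l) (poly (q l e') (e' x))) \<longrightarrow> (C e \<longleftrightarrow> C e')"
proof -
  obtain A where A: "finite A" "\<forall>(p, n)\<in>A. p \<in> Pol \<and> 0 < n"
    "\<forall>e e'. (\<forall>(p, n)\<in>A. cls n (p e) = cls n (p e')) \<longrightarrow> (e \<in> {e. C e} \<longleftrightarrow> e' \<in> {e. C e})"
    using Qset_nf[OF assms[unfolded qs.QP_def]] by (elim exE conjE)
  obtain as where as: "set as = A" using finite_list[OF A(1)] by blast
  define L where "L = {..<length as}"
  define n where "n l = snd (as ! l)" for l
  have "\<exists>q. pol.PolyP q \<and> (\<forall>e t. fst (as ! l) (e(x := t)) = poly (q e) t) \<and> (\<forall>e t. q (e(x := t)) = q e)" if "l \<in> L" for l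
  proof -
    have "as ! l \<in> A" using that as by (auto simp: L_def)
    then show ?thesis using A(2) by (intro Pol_as_poly) auto
  qed
  then obtain q where q: "\<And>l. l \<in> L \<Longrightarrow> pol.PolyP (q l)"
    "\<And>l e t. l \<in> L \<Longrightarrow> fst (as ! l) (e(x := t)) = poly (q l e) t" "\<And>l e t. l \<in> L \<Longrightarrow> q l (e(x := t)) = q l e" by metis
  have val: "fst (as ! l) e = poly (q l e) (e x)" if "l \<in> L" for l e
    using q(2)[OF that, of e "e x"] by simp
  show thesis
  proof (rule that[of L q n])
    show "finite L" by (simp add: L_def)
    show "\<forall>l\<in>L. 0 < n l"
    proof
      fix l assume "l \<in> L"
      then have "as ! l \<in> A" using as by (auto simp: L_def)
      then show "0 < n l" using A(2) by (auto simp: n_def)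
    qed
    show "\<forall>l\<in>L. pol.PolyP (q l)" "\<forall>l\<in>L. \<forall>e t. q l (e(x := t)) = q l e" using q by auto
    show "\<forall>e e'. (\<forall>l\<in>L. cls (n l) (poly (q l e) (e x)) = cls (n l) (poly (q l e') (e' x))) \<longrightarrow> (C e \<longleftrightarrow> C e')"
    proof (intro allI impI)
    fix e e' assume eq: "\<forall>l\<in>L. cls (n l) (poly (q l e) (e x)) = cls (n l) (poly (q l e') (e' x))"
    have "\<forall>(p, n)\<in>A. cls n (p e) = cls n (p e')"
    proof clarify
      fix p m assume "(p, m) \<in> A"
      then obtain l where l: "l \<in> L" "as ! l = (p, m)" using as by (auto simp: L_def in_set_conv_nth)
      show "cls m (p e) = cls m (p e')" using bspec[OF eq l(1)] val[OF l(1), symmetric] l(2) by (simp add: n_def)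
    qed
    then show "C e \<longleftrightarrow> C e'" using A(3) by simp
    qed
  qed
qed

text \<open>Quantifier elimination: C is a finite union over vectors of classes, and for each vector
  the existence of t is \<open>QP_ex_cls\<close>, applied inside a maximal ring that contains the
  polynomials.\<close>

theorem dfp_ex:
  assumes "dfp C" shows "dfp (\<lambda>e. \<exists>t. C (e(x := t)))"
proof -
  obtain L :: "nat set" and q n where L0: "finite L" "\<forall>l\<in>L. pol.PolyP (q l)" "\<forall>l\<in>L. 0 < n l"
    "\<forall>l\<in>L. \<forall>e t. q l (e(x := t)) = q l e"
    and nf: "\<forall>e e'. (\<forall>l\<in>L. cls (n l) (poly (q l e) (e x)) = cls (n l) (poly (q l e') (e' x))) \<longrightarrow> (C e \<longleftrightarrow> C e')"
    by (rule dfp_nf[OF assms, of x])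
  note L = L0[rule_format]
  obtain M where M: "mtring (Qset :: ('a \<Rightarrow> rxy) set set) M" "Pol \<subseteq> M" using max_tring by blast
  interpret m: mtring "Qset :: ('a \<Rightarrow> rxy) set set" M by (rule M)
  have mP: "m.PolyP p" if "pol.PolyP p" for p
    unfolding m.PolyP_def using that M(2) unfolding pol.PolyP_def by (meson subsetD)
  define \<kappa> where "\<kappa> e = restrict (\<lambda>l. cls (n l) (poly (q l e) (e x))) L" for e
  define K where "K = Pi\<^sub>E L (\<lambda>l. cls_range (n l))"
  have K: "finite K" unfolding K_def by (intro finite_PiE L finite_cls_range)
  have \<kappa>K: "\<kappa> e \<in> K" for e unfolding K_def \<kappa>_def using cls_in_range L(3) by auto
  have nf': "C e \<longleftrightarrow> C e'" if "\<kappa> e = \<kappa> e'" for e e'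
  proof (rule nf[rule_format])
    fix l assume "l \<in> L"
    then show "cls (n l) (poly (q l e) (e x)) = cls (n l) (poly (q l e') (e' x))"
      using fun_cong[OF that, of l] by (simp add: \<kappa>_def)
  qed
  have eq: "(\<exists>t. C (e(x := t))) \<longleftrightarrow>
    (\<exists>k\<in>K. (\<exists>e'. \<kappa> e' = k \<and> C e') \<and> (\<exists>t. \<forall>l\<in>L. cls (n l) (poly (q l e) t) = k l))" for e
  proof
    assume "\<exists>t. C (e(x := t))"
    then obtain t where t: "C (e(x := t))" by blast
    have "\<forall>l\<in>L. cls (n l) (poly (q l e) t) = \<kappa> (e(x := t)) l" by (simp add: \<kappa>_def L(4))
    then show "\<exists>k\<in>K. (\<exists>e'. \<kappa> e' = k \<and> C e') \<and> (\<exists>t. \<forall>l\<in>L. cls (n l) (poly (q l e) t) = k l)"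
      using t by (intro bexI[of _ "\<kappa> (e(x := t))"] conjI exI[of _ "e(x := t)"] exI[of _ t] refl \<kappa>K)
  next
    assume "\<exists>k\<in>K. (\<exists>e'. \<kappa> e' = k \<and> C e') \<and> (\<exists>t. \<forall>l\<in>L. cls (n l) (poly (q l e) t) = k l)"
    then obtain e' t where e': "C e'" "\<And>l. l \<in> L \<Longrightarrow> cls (n l) (poly (q l e) t) = \<kappa> e' l" by blast
    have "\<kappa> (e(x := t)) = \<kappa> e'"
    proof
      fix l show "\<kappa> (e(x := t)) l = \<kappa> e' l"
        using e'(2)[of l] by (cases "l \<in> L") (auto simp: \<kappa>_def L(4))
    qed
    then show "\<exists>t. C (e(x := t))" using nf' e'(1) by blast
  qed
  have "dfp (\<lambda>e. \<exists>t. \<forall>l\<in>L. cls (n l) (poly (q l e) t) = k l)" for k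
    by (rule m.QP_ex_cls[OF L(1) mP[OF L(2)] L(3)])
  then show ?thesis by (intro qs.QP_cong[OF eq] qs.QP_bex K qs.QP_conj qs.QP_const)
qed

section \<open>Substitution and definable functions\<close>

lemma Pol_subst:
  assumes "p \<in> Pol" "\<And>w. g w \<in> Pol" shows "(\<lambda>e. p (\<lambda>w. g w e)) \<in> Pol"
  using assms(1) by (induction rule: Pol.induct) (auto intro: Pol.intros assms(2))

lemma dfp_subst:
  assumes "dfp C" "\<And>w. g w \<in> Pol" shows "dfp (\<lambda>e. C (\<lambda>w. g w e))"
proof -
  have "{e. (\<lambda>w. g w e) \<in> S} \<in> Qset" if "S \<in> Qset" for S
    using that
  proof (induction rule: Qset.induct)
    case (Q_atom p n k)
    have "{e. cls n (p (\<lambda>w. g w e)) = k} \<in> Qset" by (rule Qset.Q_atom[OF Pol_subst]) (use Q_atom assms in auto)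
    then show ?case by simp
  next
    case (Q_not A)
    from Qset.Q_not[OF this(2)] show ?case by (simp add: Collect_neg_eq)
  next
    case (Q_and A B)
    from Qset.Q_and[OF this(3,4)] show ?case by (simp add: Collect_conj_eq)
  qed
  from this[of "{e. C e}"] show ?thesis using assms(1) by (simp add: qs.QP_def)
qed

lemma dfp_all: "dfp C \<Longrightarrow> dfp (\<lambda>e. \<forall>t. C (e(x := t)))"
  using qs.QP_not[OF dfp_ex[OF qs.QP_not[of C], of x]] by simp

text \<open>A fresh variable is added by passing to the option type: \<open>None\<close> is the new
  variable, and iteration provides several.\<close>

abbreviation push :: "rxy \<Rightarrow> ('v \<Rightarrow> rxy) \<Rightarrow> 'v option \<Rightarrow> rxy" where
  "push t e \<equiv> case_option t e"

lemma push_upd: "(push s e)(None := t) = push t e"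
  by (auto simp: fun_eq_iff split: option.split)

lemma dfp_ex_push: assumes "dfp D" shows "dfp (\<lambda>e. \<exists>t. D (push t e))"
proof -
  let ?g = "\<lambda>w e. case w of None \<Rightarrow> 0 | Some v \<Rightarrow> e v"
  have "?g w \<in> Pol" for w by (cases w) (auto intro: Pol.intros)
  from dfp_subst[where g = ?g, OF dfp_ex[OF assms, of None] this] show ?thesis
    by (simp only: push_upd)
qed

text \<open>A definable function, given by its graph. The variable x holds the value in the graph,
  which is possible because f does not depend on x.\<close>

definition dfx :: "'v \<Rightarrow> (('v \<Rightarrow> rxy) \<Rightarrow> rxy) \<Rightarrow> bool" where
  "dfx x f \<longleftrightarrow> (\<forall>e t. f (e(x := t)) = f e) \<and> dfp (\<lambda>e. e x = f e)"

lemma dfx_upd: "dfx x f \<Longrightarrow> f (e(x := t)) = f e" by (simp add: dfx_def)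

text \<open>D at the value of f is rewritten as the existence of some t that equals f e and
  satisfies D; quantifier elimination makes this definable.\<close>

lemma dfp_inst:
  assumes D: "dfp D" and f: "dfx x f" shows "dfp (\<lambda>e. D (push (f e) e))"
proof -
  let ?g = "\<lambda>w e. if w = x then e None else e (Some w)"
  have "?g w \<in> Pol" for w by (cases "w = x") (auto intro: Pol.intros)
  from dfp_subst[where g = ?g and C = "\<lambda>e. e x = f e", OF _ this] f
  have "dfp (\<lambda>e'. e' None = f (\<lambda>w. ?g w e'))" by (simp add: dfx_def)
  from dfp_ex_push[OF qs.QP_conj[OF this D]]
  have "dfp (\<lambda>e. \<exists>t. t = f (\<lambda>w. if w = x then t else push t e (Some w)) \<and> D (push t e))"
    by (simp cong: if_cong)
  moreover have "f (\<lambda>w. if w = x then t else push t e (Some w)) = f e" for e t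
  proof -
    have "(\<lambda>w. if w = x then t else push t e (Some w)) = e(x := t)" by auto
    then show ?thesis using f by (simp add: dfx_def)
  qed
  ultimately show ?thesis by simp
qed

lemma dfx_push:
  assumes "dfx x f" shows "dfx (Some x) (\<lambda>e. f (\<lambda>v. e (Some v)))"
proof -
  have "dfp (\<lambda>e'. e' (Some x) = f (\<lambda>w. e' (Some w)))"
    using dfp_subst[of "\<lambda>e. e x = f e" "\<lambda>w e. e (Some w)"] assms by (auto simp: dfx_def intro: Pol.intros)
  moreover have "(\<lambda>v. (e(Some x := t)) (Some v)) = (\<lambda>v. e (Some v))(x := t)" for e :: "'a option \<Rightarrow> rxy" and t
    by auto
  ultimately show ?thesis using assms by (simp add: dfx_def)
qed

lemma dfp_inst2:
  assumes D: "dfp D" and f: "dfx x f" "dfx x g" shows "dfp (\<lambda>e. D (push (f e) (push (g e) e)))"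
  using dfp_inst[OF dfp_inst[OF D dfx_push[OF f(1)]] f(2)] by simp

lemma dfp_inst3:
  assumes D: "dfp D" and f: "dfx x f" "dfx x g" "dfx x h"
  shows "dfp (\<lambda>e. D (push (f e) (push (g e) (push (h e) e))))"
  using dfp_inst[OF dfp_inst2[OF D dfx_push[OF f(1)] dfx_push[OF f(2)]] f(3)] by simp

lemma Pol_push: "p \<in> Pol \<Longrightarrow> (\<lambda>e. p (\<lambda>v. e (Some v))) \<in> Pol"
  by (rule Pol_subst) (auto intro: Pol.intros)

lemma dfx_Pol:
  assumes "p \<in> Pol" "\<And>e t. p (e(x := t)) = p e" shows "dfx x p"
  using pol.QP_eq[OF Pol_var assms(1), of x] assms by (simp add: dfx_def)

lemma dfx_comp:
  assumes p: "p \<in> Pol" "\<And>e t. p (e(Some x := t)) = p e" and f: "dfx x f"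
  shows "dfx x (\<lambda>e. p (push (f e) e))"
proof -
  have "dfp (\<lambda>e'. e' (Some x) = p e')" by (intro pol.QP_eq Pol_var p)
  from dfp_inst[OF this f] have "dfp (\<lambda>e. e x = p (push (f e) e))" by simp
  moreover have "push (f e) (e(x := t)) = (push (f e) e)(Some x := t)" for e t
    by (auto simp: fun_eq_iff split: option.split)
  ultimately show ?thesis using p(2) f by (simp add: dfx_def)
qed

lemma dfx_diff:
  assumes "dfx x f" "dfx x g" shows "dfx x (\<lambda>e. f e - g e)"
proof -
  have "dfp (\<lambda>e. e (Some (Some x)) = e None - e (Some None))"
    by (intro pol.QP_eq pol.P_diff Pol_var)
  from dfp_inst2[OF this assms] show ?thesis using assms by (simp add: dfx_def)
qed

lemma dfp_cls_diff:
  assumes "dfx x f" "dfx x g" "0 < n" shows "dfp (\<lambda>e. cls n (f e - g e) = k)"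
proof -
  have "dfp (\<lambda>e. cls n (e None - e (Some None)) = k)"
    by (intro pol.P_cls pol.P_diff Pol_var assms(3))
  from dfp_inst2[OF this assms(1,2)] show ?thesis by simp
qed

section \<open>One-variable structure of definable sets\<close>

definition rk :: "rxy set \<Rightarrow> rxy \<Rightarrow> nat" where
  "rk T t = card {s \<in> T. 0 < lc (t - s)}"

lemma lc_less_trans: "0 < lc (b - a) \<Longrightarrow> 0 < lc (c - b) \<Longrightarrow> 0 < lc (c - a)"
  using pos_add(1)[of "b - a" "c - b"] by simp

lemma rk_less:
  assumes "finite T" "s \<in> T" "0 < lc (t - s)" shows "rk T s < rk T t"
  unfolding rk_def
proof (rule psubset_card_mono)
  show "{u \<in> T. 0 < lc (s - u)} \<subset> {u \<in> T. 0 < lc (t - u)}"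
  proof (rule psubsetI)
    show "{u \<in> T. 0 < lc (s - u)} \<subseteq> {u \<in> T. 0 < lc (t - u)}"
      using lc_less_trans[OF _ assms(3)] by blast
    show "{u \<in> T. 0 < lc (s - u)} \<noteq> {u \<in> T. 0 < lc (t - u)}"
    proof
      assume "{u \<in> T. 0 < lc (s - u)} = {u \<in> T. 0 < lc (t - u)}"
      then have "s \<in> {u \<in> T. 0 < lc (s - u)}" using assms by blast
      then show False by simp
    qed
  qed
qed (use assms in simp)

lemma rk_inj: "finite T \<Longrightarrow> s \<in> T \<Longrightarrow> t \<in> T \<Longrightarrow> rk T s = rk T t \<Longrightarrow> s = t"
  using lc_diff_total[of s t] rk_less[of T s t] rk_less[of T t s] by auto

lemma rk_less_card: assumes "finite T" "t \<in> T" shows "rk T t < card T"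
proof -
  have "t \<notin> {s \<in> T. 0 < lc (t - s)}" by simp
  then have "{s \<in> T. 0 < lc (t - s)} \<subset> T" using assms(2) by blast
  then show ?thesis unfolding rk_def by (rule psubset_card_mono[OF assms(1)])
qed

text \<open>Cardinalities are not first-order, but this recursion expresses a lower bound for the
  rank with one quantifier per step.\<close>

lemma rk_Suc:
  assumes T: "finite T"
  shows "Suc k \<le> rk T t \<longleftrightarrow> (\<exists>s\<in>T. 0 < lc (t - s) \<and> k \<le> rk T s)"
proof
  assume k: "Suc k \<le> rk T t"
  let ?A = "{s \<in> T. 0 < lc (t - s)}"
  have fA: "finite ?A" using T by simp
  have "?A \<noteq> {}"
  proof
    assume "?A = {}"
    then have "rk T t = 0" unfolding rk_def by (simp only: card.empty)
    then show False using k by simp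
  qed
  then obtain s0 where s0: "s0 \<in> ?A" by blast
  obtain m where m: "m \<in> (\<lambda>s. t - s) ` ?A" "0 < lc m"
    "\<And>d. d \<in> (\<lambda>s. t - s) ` ?A \<Longrightarrow> 0 < lc d \<Longrightarrow> d = m \<or> 0 < lc (d - m)"
    by (rule ex_min_pos[of "(\<lambda>s. t - s) ` ?A" "t - s0"]) (use fA s0 in auto)
  then obtain s where s: "s \<in> ?A" "m = t - s" by blast
  have "?A \<subseteq> insert s {u \<in> T. 0 < lc (s - u)}"
  proof
    fix u assume u: "u \<in> ?A"
    then have "t - u = m \<or> 0 < lc (t - u - m)" by (intro m(3)) auto
    then show "u \<in> insert s {u \<in> T. 0 < lc (s - u)}" using s(2) u by auto
  qed
  then have "rk T t \<le> card (insert s {u \<in> T. 0 < lc (s - u)})"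
    unfolding rk_def using T by (intro card_mono) auto
  also have "\<dots> = Suc (rk T s)" using T by (simp add: rk_def)
  finally show "\<exists>s\<in>T. 0 < lc (t - s) \<and> k \<le> rk T s" using k s by (intro bexI[of _ s]) auto
next
  assume "\<exists>s\<in>T. 0 < lc (t - s) \<and> k \<le> rk T s"
  then obtain s where "s \<in> T" "0 < lc (t - s)" "k \<le> rk T s" by blast
  then show "Suc k \<le> rk T t" using rk_less[OF T, of s t] by simp
qed

definition kth :: "rxy set \<Rightarrow> nat \<Rightarrow> rxy" where
  "kth T k = (if \<exists>t\<in>T. rk T t = k then THE t. t \<in> T \<and> rk T t = k else 0)"

lemma kth_eq:
  assumes "finite T" "t \<in> T" "rk T t = k" shows "kth T k = t"
proof -
  have "(THE t. t \<in> T \<and> rk T t = k) = t"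
  proof (rule the_equality)
    fix s assume "s \<in> T \<and> rk T s = k"
    then show "s = t" using assms by (intro rk_inj[of T s t]) auto
  qed (use assms in simp)
  moreover have "\<exists>t\<in>T. rk T t = k" using assms by (intro bexI[of _ t])
  ultimately show ?thesis by (simp add: kth_def)
qed

lemma kth_iff:
  assumes "finite T"
  shows "t = kth T k \<longleftrightarrow> t \<in> T \<and> rk T t = k \<or> (\<not> (\<exists>s. s \<in> T \<and> rk T s = k)) \<and> t = 0"
proof (cases "\<exists>s. s \<in> T \<and> rk T s = k")
  case True
  then obtain s where s: "s \<in> T" "rk T s = k" by blast
  show ?thesis unfolding kth_eq[OF assms s] using True s rk_inj[OF assms, of t s] by auto
next
  case False
  then have "kth T k = 0" by (auto simp: kth_def)
  then show ?thesis using False by auto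
qed

text \<open>The order makes the members of a definable family of finite sets definable, as the k-th
  smallest ones. This provides the zeros of a polynomial as definable functions that do not depend
  on x.\<close>

locale definable_finite =
  fixes T :: "('v \<Rightarrow> rxy) \<Rightarrow> rxy set" and x :: 'v
  assumes fin: "finite (T e)" and indep: "T (e(x := t)) = T e"
    and dfp_mem: "dfp (\<lambda>e'. e' None \<in> T (\<lambda>v. e' (Some v)))"
begin

lemma dfp_rk_ge:
  "dfp (\<lambda>e'. e' None \<in> T (\<lambda>v. e' (Some v)) \<and> k \<le> rk (T (\<lambda>v. e' (Some v))) (e' None))"
proof (induction k)
  case 0
  then show ?case using dfp_mem by simp
next
  case (Suc k)
  let ?g = "\<lambda>w (e'' :: 'v option option \<Rightarrow> rxy). case_option (e'' None) (\<lambda>v. e'' (Some (Some v))) w"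
  have g: "?g w \<in> Pol" for w :: "'v option" by (cases w) (auto intro: Pol.intros)
  have "dfp (\<lambda>e''. (e'' None \<in> T (\<lambda>v. e'' (Some (Some v))) \<and> k \<le> rk (T (\<lambda>v. e'' (Some (Some v)))) (e'' None)))"
    using dfp_subst[where g = ?g, OF Suc g] by simp
  moreover have "dfp (\<lambda>e''. 0 < lc (e'' (Some None) - e'' None))" by (intro pol.QP_pos pol.P_diff Pol_var)
  ultimately have "dfp (\<lambda>e''. (e'' None \<in> T (\<lambda>v. e'' (Some (Some v))) \<and> k \<le> rk (T (\<lambda>v. e'' (Some (Some v)))) (e'' None))
     \<and> 0 < lc (e'' (Some None) - e'' None))"
    by (rule qs.QP_conj)
  from dfp_ex_push[OF this]
  have "dfp (\<lambda>e'. \<exists>s. (s \<in> T (\<lambda>v. e' (Some v)) \<and> k \<le> rk (T (\<lambda>v. e' (Some v))) s) \<and> 0 < lc (e' None - s))"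
    by simp
  from qs.QP_conj[OF dfp_mem this] show ?case
    by (rule qs.QP_cong[rotated]) (auto simp: rk_Suc[OF fin])
qed

lemma dfp_rk:
  "dfp (\<lambda>e'. e' None \<in> T (\<lambda>v. e' (Some v)) \<and> rk (T (\<lambda>v. e' (Some v))) (e' None) = k)"
  using qs.QP_conj[OF dfp_rk_ge[of k] qs.QP_not[OF dfp_rk_ge[of "Suc k"]]]
  by (rule qs.QP_cong[rotated]) auto

definition has :: "nat \<Rightarrow> ('v \<Rightarrow> rxy) \<Rightarrow> bool" where "has k e \<longleftrightarrow> (\<exists>t. t \<in> T e \<and> rk (T e) t = k)"

lemma dfp_has: "dfp (has k)"
  using dfp_ex_push[OF dfp_rk[of k]] by (simp add: has_def[abs_def])

lemma has_upd: "has k (e(x := t)) = has k e" by (simp add: has_def indep)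

lemma dfx_kth: "dfx x (\<lambda>e. kth (T e) k)"
proof -
  let ?g = "\<lambda>w (e :: 'v \<Rightarrow> rxy). case_option (e x) e w"
  have g: "?g w \<in> Pol" for w :: "'v option" by (cases w) (auto intro: Pol.intros)
  have "dfp (\<lambda>e. e x \<in> T e \<and> rk (T e) (e x) = k)"
    using dfp_subst[where g = ?g, OF dfp_rk g] by simp
  moreover have "dfp (\<lambda>e. \<not> has k e \<and> e x = 0)"
    by (intro qs.QP_conj qs.QP_not dfp_has pol.QP_zero Pol_var)
  ultimately have "dfp (\<lambda>e. (e x \<in> T e \<and> rk (T e) (e x) = k) \<or> (\<not> has k e \<and> e x = 0))" by (rule qs.QP_disj)
  then have "dfp (\<lambda>e. e x = kth (T e) k)" by (rule qs.QP_cong[rotated]) (simp add: kth_iff[OF fin] has_def)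
  then show ?thesis by (simp add: dfx_def indep)
qed

lemma has_kth: "has k e \<Longrightarrow> kth (T e) k \<in> T e"
  unfolding has_def by (elim exE conjE) (simp add: kth_eq[OF fin])

lemma mem_kth:
  assumes "t \<in> T e" "card (T e) \<le> N" shows "\<exists>k\<in>{..<N}. has k e \<and> t = kth (T e) k"
proof (intro bexI[of _ "rk (T e) t"] conjI)
  show "has (rk (T e) t) e" unfolding has_def using assms(1) by (intro exI[of _ t]) simp
  show "t = kth (T e) (rk (T e) t)" by (rule kth_eq[OF fin assms(1) refl, symmetric])
  show "rk (T e) t \<in> {..<N}" using rk_less_card[OF fin assms(1)] assms(2) by simp
qed

end

text \<open>Boolean combinations of initial segments in the variable x. Conditions that do not
  involve x are included, as the empty or the full segment.\<close>

inductive_set Ct :: "'v \<Rightarrow> ('v \<Rightarrow> rxy) set set" for x where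
  Ct_cut: "dfp S \<Longrightarrow> (\<And>e s t. S (e(x := t)) \<Longrightarrow> 0 < lc (t - s) \<Longrightarrow> S (e(x := s))) \<Longrightarrow> {e. S e} \<in> Ct x"
| Ct_not: "A \<in> Ct x \<Longrightarrow> - A \<in> Ct x"
| Ct_and: "A \<in> Ct x \<Longrightarrow> B \<in> Ct x \<Longrightarrow> A \<inter> B \<in> Ct x"

interpretation ct: bool_alg "Ct x" for x
proof
  show "UNIV \<in> Ct x" using Ct_cut[OF qs.QP_const[of True], of x] by simp
qed (auto intro: Ct_not Ct_and)

abbreviation ctp :: "'v \<Rightarrow> (('v \<Rightarrow> rxy) \<Rightarrow> bool) \<Rightarrow> bool" where "ctp \<equiv> ct.QP"

inductive_set St :: "'v \<Rightarrow> ('v \<Rightarrow> rxy) set set" for x where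
  St_Ct: "A \<in> Ct x \<Longrightarrow> A \<in> St x"
| St_cls: "dfx x c \<Longrightarrow> 0 < n \<Longrightarrow> {e. cls n (e x - c e) = k} \<in> St x"
| St_not: "A \<in> St x \<Longrightarrow> - A \<in> St x"
| St_and: "A \<in> St x \<Longrightarrow> B \<in> St x \<Longrightarrow> A \<inter> B \<in> St x"

interpretation st: bool_alg "St x" for x
proof
  show "UNIV \<in> St x" by (rule St_Ct[OF ct.Q_UNIV])
qed (auto intro: St_not St_and)

abbreviation stp :: "'v \<Rightarrow> (('v \<Rightarrow> rxy) \<Rightarrow> bool) \<Rightarrow> bool" where "stp \<equiv> st.QP"

lemma stp_ctp: "ctp x C \<Longrightarrow> stp x C"
  unfolding st.QP_def ct.QP_def by (rule St_Ct)

lemma ctp_cut: "dfp S \<Longrightarrow> (\<And>e s t. S (e(x := t)) \<Longrightarrow> 0 < lc (t - s) \<Longrightarrow> S (e(x := s))) \<Longrightarrow> ctp x S"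
  unfolding ct.QP_def by (rule Ct_cut)

lemma ctp_base: "dfp B \<Longrightarrow> (\<And>e t. B (e(x := t)) = B e) \<Longrightarrow> ctp x B"
  by (rule ctp_cut) simp_all

lemmas stp_base = stp_ctp[OF ctp_base]

lemma stp_cls: "dfx x c \<Longrightarrow> 0 < n \<Longrightarrow> stp x (\<lambda>e. cls n (e x - c e) = k)"
  unfolding st.QP_def by (rule St_cls)

lemma ctp_less:
  assumes c: "dfx x c" shows "ctp x (\<lambda>e. 0 < lc (e x - c e))" "ctp x (\<lambda>e. 0 < lc (c e - e x))"
proof -
  have D: "dfp (\<lambda>e. 0 < lc (e (Some x) - e None))" "dfp (\<lambda>e. 0 < lc (e None - e (Some x)))"
    by (intro pol.QP_pos pol.P_diff Pol_var)+
  have ds: "dfp (\<lambda>e. 0 < lc (e x - c e))" "dfp (\<lambda>e. 0 < lc (c e - e x))"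
    using dfp_inst[OF D(1) c] dfp_inst[OF D(2) c] by simp_all
  show "ctp x (\<lambda>e. 0 < lc (c e - e x))"
    by (rule ctp_cut[OF ds(2)]) (auto simp: dfx_upd[OF c] intro: lc_less_trans)
  have "ctp x (\<lambda>e. \<not> 0 < lc (e x - c e))"
    by (rule ctp_cut[OF qs.QP_not[OF ds(1)]]) (auto simp: dfx_upd[OF c] dest: lc_less_trans)
  from ct.QP_not[OF this] show "ctp x (\<lambda>e. 0 < lc (e x - c e))" by simp
qed

lemma ctp_eq: assumes "dfx x c" shows "ctp x (\<lambda>e. e x = c e)"
proof -
  have eq: "e x = c e \<longleftrightarrow> \<not> 0 < lc (e x - c e) \<and> \<not> 0 < lc (c e - e x)" for e
    using lc_diff_total[of "e x" "c e"] by auto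
  show ?thesis unfolding eq by (intro ct.QP_conj ct.QP_not ctp_less assms)
qed

lemma dfp_inst_base:
  fixes x :: 'v
  assumes "dfx x f" "dfp (\<lambda>e' :: 'v option \<Rightarrow> rxy. R (e' None))" shows "ctp x (\<lambda>e. R (f e))"
  using dfp_inst[OF assms(2,1)] by (intro ctp_base) (auto simp: dfx_upd[OF assms(1)])

lemma ctp_dfx_cls: "dfx x f \<Longrightarrow> 0 < n \<Longrightarrow> ctp x (\<lambda>e. cls n (f e) = k)"
  by (erule dfp_inst_base) (intro pol.P_cls Pol_var)

lemma ctp_dfx_zero: "dfx x f \<Longrightarrow> ctp x (\<lambda>e. f e = 0)"
  by (erule dfp_inst_base[where R = "\<lambda>t. t = 0"]) (intro pol.QP_zero Pol_var)

lemma vle_antimono: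
  assumes "vle (a * u ^ m) b" "vv v \<le> vv u" "u \<noteq> 0" "v \<noteq> 0"
  shows "vle (a * v ^ m) b"
proof (cases "b = 0")
  case False
  then have "a \<noteq> 0" "vv (a * u ^ m) \<le> vv b" using assms by (auto simp: vle_def)
  moreover have "of_nat m * vv v \<le> of_nat m * vv u" using assms(2) by (intro mult_left_mono) auto
  ultimately show ?thesis using assms(3,4) by (simp add: vle_def vv_mult vv_power)
qed (simp add: vle_def)

text \<open>For m > 0 and nonzero a the condition says that x is far from c in valuation: a final
  segment to the right of c, an initial segment to its left. At c itself it depends on b
  alone.\<close>

lemma ctp_vle:
  assumes a: "dfx x a" and b: "dfx x b" and c: "dfx x c"
  shows "ctp x (\<lambda>e. vle (a e * (e x - c e) ^ m) (b e))"
proof (cases "m = 0")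
  case True
  have "dfp (\<lambda>e. vle (e None) (e (Some None)))" by (intro pol.QP_vle Pol_var)
  from dfp_inst2[OF this a b] show ?thesis
    using True a b by (intro ctp_base) (simp_all add: dfx_upd)
next
  case False
  have D: "dfp (\<lambda>e. vle (e None * (e (Some (Some (Some x))) - e (Some None)) ^ m) (e (Some (Some None))))"
    by (intro pol.QP_vle pol.P_mult pol.P_power pol.P_diff Pol_var)
  have dv: "dfp (\<lambda>e. vle (a e * (e x - c e) ^ m) (b e))"
    using dfp_inst3[OF D a c b] by simp
  have E: "dfp (\<lambda>e. 0 < lc (e (Some x) - e None))" "dfp (\<lambda>e. 0 < lc (e None - e (Some x)))"
    by (intro pol.QP_pos pol.P_diff Pol_var)+
  have ds: "dfp (\<lambda>e. 0 < lc (e x - c e))" "dfp (\<lambda>e. 0 < lc (c e - e x))"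
    using dfp_inst[OF E(1) c] dfp_inst[OF E(2) c] by simp_all
  let ?v = "\<lambda>e. vle (a e * (e x - c e) ^ m) (b e)"
  have mono: "vv (t - d) \<le> vv (s - d)" if "0 < lc (t - s)" "0 < lc (s - d)" for s t d
    using pos_add(2)[OF that] by (simp add: min_def split: if_splits)
  have mono': "vv (s - d) \<le> vv (t - d)" if "0 < lc (t - s)" "0 < lc (d - t)" for s t d
    using pos_add(2)[OF that] vv_uminus[of "d - t"] vv_uminus[of "d - s"] by (simp add: min_def split: if_splits)
  have 1: "ctp x (\<lambda>e. \<not> (0 < lc (e x - c e) \<and> ?v e))"
  proof (rule ctp_cut)
    show "dfp (\<lambda>e. \<not> (0 < lc (e x - c e) \<and> ?v e))" by (intro qs.QP_not qs.QP_conj ds dv)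
    fix e s t assume h: "\<not> (0 < lc ((e(x := t)) x - c (e(x := t))) \<and> ?v (e(x := t)))" and st: "0 < lc (t - s)"
    show "\<not> (0 < lc ((e(x := s)) x - c (e(x := s))) \<and> ?v (e(x := s)))"
    proof
      assume g: "0 < lc ((e(x := s)) x - c (e(x := s))) \<and> ?v (e(x := s))"
      then have g1: "0 < lc (s - c e)" "vle (a e * (s - c e) ^ m) (b e)" by (simp_all add: dfx_upd[OF a] dfx_upd[OF b] dfx_upd[OF c])
      have t: "0 < lc (t - c e)" by (rule lc_less_trans[OF g1(1) st])
      have "vle (a e * (t - c e) ^ m) (b e)"
        by (rule vle_antimono[OF g1(2) mono[OF st g1(1)]]) (use g1(1) t in auto)
      then show False using h t by (simp add: dfx_upd[OF a] dfx_upd[OF b] dfx_upd[OF c])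
    qed
  qed
  have 2: "ctp x (\<lambda>e. 0 < lc (c e - e x) \<and> ?v e)"
  proof (rule ctp_cut)
    show "dfp (\<lambda>e. 0 < lc (c e - e x) \<and> ?v e)" by (intro qs.QP_conj ds dv)
    fix e s t assume h: "0 < lc (c (e(x := t)) - (e(x := t)) x) \<and> ?v (e(x := t))" and st: "0 < lc (t - s)"
    from h have h1: "0 < lc (c e - t)" "vle (a e * (t - c e) ^ m) (b e)" by (simp_all add: dfx_upd[OF a] dfx_upd[OF b] dfx_upd[OF c])
    have s: "0 < lc (c e - s)" by (rule lc_less_trans[OF st h1(1)])
    have "vle (a e * (s - c e) ^ m) (b e)"
      by (rule vle_antimono[OF h1(2) mono'[OF st h1(1)]]) (use h1(1) s in auto)
    then show "0 < lc (c (e(x := s)) - (e(x := s)) x) \<and> ?v (e(x := s))"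
      using s by (simp add: dfx_upd[OF a] dfx_upd[OF b] dfx_upd[OF c])
  qed
  have eq: "?v e \<longleftrightarrow> 0 < lc (e x - c e) \<and> \<not> \<not> (0 < lc (e x - c e) \<and> ?v e) \<or> (0 < lc (c e - e x) \<and> ?v e) \<or> e x = c e \<and> b e = 0" for e
    using lc_diff_total[of "e x" "c e"] False by (cases "e x = c e") (auto simp: vle_def)
  show ?thesis
    by (rule ct.QP_cong[OF eq]) (intro ct.QP_disj ct.QP_conj ct.QP_not[OF 1] 2 ctp_eq c ctp_dfx_zero b ctp_less(1))
qed

lemma ctp_vle':
  assumes a: "dfx x a" and b: "dfx x b" and c: "dfx x c"
  shows "ctp x (\<lambda>e. vle (b e) (a e * (e x - c e) ^ m))"
proof -
  have "dfp (\<lambda>e. e (Some x) = fX * e None)" by (intro pol.QP_eq pol.P_mult Pol_var pol.P_const)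
  from dfp_inst[OF this a] have fa: "dfx x (\<lambda>e. fX * a e)" using a by (simp add: dfx_def)
  have eq: "vle (b e) (a e * (e x - c e) ^ m) \<longleftrightarrow>
    a e = 0 \<or> (if m = 0 then False else e x = c e) \<or> \<not> vle (fX * a e * (e x - c e) ^ m) (b e)" for e
    using not_vle_iff[of "b e" "a e * (e x - c e) ^ m"] by (auto simp: mult.assoc)
  show ?thesis
    by (rule ct.QP_cong[OF eq])
       (intro ct.QP_disj ct.QP_not ctp_vle fa b c ctp_dfx_zero a, cases "m = 0", auto intro: ct.QP_const ctp_eq c)
qed

lemma stp_cls_rel:
  assumes "dfx x a" "dfx x c" "0 < n"
  shows "stp x (\<lambda>e. R (cls n (a e)) (cls n (e x - c e)))"
proof -
  have eq: "R (cls n (a e)) (cls n (e x - c e)) \<longleftrightarrow> (\<exists>k\<in>cls_range n. \<exists>k'\<in>cls_range n.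
      (cls n (a e) = k \<and> cls n (e x - c e) = k') \<and> R k k')" for e
    using cls_in_range[OF assms(3)] by blast
  show ?thesis unfolding eq
    by (intro st.QP_bex finite_cls_range st.QP_conj st.QP_const stp_ctp[OF ctp_dfx_cls] stp_cls assms)
qed

lemma vle_sign:
  assumes "sg \<in> {1, -1 :: rxy}"
  shows "vle (a * (sg * u) ^ m) b = vle (a * u ^ m) b" "vle b (a * (sg * u) ^ m) = vle b (a * u ^ m)"
proof -
  have "sg \<noteq> 0" using assms by auto
  moreover have "sg ^ m = 1 \<or> sg ^ m = - 1" using assms by (cases "sg = 1"; cases "even m") simp_all
  ultimately show "vle (a * (sg * u) ^ m) b = vle (a * u ^ m) b" "vle b (a * (sg * u) ^ m) = vle b (a * u ^ m)"
    by (auto simp: vle_def power_mult_distrib)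
qed

lemma ctp_lc_sign:
  assumes "sg \<in> {1, -1 :: rxy}" "dfx x c"
  shows "ctp x (\<lambda>e. 0 < lc (sg * (e x - c e)))" "ctp x (\<lambda>e. lc (sg * (e x - c e)) < 0)"
proof -
  have n: "lc u < 0 \<longleftrightarrow> 0 < lc (- u)" for u :: rxy by simp
  consider "sg = 1" | "sg = - 1" using assms(1) by blast
  then have "ctp x (\<lambda>e. 0 < lc (sg * (e x - c e))) \<and> ctp x (\<lambda>e. lc (sg * (e x - c e)) < 0)"
  proof cases
    case 2
    then show ?thesis using ctp_less[OF assms(2)]
      by (simp only: n mult_minus1 minus_minus minus_diff_eq simp_thms)
  qed (use ctp_less[OF assms(2)] in \<open>simp only: n mult_1 minus_diff_eq simp_thms\<close>)
  then show "ctp x (\<lambda>e. 0 < lc (sg * (e x - c e)))" "ctp x (\<lambda>e. lc (sg * (e x - c e)) < 0)" by simp_all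
qed

section \<open>The class of a polynomial at a variable point\<close>

context
  fixes q :: "('v \<Rightarrow> rxy) \<Rightarrow> rxy poly" and x :: 'v and N
  assumes q: "pol.PolyP q" and qx: "\<And>e t. q (e(x := t)) = q e" and deg: "\<And>e. degree (q e) \<le> N"
begin

lemma PolyP_q_push: "pol.PolyP (\<lambda>e' :: 'v option \<Rightarrow> rxy. q (\<lambda>v. e' (Some v)))"
  by (rule pol.PolyPI[OF Pol_push[OF pol.PolyP_coeff[OF q]] deg])

lemma dfx_coeff:
  assumes "dfx x c" shows "dfx x (\<lambda>e. coeff (pcompose (q e) [:c e, sg:]) i)"
proof -
  have upd: "(\<lambda>v. (e'(Some x := t)) (Some v)) = (\<lambda>v. e' (Some v))(x := t)" for e' :: "'v option \<Rightarrow> rxy" and t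
    by auto
  have "pol.PolyP (\<lambda>e' :: 'v option \<Rightarrow> rxy. pcompose (q (\<lambda>v. e' (Some v))) [:e' None, sg:])"
    by (intro pol.PolyP_pcompose PolyP_q_push pol.PolyP_lin Pol_var pol.P_const)
  from dfx_comp[OF pol.PolyP_coeff[OF this, of i] _ assms] show ?thesis
    by (simp only: upd qx option.case fun_upd_other option.distinct simp_thms)
qed

lemma stp_dom:
  assumes c: "dfx x c" and sg: "sg \<in> {1, -1}"
  shows "stp x (\<lambda>e. e x \<noteq> c e \<and> dom (pcompose (q e) [:c e, sg:]) (sg * (e x - c e)) j)"
proof -
  let ?a = "\<lambda>i e. coeff (pcompose (q e) [:c e, sg:]) i"
  have deg': "degree (pcompose (q e) [:c e, sg:]) \<le> N" for e
    using deg[of e] by (simp add: degree_pcompose)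
  have eq: "e x \<noteq> c e \<and> dom (pcompose (q e) [:c e, sg:]) (sg * (e x - c e)) j \<longleftrightarrow>
    e x \<noteq> c e \<and> (?a j e \<noteq> 0 \<and> (\<forall>i\<in>{..N}. ?a i e \<noteq> 0 \<longrightarrow>
      (if i < j then \<not> vle (?a i e) (?a j e * (e x - c e) ^ (j - i)) else vle (?a j e) (?a i e * (e x - c e) ^ (i - j)))))" for e
  proof (cases "e x = c e")
    case False
    then have "sg * (e x - c e) \<noteq> 0" using sg by auto
    from dom_iff_vle[OF this deg'[of e]] show ?thesis using False by (simp only: vle_sign[OF sg] simp_thms)
  qed simp
  have if_stp: "stp x (\<lambda>e. if b then A e else B e)" if "stp x A" "stp x B" for b A B
    using that by (cases b) auto
  show ?thesis unfolding eq
    by (intro st.QP_conj st.QP_not stp_ctp[OF ctp_eq] c stp_ctp[OF ctp_dfx_zero] st.QP_ball finite_atMost st.QP_imp if_stp stp_ctp[OF ctp_vle'] dfx_coeff)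
qed

text \<open>0 is added so that the set of centres is never empty, as \<open>locate\<close>
  requires.\<close>

definition rts :: "('v \<Rightarrow> rxy) \<Rightarrow> rxy set" where "rts e = insert 0 (droots (q e) 0)"

lemma degree_pderivs: "degree ((pderiv ^^ i) p) \<le> degree (p :: rxy poly)"
  by (induction i) (auto simp: degree_pderiv)

lemma card_rts: "card (rts e) \<le> Suc (Suc N * N)"
proof -
  let ?R = "\<lambda>i. if (pderiv ^^ i) (q e) = 0 then {} else {c. poly ((pderiv ^^ i) (q e)) c = 0}"
  have "droots (q e) 0 \<subseteq> (\<Union>i\<in>{..N}. ?R i)"
  proof
    fix c assume "c \<in> droots (q e) 0"
    then obtain i where i: "(pderiv ^^ i) (q e) \<noteq> 0" "poly ((pderiv ^^ i) (q e)) c = 0" by (auto simp: droots_def)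
    then have "i \<le> N" using pderiv_funpow_0[of "q e" i] deg[of e] by (cases "degree (q e) < i") auto
    then show "c \<in> (\<Union>i\<in>{..N}. ?R i)" using i by auto
  qed
  moreover have f: "finite (?R i)" for i using poly_roots_finite by auto
  ultimately have "card (droots (q e) 0) \<le> card (\<Union>i\<in>{..N}. ?R i)" by (intro card_mono finite_UN_I[OF finite_atMost f])
  also have "\<dots> \<le> (\<Sum>i\<in>{..N}. card (?R i))" by (rule card_UN_le) simp
  also have "\<dots> \<le> (\<Sum>i\<in>{..N}. N)"
  proof (rule sum_mono)
    fix i
    show "card (?R i) \<le> N"
      using card_poly_roots_bound[of "(pderiv ^^ i) (q e)"] degree_pderivs[of i "q e"] deg[of e] by auto
  qed
  finally have "card (droots (q e) 0) \<le> Suc N * N" by simp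
  then show ?thesis unfolding rts_def by (simp add: card_insert_if finite_droots)
qed

interpretation d: definable_finite rts x
proof
  show "finite (rts e)" for e by (simp add: rts_def finite_droots)
  show "rts (e(x := t)) = rts e" for e t by (simp add: rts_def qx)
  have eq: "e' None \<in> rts (\<lambda>v. e' (Some v)) \<longleftrightarrow> e' None = 0 \<or>
    (\<exists>i\<in>{..N}. (pderiv ^^ i) (q (\<lambda>v. e' (Some v))) \<noteq> 0 \<and> poly ((pderiv ^^ i) (q (\<lambda>v. e' (Some v)))) (e' None) = 0)" for e' :: "'v option \<Rightarrow> rxy"
  proof -
    have "i \<le> N" if "(pderiv ^^ i) (q (\<lambda>v. e' (Some v))) \<noteq> 0" for i
      using that pderiv_funpow_0[of "q (\<lambda>v. e' (Some v))" i] deg[of "\<lambda>v. e' (Some v)"]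
      by (cases "degree (q (\<lambda>v. e' (Some v))) < i") auto
    then show ?thesis by (auto simp: rts_def droots_def)
  qed
  show "dfp (\<lambda>e'. e' None \<in> rts (\<lambda>v. e' (Some v)))"
    unfolding eq
    by (intro qs.QP_disj qs.QP_bex finite_atMost qs.QP_conj qs.QP_not pol.QP_zero Pol_var pol.QP_poly_zero
        pol.PolyP_pderivs PolyP_q_push pol.PolyP_poly)
qed

lemma stp_good:
  assumes sg: "sg \<in> {1, -1}"
  shows "stp x (\<lambda>e. good (sg * (e x - kth (rts e) i)) (shifted (kth (rts e) i) sg (rts e)))"
proof -
  let ?c = "\<lambda>k e. kth (rts e) k"
  have eq: "good (sg * (e x - ?c i e)) (shifted (?c i e) sg (rts e)) \<longleftrightarrow> 0 < lc (sg * (e x - ?c i e)) \<and>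
    (\<forall>k\<in>{..<Suc (Suc N * N)}. d.has k e \<longrightarrow> 0 < lc (sg * (?c k e - ?c i e)) \<longrightarrow>
      lc (sg * (e x - ?c k e)) < 0 \<and> vle (1 * (e x - ?c k e) ^ 1) (?c k e - ?c i e))" for e
  proof -
    have "(\<forall>c'\<in>rts e. R c') \<longleftrightarrow> (\<forall>k\<in>{..<Suc (Suc N * N)}. d.has k e \<longrightarrow> R (?c k e))" for R
      using d.mem_kth[OF _ card_rts] d.has_kth by fast
    then show ?thesis unfolding good_iff_vle[OF sg d.fin] by simp
  qed
  have pos: "stp x (\<lambda>e. 0 < lc (sg * (?c k e - ?c i e)))" for k
  proof -
    have "dfp (\<lambda>e'. 0 < lc (sg * (e' None - e' (Some None))))" by (intro pol.QP_pos pol.P_mult pol.P_diff pol.P_const Pol_var)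
    from dfp_inst2[OF this d.dfx_kth[of k] d.dfx_kth[of i]] show ?thesis
      by (intro stp_base) (simp_all add: d.indep)
  qed
  have "dfx x (\<lambda>_. 1)" by (rule dfx_Pol) (simp_all add: pol.P_const)
  then show ?thesis unfolding eq
    by (intro st.QP_conj st.QP_ball finite_lessThan st.QP_imp stp_ctp[OF ctp_lc_sign(1)] stp_ctp[OF ctp_lc_sign(2)] sg d.dfx_kth pos stp_ctp[OF ctp_vle] dfx_diff
        stp_base[OF d.dfp_has d.has_upd])
qed

text \<open>The point x is located relative to the k-th elements of \<open>rts\<close>, which are
  definable functions. There the polynomial is a monomial in x - c up to \<open>ssim\<close>, so its
  class needs only the class of x - c, and the location itself only cuts.\<close>

lemma stp_poly_cls:
  assumes n: "0 < n"
  shows "stp x (\<lambda>e. cls n (poly (q e) (e x)) = k)"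
proof -
  let ?c = "\<lambda>k e. kth (rts e) k"
  let ?P = "\<lambda>i sg e. pcompose (q e) [:?c i e, sg:]"
  let ?s = "\<lambda>i sg e. sg * (e x - ?c i e) :: rxy"
  let ?I = "{..<Suc (Suc N * N)}"
  let ?at = "\<lambda>i e. (d.has i e \<and> e x = ?c i e) \<and> cls n (poly (q e) (?c i e)) = k"
  let ?near = "\<lambda>i sg j e. ((q e \<noteq> 0 \<and> d.has i e \<and> good (?s i sg e) (shifted (?c i e) sg (rts e))) \<and>
      (e x \<noteq> ?c i e \<and> dom (?P i sg e) (?s i sg e) j)) \<and> cls n (coeff (?P i sg e) j * (?s i sg e) ^ j) = k"
  have nearval: "cls n (poly (q e) (e x)) = cls n (coeff (?P i sg e) j * (?s i sg e) ^ j)"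
    if h: "q e \<noteq> 0" "good (?s i sg e) (shifted (?c i e) sg (rts e))" "dom (?P i sg e) (?s i sg e) j" and sg: "sg \<in> {1, -1}"
    for e i sg j
  proof -
    have "covers (shifted (?c i e) sg (rts e)) (?P i sg e) 0"
      unfolding shifted_def by (rule covers_shift[OF _ sg]) (auto simp: rts_def)
    from value_at_good[OF pcompose_lin_nz[OF h(1) sg] this h(2,3)]
    have "ssim (poly (?P i sg e) (?s i sg e)) (coeff (?P i sg e) j * (?s i sg e) ^ j)" .
    moreover have "poly (?P i sg e) (?s i sg e) = poly (q e) (e x)"
      using sg by (auto simp: poly_pcompose)
    ultimately show ?thesis by (simp add: cls_ssim)
  qed
  have eq: "cls n (poly (q e) (e x)) = k \<longleftrightarrow> (q e = 0 \<and> k = (0, 0, 0)) \<or> (\<exists>i\<in>?I. ?at i e) \<or>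
    (\<exists>i\<in>?I. \<exists>sg\<in>{1, -1}. \<exists>j\<in>{..N}. ?near i sg j e)" for e
  proof
    assume k: "cls n (poly (q e) (e x)) = k"
    consider "q e = 0" | "q e \<noteq> 0" "e x \<in> rts e" | "q e \<noteq> 0" "e x \<notin> rts e" by blast
    then show "(q e = 0 \<and> k = (0, 0, 0)) \<or> (\<exists>i\<in>?I. ?at i e) \<or> (\<exists>i\<in>?I. \<exists>sg\<in>{1, -1}. \<exists>j\<in>{..N}. ?near i sg j e)"
    proof cases
      case 1
      then have "q e = 0 \<and> k = (0, 0, 0)" using k by simp
      then show ?thesis by (rule disjI1)
    next
      case 2
      obtain i where i: "i \<in> ?I" "d.has i e" "e x = ?c i e" using d.mem_kth[OF 2(2) card_rts] by (elim bexE conjE)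
      then have "?at i e" using k by (simp only: i(3)[symmetric] simp_thms)
      then show ?thesis using i(1) by (intro disjI2 disjI1 bexI)
    next
      case 3
      have "rts e \<noteq> {}" by (simp add: rts_def)
      from locate[OF d.fin this 3(2)]
      obtain c sg where c: "c \<in> rts e" "sg \<in> {1, -1}" "good (sg * (e x - c)) (shifted c sg (rts e))"
        unfolding shifted_def by (elim bexE)
      obtain i where i: "i \<in> ?I" "d.has i e" "c = ?c i e" using d.mem_kth[OF c(1) card_rts] by (elim bexE conjE)
      have deg': "degree (?P i sg e) \<le> N" using deg[of e] by (simp add: degree_pcompose)
      obtain j where j: "dom (?P i sg e) (?s i sg e) j" "j \<le> degree (?P i sg e)"
        by (rule dom_exists[OF pcompose_lin_nz[OF 3(1) c(2)]])
      have ne: "e x \<noteq> ?c i e" using c(1) i(3) 3(2) by auto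
      note g = c(3)[unfolded i(3)]
      have "?near i sg j e"
        using nearval[OF 3(1) g j(1) c(2)] k 3(1) i(2) g ne j(1) by (intro conjI) simp_all
      moreover have "j \<in> {..N}" using j(2) deg' by simp
      ultimately show ?thesis using i(1) c(2) by (intro disjI2) (intro bexI)
    qed
  next
    assume "(q e = 0 \<and> k = (0, 0, 0)) \<or> (\<exists>i\<in>?I. ?at i e) \<or> (\<exists>i\<in>?I. \<exists>sg\<in>{1, -1}. \<exists>j\<in>{..N}. ?near i sg j e)"
    then consider "q e = 0 \<and> k = (0, 0, 0)" | i where "?at i e" | i sg j where "sg \<in> {1, -1}" "?near i sg j e"
      by (elim disjE bexE) 
    then show "cls n (poly (q e) (e x)) = k"
    proof cases
      case 3
      then show ?thesis using nearval[where e = e and i = i and sg = sg and j = j] by simp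
    qed simp_all
  qed
  have dfq: "dfp (\<lambda>e. q e = 0)" by (rule pol.QP_poly_zero[OF q])
  have at_cls: "stp x (\<lambda>e. cls n (poly (q e) (?c i e)) = k)" for i
  proof -
    have "dfp (\<lambda>e' :: 'v option \<Rightarrow> rxy. cls n (poly (q (\<lambda>v. e' (Some v))) (e' None)) = k)"
      by (intro pol.P_cls pol.PolyP_poly PolyP_q_push Pol_var n)
    from dfp_inst[OF this d.dfx_kth[of i]] show ?thesis
      by (intro stp_base) (simp_all add: d.indep qx)
  qed
  have near_cls: "stp x (\<lambda>e. cls n (coeff (?P i sg e) j * (?s i sg e) ^ j) = k)" for i sg j
    unfolding cls_mult cls_power by (rule stp_cls_rel[OF dfx_coeff[OF d.dfx_kth] d.dfx_kth n])
  have qz: "stp x (\<lambda>e. q e = 0)" by (rule stp_base[OF dfq]) (simp add: qx)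
  have finI: "finite ?I" "finite {1, -1 :: rxy}" by simp_all
  show ?thesis
    by (rule st.QP_cong[OF eq])
       (intro st.QP_disj st.QP_conj st.QP_bex finI finite_atMost st.QP_not qz st.QP_const at_cls near_cls stp_ctp[OF ctp_eq]
          d.dfx_kth stp_dom stp_good stp_base[OF d.dfp_has d.has_upd])
qed

end

theorem dfp_stp: assumes "dfp C" shows "stp x C"
proof -
  have "S \<in> St x" if "S \<in> Qset" for S
    using that
  proof (induction rule: Qset.induct)
    case (Q_atom p n k)
    obtain q where q: "pol.PolyP q" "\<forall>e t. p (e(x := t)) = poly (q e) t" "\<forall>e t. q (e(x := t)) = q e"
      using Pol_as_poly[OF Q_atom(1), of x] by blast
    obtain N where N: "\<forall>e. degree (q e) \<le> N" using pol.PolyP_deg[OF q(1)] by blast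
    have "p e = poly (q e) (e x)" for e using q(2)[rule_format, of e "e x"] by simp
    then show ?case
      using stp_poly_cls[of q x N n k, OF q(1) q(3)[rule_format] N[rule_format] Q_atom(2)]
      by (simp add: st.QP_def)
  qed (auto intro: St_not St_and)
  then show ?thesis using assms by (simp add: qs.QP_def st.QP_def)
qed

definition cut :: "'v \<Rightarrow> (('v \<Rightarrow> rxy) \<Rightarrow> bool) \<Rightarrow> bool" where
  "cut x S \<longleftrightarrow> dfp S \<and> (\<forall>e s t. S (e(x := t)) \<longrightarrow> 0 < lc (t - s) \<longrightarrow> S (e(x := s)))"

lemma ctp_cuts:
  assumes "ctp x C"
  shows "\<exists>\<S>. finite \<S> \<and> (\<forall>S\<in>\<S>. cut x S) \<and> (\<forall>e e'. (\<forall>S\<in>\<S>. S e = S e') \<longrightarrow> C e = C e')"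
proof -
  have "\<exists>\<S>. finite \<S> \<and> (\<forall>S\<in>\<S>. cut x S) \<and> (\<forall>e e'. (\<forall>S\<in>\<S>. S e = S e') \<longrightarrow> (e \<in> A) = (e' \<in> A))" if "A \<in> Ct x" for A
    using that
  proof (induction rule: Ct.induct)
    case (Ct_cut S)
    then show ?case by (intro exI[of _ "{S}"]) (auto simp: cut_def)
  next
    case (Ct_not A)
    then show ?case by simp
  next
    case (Ct_and A B)
    then obtain \<A> \<B> where h: "finite \<A>" "\<forall>A\<in>\<A>. cut x A" "\<forall>e e'. (\<forall>A\<in>\<A>. A e = A e') \<longrightarrow> (e \<in> A) = (e' \<in> A)"
      "finite \<B>" "\<forall>A\<in>\<B>. cut x A" "\<forall>e e'. (\<forall>A\<in>\<B>. A e = A e') \<longrightarrow> (e \<in> B) = (e' \<in> B)" by blast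
    show ?case
    proof (intro exI[of _ "\<A> \<union> \<B>"] conjI allI impI)
      fix e e' assume eq: "\<forall>A\<in>\<A> \<union> \<B>. A e = A e'"
      show "(e \<in> A \<inter> B) = (e' \<in> A \<inter> B)"
        using h(3)[rule_format, of e e'] h(6)[rule_format, of e e'] eq by (simp add: ball_Un)
    qed (use h in \<open>auto simp: ball_Un\<close>)
  qed
  from this[of "{e. C e}"] show ?thesis using assms by (simp add: ct.QP_def)
qed

text \<open>The form in which one-variable definability enters the rank argument: cuts in x and
  classes of x - c are the only ways in which C can detect x.\<close>

theorem dfp_structure:
  assumes "dfp C"
  shows "\<exists>\<S> \<K>. finite \<S> \<and> (\<forall>S\<in>\<S>. cut x S) \<and> finite \<K> \<and> (\<forall>(c, n)\<in>\<K>. dfx x c \<and> 0 < n) \<and>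
    (\<forall>e e'. (\<forall>S\<in>\<S>. S e = S e') \<longrightarrow> (\<forall>(c, n)\<in>\<K>. cls n (e x - c e) = cls n (e' x - c e')) \<longrightarrow> C e = C e')"
proof -
  let ?P = "\<lambda>A \<S> \<K>. finite \<S> \<and> (\<forall>S\<in>\<S>. cut x S) \<and> finite \<K> \<and> (\<forall>(c, n)\<in>\<K>. dfx x c \<and> 0 < n) \<and>
    (\<forall>e e'. (\<forall>S\<in>\<S>. S e = S e') \<longrightarrow> (\<forall>(c, n)\<in>\<K>. cls n (e x - c e) = cls n (e' x - c e')) \<longrightarrow> (e \<in> A) = (e' \<in> A))"
  have "\<exists>\<S> \<K>. ?P A \<S> \<K>" if "A \<in> St x" for A
    using that
  proof (induction rule: St.induct)
    case (St_Ct A)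
    then have "ctp x (\<lambda>e. e \<in> A)" by (simp add: ct.QP_def)
    from ctp_cuts[OF this] obtain \<S> where "finite \<S> \<and> (\<forall>S\<in>\<S>. cut x S) \<and>
      (\<forall>e e'. (\<forall>S\<in>\<S>. S e = S e') \<longrightarrow> (e \<in> A) = (e' \<in> A))" by (elim exE)
    then show ?case by (intro exI[of _ \<S>] exI[of _ "{}"]) simp
  next
    case (St_cls c n k)
    then show ?case by (intro exI[of _ "{}"] exI[of _ "{(c, n)}"]) simp
  next
    case (St_not A)
    then show ?case by simp
  next
    case (St_and A B)
    from St_and.IH obtain \<S> \<K> \<S>' \<K>' where h: "?P A \<S> \<K>" "?P B \<S>' \<K>'" by (elim exE)
    have "?P (A \<inter> B) (\<S> \<union> \<S>') (\<K> \<union> \<K>')"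
    proof (intro conjI allI impI)
      fix e e' assume eq: "\<forall>S\<in>\<S> \<union> \<S>'. S e = S e'" "\<forall>(c, n)\<in>\<K> \<union> \<K>'. cls n (e x - c e) = cls n (e' x - c e')"
      have "(e \<in> A) = (e' \<in> A)" using h(1) eq unfolding ball_Un by (elim conjE) (simp only: simp_thms)
      moreover have "(e \<in> B) = (e' \<in> B)" using h(2) eq unfolding ball_Un by (elim conjE) (simp only: simp_thms)
      ultimately show "(e \<in> A \<inter> B) = (e' \<in> A \<inter> B)" by simp
    qed (use h in \<open>simp_all add: ball_Un\<close>)
    then show ?case by (intro exI)
  qed
  from this[of "{e. C e}"] show ?thesis using dfp_stp[OF assms, of x] by (simp add: st.QP_def)
qed

section \<open>Homogeneous arrays\<close>

type_synonym pvar = "nat + nat \<times> nat \<times> nat"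
type_synonym pprd = "(pvar \<Rightarrow> rxy) \<Rightarrow> bool"

text \<open>The \<open>Inl\<close> variables hold the point and fixed parameters;
  \<open>Inr (i, l, s)\<close> is entry s of the tuple in slot l of row i, taken from column
  \<open>u i l\<close>. A predicate thus sees r columns in each row of R, chosen independently for
  every row.\<close>

definition arr :: "nat \<Rightarrow> (nat \<Rightarrow> nat \<Rightarrow> nat \<Rightarrow> rxy) \<Rightarrow> (nat \<Rightarrow> rxy) \<Rightarrow> nat set \<Rightarrow> (nat \<Rightarrow> nat \<Rightarrow> nat) \<Rightarrow> pvar \<Rightarrow> rxy" where
  "arr r b e0 R u v = (case v of Inl j \<Rightarrow> e0 j | Inr (i, l, s) \<Rightarrow> if i \<in> R \<and> l < r then b i (u i l) s else 0)"

definition win :: "nat set \<Rightarrow> nat \<Rightarrow> nat \<Rightarrow> nat \<Rightarrow> (nat \<Rightarrow> nat \<Rightarrow> nat) \<Rightarrow> bool" where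
  "win R r lo hi u \<longleftrightarrow> (\<forall>i\<in>R. \<forall>l<r. lo \<le> u i l \<and> u i l < hi)"

text \<open>Since < is compared in both directions, equalities among the columns of one row agree as
  well; columns of different rows are never compared.\<close>

definition oeq :: "nat set \<Rightarrow> nat \<Rightarrow> (nat \<Rightarrow> nat \<Rightarrow> nat) \<Rightarrow> (nat \<Rightarrow> nat \<Rightarrow> nat) \<Rightarrow> bool" where
  "oeq R r u w \<longleftrightarrow> (\<forall>i\<in>R. \<forall>l<r. \<forall>l'<r. u i l < u i l' \<longleftrightarrow> w i l < w i l')"

text \<open>A finite form of mutual indiscernibility: for a single predicate, with r slots per row
  and columns from the window [lo, hi).\<close>

definition hom where
  "hom Q r b e0 R lo hi \<longleftrightarrow> (\<forall>u w. win R r lo hi u \<longrightarrow> win R r lo hi w \<longrightarrow> oeq R r u w \<longrightarrow>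
     Q (arr r b e0 R u) = Q (arr r b e0 R w))"

lemma homD: "hom Q r b e0 R lo hi \<Longrightarrow> win R r lo hi u \<Longrightarrow> win R r lo hi w \<Longrightarrow> oeq R r u w \<Longrightarrow>
   Q (arr r b e0 R u) = Q (arr r b e0 R w)"
  unfolding hom_def by blast

lemma arr_cong:
  "(\<And>i l. i \<in> R \<Longrightarrow> l < r \<Longrightarrow> u i l = w i l) \<Longrightarrow> arr r b e0 R u = arr r b e0 R w"
  by (auto simp: arr_def fun_eq_iff split: sum.split)

lemma arr_upd: "arr r b (e0(k := a)) R u = (arr r b e0 R u)(Inl k := a)"
  by (auto simp: arr_def fun_eq_iff split: sum.split)

lemma oeq_sym: "oeq R r u w \<Longrightarrow> oeq R r w u" by (simp add: oeq_def)

text \<open>Lets a predicate in r slots read the slots p, ..., p + r - 1 of the rows in R, so that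
  two copies of it can be evaluated on one longer array.\<close>

definition zz :: "nat set \<Rightarrow> nat \<Rightarrow> nat \<Rightarrow> pvar \<Rightarrow> (pvar \<Rightarrow> rxy) \<Rightarrow> rxy" where
  "zz R p r v e = (case v of Inl j \<Rightarrow> e (Inl j) | Inr (i, l, s) \<Rightarrow> if i \<in> R \<and> l < r then e (Inr (i, p + l, s)) else 0)"

lemma zz_Pol: "zz R p r v \<in> Pol"
proof (cases v)
  case (Inl j)
  have "(\<lambda>e. e (Inl j)) \<in> Pol" by (rule Pol_var)
  then show ?thesis using Inl by (simp add: zz_def[abs_def])
next
  case (Inr w)
  obtain i l s where w: "w = (i, l, s)" by (cases w)
  have "(\<lambda>e. if i \<in> R \<and> l < r then e (Inr (i, p + l, s)) else 0) \<in> Pol"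
    by (cases "i \<in> R \<and> l < r") (auto intro: Pol.intros)
  then show ?thesis using Inr w by (simp add: zz_def[abs_def])
qed

abbreviation sub :: "nat set \<Rightarrow> nat \<Rightarrow> nat \<Rightarrow> ((pvar \<Rightarrow> rxy) \<Rightarrow> 'c) \<Rightarrow> (pvar \<Rightarrow> rxy) \<Rightarrow> 'c" where
  "sub R p r Q \<equiv> \<lambda>e. Q (\<lambda>v. zz R p r v e)"

lemma dfp_sub: "dfp Q \<Longrightarrow> dfp (sub R p r Q)"
  by (rule dfp_subst[OF _ zz_Pol])

lemma zz_arr:
  assumes "R' \<subseteq> R" "p + r \<le> r0"
  shows "(\<lambda>v. zz R' p r v (arr r0 b e0 R w)) = arr r b e0 R' (\<lambda>i l. w i (p + l))"
  using assms by (auto simp: fun_eq_iff zz_def arr_def split: sum.split)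

lemma zz_upd: "(\<lambda>v. zz R p r v (e(Inl k := t))) = (\<lambda>v. zz R p r v e)(Inl k := t)"
  by (auto simp: fun_eq_iff zz_def split: sum.split)

lemma zz_UNIV_arr: 
  assumes "p + r \<le> r0"
  shows "(\<lambda>v. zz UNIV p r v (arr r0 b e0 R w)) = arr r b e0 R (\<lambda>i l. w i (p + l))"
  using assms by (auto simp: fun_eq_iff zz_def arr_def split: sum.split)

definition app :: "nat \<Rightarrow> (nat \<Rightarrow> nat \<Rightarrow> nat) \<Rightarrow> (nat \<Rightarrow> nat \<Rightarrow> nat) \<Rightarrow> nat \<Rightarrow> nat \<Rightarrow> nat" where
  "app r u v = (\<lambda>i l. if l < r then u i l else v i (l - r))"

lemma arr_app1: "arr r b e0 R (app r u v) = arr r b e0 R u"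
  by (rule arr_cong) (simp add: app_def)

lemma arr_app2: "arr r b e0 R (\<lambda>i l. app r u v i (r + l)) = arr r b e0 R v"
  by (rule arr_cong) (simp add: app_def)

lemma win_app: "win R r lo hi u \<Longrightarrow> win R r lo hi v \<Longrightarrow> win R (2 * r) lo hi (app r u v)"
  unfolding win_def app_def by (auto simp: less_diff_conv2)

lemma win_mono: "win R r lo hi u \<Longrightarrow> R' \<subseteq> R \<Longrightarrow> lo' \<le> lo \<Longrightarrow> hi \<le> hi' \<Longrightarrow> win R' r lo' hi' u"
  unfolding win_def by (meson order_less_le_trans order_trans subsetD)

lemma hom_sub:
  assumes "hom (sub R' 0 r Q) r0 b e0 R lo hi" "R' \<subseteq> R" "r \<le> r0" "0 < r" "lo < hi"
  shows "hom Q r b e0 R' lo hi"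
  unfolding hom_def
proof (intro allI impI)
  fix u w assume h: "win R' r lo hi u" "win R' r lo hi w" "oeq R' r u w"
  let ?f = "\<lambda>(u :: nat \<Rightarrow> nat \<Rightarrow> nat) i l. if i \<in> R' then u i (if l < r then l else 0) else lo"
  have "win R r0 lo hi (?f u)" "win R r0 lo hi (?f w)"
    using h(1,2) assms(4,5) unfolding win_def by auto
  moreover have "oeq R r0 (?f u) (?f w)" using h(3) assms(4) unfolding oeq_def by auto
  ultimately have eq: "sub R' 0 r Q (arr r0 b e0 R (?f u)) = sub R' 0 r Q (arr r0 b e0 R (?f w))"
    by (rule homD[OF assms(1)])
  have "arr r b e0 R' (\<lambda>i l. ?f u i (0 + l)) = arr r b e0 R' u" for u
    by (rule arr_cong) simp
  moreover have "0 + r \<le> r0" using assms(3) by simp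
  note zz_arr[OF assms(2) this, of b e0]
  ultimately show "Q (arr r b e0 R' u) = Q (arr r b e0 R' w)" using eq by (simp only:)
qed

lemma hom_indep:
  assumes "\<And>e t. Q (e(Inl k := t)) = Q e" "hom Q r b e0 R lo hi" shows "hom Q r b (e0(k := a)) R lo hi"
  using assms(2) unfolding hom_def arr_upd assms(1) .

subsection \<open>Cuts\<close>

text \<open>Inclusion of two cuts. The variable k is bound here, so the condition concerns the array
  alone, and its homogeneity can be secured before a value for k is chosen.\<close>

definition cut_le :: "nat \<Rightarrow> nat \<Rightarrow> nat set \<Rightarrow> nat set \<Rightarrow> pprd \<Rightarrow> pprd \<Rightarrow> pprd" where
  "cut_le k r R1 R2 S S' e \<longleftrightarrow> (\<forall>t. sub R1 0 r S (e(Inl k := t)) \<longrightarrow> sub R2 r r S' (e(Inl k := t)))"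

lemma dfp_cut_le: "dfp S \<Longrightarrow> dfp S' \<Longrightarrow> dfp (cut_le k r R1 R2 S S')"
  unfolding cut_le_def[abs_def]
  by (rule dfp_all[of "\<lambda>e. sub R1 0 r S e \<longrightarrow> sub R2 r r S' e"]) (intro qs.QP_imp dfp_sub)

definition cut_le_fam :: "nat \<Rightarrow> nat \<Rightarrow> nat \<Rightarrow> pprd set \<Rightarrow> pprd set" where
  "cut_le_fam k r t \<S> = (\<lambda>(R1, R2, S, S'). cut_le k r R1 R2 S S') ` (Pow {..<t} \<times> Pow {..<t} \<times> \<S> \<times> \<S>)"

lemma cut_total:
  assumes "cut x S" "cut x S'"
  shows "{t. S (e(x := t))} \<subseteq> {t. S' (e'(x := t))} \<or> {t. S' (e'(x := t))} \<subseteq> {t. S (e(x := t))}"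
proof (rule ccontr)
  assume "\<not> ?thesis"
  then obtain s t where st: "S (e(x := s))" "\<not> S' (e'(x := s))" "S' (e'(x := t))" "\<not> S (e(x := t))" by blast
  from lc_diff_total[of s t] consider "s = t" | "0 < lc (s - t)" | "0 < lc (t - s)" by blast
  then show False
  proof cases
    case 2 then show False using assms(1) st unfolding cut_def by blast
  next
    case 3 then show False using assms(2) st unfolding cut_def by blast
  qed (use st in simp)
qed

text \<open>The rows are exchanged one after another, and the truth value must change at some
  exchange. Order types are compared row by row, so all mixed arrays have the same one.\<close>

lemma one_row_change:
  assumes "finite R" "win R r lo hi u" "win R r lo hi w" "oeq R r u w"
    and "Q (arr r b e0 R u)" "\<not> Q (arr r b e0 R w)"
  shows "\<exists>u w. \<exists>\<mu>\<in>R. win R r lo hi u \<and> win R r lo hi w \<and> oeq R r u w \<and> Q (arr r b e0 R u) \<and>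
     \<not> Q (arr r b e0 R w) \<and> (\<forall>i. i \<noteq> \<mu> \<longrightarrow> u i = w i)"
proof (rule ccontr)
  assume no: "\<not> ?thesis"
  let ?m = "\<lambda>A i. if i \<in> A then w i else u i"
  have "Q (arr r b e0 R (?m A))" if "finite A" "A \<subseteq> R" for A
    using that
  proof (induction A rule: finite_induct)
    case empty
    then show ?case using assms(5) by simp
  next
    case (insert \<mu> A)
    have w: "win R r lo hi (?m B)" for B using assms(2,3) unfolding win_def by simp
    have o: "oeq R r (?m A) (?m (insert \<mu> A))" using assms(4) unfolding oeq_def by simp
    have d: "\<forall>i. i \<noteq> \<mu> \<longrightarrow> ?m A i = ?m (insert \<mu> A) i" by simp
    have q: "Q (arr r b e0 R (?m A))" using insert by simp
    show ?case
    proof (rule ccontr)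
      assume n: "\<not> ?case"
      have "\<mu> \<in> R" using insert by simp
      then have "\<exists>\<mu>\<in>R. win R r lo hi (?m A) \<and> win R r lo hi (?m (insert \<mu> A)) \<and> oeq R r (?m A) (?m (insert \<mu> A)) \<and>
        Q (arr r b e0 R (?m A)) \<and> \<not> Q (arr r b e0 R (?m (insert \<mu> A))) \<and> (\<forall>i. i \<noteq> \<mu> \<longrightarrow> ?m A i = ?m (insert \<mu> A) i)"
        using w o d q n by (intro bexI[of _ \<mu>] conjI)
      then obtain \<mu>' where "\<mu>' \<in> R" "win R r lo hi (?m A) \<and> win R r lo hi (?m (insert \<mu>' A)) \<and> oeq R r (?m A) (?m (insert \<mu>' A)) \<and>
        Q (arr r b e0 R (?m A)) \<and> \<not> Q (arr r b e0 R (?m (insert \<mu>' A))) \<and> (\<forall>i. i \<noteq> \<mu>' \<longrightarrow> ?m A i = ?m (insert \<mu>' A) i)"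
        by (elim bexE)
      then show False using no by blast
    qed
  qed
  from this[OF assms(1) order_refl] have "Q (arr r b e0 R (?m R))" .
  moreover have "arr r b e0 R (?m R) = arr r b e0 R w" by (rule arr_cong) simp
  ultimately show False using assms(6) by simp
qed

text \<open>Suppose that the rows other than \<open>i\<close> fail to be homogeneous over \<open>a\<close>, for every \<open>i\<close>; then some cut
  over those rows does not contain \<open>a\<close>. Take \<open>m\<close> with the smallest such cut. Its failure occurs in a single
  row \<open>n\<close>, and comparison with the cut chosen for \<open>n\<close>, which does not involve row \<open>n\<close>, contradicts homogeneity.\<close>

lemma cut_step:
  assumes \<S>: "finite \<S>" "\<And>S. S \<in> \<S> \<Longrightarrow> cut (Inl k) S"
    and R: "R \<subseteq> {..<t}" "R \<noteq> {}"
    and hom: "\<And>Q. Q \<in> cut_le_fam k r t \<S> \<Longrightarrow> hom Q (2 * r) b e0 R lo hi"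
  shows "\<exists>i0\<in>R. \<forall>S\<in>\<S>. hom S r b (e0(k := a)) (R - {i0}) lo hi"
proof (rule ccontr)
  let ?arr = "arr r b (e0(k := a))"
  assume no: "\<not> ?thesis"
  have finR: "finite R" using R(1) finite_subset by blast
  define W where "W i0 S u w \<mu> \<longleftrightarrow> S \<in> \<S> \<and> \<mu> \<in> R - {i0} \<and> win (R - {i0}) r lo hi u \<and> win (R - {i0}) r lo hi w \<and>
    oeq (R - {i0}) r u w \<and> S (?arr (R - {i0}) u) \<and> \<not> S (?arr (R - {i0}) w) \<and>
    (\<forall>i. i \<noteq> \<mu> \<longrightarrow> u i = w i)" for i0 S u w \<mu>
  have "\<exists>S u w \<mu>. W i0 S u w \<mu>" if i0: "i0 \<in> R" for i0
  proof -
    from no i0 obtain S where S: "S \<in> \<S>" "\<not> hom S r b (e0(k := a)) (R - {i0}) lo hi" by blast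
    then obtain u w where uw: "win (R - {i0}) r lo hi u" "win (R - {i0}) r lo hi w" "oeq (R - {i0}) r u w"
      "S (?arr (R - {i0}) u) \<noteq> S (?arr (R - {i0}) w)"
      unfolding hom_def by blast
    have "\<exists>u w. win (R - {i0}) r lo hi u \<and> win (R - {i0}) r lo hi w \<and> oeq (R - {i0}) r u w \<and>
      S (?arr (R - {i0}) u) \<and> \<not> S (?arr (R - {i0}) w)"
      using uw oeq_sym[OF uw(3)] by (cases "S (?arr (R - {i0}) u)") (intro exI conjI; simp)+
    then obtain u w where uw: "win (R - {i0}) r lo hi u" "win (R - {i0}) r lo hi w" "oeq (R - {i0}) r u w"
      "S (?arr (R - {i0}) u)" "\<not> S (?arr (R - {i0}) w)" by (elim exE conjE)
    have "finite (R - {i0})" using finR by simp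
    from one_row_change[OF this uw] S(1) show ?thesis unfolding W_def by blast
  qed
  then obtain S u w \<mu> where W: "\<And>i. i \<in> R \<Longrightarrow> W i (S i) (u i) (w i) (\<mu> i)" by metis
  \<comment> \<open>The cut is taken at the array where the predicate fails, so a lies outside every
    \<open>L i\<close>. Cuts are linearly ordered by inclusion, hence one of them is least.\<close>
  define L where "L i = {t. S i ((arr r b e0 (R - {i}) (w i))(Inl k := t))}" for i
  have tot: "L i \<subseteq> L j \<or> L j \<subseteq> L i" if "i \<in> R" "j \<in> R" for i j
  proof -
    have "S i \<in> \<S>" "S j \<in> \<S>" using W that unfolding W_def by blast+
    then show ?thesis unfolding L_def by (intro cut_total \<S>(2))
  qed
  have "\<exists>m\<in>A. \<forall>i\<in>A. L m \<subseteq> L i" if "finite A" "A \<noteq> {}" "A \<subseteq> R" for A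
    using that
  proof (induction A rule: finite_ne_induct)
    case (singleton i)
    then show ?case by simp
  next
    case (insert i A)
    then obtain m where m: "m \<in> A" "\<forall>i\<in>A. L m \<subseteq> L i" by auto
    have mi: "m \<in> R" "i \<in> R" using m(1) insert.prems by auto
    from tot[OF mi] show ?case
    proof
      assume "L m \<subseteq> L i" then show ?thesis using m by (intro bexI[of _ m]) auto
    next
      assume "L i \<subseteq> L m" then show ?thesis using m by (intro bexI[of _ i]) auto
    qed
  qed
  from this[OF finR R(2) order_refl] obtain m where m: "m \<in> R" "\<And>i. i \<in> R \<Longrightarrow> L m \<subseteq> L i" by blast
  define n where "n = \<mu> m"
  have Wm: "W m (S m) (u m) (w m) n" using W[OF m(1)] by (simp add: n_def)
  have n: "n \<in> R" "n \<noteq> m" using Wm unfolding W_def by auto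
  have Wn: "W n (S n) (u n) (w n) (\<mu> n)" by (rule W[OF n(1)])
  have Q: "cut_le k r (R - {m}) (R - {n}) (S m) (S n) \<in> cut_le_fam k r t \<S>"
    unfolding cut_le_fam_def using R(1) Wm Wn unfolding W_def by (intro image_eqI[of _ _ "(R - {m}, R - {n}, S m, S n)"]) auto
  \<comment> \<open>In row \<open>n\<close> the second half of the slots is irrelevant and copies the first half.\<close>
  define tail where "tail v i = (if i = n then v i else if i = m then w n m else w n i)" for v :: "nat \<Rightarrow> nat \<Rightarrow> nat" and i
  define hd' where "hd' v i = (if i = m then w n m else v i)" for v :: "nat \<Rightarrow> nat \<Rightarrow> nat" and i
  let ?A = "\<lambda>v. app r (hd' v) (tail v)"
  have winA: "win R (2 * r) lo hi (?A v)" if "win (R - {m}) r lo hi v" for v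
  proof (rule win_app)
    show "win R r lo hi (hd' v)" "win R r lo hi (tail v)"
      using that Wn n m(1) unfolding W_def win_def hd'_def tail_def by auto
  qed
  have oA: "oeq R (2 * r) (?A (u m)) (?A (w m))"
    unfolding oeq_def
  proof (intro ballI allI impI)
    fix i l l' assume h: "i \<in> R" "l < 2 * r" "l' < 2 * r"
    show "?A (u m) i l < ?A (u m) i l' \<longleftrightarrow> ?A (w m) i l < ?A (w m) i l'"
    proof (cases "i = n")
      case True
      have "i \<in> R - {m}" using True n by simp
      then have "u m i l < u m i l' \<longleftrightarrow> w m i l < w m i l'" if "l < r" "l' < r" for l l'
        using Wm that unfolding W_def oeq_def by blast
      then show ?thesis using True n(2) h(2,3) by (simp add: app_def hd'_def tail_def)
    next
      case False
      then have "u m i = w m i" using Wm unfolding W_def by blast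
      then show ?thesis using False by (simp add: app_def hd'_def tail_def)
    qed
  qed
  have arrA: "(\<lambda>v'. zz (R - {m}) 0 r v' ((arr (2 * r) b e0 R (?A v))(Inl k := t))) = (arr r b e0 (R - {m}) v)(Inl k := t)"
    "(\<lambda>v'. zz (R - {n}) r r v' ((arr (2 * r) b e0 R (?A v))(Inl k := t))) = (arr r b e0 (R - {n}) (w n))(Inl k := t)" for v t
  proof -
    have "arr r b e0 (R - {m}) (\<lambda>i l. ?A v i (0 + l)) = arr r b e0 (R - {m}) v"
      by (rule arr_cong) (simp add: app_def hd'_def)
    then show "(\<lambda>v'. zz (R - {m}) 0 r v' ((arr (2 * r) b e0 R (?A v))(Inl k := t))) = (arr r b e0 (R - {m}) v)(Inl k := t)"
      unfolding zz_upd by (subst zz_arr) auto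
    have "arr r b e0 (R - {n}) (\<lambda>i l. ?A v i (r + l)) = arr r b e0 (R - {n}) (w n)"
      by (rule arr_cong) (simp add: app_def tail_def)
    then show "(\<lambda>v'. zz (R - {n}) r r v' ((arr (2 * r) b e0 R (?A v))(Inl k := t))) = (arr r b e0 (R - {n}) (w n))(Inl k := t)"
      unfolding zz_upd by (subst zz_arr) auto
  qed
  have le_iff: "cut_le k r (R - {m}) (R - {n}) (S m) (S n) (arr (2 * r) b e0 R (?A v)) \<longleftrightarrow>
     (\<forall>t. S m ((arr r b e0 (R - {m}) v)(Inl k := t)) \<longrightarrow> t \<in> L n)" for v
    unfolding cut_le_def arrA L_def by simp
  have "win (R - {m}) r lo hi (u m)" "win (R - {m}) r lo hi (w m)" using Wm unfolding W_def by blast+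
  from homD[OF hom[OF Q] winA[OF this(1)] winA[OF this(2)] oA]
  have iff: "(\<forall>t. S m ((arr r b e0 (R - {m}) (u m))(Inl k := t)) \<longrightarrow> t \<in> L n) \<longleftrightarrow>
    (\<forall>t. S m ((arr r b e0 (R - {m}) (w m))(Inl k := t)) \<longrightarrow> t \<in> L n)" unfolding le_iff .
  \<comment> \<open>The inclusion holds at \<open>w m\<close>. Homogeneity transports it to
    \<open>u m\<close>, since \<open>L n\<close> does not involve row n, the only row that changes.
    There it would put a into \<open>L n\<close>.\<close>
  have "L m \<subseteq> L n" by (rule m(2)[OF n(1)])
  then have "\<forall>t. S m ((arr r b e0 (R - {m}) (w m))(Inl k := t)) \<longrightarrow> t \<in> L n" unfolding L_def by blast
  then have "S m ((arr r b e0 (R - {m}) (u m))(Inl k := a)) \<longrightarrow> a \<in> L n" unfolding iff[symmetric] by blast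
  moreover have "S m ((arr r b e0 (R - {m}) (u m))(Inl k := a))" using Wm unfolding W_def arr_upd by blast
  moreover have "a \<notin> L n" using Wn unfolding W_def arr_upd L_def by blast
  ultimately show False by blast
qed

subsection \<open>Classes\<close>

lemma not_vle_ssim: assumes "\<not> vle f g" shows "ssim (f + g) g"
proof (cases "f = 0")
  case False
  then have h: "g \<noteq> 0" "vv g < vv f" using assms by (auto simp: vle_def)
  then show ?thesis using add_less[of g f] False by (simp add: ssim_def add.commute)
qed (simp add: ssim_def)

lemma vle_uminus: "vle f (- g) = vle f g" by (simp add: vle_def)

lemma dfx_sub: "dfx (Inl k) c \<Longrightarrow> dfx (Inl k) (sub R p r c)"
  using dfp_sub[of "\<lambda>e. e (Inl k) = c e" R p r] by (simp add: dfx_def zz_upd) (simp add: zz_def)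

lemma oeq_app:
  assumes "oeq R r u w" "oeq R r v v'"
    and "(\<forall>i\<in>R. \<forall>l<r. \<forall>l'<r. u i l < v i l' \<and> w i l < v' i l') \<or>
         (\<forall>i\<in>R. \<forall>l<r. \<forall>l'<r. v i l < u i l' \<and> v' i l < w i l')"
  shows "oeq R (2 * r) (app r u v) (app r w v')"
  unfolding oeq_def
proof (intro ballI allI impI)
  fix i l l' assume h: "i \<in> R" "l < 2 * r" "l' < 2 * r"
  have eq: "\<And>l l'. l < r \<Longrightarrow> l' < r \<Longrightarrow> u i l < u i l' \<longleftrightarrow> w i l < w i l'"
    "\<And>l l'. l < r \<Longrightarrow> l' < r \<Longrightarrow> v i l < v i l' \<longleftrightarrow> v' i l < v' i l'"
    using assms(1,2) h(1) unfolding oeq_def by simp_all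
  have r: "\<not> l < r \<Longrightarrow> l - r < r" "\<not> l' < r \<Longrightarrow> l' - r < r" using h by auto
  from assms(3) show "app r u v i l < app r u v i l' \<longleftrightarrow> app r w v' i l < app r w v' i l'"
  proof
    assume "\<forall>i\<in>R. \<forall>l<r. \<forall>l'<r. u i l < v i l' \<and> w i l < v' i l'"
    then have "\<And>l l'. l < r \<Longrightarrow> l' < r \<Longrightarrow> u i l < v i l' \<and> w i l < v' i l'" using h(1) by blast
    then have s: "\<And>l l'. l < r \<Longrightarrow> l' < r \<Longrightarrow> u i l < v i l'" "\<And>l l'. l < r \<Longrightarrow> l' < r \<Longrightarrow> w i l < v' i l'" by blast+
    show ?thesis using eq r s(1)[of l "l' - r"] s(2)[of l "l' - r"] s(1)[of l' "l - r"] s(2)[of l' "l - r"]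
      by (auto simp: app_def)
  next
    assume "\<forall>i\<in>R. \<forall>l<r. \<forall>l'<r. v i l < u i l' \<and> v' i l < w i l'"
    then have "\<And>l l'. l < r \<Longrightarrow> l' < r \<Longrightarrow> v i l < u i l' \<and> v' i l < w i l'" using h(1) by blast
    then have s: "\<And>l l'. l < r \<Longrightarrow> l' < r \<Longrightarrow> v i l < u i l'" "\<And>l l'. l < r \<Longrightarrow> l' < r \<Longrightarrow> v' i l < w i l'" by blast+
    show ?thesis using eq r s(1)[of "l - r" l'] s(2)[of "l - r" l'] s(1)[of "l' - r" l] s(2)[of "l' - r" l]
      by (auto simp: app_def)
  qed
qed

text \<open>Serves to copy the order type of a row onto r consecutive columns.\<close>

definition rank :: "nat \<Rightarrow> (nat \<Rightarrow> nat \<Rightarrow> nat) \<Rightarrow> nat \<Rightarrow> nat \<Rightarrow> nat" where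
  "rank r u i l = card {l'. l' < r \<and> u i l' < u i l}"

lemma rank_less: "l < r \<Longrightarrow> rank r u i l < r"
proof -
  assume l: "l < r"
  have "{l'. l' < r \<and> u i l' < u i l} \<subset> {..<r}" using l by auto
  then have "card {l'. l' < r \<and> u i l' < u i l} < card {..<r}" by (rule psubset_card_mono[rotated]) simp
  then show ?thesis by (simp add: rank_def)
qed

lemma rank_iff: assumes "l < r" "l' < r" shows "rank r u i l < rank r u i l' \<longleftrightarrow> u i l < u i l'"
proof (cases "u i l < u i l'")
  case True
  have "l \<in> {m. m < r \<and> u i m < u i l'}" using True assms by simp
  moreover have "{m. m < r \<and> u i m < u i l} \<subseteq> {m. m < r \<and> u i m < u i l'}" using True by auto
  ultimately have "{m. m < r \<and> u i m < u i l} \<subset> {m. m < r \<and> u i m < u i l'}" by blast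
  then have "rank r u i l < rank r u i l'" unfolding rank_def by (rule psubset_card_mono[rotated]) simp
  then show ?thesis using True by simp
next
  case False
  then have "{m. m < r \<and> u i m < u i l'} \<subseteq> {m. m < r \<and> u i m < u i l}" by auto
  then have "rank r u i l' \<le> rank r u i l" unfolding rank_def by (rule card_mono[rotated]) simp
  then show ?thesis using False by simp
qed

text \<open>The two halves of the slots give two values of c. The first predicate says that variable
  k is closer to the second value than the two values are to each other, the second says the same
  for the first value, and the others record the side of the first value. All of them are Boolean
  combinations of cuts.\<close>

definition cls_preds :: "nat \<Rightarrow> nat \<Rightarrow> ((pvar \<Rightarrow> rxy) \<Rightarrow> rxy) \<Rightarrow> pprd set" where
  "cls_preds k r c =
    {\<lambda>e. \<not> vle (1 * (e (Inl k) - sub UNIV r r c e) ^ 1) (sub UNIV r r c e - sub UNIV 0 r c e),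
     \<lambda>e. \<not> vle (1 * (e (Inl k) - sub UNIV 0 r c e) ^ 1) (sub UNIV r r c e - sub UNIV 0 r c e),
     \<lambda>e. 0 < lc (e (Inl k) - sub UNIV 0 r c e),
     \<lambda>e. 0 < lc (sub UNIV 0 r c e - e (Inl k))}"

lemma ctp_cls_preds: assumes "dfx (Inl k) c" "P \<in> cls_preds k r c" shows "ctp (Inl k) P"
proof -
  have 1: "dfx (Inl k) (\<lambda>_. 1)" by (rule dfx_Pol) (simp_all add: pol.P_const)
  note d = dfx_sub[OF assms(1)]
  show ?thesis
    using assms(2) ct.QP_not[OF ctp_vle[OF 1 dfx_diff[OF d d] d]] ctp_less[OF d]
    unfolding cls_preds_def by blast
qed

text \<open>\<open>c\<close> is compared at \<open>u\<close> and \<open>w\<close> with its values at tuples \<open>y\<close> and \<open>z\<close> of the same order type that lie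
  entirely to the left and to the right of both.\<close>

lemma cls_step:
  assumes c: "dfx (Inl k) c" "0 < n"
    and P: "\<And>P. P \<in> cls_preds k r c \<Longrightarrow> hom P (2 * r) b (e0(k := a)) R lo hi"
    and K: "\<And>\<kappa>. \<kappa> \<in> cls_range n \<Longrightarrow> hom (\<lambda>e. cls n (sub UNIV r r c e - sub UNIV 0 r c e) = \<kappa>) (2 * r) b (e0(k := a)) R lo hi"
    and uw: "win R r (lo + r) (hi - r) u" "win R r (lo + r) (hi - r) w" "oeq R r u w"
  shows "cls n (a - c (arr r b (e0(k := a)) R u)) = cls n (a - c (arr r b (e0(k := a)) R w))"
proof (cases "R = {} \<or> r = 0")
  case True
  then have "arr r b (e0(k := a)) R u = arr r b (e0(k := a)) R w" by (intro arr_cong) auto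
  then show ?thesis by simp
next
  case False
  then obtain i0 where i0: "i0 \<in> R" "0 < r" by blast
  have wide: "lo + r < hi - r" using uw(1) i0 unfolding win_def by (meson le_less_trans)
  define C where "C u = c (arr r b (e0(k := a)) R u)" for u
  define A where "A u v = arr (2 * r) b (e0(k := a)) R (app r u v)" for u v
  have A0: "sub UNIV 0 r c (A u v) = C u" for u v
    unfolding A_def by (subst zz_UNIV_arr) (use arr_app1 in \<open>simp_all add: C_def\<close>)
  have A1: "sub UNIV r r c (A u v) = C v" for u v
    unfolding A_def by (subst zz_UNIV_arr) (use arr_app2 in \<open>simp_all add: C_def\<close>)
  have Ak: "A u v (Inl k) = a" for u v by (simp add: A_def arr_def)
  have good: "P (A v v') = P (A w w')"
    if "hom P (2 * r) b (e0(k := a)) R lo hi" "win R r lo hi v" "win R r lo hi v'" "win R r lo hi w" "win R r lo hi w'"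
      "oeq R (2 * r) (app r v v') (app r w w')" for P v v' w w'
    unfolding A_def by (rule homD[OF that(1) win_app win_app that(6)]) (use that in auto)
  \<comment> \<open>y occupies the first r columns of the window and z the last r, which is why u
    and w keep a margin of r columns on both sides.\<close>
  define y where "y i l = lo + rank r u i l" for i l
  define z where "z i l = (hi - r) + rank r u i l" for i l
  have rl: "rank r u i l < r" if "l < r" for i l by (rule rank_less[OF that])
  have y: "win R r lo hi y" and z: "win R r lo hi z"
    unfolding win_def y_def z_def using wide rl by (auto intro: order_less_trans[OF add_strict_left_mono[OF rl]] simp: less_diff_conv2)
  have y2: "oeq R r y u" and z2: "oeq R r z u"
    unfolding oeq_def y_def z_def by (simp_all add: rank_iff)
  note y = y y2 and z = z z2
  have u': "win R r lo hi u" and w': "win R r lo hi w"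
    using win_mono[OF uw(1) order_refl] win_mono[OF uw(2) order_refl] by auto
  have yw: "oeq R r y w" and zw: "oeq R r z w" and yz: "oeq R r y z"
    using y(2) z(2) uw(3) unfolding oeq_def by simp_all
  have oy: "oeq R r y y" "oeq R r z z" by (simp_all add: oeq_def)
  have less: "\<forall>i\<in>R. \<forall>l<r. \<forall>l'<r. y i l < v i l'" "\<forall>i\<in>R. \<forall>l<r. \<forall>l'<r. v i l < z i l'"
    if "win R r (lo + r) (hi - r) v" for v
  proof (intro ballI allI impI)
    fix i l l' assume h: "i \<in> R" "l < r" "l' < r"
    have "lo + r \<le> v i l'" using that h unfolding win_def by blast
    then show "y i l < v i l'" using rank_less[OF h(2), of u i] by (simp add: y_def)
  next
    show "\<forall>i\<in>R. \<forall>l<r. \<forall>l'<r. v i l < z i l'"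
    proof (intro ballI allI impI)
      fix i l l' assume h: "i \<in> R" "l < r" "l' < r"
      have "v i l < hi - r" using that h unfolding win_def by blast
      then show "v i l < z i l'" by (simp add: z_def)
    qed
  qed
  have yz': "\<forall>i\<in>R. \<forall>l<r. \<forall>l'<r. y i l < z i l'"
  proof (intro ballI allI impI)
    fix i l l' assume "l < r"
    then show "y i l < z i l'" using wide rl[of l i] unfolding y_def z_def by linarith
  qed
  have o1: "oeq R (2 * r) (app r u y) (app r w y)"
    by (rule oeq_app[OF uw(3) oy(1)], rule disjI2) (use less(1)[OF uw(1)] less(1)[OF uw(2)] in simp)
  have o2: "oeq R (2 * r) (app r u y) (app r z y)"
    by (rule oeq_app[OF oeq_sym[OF z(2)] oy(1)], rule disjI2) (use less(1)[OF uw(1)] yz' in simp)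
  have o3: "oeq R (2 * r) (app r u z) (app r w z)"
    by (rule oeq_app[OF uw(3) oy(2)], rule disjI1) (use less(2)[OF uw(1)] less(2)[OF uw(2)] in simp)
  have o4: "oeq R (2 * r) (app r u z) (app r y z)"
    by (rule oeq_app[OF oeq_sym[OF y(2)] oy(2)], rule disjI1) (use less(2)[OF uw(1)] yz' in simp)
  note g1 = good[OF _ u' y(1) w' y(1) o1] and g2 = good[OF _ u' y(1) z(1) y(1) o2]
    and g3 = good[OF _ u' z(1) w' z(1) o3] and g4 = good[OF _ u' z(1) y(1) z(1) o4]
  let ?P1 = "\<lambda>u v. \<not> vle (a - C v) (C v - C u)" and ?P2 = "\<lambda>u v. \<not> vle (a - C u) (C v - C u)"
  have P: "\<And>P. P \<in> cls_preds k r c \<Longrightarrow> hom P (2 * r) b (e0(k := a)) R lo hi" by (rule P)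
  note hP = P[unfolded cls_preds_def, OF insertI1] P[unfolded cls_preds_def, OF insertI2[OF insertI1]]
    P[unfolded cls_preds_def, OF insertI2[OF insertI2[OF insertI1]]]
    P[unfolded cls_preds_def, OF insertI2[OF insertI2[OF insertI2[OF insertI1]]]]
  have p1: "?P1 u y = ?P1 w y" "?P1 u z = ?P1 w z" "?P1 u z = ?P1 y z"
    using g1[OF hP(1)] g3[OF hP(1)] g4[OF hP(1)] by (simp_all only: A0 A1 Ak mult_1 power_one_right)
  have p2: "?P2 u y = ?P2 w y" "?P2 u y = ?P2 z y"
    using g1[OF hP(2)] g2[OF hP(2)] by (simp_all only: A0 A1 Ak mult_1 power_one_right)
  have sgn: "0 < lc (a - C u) \<longleftrightarrow> 0 < lc (a - C w)" "0 < lc (C u - a) \<longleftrightarrow> 0 < lc (C w - a)"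
    using g1[OF hP(3)] g1[OF hP(4)] by (simp_all only: A0 A1 Ak)
  have ky: "cls n (C y - C u) = cls n (C y - C w)"
    using g1[OF K[OF cls_in_range[OF c(2)]], of "C y - C u"] by (simp only: A0 A1) simp
  have kz: "cls n (C z - C u) = cls n (C z - C w)"
    using g3[OF K[OF cls_in_range[OF c(2)]], of "C z - C u"] by (simp only: A0 A1) simp
  \<comment> \<open>If a is closer to \<open>C v'\<close> than \<open>C v\<close> is, then
    \<open>a - C v\<close> has the class of \<open>C v' - C v\<close>, in which a does not
    occur.\<close>
  have near: "cls n (a - C v) = cls n (C v' - C v)" if "?P1 v v'" for v v'
    using cls_ssim[OF not_vle_ssim[OF that], of n] by simp
  show ?thesis unfolding C_def[symmetric]
  proof (cases "?P1 u y")
    case True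
    then show "cls n (a - C u) = cls n (a - C w)" using near[OF True] near[OF iffD1[OF p1(1) True]] ky by (simp only:)
  next
    case n1: False
    show "cls n (a - C u) = cls n (a - C w)"
    proof (cases "?P2 u y")
      case True
      \<comment> \<open>The pairs (u, y) and (z, y) have the same order type, and so do (y, z) and
        (u, z). Thus closeness of a to \<open>C u\<close> passes to \<open>C z\<close>, and z can
        take over the role of y.\<close>
      have "?P2 z y" by (rule iffD1[OF p2(2) True])
      then have yz1: "?P1 y z" using vle_uminus[of "a - C z" "C y - C z"] by (simp only: minus_diff_eq simp_thms)
      have uz1: "?P1 u z" by (rule iffD2[OF p1(3) yz1])
      show ?thesis using near[OF uz1] near[OF iffD1[OF p1(2) uz1]] kz by (simp only:)
    next
      case n2: False
      show ?thesis
      proof (cases "C y = C u")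
        case True
        then have "cls n (C y - C w) = (0, 0, 0)" using ky by simp
        then have "C y = C w" by (simp add: cls_def sgn_zero_iff)
        then show ?thesis using True by simp
      next
        case False
        \<comment> \<open>If a is close to neither value, the ultrametric inequality gives
          \<open>a - C v\<close> and \<open>a - C y\<close> the same valuation. Applied to u and to
          w this settles the class up to the sign.\<close>
        have vv: "a - C v \<noteq> 0 \<and> vv (a - C v) = vv (a - C y)" if "\<not> ?P1 v y" "\<not> ?P2 v y" "C y \<noteq> C v" for v
        proof -
          have h: "a - C y \<noteq> 0" "a - C v \<noteq> 0" "C y - C v \<noteq> 0" "vv (a - C y) \<le> vv (C y - C v)" "vv (a - C v) \<le> vv (C y - C v)"
            using that by (auto simp: vle_def)
          have "vv (a - C y) \<le> vv (a - C v)"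
            using vv_add_ge[of "a - C y" "a - C y" "C y - C v"] h by simp
          moreover have "vv (a - C v) \<le> vv (a - C y)"
            using vv_add_ge[of "a - C v" "a - C v" "- (C y - C v)"] h vv_uminus[of "C y - C v"] by (simp del: minus_diff_eq)
          ultimately show ?thesis using h by simp
        qed
        have cw: "C y \<noteq> C w"
        proof
          assume "C y = C w"
          then have "cls n (C y - C u) = (0, 0, 0)" using ky by simp
          then show False using False by (simp add: cls_def sgn_zero_iff)
        qed
        have n1w: "\<not> ?P1 w y" by (rule contrapos_nn[OF n1]) (rule iffD2[OF p1(1)])
        have n2w: "\<not> ?P2 w y" by (rule contrapos_nn[OF n2]) (rule iffD2[OF p2(1)])
        have "vv (a - C u) = vv (a - C w)" "a - C u \<noteq> 0" "a - C w \<noteq> 0"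
          using vv[OF n1 n2 False] vv[OF n1w n2w cw] by simp_all
        moreover have "sgn (lc (a - C u)) = sgn (lc (a - C w))"
        proof -
          have "0 < lc (C v - a) \<longleftrightarrow> lc (a - C v) < 0" for v
            using lc_uminus[of "a - C v"] by (simp only: minus_diff_eq) simp
          then have "lc (a - C u) < 0 \<longleftrightarrow> lc (a - C w) < 0" using sgn(2) by (simp only:)
          moreover have "sgn p = sgn q" if "0 < p \<longleftrightarrow> 0 < q" "p < 0 \<longleftrightarrow> q < 0" for p q :: real
            using that by (auto simp: sgn_if)
          ultimately show ?thesis using sgn(1) by blast
        qed
        ultimately show ?thesis by (simp add: cls_def vv_def)
      qed
    qed
  qed
qed

subsection \<open>Adding one coordinate costs at most one row\<close>

lemma cut_sub: "cut (Inl k) S \<Longrightarrow> cut (Inl k) (sub R p r S)"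
  unfolding cut_def zz_upd by (auto intro: dfp_sub)

definition cls_rel :: "nat \<Rightarrow> ((pvar \<Rightarrow> rxy) \<Rightarrow> rxy) \<Rightarrow> nat \<Rightarrow> real \<times> int \<times> int \<Rightarrow> pprd" where
  "cls_rel r c n \<kappa> = (\<lambda>e. cls n (sub UNIV r r c e - sub UNIV 0 r c e) = \<kappa>)"

text \<open>The number of slots doubles twice: classes require c at two tuples, and the cuts behind
  this comparison are in turn compared in pairs. The margin r on both sides is consumed by
  \<open>cls_step\<close>.\<close>

theorem add_coordinate:
  fixes \<Delta> :: "pprd set"
  assumes \<Delta>: "finite \<Delta>" "\<forall>Q\<in>\<Delta>. dfp Q" and r: "0 < r"
  shows "\<exists>\<Delta>'. finite \<Delta>' \<and> (\<forall>Q\<in>\<Delta>'. dfp Q) \<and>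
    (\<forall>b e0 R lo hi a. R \<subseteq> {..<t} \<longrightarrow> R \<noteq> {} \<longrightarrow> (\<forall>Q\<in>\<Delta>'. hom Q (4 * r) b e0 R lo hi) \<longrightarrow>
      (\<exists>i0\<in>R. \<forall>Q\<in>\<Delta>. hom Q r b (e0(k := a)) (R - {i0}) (lo + r) (hi - r)))"
proof -
  let ?x = "Inl k :: pvar"
  let ?st = "\<lambda>\<S> \<K> Q. finite \<S> \<and> (\<forall>S\<in>\<S>. cut ?x S) \<and> finite \<K> \<and> (\<forall>(c, n)\<in>\<K>. dfx ?x c \<and> 0 < n) \<and>
    (\<forall>e e'. (\<forall>S\<in>\<S>. S e = S e') \<longrightarrow> (\<forall>(c, n)\<in>\<K>. cls n (e ?x - c e) = cls n (e' ?x - c e')) \<longrightarrow> Q e = Q e')"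
  have "\<forall>Q\<in>\<Delta>. \<exists>\<S> \<K>. ?st \<S> \<K> Q" by (intro ballI dfp_structure bspec[OF \<Delta>(2)])
  from bchoice[OF this] obtain \<S> where "\<forall>Q\<in>\<Delta>. \<exists>\<K>. ?st (\<S> Q) \<K> Q" by (elim exE)
  from bchoice[OF this] obtain \<K> where st0: "\<forall>Q\<in>\<Delta>. ?st (\<S> Q) (\<K> Q) Q" by (elim exE)
  define \<S>0 where "\<S>0 = (\<Union>Q\<in>\<Delta>. \<S> Q)"
  define \<K>0 where "\<K>0 = (\<Union>Q\<in>\<Delta>. \<K> Q)"
  have fin0: "finite \<S>0" "finite \<K>0" using st0 \<Delta>(1) by (auto simp: \<S>0_def \<K>0_def)
  have \<S>0: "cut ?x S" if "S \<in> \<S>0" for S using that st0 by (auto simp: \<S>0_def)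
  have \<K>0: "dfx ?x c" "0 < n" if "(c, n) \<in> \<K>0" for c n using that st0 by (auto simp: \<K>0_def)
  have stQ: "Q e = Q e'" if "Q \<in> \<Delta>" "\<And>S. S \<in> \<S>0 \<Longrightarrow> S e = S e'"
    "\<And>c n. (c, n) \<in> \<K>0 \<Longrightarrow> cls n (e ?x - c e) = cls n (e' ?x - c e')" for Q e e'
  proof -
    have "\<forall>S\<in>\<S> Q. S e = S e'" using that(1,2) by (auto simp: \<S>0_def)
    moreover have "\<forall>(c, n)\<in>\<K> Q. cls n (e ?x - c e) = cls n (e' ?x - c e')" using that(1,3) by (auto simp: \<K>0_def)
    ultimately show ?thesis using st0 that(1) by blast
  qed
  define PP where "PP = (\<Union>(c, n)\<in>\<K>0. cls_preds k r c)"
  have finPP: "finite PP" unfolding PP_def using fin0(2) by (auto simp: cls_preds_def)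
  have "\<forall>P\<in>PP. \<exists>\<S>. finite \<S> \<and> (\<forall>S\<in>\<S>. cut ?x S) \<and> (\<forall>e e'. (\<forall>S\<in>\<S>. S e = S e') \<longrightarrow> P e = P e')"
  proof
    fix P assume "P \<in> PP"
    then obtain c n where "(c, n) \<in> \<K>0" "P \<in> cls_preds k r c" by (auto simp: PP_def)
    then show "\<exists>\<S>. finite \<S> \<and> (\<forall>S\<in>\<S>. cut ?x S) \<and> (\<forall>e e'. (\<forall>S\<in>\<S>. S e = S e') \<longrightarrow> P e = P e')"
      by (intro ctp_cuts ctp_cls_preds \<K>0)
  qed
  then obtain \<T> where \<T>: "\<forall>P\<in>PP. finite (\<T> P) \<and> (\<forall>S\<in>\<T> P. cut ?x S) \<and> (\<forall>e e'. (\<forall>S\<in>\<T> P. S e = S e') \<longrightarrow> P e = P e')"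
    by (elim bchoice[THEN exE])
  \<comment> \<open>All cuts that matter: those of the predicates themselves, read on any set of
    rows, and those behind \<open>cls_preds\<close>. A single application of \<open>cut_step\<close>
    drops one row for all of them.\<close>
  define \<S>1 where "\<S>1 = (\<lambda>(R, S). sub R 0 r S) ` (Pow {..<t} \<times> \<S>0) \<union> (\<Union>P\<in>PP. \<T> P)"
  have fin1: "finite \<S>1" using fin0 finPP \<T> by (auto simp: \<S>1_def)
  have \<S>1: "cut ?x S" if "S \<in> \<S>1" for S using that \<T> \<S>0 by (auto simp: \<S>1_def intro: cut_sub)
  \<comment> \<open>The class of a difference of two values of c does not involve the new
    coordinate, so its homogeneity can be demanded beforehand.\<close>
  define KK where "KK = (\<Union>(c, n)\<in>\<K>0. (\<lambda>(R, \<kappa>). sub R 0 (2 * r) (cls_rel r c n \<kappa>)) ` (Pow {..<t} \<times> cls_range n))"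
  have finKK: "finite KK" using fin0(2) unfolding KK_def by (intro finite_UN_I) auto
  have dfp_rel: "dfp (cls_rel r c n \<kappa>)" if "(c, n) \<in> \<K>0" for c n \<kappa>
    unfolding cls_rel_def by (intro dfp_cls_diff[of ?x] dfx_sub \<K>0[OF that])
  have rel_upd: "cls_rel r c n \<kappa> (e(?x := t)) = cls_rel r c n \<kappa> e" if "(c, n) \<in> \<K>0" for c n \<kappa> e t
    unfolding cls_rel_def zz_upd using dfx_upd[OF \<K>0(1)[OF that]] by simp
  show ?thesis
  proof (intro exI[of _ "cut_le_fam k (2 * r) t \<S>1 \<union> KK"] conjI allI impI)
    show "finite (cut_le_fam k (2 * r) t \<S>1 \<union> KK)" using fin1 finKK by (simp add: cut_le_fam_def)
    have "dfp Q" if "Q \<in> KK" for Q using that unfolding KK_def by (auto intro: dfp_sub dfp_rel)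
    moreover have "dfp Q" if "Q \<in> cut_le_fam k (2 * r) t \<S>1" for Q
      using that \<S>1 unfolding cut_le_fam_def cut_def by (auto intro!: dfp_cut_le)
    ultimately show "\<forall>Q\<in>cut_le_fam k (2 * r) t \<S>1 \<union> KK. dfp Q" by blast
  next
    fix b e0 R lo hi a
    assume R: "R \<subseteq> {..<t}" "R \<noteq> {}" and hom: "\<forall>Q\<in>cut_le_fam k (2 * r) t \<S>1 \<union> KK. hom Q (4 * r) b e0 R lo hi"
    have "\<exists>i0\<in>R. \<forall>S\<in>\<S>1. hom S (2 * r) b (e0(k := a)) (R - {i0}) lo hi"
    proof (rule cut_step[OF fin1 \<S>1 R])
      fix Q assume "Q \<in> cut_le_fam k (2 * r) t \<S>1"
      then show "hom Q (2 * (2 * r)) b e0 R lo hi" using hom by simp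
    qed
    then obtain i0 where i0: "i0 \<in> R" "\<And>S. S \<in> \<S>1 \<Longrightarrow> hom S (2 * r) b (e0(k := a)) (R - {i0}) lo hi" by blast
    let ?R = "R - {i0}" and ?e = "e0(k := a)"
    have "hom Q r b ?e ?R (lo + r) (hi - r)" if Q: "Q \<in> \<Delta>" for Q
      unfolding hom_def
    proof (intro allI impI)
      fix u w assume uw: "win ?R r (lo + r) (hi - r) u" "win ?R r (lo + r) (hi - r) w" "oeq ?R r u w"
      show "Q (arr r b ?e ?R u) = Q (arr r b ?e ?R w)"
      proof (cases "?R = {}")
        case True
        then have "arr r b ?e ?R u = arr r b ?e ?R w" by (intro arr_cong) auto
        then show ?thesis by (simp only:)
      next
        case False
        then obtain i1 where "i1 \<in> ?R" by blast
        then have lohi: "lo < hi" using uw(1) r unfolding win_def by fastforce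
        have RP: "?R \<in> Pow {..<t}" using R(1) by blast
        have uw': "win ?R r lo hi u" "win ?R r lo hi w"
          using win_mono[OF uw(1) order_refl] win_mono[OF uw(2) order_refl] by auto
        show ?thesis
        proof (rule stQ[OF Q])
          fix S assume S: "S \<in> \<S>0"
          have "sub ?R 0 r S \<in> \<S>1" unfolding \<S>1_def using S RP by (intro UnI1 image_eqI[of _ _ "(?R, S)"]) auto
          have "r \<le> 2 * r" by simp
          from hom_sub[OF i0(2)[OF \<open>sub ?R 0 r S \<in> \<S>1\<close>] order_refl this r lohi] have "hom S r b ?e ?R lo hi" .
          from homD[OF this uw' uw(3)] show "S (arr r b ?e ?R u) = S (arr r b ?e ?R w)" .
        next
          fix c n assume cn: "(c, n) \<in> \<K>0"
          have "cls n (a - c (arr r b ?e ?R u)) = cls n (a - c (arr r b ?e ?R w))"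
          proof (rule cls_step[OF \<K>0[OF cn] _ _ uw])
            fix P assume "P \<in> cls_preds k r c"
            then have P: "P \<in> PP" using cn by (auto simp: PP_def)
            show "hom P (2 * r) b ?e ?R lo hi"
              unfolding hom_def
            proof (intro allI impI)
              fix v v' assume v: "win ?R (2 * r) lo hi v" "win ?R (2 * r) lo hi v'" "oeq ?R (2 * r) v v'"
              have "\<forall>S\<in>\<T> P. S (arr (2 * r) b ?e ?R v) = S (arr (2 * r) b ?e ?R v')"
              proof
                fix S assume "S \<in> \<T> P"
                then have "S \<in> \<S>1" using P by (auto simp: \<S>1_def)
                from homD[OF i0(2)[OF this] v] show "S (arr (2 * r) b ?e ?R v) = S (arr (2 * r) b ?e ?R v')" .
              qed
              then show "P (arr (2 * r) b ?e ?R v) = P (arr (2 * r) b ?e ?R v')" using \<T> P by blast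
            qed
          next
            fix \<kappa> assume "\<kappa> \<in> cls_range n"
            then have "sub ?R 0 (2 * r) (cls_rel r c n \<kappa>) \<in> KK" unfolding KK_def using cn RP
              by (intro UN_I[of "(c, n)"]) (auto intro!: image_eqI[of _ _ "(?R, \<kappa>)"])
            then have "hom (sub ?R 0 (2 * r) (cls_rel r c n \<kappa>)) (4 * r) b e0 R lo hi" using hom by blast
            from hom_sub[OF this _ _ _ lohi] have "hom (cls_rel r c n \<kappa>) (2 * r) b e0 ?R lo hi" using r by auto
            from hom_indep[OF rel_upd[OF cn] this]
            show "hom (\<lambda>e. cls n (sub UNIV r r c e - sub UNIV 0 r c e) = \<kappa>) (2 * r) b ?e ?R lo hi"
              unfolding cls_rel_def .
          qed
          then show "cls n (arr r b ?e ?R u ?x - c (arr r b ?e ?R u)) = cls n (arr r b ?e ?R w ?x - c (arr r b ?e ?R w))"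
            by (simp add: arr_def)
        qed
      qed
    qed
    then show "\<exists>i0\<in>R. \<forall>Q\<in>\<Delta>. hom Q r b ?e (R - {i0}) (lo + r) (hi - r)" using i0(1) by blast
  qed
qed

text \<open>The predicates, slots and margins needed before a coordinate is added are computed from
  those needed afterwards. They depend only on \<Delta>, t and m, so that Ramsey's theorem can be
  applied once, before any point is chosen.\<close>

theorem add_coordinates:
  fixes \<Delta> :: "pprd set"
  assumes "finite \<Delta>" "\<forall>Q\<in>\<Delta>. dfp Q"
  shows "\<exists>\<Delta>' r d. finite \<Delta>' \<and> (\<forall>Q\<in>\<Delta>'. dfp Q) \<and> 0 < r \<and>
    (\<forall>b e0 R lo hi x. R \<subseteq> {..<t} \<longrightarrow> m < card R \<longrightarrow> (\<forall>Q\<in>\<Delta>'. hom Q r b e0 R lo hi) \<longrightarrow>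
      (\<exists>R'\<subseteq>R. R' \<noteq> {} \<and> (\<forall>Q\<in>\<Delta>. hom Q 1 b (\<lambda>j. if j < m then x j else e0 j) R' (lo + d) (hi - d))))"
proof (induction m)
  case 0
  show ?case
  proof (rule exI[of _ \<Delta>], rule exI[of _ 1], rule exI[of _ 0], intro conjI allI impI)
    fix b e0 R lo hi and x :: "nat \<Rightarrow> rxy"
    assume "0 < card R" "\<forall>Q\<in>\<Delta>. hom Q 1 b e0 R lo hi"
    then show "\<exists>R'\<subseteq>R. R' \<noteq> {} \<and> (\<forall>Q\<in>\<Delta>. hom Q 1 b (\<lambda>j. if j < 0 then x j else e0 j) R' (lo + 0) (hi - 0))"
      by (intro exI[of _ R]) auto
  qed (use assms in auto)
next
  case (Suc m)
  then obtain \<Delta>1 r d where 1: "finite \<Delta>1" "\<forall>Q\<in>\<Delta>1. dfp Q" "0 < r"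
    and IH: "\<forall>b e0 R lo hi x. R \<subseteq> {..<t} \<longrightarrow> m < card R \<longrightarrow> (\<forall>Q\<in>\<Delta>1. hom Q r b e0 R lo hi) \<longrightarrow>
      (\<exists>R'\<subseteq>R. R' \<noteq> {} \<and> (\<forall>Q\<in>\<Delta>. hom Q 1 b (\<lambda>j. if j < m then x j else e0 j) R' (lo + d) (hi - d)))"
    by (elim exE conjE)
  obtain \<Delta>' where \<Delta>': "finite \<Delta>'" "\<forall>Q\<in>\<Delta>'. dfp Q"
    and step: "\<forall>b e0 R lo hi a. R \<subseteq> {..<t} \<longrightarrow> R \<noteq> {} \<longrightarrow> (\<forall>Q\<in>\<Delta>'. hom Q (4 * r) b e0 R lo hi) \<longrightarrow>
      (\<exists>i0\<in>R. \<forall>Q\<in>\<Delta>1. hom Q r b (e0(m := a)) (R - {i0}) (lo + r) (hi - r))"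
    using add_coordinate[OF 1, of t m] by (elim exE conjE)
  show ?case
  proof (rule exI[of _ \<Delta>'], rule exI[of _ "4 * r"], rule exI[of _ "r + d"], intro conjI allI impI)
    fix b e0 R lo hi and x :: "nat \<Rightarrow> rxy"
    assume R: "R \<subseteq> {..<t}" "Suc m < card R" and h: "\<forall>Q\<in>\<Delta>'. hom Q (4 * r) b e0 R lo hi"
    have ne: "R \<noteq> {}" using R(2) by auto
    have "\<exists>i0\<in>R. \<forall>Q\<in>\<Delta>1. hom Q r b (e0(m := x m)) (R - {i0}) (lo + r) (hi - r)"
      by (rule step[rule_format, OF R(1) ne]) (use h in blast)
    then obtain i0 where i0: "i0 \<in> R" "\<forall>Q\<in>\<Delta>1. hom Q r b (e0(m := x m)) (R - {i0}) (lo + r) (hi - r)" by (elim bexE)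
    have "m < card (R - {i0})" using R(2) i0(1) by (simp add: card_Diff_singleton)
    moreover have "R - {i0} \<subseteq> {..<t}" using R(1) by blast
    ultimately have "\<exists>R'\<subseteq>R - {i0}. R' \<noteq> {} \<and>
      (\<forall>Q\<in>\<Delta>. hom Q 1 b (\<lambda>j. if j < m then x j else (e0(m := x m)) j) R' (lo + r + d) (hi - r - d))"
      by (intro IH[rule_format]) (use i0(2) in blast)+
    then obtain R' where R': "R' \<subseteq> R - {i0}" "R' \<noteq> {}"
      "\<forall>Q\<in>\<Delta>. hom Q 1 b (\<lambda>j. if j < m then x j else (e0(m := x m)) j) R' (lo + r + d) (hi - r - d)"
      by (elim exE conjE)
    have "(\<lambda>j. if j < m then x j else (e0(m := x m)) j) = (\<lambda>j. if j < Suc m then x j else e0 j)"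
      by (auto simp: fun_eq_iff less_Suc_eq)
    then show "\<exists>R'\<subseteq>R. R' \<noteq> {} \<and> (\<forall>Q\<in>\<Delta>. hom Q 1 b (\<lambda>j. if j < Suc m then x j else e0 j) R' (lo + (r + d)) (hi - (r + d)))"
      using R' by (intro exI[of _ R']) (auto simp: add.assoc)
  qed (use \<Delta>' 1(3) in auto)
qed

section \<open>Ramsey's theorem for arrays\<close>

lemma ramsey_colors:
  assumes "finite (K :: 'k set)"
  shows "\<exists>M::nat. \<forall>f. f \<in> nsets {..<M} L \<rightarrow> K \<longrightarrow>
    (\<exists>H. H \<subseteq> {..<M} \<and> card H = N \<and> (\<forall>A\<in>nsets H L. \<forall>B\<in>nsets H L. f A = f B))"
proof -
  obtain g :: "'k \<Rightarrow> nat" where g: "bij_betw g K {..<card K}" using ex_bij_betw_finite_nat[OF assms] by (auto simp: atLeast0LessThan)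
  obtain M :: nat where M: "partn_lst {..<M} (replicate (card K) N) L" using ramsey_full by blast
  show ?thesis
  proof (intro exI[of _ M] allI impI)
    fix f assume f: "f \<in> nsets {..<M} L \<rightarrow> K"
    have "g \<circ> f \<in> nsets {..<M} L \<rightarrow> {..<card K}" using f bij_betwE[OF g] by (auto simp: Pi_iff)
    then obtain i H where H: "i < card K" "H \<in> nsets {..<M} (replicate (card K) N ! i)" "(g \<circ> f) ` nsets H L \<subseteq> {i}"
      by (rule partn_lstE[OF M]) auto
    have HM: "H \<subseteq> {..<M}" "card H = N" using H(1,2) by (auto simp: nsets_def)
    have "f A = f B" if "A \<in> nsets H L" "B \<in> nsets H L" for A B
    proof -
      have "g (f A) = g (f B)" using H(3) that by auto
      moreover have "f A \<in> K" "f B \<in> K" using f that nsets_mono[OF HM(1)] by blast+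
      ultimately show ?thesis using g by (meson bij_betw_def inj_onD)
    qed
    then show "\<exists>H. H \<subseteq> {..<M} \<and> card H = N \<and> (\<forall>A\<in>nsets H L. \<forall>B\<in>nsets H L. f A = f B)" using HM by blast
  qed
qed

lemma card_image_eq:
  assumes "\<And>x y. x \<in> A \<Longrightarrow> y \<in> A \<Longrightarrow> f x = f y \<longleftrightarrow> g x = g y"
  shows "card (f ` A) = card (g ` A)"
proof -
  let ?\<phi> = "\<lambda>z. g (inv_into A f z)"
  have \<phi>: "?\<phi> (f x) = g x" if "x \<in> A" for x
    using assms[OF inv_into_into[of "f x" f A] that] that by (simp add: f_inv_into_f)
  then have "g ` A = ?\<phi> ` f ` A" by (auto simp: image_iff)
  moreover have "inj_on ?\<phi> (f ` A)" using \<phi> assms by (auto simp: inj_on_def)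
  ultimately show ?thesis by (simp add: card_image)
qed

definition nth_elt :: "nat set \<Rightarrow> nat \<Rightarrow> nat" where
  "nth_elt A i = (SOME x. x \<in> A \<and> card {a \<in> A. a < x} = i)"

lemma nth_elt_card:
  assumes "finite A" "x \<in> A" shows "nth_elt A (card {a \<in> A. a < x}) = x"
proof -
  have less: "card {a \<in> A. a < y} < card {a \<in> A. a < z}" if "y \<in> A" "y < z" for y z
  proof (rule psubset_card_mono)
    have "y \<in> {a \<in> A. a < z}" using that by simp
    moreover have "{a \<in> A. a < y} \<subseteq> {a \<in> A. a < z}" using that by auto
    ultimately show "{a \<in> A. a < y} \<subset> {a \<in> A. a < z}" by blast
  qed (use assms in simp)
  have "\<exists>y. y \<in> A \<and> card {a \<in> A. a < y} = card {a \<in> A. a < x}" using assms by blast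
  from someI_ex[OF this] show ?thesis
    unfolding nth_elt_def[symmetric] using less[of "nth_elt A (card {a \<in> A. a < x})" x] less[of x "nth_elt A (card {a \<in> A. a < x})"] assms(2)
    by (metis linorder_neqE_nat nat_less_le)
qed

text \<open>Tuples may be unordered and have repetitions, so a set A of size L is coloured by the
  function that sends each pattern \<sigma> to the colour of the tuple which \<sigma> selects from
  A. The homogeneous set has L spare elements, to fill up the entries of a tuple to a set of size
  L.\<close>

lemma ramsey_tuples:
  fixes L N :: nat
  assumes K: "finite (K :: 'k set)"
  shows "\<exists>M::nat. \<forall>\<chi>. (\<forall>u. \<chi> u \<in> K) \<longrightarrow> (\<forall>u w. (\<forall>l<L. u l = w l) \<longrightarrow> \<chi> u = \<chi> w) \<longrightarrow>
    (\<exists>h. (\<forall>i<N. \<forall>j<N. i < j \<longrightarrow> h i < h j) \<and> (\<forall>i<N. h i < M) \<and>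
      (\<forall>u w. (\<forall>l<L. u l < N \<and> w l < N) \<longrightarrow> (\<forall>l<L. \<forall>l'<L. u l < u l' \<longleftrightarrow> w l < w l') \<longrightarrow>
        \<chi> (h \<circ> u) = \<chi> (h \<circ> w)))"
proof -
  define K' where "K' = Pi\<^sub>E (Pi\<^sub>E {..<L} (\<lambda>_. {..<L})) (\<lambda>_. K)"
  have "finite K'" unfolding K'_def by (intro finite_PiE K) auto
  from ramsey_colors[OF this, of L "N + L"] obtain M :: nat where M: "\<forall>f. f \<in> nsets {..<M} L \<rightarrow> K' \<longrightarrow>
    (\<exists>H. H \<subseteq> {..<M} \<and> card H = N + L \<and> (\<forall>A\<in>nsets H L. \<forall>B\<in>nsets H L. f A = f B))" by (elim exE)
  show ?thesis
  proof (intro exI[of _ M] allI impI)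
    fix \<chi> :: "(nat \<Rightarrow> nat) \<Rightarrow> 'k"
    assume \<chi>K: "\<forall>u. \<chi> u \<in> K" and \<chi>: "\<forall>u w. (\<forall>l<L. u l = w l) \<longrightarrow> \<chi> u = \<chi> w"
    define f where "f A = restrict (\<lambda>\<sigma>. \<chi> (\<lambda>l. nth_elt A (\<sigma> l))) (Pi\<^sub>E {..<L} (\<lambda>_. {..<L}))" for A
    have "f \<in> nsets {..<M} L \<rightarrow> K'" using \<chi>K by (auto simp: f_def K'_def)
    from M[rule_format, OF this] obtain H where H: "H \<subseteq> {..<M}" "card H = N + L" "\<forall>A\<in>nsets H L. \<forall>B\<in>nsets H L. f A = f B"
      by (elim exE conjE)
    have finH: "finite H" using H(1) finite_subset by blast
    define h where "h i = sorted_list_of_set H ! i" for i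
    have len: "length (sorted_list_of_set H) = N + L" using H(2) by simp
    have hmono: "h i < h j" if "i < j" "j < N + L" for i j
      unfolding h_def using sorted_wrt_nth_less[OF strict_sorted_list_of_set[of H] that(1)] that(2) len by simp
    have hH: "h i \<in> H" if "i < N + L" for i
      using nth_mem[of i "sorted_list_of_set H"] that len finH by (simp add: h_def)
    have hless: "h i < h j \<longleftrightarrow> i < j" if "i < N + L" "j < N + L" for i j
      using hmono[of i j] hmono[of j i] that by (cases i j rule: linorder_cases) auto
    have hinj: "inj_on h {..<N + L}" 
    proof (rule inj_onI)
      fix i j assume "i \<in> {..<N + L}" "j \<in> {..<N + L}" "h i = h j"
      then show "i = j" using hless[of i j] hless[of j i] by (cases i j rule: linorder_cases) auto
    qed
    \<comment> \<open>The padding starts at N, above all entries of u, and hence does not disturb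
      their ranks.\<close>
    define S where "S u = u ` {..<L} \<union> {N..<N + L - card (u ` {..<L})}" for u :: "nat \<Rightarrow> nat"
    define A where "A u = h ` S u" for u
    define \<sigma> where "\<sigma> u = restrict (\<lambda>l. card (u ` {l'. l' < L \<and> u l' < u l})) {..<L}" for u :: "nat \<Rightarrow> nat"
    have main: "\<chi> (h \<circ> u) = f (A u) (\<sigma> u)" "A u \<in> nsets H L" if u: "\<forall>l<L. u l < N" for u
    proof -
      let ?p = "card (u ` {..<L})"
      have p: "?p \<le> L" using card_image_le[of "{..<L}" u] by simp
      have uN: "u ` {..<L} \<subseteq> {..<N}" using u by blast
      have SN: "S u \<subseteq> {..<N + L}" unfolding S_def using uN by fastforce
      have "u ` {..<L} \<inter> {N..<N + L - ?p} = {}" using uN by fastforce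
      then have cS: "card (S u) = L" unfolding S_def using p by (subst card_Un_disjoint) simp_all
      have finA: "finite (A u)" by (simp add: A_def S_def)
      have "card (A u) = L" unfolding A_def using card_image[OF inj_on_subset[OF hinj SN]] cS by simp
      moreover have "A u \<subseteq> H" unfolding A_def using hH SN by (intro image_subsetI) auto
      ultimately show "A u \<in> nsets H L" using finA by (simp add: nsets_def)
      have "nth_elt (A u) (\<sigma> u l) = h (u l)" if l: "l < L" for l
      proof -
        have "{a \<in> A u. a < h (u l)} = h ` {s \<in> S u. s < u l}"
        proof -
          have "h s < h (u l) \<longleftrightarrow> s < u l" if "s \<in> S u" for s
          proof (rule hless)
            show "s < N + L" using that SN by auto
            show "u l < N + L" using u l by (simp add: trans_less_add1)
          qed
          then show ?thesis unfolding A_def by auto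
        qed
        moreover have "{s \<in> S u. s < u l} = u ` {l'. l' < L \<and> u l' < u l}"
        proof -
          have "u l < N" using u l by blast
          then show ?thesis unfolding S_def by auto
        qed
        moreover have "inj_on h (u ` {l'. l' < L \<and> u l' < u l})"
        proof (rule inj_on_subset[OF hinj], rule image_subsetI)
          fix l' assume "l' \<in> {l'. l' < L \<and> u l' < u l}"
          then have "u l' < N" using u by blast
          then show "u l' \<in> {..<N + L}" by simp
        qed
        ultimately have "card {a \<in> A u. a < h (u l)} = \<sigma> u l" using l by (simp add: card_image \<sigma>_def)
        moreover have "h (u l) \<in> A u" using l by (simp add: A_def S_def)
        ultimately show ?thesis using nth_elt_card[OF finA, of "h (u l)"] by simp
      qed
      then have "\<chi> (\<lambda>l. nth_elt (A u) (\<sigma> u l)) = \<chi> (h \<circ> u)" by (intro \<chi>[rule_format]) simp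
      moreover have "\<sigma> u \<in> Pi\<^sub>E {..<L} (\<lambda>_. {..<L})"
      proof -
        have "card (u ` {l'. l' < L \<and> u l' < u l}) < L" if l: "l < L" for l
        proof -
          have "{l'. l' < L \<and> u l' < u l} \<subset> {..<L}" using l by auto
          from psubset_card_mono[OF finite_lessThan this] have "card {l'. l' < L \<and> u l' < u l} < L" by simp
          then show ?thesis using card_image_le[of "{l'. l' < L \<and> u l' < u l}" u] by simp
        qed
        then show ?thesis unfolding \<sigma>_def by (simp add: PiE_iff)
      qed
      ultimately show "\<chi> (h \<circ> u) = f (A u) (\<sigma> u)" unfolding f_def by (simp only: restrict_apply if_True)
    qed
    show "\<exists>h. (\<forall>i<N. \<forall>j<N. i < j \<longrightarrow> h i < h j) \<and> (\<forall>i<N. h i < M) \<and>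
      (\<forall>u w. (\<forall>l<L. u l < N \<and> w l < N) \<longrightarrow> (\<forall>l<L. \<forall>l'<L. u l < u l' \<longleftrightarrow> w l < w l') \<longrightarrow> \<chi> (h \<circ> u) = \<chi> (h \<circ> w))"
    proof (intro exI[of _ h] conjI allI impI)
      fix u w assume uw: "\<forall>l<L. u l < N \<and> w l < N" "\<forall>l<L. \<forall>l'<L. u l < u l' \<longleftrightarrow> w l < w l'"
      have "\<sigma> u = \<sigma> w"
      proof
        fix l show "\<sigma> u l = \<sigma> w l"
        proof (cases "l < L")
          case True
          then have e: "{l'. l' < L \<and> u l' < u l} = {l'. l' < L \<and> w l' < w l}" using uw(2) by blast
          have "card (u ` {l'. l' < L \<and> w l' < w l}) = card (w ` {l'. l' < L \<and> w l' < w l})"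
          proof (rule card_image_eq)
            fix x y assume "x \<in> {l'. l' < L \<and> w l' < w l}" "y \<in> {l'. l' < L \<and> w l' < w l}"
            then have "u x < u y \<longleftrightarrow> w x < w y" "u y < u x \<longleftrightarrow> w y < w x" using uw(2) by simp_all
            then show "u x = u y \<longleftrightarrow> w x = w y" by (auto simp: nat_neq_iff)
          qed
          then show ?thesis using True e by (simp add: \<sigma>_def)
        qed (simp add: \<sigma>_def)
      qed
      moreover have "f (A u) = f (A w)" using H(3) main(2)[of u] main(2)[of w] uw(1) by blast
      ultimately show "\<chi> (h \<circ> u) = \<chi> (h \<circ> w)" using main(1)[of u] main(1)[of w] uw(1) by simp
    next
      fix i assume "i < N"
      then have "h i \<in> H" by (intro hH) simp
      then show "h i < M" using H(1) by blast
    qed (use hmono in simp)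
  qed
qed

text \<open>The t rows are laid out as consecutive blocks of length N in one homogeneous sequence.
  Indices from different blocks compare by block number, so the order types of the rows determine
  that of the flattened tuple.\<close>

lemma ramsey_array:
  assumes K: "finite (K :: 'k set)" and r: "0 < r"
  shows "\<exists>M::nat. \<forall>\<chi>. (\<forall>u. \<chi> u \<in> K) \<longrightarrow> (\<forall>u w. (\<forall>i<t. \<forall>l<r. u i l = w i l) \<longrightarrow> \<chi> u = \<chi> w) \<longrightarrow>
    (\<exists>h. (\<forall>i<t. \<forall>j<N. h i j < M) \<and> (\<forall>i<t. inj_on (h i) {..<N}) \<and>
      (\<forall>u w. win {..<t} r 0 N u \<longrightarrow> win {..<t} r 0 N w \<longrightarrow> oeq {..<t} r u w \<longrightarrow>
        \<chi> (\<lambda>i l. h i (u i l)) = \<chi> (\<lambda>i l. h i (w i l))))"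
proof -
  obtain M :: nat where M: "\<forall>\<chi>. (\<forall>u. \<chi> u \<in> K) \<longrightarrow> (\<forall>u w. (\<forall>l<t * r. u l = w l) \<longrightarrow> \<chi> u = \<chi> w) \<longrightarrow>
    (\<exists>h. (\<forall>i<t * N. \<forall>j<t * N. i < j \<longrightarrow> h i < h j) \<and> (\<forall>i<t * N. h i < M) \<and>
      (\<forall>u w. (\<forall>l<t * r. u l < t * N \<and> w l < t * N) \<longrightarrow> (\<forall>l<t * r. \<forall>l'<t * r. u l < u l' \<longleftrightarrow> w l < w l') \<longrightarrow>
        \<chi> (h \<circ> u) = \<chi> (h \<circ> w)))"
    using ramsey_tuples[OF K, of "t * r" "t * N"] by (elim exE)
  have lt: "i * n + j < t * n" if "i < t" "j < n" for i j n :: nat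
  proof -
    have "i * n + j < Suc i * n" using that by simp
    also have "\<dots> \<le> t * n" using that by (intro mult_le_mono1) simp
    finally show ?thesis .
  qed
  show ?thesis
  proof (intro exI[of _ M] allI impI)
    fix \<chi> :: "(nat \<Rightarrow> nat \<Rightarrow> nat) \<Rightarrow> 'k"
    assume \<chi>K: "\<forall>u. \<chi> u \<in> K" and \<chi>: "\<forall>u w. (\<forall>i<t. \<forall>l<r. u i l = w i l) \<longrightarrow> \<chi> u = \<chi> w"
    define \<chi>' where "\<chi>' v = \<chi> (\<lambda>i l. v (i * r + l))" for v
    have c1: "\<forall>u. \<chi>' u \<in> K" using \<chi>K by (simp add: \<chi>'_def)
    have c2: "\<forall>u w. (\<forall>l<t * r. u l = w l) \<longrightarrow> \<chi>' u = \<chi>' w"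
    proof (intro allI impI)
      fix u w :: "nat \<Rightarrow> nat" assume "\<forall>l<t * r. u l = w l"
      then show "\<chi>' u = \<chi>' w" unfolding \<chi>'_def by (intro \<chi>[rule_format]) (simp add: lt)
    qed
    obtain h where h: "\<forall>i<t * N. \<forall>j<t * N. i < j \<longrightarrow> h i < h j" "\<forall>i<t * N. h i < M"
      "\<forall>u w. (\<forall>l<t * r. u l < t * N \<and> w l < t * N) \<longrightarrow> (\<forall>l<t * r. \<forall>l'<t * r. u l < u l' \<longleftrightarrow> w l < w l') \<longrightarrow> \<chi>' (h \<circ> u) = \<chi>' (h \<circ> w)"
      using mp[OF mp[OF spec[OF M, of \<chi>'] c1] c2] by (elim exE conjE)
    define v where "v u m = (m div r) * N + u (m div r) (m mod r)" for u :: "nat \<Rightarrow> nat \<Rightarrow> nat" and m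
    have dm: "m div r < t" "m mod r < r" if "m < t * r" for m
      using that r by (simp_all add: less_mult_imp_div_less)
    have vlt: "v u m < t * N" if "win {..<t} r 0 N u" "m < t * r" for u m
      unfolding v_def by (rule lt) (use that dm[OF that(2)] in \<open>auto simp: win_def\<close>)
    have vless: "v u m < v u m' \<longleftrightarrow> m div r < m' div r \<or> m div r = m' div r \<and> u (m div r) (m mod r) < u (m' div r) (m' mod r)"
      if "win {..<t} r 0 N u" "m < t * r" "m' < t * r" for u m m'
    proof -
      have ineq: "i * N + x < i' * N + y" if "i < i'" "x < N" for i i' x y :: nat
      proof -
        have "i * N + x < Suc i * N" using that by simp
        also have "\<dots> \<le> i' * N" using that by (intro mult_le_mono1) simp
        finally show ?thesis by simp
      qed
      have b: "u (m div r) (m mod r) < N" "u (m' div r) (m' mod r) < N"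
        using that dm[OF that(2)] dm[OF that(3)] by (auto simp: win_def)
      consider "m div r < m' div r" | "m div r = m' div r" | "m' div r < m div r" by linarith
      then show ?thesis
      proof cases
        case 1 then show ?thesis unfolding v_def using ineq[OF 1 b(1)] by simp
      next
        case 2 then show ?thesis by (simp add: v_def)
      next
        case 3 then show ?thesis unfolding v_def using ineq[OF 3 b(2), of "u (m div r) (m mod r)"] by simp
      qed
    qed
    have \<chi>v: "\<chi>' (h \<circ> v u) = \<chi> (\<lambda>i l. h (i * N + u i l))" for u
      unfolding \<chi>'_def by (rule \<chi>[rule_format]) (simp add: v_def)
    show "\<exists>h. (\<forall>i<t. \<forall>j<N. h i j < M) \<and> (\<forall>i<t. inj_on (h i) {..<N}) \<and>
      (\<forall>u w. win {..<t} r 0 N u \<longrightarrow> win {..<t} r 0 N w \<longrightarrow> oeq {..<t} r u w \<longrightarrow>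
        \<chi> (\<lambda>i l. h i (u i l)) = \<chi> (\<lambda>i l. h i (w i l)))"
    proof (intro exI[of _ "\<lambda>i j. h (i * N + j)"] conjI allI impI)
      fix u w assume uw: "win {..<t} r 0 N u" "win {..<t} r 0 N w" "oeq {..<t} r u w"
      have "v u m < v u m' \<longleftrightarrow> v w m < v w m'" if "m < t * r" "m' < t * r" for m m'
        unfolding vless[OF uw(1) that] vless[OF uw(2) that]
        using uw(3) dm[OF that(1)] dm[OF that(2)] unfolding oeq_def by auto
      then have "\<chi>' (h \<circ> v u) = \<chi>' (h \<circ> v w)" using h(3)[rule_format, of "v u" "v w"] vlt[OF uw(1)] vlt[OF uw(2)] by simp
      then show "\<chi> (\<lambda>i l. h (i * N + u i l)) = \<chi> (\<lambda>i l. h (i * N + w i l))" unfolding \<chi>v .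
    next
      fix i assume i: "i < t"
      show "inj_on (\<lambda>j. h (i * N + j)) {..<N}"
      proof (rule inj_onI)
        fix j j' assume j: "j \<in> {..<N}" "j' \<in> {..<N}" "h (i * N + j) = h (i * N + j')"
        have "i * N + j < t * N" "i * N + j' < t * N" using lt[OF i] j by auto
        then show "j = j'" using h(1)[rule_format, of "i * N + j" "i * N + j'"] h(1)[rule_format, of "i * N + j'" "i * N + j"] j(3)
          by (cases j j' rule: linorder_cases) auto
      qed
    qed (use h(2) lt in auto)
  qed
qed

section \<open>Patterns in elementary extensions\<close>

primrec tm_bound :: "ring_term \<Rightarrow> nat" where
  "tm_bound (Var k) = Suc k"
| "tm_bound Zero = 0"
| "tm_bound One = 0"
| "tm_bound (Minus s) = tm_bound s"
| "tm_bound (Plus s t) = max (tm_bound s) (tm_bound t)"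
| "tm_bound (Times s t) = max (tm_bound s) (tm_bound t)"

primrec fm_bound :: "ring_formula \<Rightarrow> nat" where
  "fm_bound (Eq s t) = max (tm_bound s) (tm_bound t)"
| "fm_bound (Not \<phi>) = fm_bound \<phi>"
| "fm_bound (And \<phi> \<psi>) = max (fm_bound \<phi>) (fm_bound \<psi>)"
| "fm_bound (Ex k \<phi>) = fm_bound \<phi>"

lemma eval_term_cong: "(\<And>k. k < tm_bound s \<Longrightarrow> e k = e' k) \<Longrightarrow> eval_term M e s = eval_term M e' s"
  by (induction s) auto

lemma sat_cong: "(\<And>k. k < fm_bound \<phi> \<Longrightarrow> e k = e' k) \<Longrightarrow> sat M e \<phi> = sat M e' \<phi>"
proof (induction \<phi> arbitrary: e e')
  case (Eq s t)
  then have "eval_term M e s = eval_term M e' s" "eval_term M e t = eval_term M e' t"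
    by (auto intro!: eval_term_cong)
  then show ?case by simp
next
  case (Not \<phi>)
  from Not.IH[of e e'] Not.prems show ?case by simp
next
  case (And \<phi> \<psi>)
  from And.IH(1)[of e e'] And.IH(2)[of e e'] And.prems show ?case by simp
next
  case (Ex k \<phi>)
  have "sat M (e(k := a)) \<phi> = sat M (e'(k := a)) \<phi>" for a using Ex.prems by (intro Ex.IH) simp
  then show ?case by simp
qed

definition exs :: "nat list \<Rightarrow> ring_formula \<Rightarrow> ring_formula" where
  "exs ks \<phi> = foldr Ex ks \<phi>"

definition conjs :: "ring_formula list \<Rightarrow> ring_formula" where
  "conjs fs = foldr And fs (Eq Zero Zero)"

lemma sat_conjs [simp]: "sat M e (conjs fs) \<longleftrightarrow> (\<forall>f\<in>set fs. sat M e f)"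
  by (induction fs) (auto simp: conjs_def)

lemma sat_exs:
  assumes "\<And>k. e k \<in> carrier M"
  shows "sat M e (exs ks \<phi>) \<longleftrightarrow> (\<exists>e'. (\<forall>k. e' k \<in> carrier M) \<and> (\<forall>k. k \<notin> set ks \<longrightarrow> e' k = e k) \<and> sat M e' \<phi>)"
  using assms
proof (induction ks arbitrary: e)
  case Nil
  have "e' = e" if "\<forall>k. k \<notin> set [] \<longrightarrow> e' k = e k" for e' using that by auto
  then show ?case using Nil by (auto simp: exs_def)
next
  case (Cons k ks)
  have "sat M e (exs (k # ks) \<phi>) \<longleftrightarrow> (\<exists>a\<in>carrier M. sat M (e(k := a)) (exs ks \<phi>))" by (simp add: exs_def)
  also have "\<dots> \<longleftrightarrow> (\<exists>a\<in>carrier M. \<exists>e'. (\<forall>k. e' k \<in> carrier M) \<and> (\<forall>k'. k' \<notin> set ks \<longrightarrow> e' k' = (e(k := a)) k') \<and> sat M e' \<phi>)"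
    using Cons.prems by (intro bex_cong refl Cons.IH) auto
  also have "\<dots> \<longleftrightarrow> (\<exists>e'. (\<forall>k. e' k \<in> carrier M) \<and> (\<forall>k'. k' \<notin> set (k # ks) \<longrightarrow> e' k' = e k') \<and> sat M e' \<phi>)"
  proof
    assume "\<exists>a\<in>carrier M. \<exists>e'. (\<forall>k. e' k \<in> carrier M) \<and> (\<forall>k'. k' \<notin> set ks \<longrightarrow> e' k' = (e(k := a)) k') \<and> sat M e' \<phi>"
    then obtain a e' where e': "\<forall>k. e' k \<in> carrier M" "\<forall>k'. k' \<notin> set ks \<longrightarrow> e' k' = (e(k := a)) k'" "sat M e' \<phi>"
      by (elim bexE exE conjE)
    show "\<exists>e'. (\<forall>k. e' k \<in> carrier M) \<and> (\<forall>k'. k' \<notin> set (k # ks) \<longrightarrow> e' k' = e k') \<and> sat M e' \<phi>"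
      using e' by (intro exI[of _ e']) auto
  next
    assume "\<exists>e'. (\<forall>k. e' k \<in> carrier M) \<and> (\<forall>k'. k' \<notin> set (k # ks) \<longrightarrow> e' k' = e k') \<and> sat M e' \<phi>"
    then obtain e' where e': "\<forall>k. e' k \<in> carrier M" "\<forall>k'. k' \<notin> set (k # ks) \<longrightarrow> e' k' = e k'" "sat M e' \<phi>"
      by (elim exE conjE)
    show "\<exists>a\<in>carrier M. \<exists>e'. (\<forall>k. e' k \<in> carrier M) \<and> (\<forall>k'. k' \<notin> set ks \<longrightarrow> e' k' = (e(k := a)) k') \<and> sat M e' \<phi>"
      using e' by (intro bexI[of _ "e' k"] exI[of _ e']) auto
  qed
  finally show ?case .
qed

text \<open>The parameter tuple of row \<open>i\<close> and column \<open>j\<close> is kept in variables beyond those of \<open>\<phi>\<close>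
  and copied into place by quantifiers in front of \<open>\<phi>\<close>, so that no bound variable has to be renamed.\<close>

definition pvar_code :: "nat \<Rightarrow> nat \<Rightarrow> nat \<Rightarrow> nat \<Rightarrow> nat" where
  "pvar_code B i j k = B + prod_encode (i, prod_encode (j, k))"

abbreviation pvals :: "nat \<Rightarrow> nat \<Rightarrow> (nat \<Rightarrow> 'a) \<Rightarrow> nat \<Rightarrow> nat \<Rightarrow> nat \<Rightarrow> 'a" where
  "pvals B m e i j \<equiv> \<lambda>k. e (pvar_code B i j (m + k))"

lemma pvar_code_inj [simp]: "pvar_code B i j k = pvar_code B i' j' k' \<longleftrightarrow> i = i' \<and> j = j' \<and> k = k'"
  by (simp add: pvar_code_def)

definition inst_fm :: "nat \<Rightarrow> nat \<Rightarrow> nat \<Rightarrow> nat \<Rightarrow> ring_formula \<Rightarrow> ring_formula" where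
  "inst_fm B m i j \<phi> = exs [m..<B] (And (conjs (map (\<lambda>k. Eq (Var k) (Var (pvar_code B i j k))) [m..<B])) \<phi>)"

lemma sat_inst_fm:
  assumes e: "\<And>k. e k \<in> carrier M" and B: "fm_bound \<phi> \<le> B"
  shows "sat M e (inst_fm B m i j \<phi>) \<longleftrightarrow> sat M (join_env m e (pvals B m e i j)) \<phi>"
proof -
  have code: "pvar_code B i j k \<ge> B" for k by (simp add: pvar_code_def)
  have "sat M e (inst_fm B m i j \<phi>) \<longleftrightarrow> (\<exists>e'. (\<forall>k. e' k \<in> carrier M) \<and> (\<forall>k. k \<notin> {m..<B} \<longrightarrow> e' k = e k) \<and>
     (\<forall>k\<in>{m..<B}. e' k = e' (pvar_code B i j k)) \<and> sat M e' \<phi>)"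
    unfolding inst_fm_def sat_exs[OF e] by simp
  also have "\<dots> \<longleftrightarrow> sat M (join_env m e (pvals B m e i j)) \<phi>"
  proof
    assume "\<exists>e'. (\<forall>k. e' k \<in> carrier M) \<and> (\<forall>k. k \<notin> {m..<B} \<longrightarrow> e' k = e k) \<and>
     (\<forall>k\<in>{m..<B}. e' k = e' (pvar_code B i j k)) \<and> sat M e' \<phi>"
    then obtain e' where e': "\<forall>k. k \<notin> {m..<B} \<longrightarrow> e' k = e k" "\<forall>k\<in>{m..<B}. e' k = e' (pvar_code B i j k)" "sat M e' \<phi>"
      by (elim exE conjE)
    have "sat M e' \<phi> = sat M (join_env m e (pvals B m e i j)) \<phi>"
    proof (rule sat_cong)
      fix k assume "k < fm_bound \<phi>"
      then have k: "k < B" using B by simp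
      have "e' (pvar_code B i j k) = e (pvar_code B i j k)" using e'(1) code[of k] by simp
      then show "e' k = join_env m e (pvals B m e i j) k"
        using e'(1,2) k by (cases "k < m") (simp_all add: join_env_def)
    qed
    then show "sat M (join_env m e (pvals B m e i j)) \<phi>" using e'(3) by simp
  next
    assume s: "sat M (join_env m e (pvals B m e i j)) \<phi>"
    let ?e = "\<lambda>k. if m \<le> k \<and> k < B then e (pvar_code B i j k) else e k"
    have "sat M ?e \<phi> = sat M (join_env m e (pvals B m e i j)) \<phi>"
    proof (rule sat_cong)
      fix k assume "k < fm_bound \<phi>"
      then have k: "k < B" using B by simp
      then show "?e k = join_env m e (pvals B m e i j) k"
        by (simp add: join_env_def)
    qed
    moreover have "?e (pvar_code B i j k) = e (pvar_code B i j k)" for k using code[of k] by simp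
    ultimately show "\<exists>e'. (\<forall>k. e' k \<in> carrier M) \<and> (\<forall>k. k \<notin> {m..<B} \<longrightarrow> e' k = e k) \<and>
     (\<forall>k\<in>{m..<B}. e' k = e' (pvar_code B i j k)) \<and> sat M e' \<phi>"
      using s e by (intro exI[of _ ?e]) auto
  qed
  finally show ?thesis .
qed

definition column_fm :: "nat \<Rightarrow> nat \<Rightarrow> nat \<Rightarrow> (nat \<Rightarrow> ring_formula) \<Rightarrow> nat \<Rightarrow> (nat \<Rightarrow> nat) \<Rightarrow> ring_formula" where
  "column_fm B m t \<phi> n \<eta> = exs [0..<m] (conjs (map (\<lambda>(i, j). if j = \<eta> i then inst_fm B m i j (\<phi> i) else Not (inst_fm B m i j (\<phi> i)))
     (List.product [0..<t] [0..<n])))"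

lemma sat_column_fm:
  assumes e0: "\<forall>k. e k \<in> carrier M" and B0: "\<forall>i<t. fm_bound (\<phi> i) \<le> B" and mB: "m \<le> B"
  shows "sat M e (column_fm B m t \<phi> n \<eta>) \<longleftrightarrow> (\<exists>x. (\<forall>k. x k \<in> carrier M) \<and>
    (\<forall>i<t. \<forall>j<n. sat M (join_env m x (pvals B m e i j)) (\<phi> i) \<longleftrightarrow> j = \<eta> i))"
proof -
  have e: "\<And>k. e k \<in> carrier M" and B: "\<And>i. i < t \<Longrightarrow> fm_bound (\<phi> i) \<le> B" using e0 B0 by auto
  have code: "e' (pvar_code B i j k) = e (pvar_code B i j k)" if "\<forall>k. k \<notin> {0..<m} \<longrightarrow> e' k = e k" for e' i j k
    using that mB by (simp add: pvar_code_def)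
  have jc: "join_env m e' b = join_env m x b" if "\<forall>k<m. e' k = x k" for e' x b
    using that by (auto simp: join_env_def)
  have inner: "sat M e' (conjs (map (\<lambda>(i, j). if j = \<eta> i then inst_fm B m i j (\<phi> i) else Not (inst_fm B m i j (\<phi> i)))
     (List.product [0..<t] [0..<n]))) \<longleftrightarrow>
     (\<forall>i<t. \<forall>j<n. sat M (join_env m e' (pvals B m e' i j)) (\<phi> i) \<longleftrightarrow> j = \<eta> i)"
    if e': "\<And>k. e' k \<in> carrier M" for e'
  proof -
    have "sat M e' (if j = \<eta> i then inst_fm B m i j (\<phi> i) else Not (inst_fm B m i j (\<phi> i))) \<longleftrightarrow>
      (sat M (join_env m e' (pvals B m e' i j)) (\<phi> i) \<longleftrightarrow> j = \<eta> i)" if "i < t" for i j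
      using sat_inst_fm[where e = e' and M = M and \<phi> = "\<phi> i" and m = m and i = i and j = j, OF e' B[OF that]] by (cases "j = \<eta> i") simp_all
    then show ?thesis by auto
  qed
  have "sat M e (column_fm B m t \<phi> n \<eta>) \<longleftrightarrow> (\<exists>e'. (\<forall>k. e' k \<in> carrier M) \<and> (\<forall>k. k \<notin> {0..<m} \<longrightarrow> e' k = e k) \<and>
    (\<forall>i<t. \<forall>j<n. sat M (join_env m e' (pvals B m e' i j)) (\<phi> i) \<longleftrightarrow> j = \<eta> i))"
    unfolding column_fm_def sat_exs[OF e] set_upt using inner by blast
  also have "\<dots> \<longleftrightarrow> (\<exists>x. (\<forall>k. x k \<in> carrier M) \<and>
    (\<forall>i<t. \<forall>j<n. sat M (join_env m x (pvals B m e i j)) (\<phi> i) \<longleftrightarrow> j = \<eta> i))"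
  proof
    assume "\<exists>e'. (\<forall>k. e' k \<in> carrier M) \<and> (\<forall>k. k \<notin> {0..<m} \<longrightarrow> e' k = e k) \<and>
    (\<forall>i<t. \<forall>j<n. sat M (join_env m e' (pvals B m e' i j)) (\<phi> i) \<longleftrightarrow> j = \<eta> i)"
    then obtain e' where e': "\<forall>k. e' k \<in> carrier M" "\<forall>k. k \<notin> {0..<m} \<longrightarrow> e' k = e k"
      "\<forall>i<t. \<forall>j<n. sat M (join_env m e' (pvals B m e' i j)) (\<phi> i) \<longleftrightarrow> j = \<eta> i" by (elim exE conjE)
    show "\<exists>x. (\<forall>k. x k \<in> carrier M) \<and>
      (\<forall>i<t. \<forall>j<n. sat M (join_env m x (pvals B m e i j)) (\<phi> i) \<longleftrightarrow> j = \<eta> i)"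
      using e'(1,3) unfolding code[OF e'(2)] by (intro exI[of _ e'] conjI)
  next
    assume "\<exists>x. (\<forall>k. x k \<in> carrier M) \<and>
      (\<forall>i<t. \<forall>j<n. sat M (join_env m x (pvals B m e i j)) (\<phi> i) \<longleftrightarrow> j = \<eta> i)"
    then obtain x where x: "\<forall>k. x k \<in> carrier M"
      "\<forall>i<t. \<forall>j<n. sat M (join_env m x (pvals B m e i j)) (\<phi> i) \<longleftrightarrow> j = \<eta> i" by (elim exE conjE)
    let ?e = "\<lambda>k. if k < m then x k else e k"
    have off: "\<forall>k. k \<notin> {0..<m} \<longrightarrow> ?e k = e k" by simp
    show "\<exists>e'. (\<forall>k. e' k \<in> carrier M) \<and> (\<forall>k. k \<notin> {0..<m} \<longrightarrow> e' k = e k) \<and>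
      (\<forall>i<t. \<forall>j<n. sat M (join_env m e' (pvals B m e' i j)) (\<phi> i) \<longleftrightarrow> j = \<eta> i)"
    proof (intro exI[of _ ?e] conjI off)
      have "join_env m ?e b = join_env m x b" for b by (rule jc) simp
      then show "\<forall>i<t. \<forall>j<n. sat M (join_env m ?e (\<lambda>k. ?e (pvar_code B i j (m + k)))) (\<phi> i) \<longleftrightarrow> j = \<eta> i"
        using x(2) unfolding code[OF off] by (simp only:)
    qed (use x(1) e in simp)
  qed
  finally show ?thesis .
qed

text \<open>That some parameters realise all paths through t rows and n columns is expressed by one
  formula, evaluated at a constant assignment from M. It holds in N by consistency, hence in M; this
  is why only finitely many columns can be transferred.\<close>

lemma pattern_finite:
  fixes n :: nat
  assumes pat: "ict_pattern M m \<theta> c N \<kappa> \<phi> b" and t: "enat t \<le> \<kappa>"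
    and M: "carrier M \<noteq> {}"
  shows "\<exists>b'. \<forall>\<eta>. (\<forall>i<t. \<eta> i < n) \<longrightarrow>
    (\<exists>x. \<forall>i<t. \<forall>j<n. sat M (join_env m x (b' i j)) (\<phi> i) \<longleftrightarrow> j = \<eta> i)"
proof -
  obtain a where a: "a \<in> carrier M" using M by blast
  have el: "elementary_extension M N" and bN: "\<And>i j k. b i j k \<in> carrier N" using pat by (auto simp: ict_pattern_def)
  define B where "B = Max (insert m ((\<lambda>i. fm_bound (\<phi> i)) ` {..<t}))"
  have B: "fm_bound (\<phi> i) \<le> B" if "i < t" for i unfolding B_def using that by (intro Max_ge) auto
  then have B0: "\<forall>i<t. fm_bound (\<phi> i) \<le> B" by blast
  have mB: "m \<le> B" unfolding B_def by (intro Max_ge) auto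
  have "finite (Pi\<^sub>E {..<t} (\<lambda>_. {..<n}))" by (intro finite_PiE) auto
  from finite_list[OF this] obtain \<eta>s where \<eta>s: "set \<eta>s = Pi\<^sub>E {..<t} (\<lambda>_. {..<n})" by (elim exE)
  define ks where "ks = map (\<lambda>(i, j, k). pvar_code B i j (m + k)) (List.product [0..<t] (List.product [0..<n] [0..<B]))"
  have ks: "pvar_code B i j (m + k) \<in> set ks" if "i < t" "j < n" "k < B" for i j k
  proof -
    have "(i, j, k) \<in> set (List.product [0..<t] (List.product [0..<n] [0..<B]))" using that by simp
    then show ?thesis unfolding ks_def set_map by (rule rev_image_eqI) simp
  qed
  define \<psi> where "\<psi> = exs ks (conjs (map (column_fm B m t \<phi> n) \<eta>s))"
  have tail: "sat L (join_env m x b1) (\<phi> i) \<longleftrightarrow> sat L (join_env m x b2) (\<phi> i)"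
    if "i < t" "\<forall>k<B. b1 k = b2 k" for L :: "'c ring" and x b1 b2 i
  proof (rule sat_cong)
    fix k assume "k < fm_bound (\<phi> i)"
    then have "k - m < B" using B[OF that(1)] by simp
    then show "join_env m x b1 k = join_env m x b2 k" using that(2) by (simp add: join_env_def)
  qed
  have aN: "Inl a \<in> carrier N" using el a by (auto simp: elementary_extension_def)
  have "sat N (\<lambda>_. Inl a) \<psi>"
  proof -
    \<comment> \<open>Decodes the parameter variables. All others keep the value
      \<open>Inl a\<close>, because only the variables in \<open>ks\<close> are quantified.\<close>
    define e where "e k = (if \<exists>i<t. \<exists>j<n. \<exists>l<B. k = pvar_code B i j (m + l)
        then (case prod_decode (k - B) of (i, p) \<Rightarrow> case prod_decode p of (j, l) \<Rightarrow> b i j (l - m)) else Inl a)" for k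
    have e: "e k \<in> carrier N" for k using bN aN by (simp add: e_def split: prod.split)
    then have eN: "\<forall>k. e k \<in> carrier N" by blast
    have eb: "e (pvar_code B i j (m + l)) = b i j l" if "i < t" "j < n" "l < B" for i j l
    proof -
      have "\<exists>i'<t. \<exists>j'<n. \<exists>l'<B. pvar_code B i j (m + l) = pvar_code B i' j' (m + l')" using that by blast
      then show ?thesis unfolding e_def by (simp add: pvar_code_def)
    qed
    have off: "\<forall>k. k \<notin> set ks \<longrightarrow> e k = Inl a"
    proof (intro allI impI)
      fix k assume "k \<notin> set ks"
      then have "\<not> (\<exists>i<t. \<exists>j<n. \<exists>l<B. k = pvar_code B i j (m + l))" using ks by blast
      then show "e k = Inl a" unfolding e_def by (rule if_not_P)
    qed
    have "sat N e (column_fm B m t \<phi> n \<eta>)" if "\<eta> \<in> set \<eta>s" for \<eta>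
    proof -
      have \<eta>: "\<And>i. i < t \<Longrightarrow> \<eta> i < n" using that \<eta>s by auto
      define \<Sigma> where "\<Sigma> = (\<lambda>i. (\<phi> i, b i (\<eta> i))) ` {..<t} \<union> (\<lambda>(i, j). (Not (\<phi> i), b i j)) ` {(i, j). i < t \<and> j < n \<and> j \<noteq> \<eta> i}"
      have "{(i, j). i < t \<and> j < n \<and> j \<noteq> \<eta> i} \<subseteq> {..<t} \<times> {..<n}" by auto
      then have "finite \<Sigma>" unfolding \<Sigma>_def by (intro finite_UnI finite_imageI) (auto elim: finite_subset)
      moreover have i\<kappa>: "enat i < \<kappa>" if "i < t" for i using order_less_le_trans[OF _ t, of "enat i"] that by simp
      then have "\<Sigma> \<subseteq> {(\<theta>, Inl \<circ> c)} \<union> {(\<phi> i, b i (\<eta> i)) | i. enat i < \<kappa>} \<union> {(Not (\<phi> i), b i j) | i j. enat i < \<kappa> \<and> j \<noteq> \<eta> i}"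
        unfolding \<Sigma>_def
      proof (intro Un_least image_subsetI)
        fix i assume "i \<in> {..<t}"
        then have "enat i < \<kappa>" by (intro i\<kappa>) simp
        then show "(\<phi> i, b i (\<eta> i)) \<in> {(\<theta>, Inl \<circ> c)} \<union> {(\<phi> i, b i (\<eta> i)) | i. enat i < \<kappa>} \<union> {(Not (\<phi> i), b i j) | i j. enat i < \<kappa> \<and> j \<noteq> \<eta> i}"
          by blast
      next
        fix p assume "p \<in> {(i, j). i < t \<and> j < n \<and> j \<noteq> \<eta> i}"
        then obtain i j where p: "p = (i, j)" "i < t" "j \<noteq> \<eta> i" by blast
        have "enat i < \<kappa>" by (rule i\<kappa>[OF p(2)])
        then show "(case p of (i, j) \<Rightarrow> (Not (\<phi> i), b i j)) \<in>
          {(\<theta>, Inl \<circ> c)} \<union> {(\<phi> i, b i (\<eta> i)) | i. enat i < \<kappa>} \<union> {(Not (\<phi> i), b i j) | i j. enat i < \<kappa> \<and> j \<noteq> \<eta> i}"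
          using p(1,3) by simp blast
      qed
      moreover have "consistent N m ({(\<theta>, Inl \<circ> c)} \<union> {(\<phi> i, b i (\<eta> i)) | i. enat i < \<kappa>} \<union> {(Not (\<phi> i), b i j) | i j. enat i < \<kappa> \<and> j \<noteq> \<eta> i})"
        using pat by (simp add: ict_pattern_def)
      ultimately have "\<exists>x\<in>{..<m} \<rightarrow> carrier N. \<forall>(\<psi>, p)\<in>\<Sigma>. sat N (join_env m x p) \<psi>"
        unfolding consistent_def by blast
      then obtain x where x: "x \<in> {..<m} \<rightarrow> carrier N" "\<forall>(\<psi>, p)\<in>\<Sigma>. sat N (join_env m x p) \<psi>" by (elim bexE)
      let ?x = "\<lambda>k. if k < m then x k else Inl a"
      have jx: "join_env m ?x p = join_env m x p" for p by (auto simp: join_env_def)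
      show ?thesis
        unfolding sat_column_fm[OF eN B0 mB]
      proof (intro exI[of _ ?x] conjI allI impI)
        show "?x k \<in> carrier N" for k using x(1) aN by auto
        fix i j assume i: "i < t" and j: "j < n"
        have "sat N (join_env m ?x (pvals B m e i j)) (\<phi> i) \<longleftrightarrow> sat N (join_env m x (b i j)) (\<phi> i)"
          unfolding jx by (rule tail[OF i]) (use eb[OF i j] in simp)
        also have "\<dots> \<longleftrightarrow> j = \<eta> i"
        proof (cases "j = \<eta> i")
          case True
          have "(\<phi> i, b i (\<eta> i)) \<in> \<Sigma>" using i by (simp add: \<Sigma>_def)
          then show ?thesis using x(2) True by auto
        next
          case False
          have "(Not (\<phi> i), b i j) \<in> \<Sigma>" unfolding \<Sigma>_def using i j False by (intro UnI2 image_eqI[of _ _ "(i, j)"]) auto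
          then show ?thesis using x(2) False by auto
        qed
        finally show "sat N (join_env m ?x (pvals B m e i j)) (\<phi> i) \<longleftrightarrow> j = \<eta> i" .
      qed
    qed
    then have "sat N e (conjs (map (column_fm B m t \<phi> n) \<eta>s))" by simp
    then show ?thesis unfolding \<psi>_def
      using eN off by (subst sat_exs[where e = "\<lambda>_. Inl a", OF aN]) (rule exI[of _ e], intro conjI; assumption)
  qed
  moreover have "\<forall>\<phi> e. (\<forall>k. e k \<in> carrier M) \<longrightarrow> (sat M e \<phi> \<longleftrightarrow> sat N (Inl \<circ> e) \<phi>)"
    using el unfolding elementary_extension_def by (elim conjE)
  then have "sat M (\<lambda>_. a) \<psi> \<longleftrightarrow> sat N (Inl \<circ> (\<lambda>_. a)) \<psi>" using a by (elim allE[of _ \<psi>] allE[of _ "\<lambda>_. a"] impE) simp_all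
  ultimately have "sat M (\<lambda>_. a) \<psi>" by (simp only: comp_def)
  then have "\<exists>e. (\<forall>k. e k \<in> carrier M) \<and> (\<forall>k. k \<notin> set ks \<longrightarrow> e k = a) \<and> sat M e (conjs (map (column_fm B m t \<phi> n) \<eta>s))"
    unfolding \<psi>_def by (subst (asm) sat_exs[where e = "\<lambda>_. a", OF a])
  then obtain e where e0: "\<forall>k. e k \<in> carrier M" "sat M e (conjs (map (column_fm B m t \<phi> n) \<eta>s))" by (elim exE conjE)
  have e: "\<And>k. e k \<in> carrier M" "\<forall>\<eta>\<in>set \<eta>s. sat M e (column_fm B m t \<phi> n \<eta>)"
    using e0 by simp_all
  show ?thesis
  proof (intro exI[of _ "\<lambda>i j k. e (pvar_code B i j (m + k))"] allI impI)
    fix \<eta> assume \<eta>: "\<forall>i<t. \<eta> i < n"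
    have "restrict \<eta> {..<t} \<in> set \<eta>s" using \<eta> \<eta>s by auto
    then have "sat M e (column_fm B m t \<phi> n (restrict \<eta> {..<t}))" using e(2) by blast
    then obtain x where "\<forall>i<t. \<forall>j<n. sat M (join_env m x (pvals B m e i j)) (\<phi> i) \<longleftrightarrow> j = restrict \<eta> {..<t} i"
      unfolding sat_column_fm[OF e0(1) B0 mB] by (elim exE conjE)
    then show "\<exists>x. \<forall>i<t. \<forall>j<n. sat M (join_env m x (pvals B m e i j)) (\<phi> i) \<longleftrightarrow> j = \<eta> i"
      by (intro exI[of _ x]) simp
  qed
qed

section \<open>The dp-rank of affine space\<close>

lemma carrier_type_field: "carrier type_field = UNIV"
  by (simp add: ring_of_type_algebra_def)

lemma minus_type_field: "\<ominus>\<^bsub>type_field\<^esub> x = - (x :: 'a::field)"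
proof -
  interpret cring "type_field :: 'a ring" by (rule cring_from_type_algebra)
  show ?thesis by (rule minus_equality) (simp_all add: ring_of_type_algebra_def)
qed

lemma eval_term_Pol: "(\<lambda>e. eval_term type_field e s) \<in> Pol"
  by (induction s) (simp_all add: minus_type_field, simp_all add: ring_of_type_algebra_def pol.P_intros Pol_var)

lemma dfp_sat: "dfp (\<lambda>e. sat type_field e \<phi>)"
proof (induction \<phi>)
  case (Eq s t)
  then show ?case by (simp add: pol.QP_eq eval_term_Pol)
next
  case (Ex k \<phi>)
  from dfp_ex[OF this, of k] show ?case by (simp only: sat.simps carrier_type_field bex_UNIV)
qed (simp_all add: qs.QP_not qs.QP_conj)

text \<open>One slot per row: variables below m are the coordinates of the point, the others are
  read from the parameter tuple of row i.\<close>

definition slot0 :: "nat \<Rightarrow> nat \<Rightarrow> nat \<Rightarrow> (pvar \<Rightarrow> rxy) \<Rightarrow> rxy" where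
  "slot0 m i w e = (if w < m then e (Inl w) else e (Inr (i, 0, w - m)))"

lemma slot0_Pol: "slot0 m i w \<in> Pol"
  by (cases "w < m") (simp_all add: slot0_def[abs_def] Pol_var)

text \<open>With m + 1 rows and m coordinates some row i stays homogeneous over the point that
  realises a path; yet \<open>\<phi> i\<close> holds at the column of the path and fails at the next
  column.\<close>

theorem ict_pattern_depth:
  assumes pat: "ict_pattern (type_field :: rxy ring) m \<theta> c N \<kappa> \<phi> b"
  shows "\<kappa> \<le> enat m"
proof (rule ccontr)
  assume "\<not> \<kappa> \<le> enat m"
  then have t: "enat (Suc m) \<le> \<kappa>" by (metis eSuc_enat ileI1 not_le)
  define \<Delta> where "\<Delta> = (\<lambda>i e. sat type_field (\<lambda>w. slot0 m i w e) (\<phi> i)) ` {..<Suc m}"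
  have \<Delta>: "finite \<Delta>" "\<forall>Q\<in>\<Delta>. dfp Q"
    unfolding \<Delta>_def using dfp_subst[OF dfp_sat slot0_Pol] by auto
  obtain \<Delta>' r d where \<Delta>': "finite \<Delta>'" "\<forall>Q\<in>\<Delta>'. dfp Q" "0 < r"
    and add: "\<forall>b e0 R lo hi x. R \<subseteq> {..<Suc m} \<longrightarrow> m < card R \<longrightarrow> (\<forall>Q\<in>\<Delta>'. hom Q r b e0 R lo hi) \<longrightarrow>
      (\<exists>R'\<subseteq>R. R' \<noteq> {} \<and> (\<forall>Q\<in>\<Delta>. hom Q 1 b (\<lambda>j. if j < m then x j else e0 j) R' (lo + d) (hi - d)))"
    using add_coordinates[OF \<Delta>, of "Suc m" m] by (elim exE conjE)
  have "finite (Pow \<Delta>')" using \<Delta>'(1) by simp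
  \<comment> \<open>Width 2d + 2: after the loss of d columns on either side, the columns d and d +
    1 remain.\<close>
  from ramsey_array[OF this \<Delta>'(3), of "Suc m" "2 * d + 2"] obtain M :: nat where
    M: "\<forall>\<chi>. (\<forall>u. \<chi> u \<in> Pow \<Delta>') \<longrightarrow> (\<forall>u w. (\<forall>i<Suc m. \<forall>l<r. u i l = w i l) \<longrightarrow> \<chi> u = \<chi> w) \<longrightarrow>
    (\<exists>h. (\<forall>i<Suc m. \<forall>j<2 * d + 2. h i j < M) \<and> (\<forall>i<Suc m. inj_on (h i) {..<2 * d + 2}) \<and>
      (\<forall>u w. win {..<Suc m} r 0 (2 * d + 2) u \<longrightarrow> win {..<Suc m} r 0 (2 * d + 2) w \<longrightarrow> oeq {..<Suc m} r u w \<longrightarrow>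
        \<chi> (\<lambda>i l. h i (u i l)) = \<chi> (\<lambda>i l. h i (w i l))))"
    by (elim exE)
  have "carrier (type_field :: rxy ring) \<noteq> {}" by (simp add: ring_of_type_algebra_def)
  from pattern_finite[OF pat t this, of M] obtain b' :: "nat \<Rightarrow> nat \<Rightarrow> nat \<Rightarrow> rxy" where
    b': "\<forall>\<eta>. (\<forall>i<Suc m. \<eta> i < M) \<longrightarrow>
      (\<exists>x. \<forall>i<Suc m. \<forall>j<M. sat type_field (join_env m x (b' i j)) (\<phi> i) \<longleftrightarrow> j = \<eta> i)"
    by (elim exE)
  define \<chi> where "\<chi> u = {Q \<in> \<Delta>'. Q (arr r b' (\<lambda>_. 0) {..<Suc m} u)}" for u
  have c1: "\<forall>u. \<chi> u \<in> Pow \<Delta>'" by (auto simp: \<chi>_def)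
  have c2: "\<forall>u w. (\<forall>i<Suc m. \<forall>l<r. u i l = w i l) \<longrightarrow> \<chi> u = \<chi> w"
  proof (intro allI impI)
    fix u w :: "nat \<Rightarrow> nat \<Rightarrow> nat" assume "\<forall>i<Suc m. \<forall>l<r. u i l = w i l"
    then have "arr r b' (\<lambda>_. 0) {..<Suc m} u = arr r b' (\<lambda>_. 0) {..<Suc m} w" by (intro arr_cong) simp
    then show "\<chi> u = \<chi> w" by (simp add: \<chi>_def)
  qed
  obtain h where h: "\<forall>i<Suc m. \<forall>j<2 * d + 2. h i j < M" "\<forall>i<Suc m. inj_on (h i) {..<2 * d + 2}"
    "\<forall>u w. win {..<Suc m} r 0 (2 * d + 2) u \<longrightarrow> win {..<Suc m} r 0 (2 * d + 2) w \<longrightarrow> oeq {..<Suc m} r u w \<longrightarrow>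
        \<chi> (\<lambda>i l. h i (u i l)) = \<chi> (\<lambda>i l. h i (w i l))"
    using mp[OF mp[OF spec[OF M, of \<chi>] c1] c2] by (elim exE conjE)
  define b'' where "b'' i j = b' i (h i j)" for i j
  have arr'': "arr k b'' e0 R u = arr k b' e0 R (\<lambda>i l. h i (u i l))" for k e0 R u
    by (auto simp: arr_def b''_def fun_eq_iff split: sum.split)
  have hom: "\<forall>Q\<in>\<Delta>'. hom Q r b'' (\<lambda>_. 0) {..<Suc m} 0 (2 * d + 2)"
    unfolding hom_def
  proof (intro ballI allI impI)
    fix Q u w assume Q: "Q \<in> \<Delta>'" and uw: "win {..<Suc m} r 0 (2 * d + 2) u" "win {..<Suc m} r 0 (2 * d + 2) w" "oeq {..<Suc m} r u w"
    have "\<chi> (\<lambda>i l. h i (u i l)) = \<chi> (\<lambda>i l. h i (w i l))" using h(3) uw by blast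
    then have "Q \<in> \<chi> (\<lambda>i l. h i (u i l)) \<longleftrightarrow> Q \<in> \<chi> (\<lambda>i l. h i (w i l))" by simp
    then show "Q (arr r b'' (\<lambda>_. 0) {..<Suc m} u) = Q (arr r b'' (\<lambda>_. 0) {..<Suc m} w)"
      unfolding arr'' using Q by (simp add: \<chi>_def)
  qed
  have "\<forall>i<Suc m. h i d < M" using h(1) by simp
  then obtain x where x: "\<forall>i<Suc m. \<forall>j<M. sat type_field (join_env m x (b' i j)) (\<phi> i) \<longleftrightarrow> j = h i d"
    using b'[rule_format, of "\<lambda>i. h i d"] by blast
  have "\<exists>R'\<subseteq>{..<Suc m}. R' \<noteq> {} \<and> (\<forall>Q\<in>\<Delta>. hom Q 1 b'' (\<lambda>j. if j < m then x j else 0) R' (0 + d) (2 * d + 2 - d))"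
    using add[rule_format, of "{..<Suc m}" b'' "\<lambda>_. 0" 0 "2 * d + 2" x] hom by simp
  then obtain R' where R': "R' \<subseteq> {..<Suc m}" "R' \<noteq> {}"
    "\<forall>Q\<in>\<Delta>. hom Q 1 b'' (\<lambda>j. if j < m then x j else 0) R' (0 + d) (2 * d + 2 - d)" by (elim exE conjE)
  then obtain i where i: "i \<in> R'" by blast
  have im: "i < Suc m" using i R'(1) by blast
  let ?Q = "\<lambda>e. sat type_field (\<lambda>w. slot0 m i w e) (\<phi> i)"
  have "?Q \<in> \<Delta>" unfolding \<Delta>_def using im by blast
  then have hQ: "hom ?Q 1 b'' (\<lambda>j. if j < m then x j else 0) R' (0 + d) (2 * d + 2 - d)" using R'(3) by blast
  have val: "(\<lambda>w. slot0 m i w (arr 1 b'' (\<lambda>j. if j < m then x j else 0) R' (\<lambda>_ _. j))) = join_env m x (b' i (h i j))" for j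
    using i by (auto simp: fun_eq_iff slot0_def arr_def join_env_def b''_def)
  have "win R' 1 (0 + d) (2 * d + 2 - d) (\<lambda>_ _. d)" "win R' 1 (0 + d) (2 * d + 2 - d) (\<lambda>_ _. Suc d)"
    "oeq R' 1 (\<lambda>_ _. d) (\<lambda>_ _. Suc d)" by (simp_all add: win_def oeq_def)
  from homD[OF hQ this]
  have "sat type_field (join_env m x (b' i (h i d))) (\<phi> i) = sat type_field (join_env m x (b' i (h i (Suc d)))) (\<phi> i)"
    unfolding val .
  moreover have "h i d < M" "h i (Suc d) < M" using h(1) im by simp_all
  ultimately have "h i (Suc d) = h i d" using x im by simp
  moreover have "inj_on (h i) {..<2 * d + 2}" using h(2) im by simp
  ultimately show False by (auto dest: inj_onD)
qed

text \<open>The ground field as an elementary extension of itself. The lower bound needs no new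
  elements, and this copy is available for every type of new elements.\<close>

definition tagged :: "'n itself \<Rightarrow> ('a::field + 'n) ring" where
  "tagged T = \<lparr>carrier = range Inl, monoid.mult = (\<lambda>x y. Inl (projl x * projl y)), one = Inl 1,
     ring.zero = Inl 0, add = (\<lambda>x y. Inl (projl x + projl y))\<rparr>"

lemma ring_tagged: "ring (tagged T :: ('a::field + 'n) ring)"
proof (rule ringI)
  have "\<exists>y\<in>range Inl. Inl (projl y + a) = Inl 0" for a :: 'a
    by (rule bexI[of _ "Inl (- a)"]) auto
  then show "abelian_group (tagged T :: ('a + 'n) ring)"
    by (intro abelian_groupI) (auto simp: tagged_def algebra_simps)
  show "Group.monoid (tagged T :: ('a + 'n) ring)"
    by (intro monoidI) (auto simp: tagged_def algebra_simps)
qed (auto simp: tagged_def algebra_simps)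

lemma eval_term_tagged: "eval_term (tagged T :: ('a::field + 'n) ring) (Inl \<circ> e) s = Inl (eval_term type_field e s)"
proof (induction s)
  case (Minus s)
  interpret ring "tagged T :: ('a + 'n) ring" by (rule ring_tagged)
  have "\<ominus>\<^bsub>tagged T\<^esub> (Inl a :: 'a + 'n) = Inl (- a)" for a
    by (rule minus_equality) (simp_all add: tagged_def)
  then show ?case using Minus by (simp add: minus_type_field)
qed (simp_all add: tagged_def ring_of_type_algebra_def)

lemma sat_tagged: "sat (tagged T :: ('a::field + 'n) ring) (Inl \<circ> e) \<phi> \<longleftrightarrow> sat type_field e \<phi>"
proof (induction \<phi> arbitrary: e)
  case (Ex k \<phi>)
  have "(Inl \<circ> e)(k := Inl a :: 'a + 'n) = Inl \<circ> e(k := a)" for a by auto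
  then have "sat (tagged T :: ('a + 'n) ring) ((Inl \<circ> e)(k := Inl a)) \<phi> \<longleftrightarrow> sat type_field (e(k := a)) \<phi>" for a
    by (simp only: Ex.IH)
  moreover have "carrier (tagged T :: ('a + 'n) ring) = range Inl" by (simp add: tagged_def)
  ultimately show ?case by (simp only: sat.simps carrier_type_field bex_UNIV bex_simps)
qed (simp_all add: eval_term_tagged)

lemma elementary_extension_tagged: "elementary_extension type_field (tagged T :: ('a::field + 'n) ring)"
  unfolding elementary_extension_def by (auto simp: ring_tagged sat_tagged) (simp add: tagged_def)

text \<open>Row i speaks about coordinate i alone, so all paths are realised independently; the
  columns are the natural numbers, distinct in characteristic 0.\<close>

lemma coordinate_pattern:
  "ict_pattern (type_field :: 'a::field_char_0 ring) m (Eq Zero Zero) c (tagged T :: ('a + 'n) ring) (enat m)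
     (\<lambda>i. Eq (Var i) (Var m)) (\<lambda>i j k. Inl (of_nat j))"
  unfolding ict_pattern_def
proof (intro conjI allI elementary_extension_tagged)
  show "Inl (of_nat j) \<in> carrier (tagged T :: ('a + 'n) ring)" for j by (simp add: tagged_def)
  fix \<eta> :: "nat \<Rightarrow> nat"
  let ?\<Sigma> = "{(Eq Zero Zero, Inl \<circ> c)} \<union>
     {(Eq (Var i) (Var m), \<lambda>k. Inl (of_nat (\<eta> i))) | i. enat i < enat m} \<union>
     {(Not (Eq (Var i) (Var m)), \<lambda>k. Inl (of_nat j)) | i j. enat i < enat m \<and> j \<noteq> \<eta> i} :: (ring_formula \<times> (nat \<Rightarrow> 'a + 'n)) set"
  have sat: "sat (tagged T :: ('a + 'n) ring) (join_env m (\<lambda>i. Inl (of_nat (\<eta> i))) p) \<psi>" if "(\<psi>, p) \<in> ?\<Sigma>" for \<psi> p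
    using that by (auto simp: join_env_def)
  have "(\<lambda>i. Inl (of_nat (\<eta> i))) \<in> {..<m} \<rightarrow> carrier (tagged T :: ('a + 'n) ring)" by (simp add: tagged_def)
  then show "consistent (tagged T :: ('a + 'n) ring) m ?\<Sigma>"
    unfolding consistent_def using sat by (intro allI impI bexI[of _ "\<lambda>i. Inl (of_nat (\<eta> i))"]) blast+
qed

theorem dp_rank_affine: "dp_rank TYPE('n) (type_field :: rxy ring) m (Eq Zero Zero) c = enat m"
proof -
  let ?S = "{\<kappa>. \<exists>(N :: (rxy + 'n) ring) \<phi> b. ict_pattern (type_field :: rxy ring) m (Eq Zero Zero) c N \<kappa> \<phi> b}"
  have "enat m \<in> ?S" using coordinate_pattern by blast
  moreover have "\<kappa> \<le> enat m" if "\<kappa> \<in> ?S" for \<kappa> using that ict_pattern_depth by blast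
  ultimately show ?thesis unfolding dp_rank_def by (intro antisym[OF Sup_least Sup_upper])
qed

section \<open>Tensor products of coordinate algebras\<close>

lemma coord_algebra_simps:
  "carrier (coord_algebra e m) = UNIV" "x \<otimes>\<^bsub>coord_algebra e m\<^esub> y = m x y" "\<one>\<^bsub>coord_algebra e m\<^esub> = e"
  "\<zero>\<^bsub>coord_algebra e m\<^esub> = (\<lambda>_. 0)" "x \<oplus>\<^bsub>coord_algebra e m\<^esub> y = (\<lambda>i. x i + y i)"
  "c \<odot>\<^bsub>coord_algebra e m\<^esub> x = (\<lambda>i. c * x i)"
  by (simp_all add: coord_algebra_def)

lemma type_field_simps:
  "carrier type_field = UNIV" "\<one>\<^bsub>type_field\<^esub> = 1" "\<zero>\<^bsub>type_field\<^esub> = 0"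
  by (simp_all add: ring_of_type_algebra_def)

locale bilinear_coord =
  fixes m :: "('i::finite \<Rightarrow> 'a::field) \<Rightarrow> ('i \<Rightarrow> 'a) \<Rightarrow> ('i \<Rightarrow> 'a)"
  assumes addl: "m (\<lambda>i. x i + x' i) y = (\<lambda>i. m x y i + m x' y i)"
    and addr: "m y (\<lambda>i. x i + x' i) = (\<lambda>i. m y x i + m y x' i)"
    and scl: "m (\<lambda>i. c * x i) y = (\<lambda>i. c * m x y i)"
    and scr: "m y (\<lambda>i. c * x i) = (\<lambda>i. c * m y x i)"
begin

text \<open>Both sides of the associative law are trilinear and the unit laws are linear, so the
  basis suffices.\<close>

lemma assoc_algebraI:
  assumes assoc: "\<And>i j k. m (m (unit_vec i) (unit_vec j)) (unit_vec k) = m (unit_vec i) (m (unit_vec j) (unit_vec k))"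
    and one: "\<And>i. m e (unit_vec i) = unit_vec i" "\<And>i. m (unit_vec i) e = unit_vec i"
  shows "assoc_algebra type_field (coord_algebra e m)"
proof -
  note lin = addl addr scl scr
  have l: "m (m x y) z k = (\<Sum>p\<in>UNIV. x p * m (m (unit_vec p) y) z k)" "m x (m y z) k = (\<Sum>p\<in>UNIV. x p * m (unit_vec p) (m y z) k)" for x y z k
    by (rule linear_coord_expand[of "\<lambda>x. m (m x y) z"]; simp only: lin)
       (rule linear_coord_expand[of "\<lambda>x. m x (m y z)"]; simp only: lin)
  have mid: "m (m x y) z k = (\<Sum>p\<in>UNIV. y p * m (m x (unit_vec p)) z k)" "m x (m y z) k = (\<Sum>p\<in>UNIV. y p * m x (m (unit_vec p) z) k)" for x y z k
    by (rule linear_coord_expand[of "\<lambda>y. m (m x y) z"]; simp only: lin)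
       (rule linear_coord_expand[of "\<lambda>y. m x (m y z)"]; simp only: lin)
  have r: "m (m x y) z k = (\<Sum>p\<in>UNIV. z p * m (m x y) (unit_vec p) k)" "m x (m y z) k = (\<Sum>p\<in>UNIV. z p * m x (m y (unit_vec p)) k)" for x y z k
    by (rule linear_coord_expand[of "\<lambda>z. m (m x y) z"]; simp only: lin)
       (rule linear_coord_expand[of "\<lambda>z. m x (m y z)"]; simp only: lin)
  have as: "m (m x y) z = m x (m y z)" for x y z
  proof
    fix k
    have 1: "m (m (unit_vec p) (unit_vec q)) z k = m (unit_vec p) (m (unit_vec q) z) k" for p q
      by (rule trans[OF r(1)], rule sym, rule trans[OF r(2)]) (simp only: assoc)
    have 2: "m (m (unit_vec p) y) z k = m (unit_vec p) (m y z) k" for p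
      by (rule trans[OF mid(1)], rule sym, rule trans[OF mid(2)]) (simp only: 1)
    show "m (m x y) z k = m x (m y z) k"
      by (rule trans[OF l(1)], rule sym, rule trans[OF l(2)]) (simp only: 2)
  qed
  have one': "m e x = x" "m x e = x" for x
  proof -
    have "m e x k = (\<Sum>p\<in>UNIV. x p * m e (unit_vec p) k)" for k
      by (rule linear_coord_expand[of "m e"]; simp only: lin)
    then have "m e x = (\<lambda>k. \<Sum>p\<in>UNIV. x p * unit_vec p k)" unfolding one by (intro ext)
    moreover have "m x e k = (\<Sum>p\<in>UNIV. x p * m (unit_vec p) e k)" for k
      by (rule linear_coord_expand[of "\<lambda>x. m x e"]; simp only: lin)
    then have "m x e = (\<lambda>k. \<Sum>p\<in>UNIV. x p * unit_vec p k)" unfolding one by (intro ext)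
    ultimately show "m e x = x" "m x e = x" unfolding sum_unit_vec by simp_all
  qed
  have mod: "module type_field (coord_algebra e m)" by (rule module_coord_algebra)
  interpret module type_field "coord_algebra e m" by (rule mod)
  have "ring (coord_algebra e m)"
    by (intro ringI M.abelian_group_axioms monoidI) (simp_all add: coord_algebra_simps as one' addl addr)
  then show ?thesis using mod by (simp add: assoc_algebra_def coord_algebra_simps scl scr)
qed

end

lemma tensor_algebra_coord:
  "tensor_algebra A B = coord_algebra (pure_tensor \<one>\<^bsub>A\<^esub> \<one>\<^bsub>B\<^esub>) (\<lambda>x y k. \<Sum>p\<in>UNIV. \<Sum>q\<in>UNIV. x p * y q *
     pure_tensor (unit_vec (fst p) \<otimes>\<^bsub>A\<^esub> unit_vec (fst q)) (unit_vec (snd p) \<otimes>\<^bsub>B\<^esub> unit_vec (snd q)) k)"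
  by (simp add: tensor_algebra_def case_prod_beta)

lemma assoc_algebra_tensor:
  fixes A :: "('a::field, 'i::finite \<Rightarrow> 'a) module" and B :: "('a, 'j::finite \<Rightarrow> 'a) module"
  assumes A: "assoc_algebra type_field A" "A = coord_algebra e m"
    and B: "assoc_algebra type_field B" "B = coord_algebra e' m'"
  shows "assoc_algebra type_field (tensor_algebra A B)"
proof -
  interpret A: ring A using A(1) by (simp add: assoc_algebra_def)
  interpret B: ring B using B(1) by (simp add: assoc_algebra_def)
  have carr: "x \<in> carrier A" "y \<in> carrier B" for x y by (simp_all add: A(2) B(2) coord_algebra_simps)
  define T where "T = (\<lambda>x y k. \<Sum>p\<in>UNIV. \<Sum>q\<in>UNIV. x p * y q *
     pure_tensor (unit_vec (fst p) \<otimes>\<^bsub>A\<^esub> unit_vec (fst q)) (unit_vec (snd p) \<otimes>\<^bsub>B\<^esub> unit_vec (snd q)) k :: 'a)"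
  have T: "tensor_algebra A B = coord_algebra (pure_tensor \<one>\<^bsub>A\<^esub> \<one>\<^bsub>B\<^esub>) T"
    unfolding tensor_algebra_coord T_def ..
  have pt: "T (pure_tensor a b) (pure_tensor a' b') = pure_tensor (a \<otimes>\<^bsub>A\<^esub> a') (b \<otimes>\<^bsub>B\<^esub> b')" for a b a' b'
    using pure_tensor_mult[OF A B, of a b a' b'] unfolding T coord_algebra_simps .
  have u: "unit_vec p = pure_tensor (unit_vec (fst p)) (unit_vec (snd p))" for p by (simp add: pure_tensor_unit_vec)
  interpret bilinear_coord T
    by unfold_locales (simp_all add: T_def fun_eq_iff sum.distrib sum_distrib_left algebra_simps)
  show ?thesis
    unfolding T
    by (rule assoc_algebraI) (simp_all only: u pt A.m_assoc B.m_assoc carr A.l_one A.r_one B.l_one B.r_one)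
qed

text \<open>An element of the tensor product is read as a family of elements of A indexed by the
  basis of B; products then follow the multiplication table of B with entries multiplied in
  A.\<close>

lemma tensor_mult_rows:
  fixes A :: "('a::field, 'i::finite \<Rightarrow> 'a) module" and B :: "('a, 'j::finite \<Rightarrow> 'a) module"
  assumes A: "assoc_algebra type_field A" "A = coord_algebra e m"
  shows "(x \<otimes>\<^bsub>tensor_algebra A B\<^esub> y) (k, l) =
    (\<Sum>j\<in>UNIV. \<Sum>j'\<in>UNIV. ((\<lambda>i. x (i, j)) \<otimes>\<^bsub>A\<^esub> (\<lambda>i. y (i, j'))) k * (unit_vec j \<otimes>\<^bsub>B\<^esub> unit_vec j') l)"
proof -
  have "(x \<otimes>\<^bsub>tensor_algebra A B\<^esub> y) (k, l) = (\<Sum>i\<in>UNIV. \<Sum>j\<in>UNIV. \<Sum>i'\<in>UNIV. \<Sum>j'\<in>UNIV.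
      x (i, j) * y (i', j') * ((unit_vec i \<otimes>\<^bsub>A\<^esub> unit_vec i') k * (unit_vec j \<otimes>\<^bsub>B\<^esub> unit_vec j') l))"
    unfolding tensor_algebra_def coord_algebra_simps
    by (simp only: UNIV_Times_UNIV[symmetric] sum.cartesian_product[symmetric] pure_tensor_def prod.case)
  also have "\<dots> = (\<Sum>j\<in>UNIV. \<Sum>i\<in>UNIV. \<Sum>i'\<in>UNIV. \<Sum>j'\<in>UNIV.
      x (i, j) * y (i', j') * ((unit_vec i \<otimes>\<^bsub>A\<^esub> unit_vec i') k * (unit_vec j \<otimes>\<^bsub>B\<^esub> unit_vec j') l))"
    by (rule sum.swap)
  also have "\<dots> = (\<Sum>j\<in>UNIV. \<Sum>i\<in>UNIV. \<Sum>j'\<in>UNIV. \<Sum>i'\<in>UNIV.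
      x (i, j) * y (i', j') * ((unit_vec i \<otimes>\<^bsub>A\<^esub> unit_vec i') k * (unit_vec j \<otimes>\<^bsub>B\<^esub> unit_vec j') l))"
    by (rule sum.cong[OF refl], rule sum.cong[OF refl], rule sum.swap)
  also have "\<dots> = (\<Sum>j\<in>UNIV. \<Sum>j'\<in>UNIV. \<Sum>i\<in>UNIV. \<Sum>i'\<in>UNIV.
      x (i, j) * y (i', j') * ((unit_vec i \<otimes>\<^bsub>A\<^esub> unit_vec i') k * (unit_vec j \<otimes>\<^bsub>B\<^esub> unit_vec j') l))"
    by (rule sum.cong[OF refl], rule sum.swap)
  also have "\<dots> = (\<Sum>j\<in>UNIV. \<Sum>j'\<in>UNIV. ((\<lambda>i. x (i, j)) \<otimes>\<^bsub>A\<^esub> (\<lambda>i. y (i, j'))) k * (unit_vec j \<otimes>\<^bsub>B\<^esub> unit_vec j') l)"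
    unfolding coord_algebra_mult_expand[OF A, of "\<lambda>i. x (i, _)"] by (simp only: sum_distrib_right mult.assoc)
  finally show ?thesis .
qed

lemma scalars_type_field: "scalars type_field (coord_algebra e m) = (\<lambda>c i. c * e i) ` UNIV"
  by (simp add: scalars_def type_field_simps coord_algebra_simps)

lemma scalars_hom:
  assumes F: "field F" and A: "assoc_algebra F A"
  shows "(\<lambda>c. c \<odot>\<^bsub>A\<^esub> \<one>\<^bsub>A\<^esub>) \<in> ring_hom F A"
proof -
  interpret F: field F by (rule F)
  interpret A: ring A using A(1) by (simp add: assoc_algebra_def)
  interpret M: module F A using A(1) by (simp add: assoc_algebra_def)
  have smult_l: "(c \<odot>\<^bsub>A\<^esub> x) \<otimes>\<^bsub>A\<^esub> y = c \<odot>\<^bsub>A\<^esub> (x \<otimes>\<^bsub>A\<^esub> y)" if "c \<in> carrier F" "x \<in> carrier A" "y \<in> carrier A" for c x y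
    using A(1) that unfolding assoc_algebra_def by blast
  show ?thesis
  proof (rule ring_hom_memI)
    fix c d assume cd: "c \<in> carrier F" "d \<in> carrier F"
    have "(c \<odot>\<^bsub>A\<^esub> \<one>\<^bsub>A\<^esub>) \<otimes>\<^bsub>A\<^esub> (d \<odot>\<^bsub>A\<^esub> \<one>\<^bsub>A\<^esub>) = c \<odot>\<^bsub>A\<^esub> (\<one>\<^bsub>A\<^esub> \<otimes>\<^bsub>A\<^esub> (d \<odot>\<^bsub>A\<^esub> \<one>\<^bsub>A\<^esub>))"
      using smult_l[OF cd(1) A.one_closed M.smult_closed[OF cd(2) A.one_closed]] .
    then show "(c \<otimes>\<^bsub>F\<^esub> d) \<odot>\<^bsub>A\<^esub> \<one>\<^bsub>A\<^esub> = (c \<odot>\<^bsub>A\<^esub> \<one>\<^bsub>A\<^esub>) \<otimes>\<^bsub>A\<^esub> (d \<odot>\<^bsub>A\<^esub> \<one>\<^bsub>A\<^esub>)"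
      using cd by (simp add: M.smult_assoc1)
  qed (simp_all add: M.smult_l_distr)
qed

lemma subfield_scalars:
  assumes F: "field F" and A: "assoc_algebra F A" "\<one>\<^bsub>A\<^esub> \<noteq> \<zero>\<^bsub>A\<^esub>"
  shows "subfield (scalars F A) A"
proof -
  interpret F: field F by (rule F)
  interpret A: ring A using A(1) by (simp add: assoc_algebra_def)
  interpret ring_hom_ring F A "\<lambda>c. c \<odot>\<^bsub>A\<^esub> \<one>\<^bsub>A\<^esub>"
    by (intro ring_hom_ringI2 F.ring_axioms A.ring_axioms scalars_hom F A)
  show ?thesis unfolding scalars_def using img_is_subfield(2)[OF F.carrier_is_subfield A(2)] .
qed

theorem dimension_coord_algebra:
  fixes e :: "'i::finite \<Rightarrow> 'a::field"
  assumes A: "assoc_algebra type_field (coord_algebra e m)"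
  shows "ring.dimension (coord_algebra e m) (card (UNIV :: 'i set)) (scalars type_field (coord_algebra e m)) (carrier (coord_algebra e m))"
proof -
  let ?A = "coord_algebra e m" and ?K = "scalars type_field (coord_algebra e m)"
  interpret ring ?A using A by (simp add: assoc_algebra_def)
  have sc: "(\<lambda>i. c * e i) \<otimes>\<^bsub>?A\<^esub> x = (\<lambda>i. c * x i)" for c x
  proof -
    have "(c \<odot>\<^bsub>?A\<^esub> \<one>\<^bsub>?A\<^esub>) \<otimes>\<^bsub>?A\<^esub> x = c \<odot>\<^bsub>?A\<^esub> (\<one>\<^bsub>?A\<^esub> \<otimes>\<^bsub>?A\<^esub> x)"
      using A unfolding assoc_algebra_def by (auto simp: type_field_simps coord_algebra_simps)
    then show ?thesis using l_one[of x] by (simp add: coord_algebra_simps)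
  qed
  have "dimension (card S) ?K {f. \<forall>i. i \<notin> S \<longrightarrow> f i = 0}" if "finite S" for S
    using that
  proof (induction S rule: finite_induct)
    case empty
    have "{f. \<forall>i. i \<notin> {} \<longrightarrow> f i = 0} = {\<zero>\<^bsub>?A\<^esub>}" by (auto simp: coord_algebra_simps)
    then show ?case by (metis card.empty zero_dim)
  next
    case (insert j S)
    have "line_extension ?K (unit_vec j) {f. \<forall>i. i \<notin> S \<longrightarrow> f i = 0} = {f. \<forall>i. i \<notin> insert j S \<longrightarrow> f i = 0}"
    proof (rule Set.set_eqI)
      fix f :: "'i \<Rightarrow> 'a"
      have "f \<in> line_extension ?K (unit_vec j) {f. \<forall>i. i \<notin> S \<longrightarrow> f i = 0} \<longleftrightarrow>
        (\<exists>c g. (\<forall>i. i \<notin> S \<longrightarrow> g i = 0) \<and> f = (\<lambda>i. c * unit_vec j i + g i))"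
        unfolding line_extension_mem_iff scalars_type_field by (auto simp: sc) (auto simp: coord_algebra_simps)
      also have "\<dots> \<longleftrightarrow> f \<in> {f. \<forall>i. i \<notin> insert j S \<longrightarrow> f i = 0}"
      proof
        assume "f \<in> {f. \<forall>i. i \<notin> insert j S \<longrightarrow> f i = 0}"
        then show "\<exists>c g. (\<forall>i. i \<notin> S \<longrightarrow> g i = 0) \<and> f = (\<lambda>i. c * unit_vec j i + g i)"
          by (intro exI[of _ "f j"] exI[of _ "\<lambda>i. if i = j then 0 else f i"]) (auto simp: unit_vec_def fun_eq_iff)
      qed (auto simp: unit_vec_def)
      finally show "f \<in> line_extension ?K (unit_vec j) {f. \<forall>i. i \<notin> S \<longrightarrow> f i = 0} \<longleftrightarrow> f \<in> {f. \<forall>i. i \<notin> insert j S \<longrightarrow> f i = 0}" .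
    qed
    moreover have "dimension (Suc (card S)) ?K (line_extension ?K (unit_vec j) {f. \<forall>i. i \<notin> S \<longrightarrow> f i = 0})"
      using insert by (intro Suc_dim) (auto simp: coord_algebra_simps unit_vec_def)
    ultimately show ?case using insert by simp
  qed
  from this[of UNIV] show ?thesis by (simp add: coord_algebra_simps)
qed

section \<open>The biquaternion algebra is a division algebra\<close>

text \<open>Pulling out q gives p + q u = q (c + u), and the product of c + u with u - \<sigma>(c)
  is u u - c \<sigma>(c), a nonzero element of S. Working with right inverses alone suffices, since
  the right inverse of a right inverse shows it to be two-sided.\<close>

lemma right_inverse_double:
  fixes u :: "'a::ring_1"
  assumes closed: "\<And>a b. a \<in> S \<Longrightarrow> b \<in> S \<Longrightarrow> a * b \<in> S" "\<And>a b. a \<in> S \<Longrightarrow> b \<in> S \<Longrightarrow> a - b \<in> S" "0 \<in> S"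
    and inv: "\<And>a. a \<in> S \<Longrightarrow> a \<noteq> 0 \<Longrightarrow> \<exists>b\<in>S. a * b = 1"
    and \<sigma>: "\<And>a. a \<in> S \<Longrightarrow> \<sigma> a \<in> S" "\<And>a. a \<in> S \<Longrightarrow> u * a = \<sigma> a * u" "\<And>a. a \<in> S \<Longrightarrow> \<sigma> (\<sigma> a) = a"
    and u: "u * u \<in> S" "\<And>c. c \<in> S \<Longrightarrow> c * \<sigma> c \<noteq> u * u"
    and pq: "p \<in> S" "q \<in> S" "p + q * u \<noteq> 0"
  shows "\<exists>r\<in>S. \<exists>s\<in>S. (p + q * u) * (r + s * u) = 1"
proof (cases "q = 0")
  case True
  then obtain b where "b \<in> S" "p * b = 1" using inv[of p] pq by auto
  then show ?thesis using True closed(3) by (intro bexI[of _ b] bexI[of _ 0]) auto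
next
  case False
  then obtain q' where q': "q' \<in> S" "q * q' = 1" using inv[OF pq(2)] by blast
  define c where "c = q' * p"
  have c: "c \<in> S" using q' pq closed by (simp add: c_def)
  define d where "d = u * u - c * \<sigma> c"
  have d: "d \<in> S" "d \<noteq> 0" using c \<sigma>(1) u(1) u(2)[OF c] closed by (simp_all add: d_def)
  then obtain t where t: "t \<in> S" "d * t = 1" using inv by blast
  define w where "w = t * q'"
  have w: "w \<in> S" using t q' closed by (simp add: w_def)
  have qc: "q * c = p" using q'(2) by (simp add: c_def mult.assoc[symmetric])
  have q1: "q' \<noteq> 0" using q'(2) by auto
  then obtain q'' where q'': "q' * q'' = 1" using inv[OF q'(1)] by blast
  have "q = q * (q' * q'')" using q'' by simp
  also have "\<dots> = q''" unfolding mult.assoc[symmetric] q'(2) by simp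
  finally have q'q: "q' * q = 1" using q'' by simp
  have "(c + u) * (u - \<sigma> c) = c * u - c * \<sigma> c + u * u - u * \<sigma> c" by (simp add: algebra_simps)
  also have "u * \<sigma> c = c * u" using \<sigma>(2)[OF \<sigma>(1)[OF c]] \<sigma>(3)[OF c] by simp
  finally have cu: "(c + u) * (u - \<sigma> c) = d" by (simp add: d_def)
  have "(p + q * u) * ((u - \<sigma> c) * w) = q * ((c + u) * (u - \<sigma> c)) * w"
    unfolding qc[symmetric] by (simp add: algebra_simps)
  also have "\<dots> = q * (d * t) * q'" unfolding cu w_def by (simp add: mult.assoc)
  also have "\<dots> = 1" using t(2) q'(2) by simp
  finally have "(p + q * u) * ((u - \<sigma> c) * w) = 1" .
  moreover have "(u - \<sigma> c) * w = (0 - \<sigma> c * w) + \<sigma> w * u"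
    using \<sigma>(2)[OF w] by (simp add: algebra_simps)
  moreover have "0 - \<sigma> c * w \<in> S" by (rule closed(2)[OF closed(3) closed(1)[OF \<sigma>(1)[OF c] w]])
  moreover have "\<sigma> w \<in> S" by (rule \<sigma>(1)[OF w])
  ultimately show ?thesis by metis
qed

text \<open>By Hensel's lemma these are exactly the squares of F. In this form closure under
  addition is visible, which is the pythagorean property.\<close>

definition ev :: "rxy \<Rightarrow> bool" where
  "ev f \<longleftrightarrow> f = 0 \<or> 0 < lc f \<and> even (vx f) \<and> even (vy f)"

lemma ev_0 [simp]: "ev 0" by (simp add: ev_def)

lemma ev_square: "ev (f\<^sup>2)"
proof (cases "f = 0")
  case False
  then have "0 < lc f * lc f" by (metis lc_eq_0_iff not_real_square_gt_zero)
  then show ?thesis using False by (simp add: ev_def power2_eq_square vx_mult vy_mult)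
qed simp

lemma ev_1 [simp]: "ev 1" using ev_square[of 1] by simp

lemma vv_min: "vv f \<le> vv g \<Longrightarrow> vy f \<le> vy g" by (auto simp: vv_def lin_le_iff)

lemma ev_add: assumes "ev f" "ev g" shows "ev (f + g)"
proof (cases "f = 0 \<or> g = 0")
  case False
  then have fg: "0 < lc f" "0 < lc g" "even (vx f)" "even (vy f)" "even (vx g)" "even (vy g)" using assms by (auto simp: ev_def)
  note p = pos_add[OF fg(1,2)]
  have "vv (f + g) = vv f \<or> vv (f + g) = vv g" using p(2) by (simp add: min_def)
  then show ?thesis using p(1) fg by (auto simp: ev_def vv_def)
qed (use assms in auto)

lemma ev_add_0: assumes "ev f" "ev g" "f + g = 0" shows "f = 0" "g = 0"
proof -
  have "f = 0"
  proof (rule ccontr)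
    assume f: "f \<noteq> 0"
    then have "g \<noteq> 0" using assms(3) by auto
    then have "0 < lc (f + g)" using f assms(1,2) by (intro pos_add) (auto simp: ev_def)
    then show False using assms(3) by simp
  qed
  then show "f = 0" "g = 0" using assms(3) by simp_all
qed

lemma ev_X: assumes "ev f" "ev g" "f = fX * g" shows "g = 0"
  using assms by (auto simp: ev_def vx_mult)

text \<open>X-orders of different parity exclude equal valuations, and with them
  cancellation.\<close>

lemma vy_add_parity:
  assumes "f \<noteq> 0" "g \<noteq> 0" "even (vx f) \<noteq> even (vx g)"
  shows "f + g \<noteq> 0" "vy (f + g) = min (vy f) (vy g)"
proof -
  have ne: "vv f \<noteq> vv g" using assms(3) by (auto simp: vv_def)
  then consider "vv f < vv g" | "vv g < vv f" by (cases "vv f" "vv g" rule: linorder_cases) auto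
  then have "f + g \<noteq> 0 \<and> vy (f + g) = min (vy f) (vy g)"
  proof cases
    case 1
    then have "vv (f + g) = vv f" "f + g \<noteq> 0" using add_less[of f g] assms by auto
    then show ?thesis using vv_min[of f g] 1 by (simp add: vv_def)
  next
    case 2
    then have "vv (g + f) = vv g" "g + f \<noteq> 0" using add_less[of g f] assms by auto
    then show ?thesis using vv_min[of g f] 2 by (simp add: vv_def add.commute)
  qed
  then show "f + g \<noteq> 0" "vy (f + g) = min (vy f) (vy g)" by simp_all
qed

text \<open>\<open>A - X B\<close> and \<open>Q\<close> are the two coordinates of a sum of four squares in \<open>F(\<surd>-X)\<close>, which is
  again a field of iterated Laurent series; the norm of such a sum has \<open>Y\<close>-order divisible by \<open>4\<close>.\<close>

lemma norm_not_Y2: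
  assumes A: "ev A" and B: "ev B" and Q: "ev (A + B + Q)" "ev (A + B - Q)"
  shows "(A - fX * B)\<^sup>2 + fX * Q\<^sup>2 \<noteq> fY\<^sup>2"
proof
  assume eq: "(A - fX * B)\<^sup>2 + fX * Q\<^sup>2 = fY\<^sup>2"
  \<comment> \<open>A + B + Q and A + B - Q are both nonnegative, so Q is bounded by A + B in the
    order and therefore in valuation.\<close>
  have Q0: "vv (A + B) \<le> vv Q \<and> A + B \<noteq> 0" if "Q \<noteq> 0"
  proof (rule ccontr)
    assume "\<not> ?thesis"
    then have n: "A + B = 0 \<or> vv Q < vv (A + B)" by auto
    have "lc (A + B + Q) = lc Q" using add_less(2)[OF that n] by (simp add: add.commute)
    moreover have "lc (A + B - Q) = - lc Q" using add_less(2)[of "- Q" "A + B"] that n by (simp add: add.commute)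
    ultimately show False using Q that lc_eq_0_iff[of Q] by (auto simp: ev_def)
  qed
  have sum: "A + B \<noteq> 0"
  proof
    assume "A + B = 0"
    then have "A = 0" "B = 0" "Q = 0" using ev_add_0[OF A B] Q0 by auto
    then show False using eq by simp
  qed
  \<comment> \<open>The X-orders of A and X B differ in parity, so their difference has the same
    Y-order as A + B.\<close>
  have P: "A - fX * B \<noteq> 0 \<and> vy (A - fX * B) = vy (A + B) \<and> even (vx ((A - fX * B)\<^sup>2)) \<and> vy ((A - fX * B)\<^sup>2) = 2 * vy (A + B)"
  proof -
    have "A - fX * B \<noteq> 0 \<and> vy (A - fX * B) = vy (A + B)"
    proof (cases "A = 0 \<or> B = 0")
      case True
      then show ?thesis using sum vy_uminus[of "fX * B"] by (auto simp: vy_mult)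
    next
      case False
      then have h: "0 < lc A" "0 < lc B" "even (vx A)" "even (vx B)" using A B by (auto simp: ev_def)
      have "vx (- (fX * B)) = 1 + vx B" "vy (- (fX * B)) = vy B" using False by (simp_all only: vx_uminus vy_uminus) (simp_all add: vx_mult vy_mult)
      then have "A + - (fX * B) \<noteq> 0" "vy (A + - (fX * B)) = min (vy A) (vy B)"
        using vy_add_parity[of A "- (fX * B)"] h False by auto
      moreover have "vy (A + B) = min (vy A) (vy B)"
        using pos_add(2)[OF h(1,2)] vv_min[of A B] vv_min[of B A] by (auto simp: min_def vv_def split: if_splits)
      ultimately show ?thesis by simp
    qed
    then show ?thesis by (simp add: power2_eq_square vx_mult vy_mult)
  qed
  have ev: "even (vy (A + B))" using ev_add[OF A B] sum by (simp add: ev_def)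
  have "vy ((A - fX * B)\<^sup>2 + fX * Q\<^sup>2) = 2 * vy (A + B)"
  proof (cases "Q = 0")
    case False
    then have q: "fX * Q\<^sup>2 \<noteq> 0" "vx (fX * Q\<^sup>2) = 1 + 2 * vx Q" "vy (fX * Q\<^sup>2) = 2 * vy Q"
      by (simp_all add: vx_mult vy_mult power2_eq_square)
    have "vy (A + B) \<le> vy Q" using Q0[OF False] vv_min by blast
    then show ?thesis using vy_add_parity(2)[of "(A - fX * B)\<^sup>2" "fX * Q\<^sup>2"] P q by auto
  qed (use P in simp)
  moreover have "vy (fY\<^sup>2) = 2" by (simp add: power2_eq_square vy_mult)
  ultimately have "vy (A + B) = 1" using eq by simp
  then show False using ev by simp
qed

section \<open>The biquaternion algebra as four rows of quaternions\<close>

abbreviation DA :: "(rxy, quat_basis \<Rightarrow> rxy) module" where "DA \<equiv> quaternion_algebra fX (- 1)"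
abbreviation DB :: "(rxy, quat_basis \<Rightarrow> rxy) module" where "DB \<equiv> quaternion_algebra (- fX) fY"
abbreviation DD :: "(rxy, quat_basis \<times> quat_basis \<Rightarrow> rxy) module" where "DD \<equiv> tensor_algebra DA DB"

lemma DD_assoc: "assoc_algebra type_field DD"
  by (rule assoc_algebra_tensor[OF assoc_algebra_quaternion quaternion_algebra_def assoc_algebra_quaternion quaternion_algebra_def])

lemma DD_coord: "\<exists>m. DD = coord_algebra (unit_vec (Q1, Q1)) m"
proof -
  have "\<one>\<^bsub>quaternion_algebra u v\<^esub> = unit_vec Q1" for u v :: rxy by (simp add: quaternion_algebra_def coord_algebra_simps)
  then have "pure_tensor \<one>\<^bsub>DA\<^esub> \<one>\<^bsub>DB\<^esub> = unit_vec (Q1, Q1)" by (simp only: pure_tensor_unit_vec)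
  note eq = tensor_algebra_coord[of DA DB, unfolded this]
  show ?thesis by (rule exI, rule eq)
qed

lemma DD_simps:
  "carrier DD = UNIV" "\<zero>\<^bsub>DD\<^esub> = (\<lambda>_. 0)" "x \<oplus>\<^bsub>DD\<^esub> y = (\<lambda>i. x i + y i)" "c \<odot>\<^bsub>DD\<^esub> x = (\<lambda>i. c * x i)"
  "\<one>\<^bsub>DD\<^esub> = unit_vec (Q1, Q1)"
  using DD_coord by (auto simp: coord_algebra_simps)

text \<open>A type of its own makes the algebra an instance of \<open>ring_1\<close>, as
  \<open>right_inverse_double\<close> expects.\<close>

typedef bq = "UNIV :: (quat_basis \<times> quat_basis \<Rightarrow> rxy) set" morphisms co mk by simp

lemmas bq_simps [simp] = mk_inverse[OF UNIV_I] co_inverse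

instantiation bq :: ring_1
begin
definition "0 = mk (\<lambda>_. 0)"
definition "1 = mk (unit_vec (Q1, Q1))"
definition "x + y = mk (\<lambda>p. co x p + co y p)"
definition "- x = mk (\<lambda>p. - co x p)"
definition "x - y = mk (\<lambda>p. co x p - co y p)"
definition "x * y = mk (co x \<otimes>\<^bsub>DD\<^esub> co y)"
instance
proof
  interpret ring DD using DD_assoc by (simp add: assoc_algebra_def)
  fix a b c :: bq
  show "(a + b) + c = a + (b + c)" "a + b = b + a" "0 + a = a" "- a + a = 0" "a - b = a + - b"
    by (simp_all add: plus_bq_def zero_bq_def uminus_bq_def minus_bq_def algebra_simps)
  show "(a * b) * c = a * (b * c)" using m_assoc[of "co a" "co b" "co c"] by (simp add: times_bq_def DD_simps)
  show "1 * a = a" "a * 1 = a" using l_one[of "co a"] r_one[of "co a"] by (simp_all add: times_bq_def one_bq_def DD_simps)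
  show "(a + b) * c = a * c + b * c" "a * (b + c) = a * b + a * c"
    using l_distr[of "co a" "co b" "co c"] r_distr[of "co b" "co c" "co a"] by (simp_all add: times_bq_def plus_bq_def DD_simps)
  show "(0 :: bq) \<noteq> 1"
  proof
    assume "(0 :: bq) = 1"
    then have "co 0 (Q1, Q1) = co 1 (Q1, Q1)" by simp
    then show False by (simp add: zero_bq_def one_bq_def unit_vec_def)
  qed
qed
end

text \<open>The coordinate in D1 that belongs to the basis element j of D2; an element of D is
  treated as four quaternions.\<close>

definition row :: "bq \<Rightarrow> quat_basis \<Rightarrow> quat_basis \<Rightarrow> rxy" where "row x j k = co x (k, j)"

lemma bq_eqI: "(\<And>j k. row x j k = row y j k) \<Longrightarrow> x = y"
  unfolding row_def by (metis co_inject ext surj_pair)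

definition of_rows :: "(quat_basis \<Rightarrow> quat_basis \<Rightarrow> rxy) \<Rightarrow> bq" where "of_rows r = mk (\<lambda>(k, j). r j k)"

lemma row_simps [simp]:
  "row (of_rows r) = r" "row 0 j k = 0" "row (x + y) j k = row x j k + row y j k" "row (x - y) j k = row x j k - row y j k"
  "row (- x) j k = - row x j k"
  by (simp_all add: row_def[abs_def] of_rows_def zero_bq_def plus_bq_def minus_bq_def uminus_bq_def)

definition qm :: "(quat_basis \<Rightarrow> rxy) \<Rightarrow> (quat_basis \<Rightarrow> rxy) \<Rightarrow> quat_basis \<Rightarrow> rxy" where
  "qm a b q = (case q of
       Q1 \<Rightarrow> a Q1 * b Q1 + fX * a QI * b QI - a QJ * b QJ + fX * a QIJ * b QIJ
     | QI \<Rightarrow> a Q1 * b QI + a QI * b Q1 + a QJ * b QIJ - a QIJ * b QJ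
     | QJ \<Rightarrow> a Q1 * b QJ + a QJ * b Q1 + fX * a QI * b QIJ - fX * a QIJ * b QI
     | QIJ \<Rightarrow> a Q1 * b QIJ + a QIJ * b Q1 + a QI * b QJ - a QJ * b QI)"

lemma qm_D1: "a \<otimes>\<^bsub>DA\<^esub> b = qm a b"
  by (auto simp: quaternion_algebra_def coord_algebra_simps qm_def fun_eq_iff split: quat_basis.split)

lemma qm_zero [simp]: "qm (\<lambda>_. 0) b = (\<lambda>_. 0)" "qm a (\<lambda>_. 0) = (\<lambda>_. 0)"
  by (auto simp: qm_def fun_eq_iff split: quat_basis.split)

lemma qm_one [simp]: "qm (unit_vec Q1) b = b" "qm a (unit_vec Q1) = a"
  by (auto simp: qm_def fun_eq_iff unit_vec_def split: quat_basis.split)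

lemma row_mult:
  "row (x * y) l k =
    (case l of
       Q1 \<Rightarrow> qm (row x Q1) (row y Q1) k - fX * qm (row x QI) (row y QI) k + fY * qm (row x QJ) (row y QJ) k
          + fX * fY * qm (row x QIJ) (row y QIJ) k
     | QI \<Rightarrow> qm (row x Q1) (row y QI) k + qm (row x QI) (row y Q1) k - fY * qm (row x QJ) (row y QIJ) k
          + fY * qm (row x QIJ) (row y QJ) k
     | QJ \<Rightarrow> qm (row x Q1) (row y QJ) k + qm (row x QJ) (row y Q1) k - fX * qm (row x QI) (row y QIJ) k
          + fX * qm (row x QIJ) (row y QI) k
     | QIJ \<Rightarrow> qm (row x Q1) (row y QIJ) k + qm (row x QIJ) (row y Q1) k + qm (row x QI) (row y QJ) k
          - qm (row x QJ) (row y QI) k)"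
proof -
  have "row (x * y) l k = (\<Sum>j\<in>UNIV. \<Sum>j'\<in>UNIV. qm (row x j) (row y j') k * (unit_vec j \<otimes>\<^bsub>DB\<^esub> unit_vec j') l)"
    unfolding row_def[abs_def] times_bq_def bq_simps qm_D1[symmetric]
    by (rule tensor_mult_rows[OF assoc_algebra_quaternion quaternion_algebra_def])
  also have "\<dots> = (\<Sum>j\<in>{Q1, QI, QJ, QIJ}. \<Sum>j'\<in>{Q1, QI, QJ, QIJ}. qm (row x j) (row y j') k * (unit_vec j \<otimes>\<^bsub>DB\<^esub> unit_vec j') l)"
    unfolding UNIV_quat_basis ..
  finally show ?thesis
    by (cases l) (simp_all add: quaternion_algebra_def coord_algebra_simps unit_vec_def)
qed

definition emb :: "(quat_basis \<Rightarrow> rxy) \<Rightarrow> bq" where "emb a = of_rows (\<lambda>j. if j = Q1 then a else (\<lambda>_. 0))"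
definition i2 :: bq where "i2 = of_rows (\<lambda>j. if j = QI then unit_vec Q1 else (\<lambda>_. 0))"
definition j2 :: bq where "j2 = of_rows (\<lambda>j. if j = QJ then unit_vec Q1 else (\<lambda>_. 0))"

lemma rows: "row (emb a) = (\<lambda>j. if j = Q1 then a else (\<lambda>_. 0))" "row i2 = (\<lambda>j. if j = QI then unit_vec Q1 else (\<lambda>_. 0))"
  "row j2 = (\<lambda>j. if j = QJ then unit_vec Q1 else (\<lambda>_. 0))"
  by (simp_all add: emb_def i2_def j2_def)

lemma emb_row: "row (emb a) Q1 = a" by (simp add: rows)

lemma emb_inj: "emb a = emb b \<longleftrightarrow> a = b" by (metis emb_row)

lemma emb_mult: "emb a * emb b = emb (qm a b)"
  by (rule bq_eqI) (simp add: row_mult rows split: quat_basis.split)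

lemma emb_diff: "emb a - emb b = emb (\<lambda>k. a k - b k)"
  by (rule bq_eqI) (simp add: rows)

lemma emb_zero: "emb (\<lambda>_. 0) = 0" by (rule bq_eqI) (simp add: rows)

lemma emb_one: "emb (unit_vec Q1) = 1"
  by (rule bq_eqI) (simp add: emb_def of_rows_def row_def one_bq_def unit_vec_def)

lemma gens: "i2 * emb a = emb a * i2" "j2 * emb a = emb a * j2" "j2 * i2 = - (i2 * j2)"
  "i2 * i2 = emb (\<lambda>k. - fX * unit_vec Q1 k)" "j2 * j2 = emb (\<lambda>k. fY * unit_vec Q1 k)"
  by (rule bq_eqI; simp add: row_mult rows split: quat_basis.split)+

lemma bq_decomp: "x = (emb (row x Q1) + emb (row x QI) * i2) + (emb (row x QJ) + emb (row x QIJ) * i2) * j2"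
  by (rule bq_eqI) (simp add: distrib_right row_mult rows split: quat_basis.split)

definition vec :: "rxy \<Rightarrow> rxy \<Rightarrow> rxy \<Rightarrow> rxy \<Rightarrow> quat_basis \<Rightarrow> rxy" where
  "vec a b c d q = (case q of Q1 \<Rightarrow> a | QI \<Rightarrow> b | QJ \<Rightarrow> c | QIJ \<Rightarrow> d)"

lemma vec_simps [simp]: "vec a b c d Q1 = a" "vec a b c d QI = b" "vec a b c d QJ = c" "vec a b c d QIJ = d"
  by (simp_all add: vec_def)

lemma quat_eq_iff: "a = b \<longleftrightarrow> a Q1 = b Q1 \<and> a QI = b QI \<and> a QJ = b QJ \<and> a QIJ = (b QIJ :: 'a)"
proof safe
  assume h: "a Q1 = b Q1" "a QI = b QI" "a QJ = b QJ" "a QIJ = b QIJ"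
  show "a = b"
  proof
    fix q show "a q = b q" using h by (cases q) simp_all
  qed
qed

lemma norm_D1:
  assumes "a \<noteq> (\<lambda>_. 0)"
  shows "(a Q1)\<^sup>2 - fX * (a QI)\<^sup>2 + (a QJ)\<^sup>2 - fX * (a QIJ)\<^sup>2 \<noteq> (0 :: rxy)"
proof
  let ?f = "(a Q1)\<^sup>2 + (a QJ)\<^sup>2" and ?g = "(a QI)\<^sup>2 + (a QIJ)\<^sup>2"
  assume "(a Q1)\<^sup>2 - fX * (a QI)\<^sup>2 + (a QJ)\<^sup>2 - fX * (a QIJ)\<^sup>2 = 0"
  then have "?f = fX * ?g" by (simp add: algebra_simps)
  moreover have e: "ev ?f" "ev ?g" by (intro ev_add ev_square)+
  ultimately have "?g = 0" "?f = 0" using ev_X by auto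
  then have "(a Q1)\<^sup>2 = 0" "(a QJ)\<^sup>2 = 0" "(a QI)\<^sup>2 = 0" "(a QIJ)\<^sup>2 = 0"
    using ev_add_0[OF ev_square ev_square] by blast+
  then show False using assms by (simp add: quat_eq_iff)
qed

lemma right_inverse_D1: assumes "a \<noteq> (\<lambda>_. 0)" shows "\<exists>b. qm a b = unit_vec Q1"
proof -
  define n where "n = (a Q1)\<^sup>2 - fX * (a QI)\<^sup>2 + (a QJ)\<^sup>2 - fX * (a QIJ)\<^sup>2"
  have n: "n \<noteq> 0" using norm_D1[OF assms] by (simp add: n_def)
  define c where "c = inverse n"
  have nc: "n * c = 1" using n by (simp add: c_def)
  let ?b = "vec (a Q1 * c) (- a QI * c) (- a QJ * c) (- a QIJ * c)"
  have "qm a ?b Q1 = n * c" by (simp add: qm_def n_def power2_eq_square algebra_simps)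
  moreover have "qm a ?b QI = 0" "qm a ?b QJ = 0" "qm a ?b QIJ = 0" by (simp_all add: qm_def algebra_simps)
  ultimately have "qm a ?b = unit_vec Q1" unfolding quat_eq_iff nc by (simp add: unit_vec_def)
  then show ?thesis by blast
qed

text \<open>The condition for the first doubling, where \<sigma> is trivial. A square root of -X in
  D1 is either a pure quaternion, and then a square equals X times a nonzero sum of squares, or a
  scalar, and then a square has odd X-order.\<close>

lemma minus_X_not_square: "qm a a \<noteq> (\<lambda>k. - fX * unit_vec Q1 k)"
proof
  assume eq: "qm a a = (\<lambda>k. - fX * unit_vec Q1 k)"
  have e: "(a Q1)\<^sup>2 + fX * (a QI)\<^sup>2 - (a QJ)\<^sup>2 + fX * (a QIJ)\<^sup>2 = - fX"
    "a Q1 * a QI = 0" "a Q1 * a QJ = 0" "a Q1 * a QIJ = 0"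
    using fun_cong[OF eq, of Q1] fun_cong[OF eq, of QI] fun_cong[OF eq, of QJ] fun_cong[OF eq, of QIJ]
    by (simp_all add: qm_def unit_vec_def power2_eq_square algebra_simps)
  show False
  proof (cases "a Q1 = 0")
    case True
    then have "(a QJ)\<^sup>2 = fX * ((a QI)\<^sup>2 + (a QIJ)\<^sup>2 + 1)" using e(1) by (simp add: algebra_simps)
    from ev_X[OF _ _ this] have "(a QI)\<^sup>2 + (a QIJ)\<^sup>2 + 1 = 0" by (simp add: ev_add ev_square)
    from ev_add_0(2)[OF _ _ this] show False by (simp add: ev_add ev_square)
  next
    case False
    then have "(a Q1)\<^sup>2 + fX = 0" using e by simp
    then have "vx ((a Q1)\<^sup>2) = vx fX" by (metis add.inverse_unique vx_uminus)
    moreover have "vx ((a Q1)\<^sup>2) = 2 * vx (a Q1)" using False by (simp add: power2_eq_square vx_mult)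
    ultimately have "2 * vx (a Q1) = 1" by simp
    then show False by presburger
  qed
qed

lemma two_mult_0: "2 * (u :: rxy) = 0 \<Longrightarrow> u = 0" by simp

text \<open>Let i be the central square root of -X, z = a + b i and z' = a - b i. The hypothesis and
  the excluded equation together say z z' = Y. Taking reduced norms over F(i), the norm of Nrd(z)
  from F(i) to F would be \<open>Y^2\<close>; and Nrd(z) is a sum of four squares because -X is a
  square in F(i).\<close>

lemma Y_not_twisted_square:
  assumes "qm a b = qm b a"
  shows "(\<lambda>k. qm a a k + fX * qm b b k) \<noteq> (\<lambda>k. fY * unit_vec Q1 k)"
proof
  assume eq: "(\<lambda>k. qm a a k + fX * qm b b k) = (\<lambda>k. fY * unit_vec Q1 k)"
  obtain a0 a1 a2 a3 b0 b1 b2 b3 where ab: "a = vec a0 a1 a2 a3" "b = vec b0 b1 b2 b3"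
    by (metis quat_eq_iff vec_simps)
  have w: "a0 * a1 + fX * b0 * b1 = 0" "a0 * a2 + fX * b0 * b2 = 0" "a0 * a3 + fX * b0 * b3 = 0"
  proof -
    have h: "2 * (a0 * a1 + fX * b0 * b1) = 0" "2 * (a0 * a2 + fX * b0 * b2) = 0" "2 * (a0 * a3 + fX * b0 * b3) = 0"
      using fun_cong[OF eq, of QI] fun_cong[OF eq, of QJ] fun_cong[OF eq, of QIJ]
      by (simp_all add: ab qm_def unit_vec_def algebra_simps)
    show "a0 * a1 + fX * b0 * b1 = 0" "a0 * a2 + fX * b0 * b2 = 0" "a0 * a3 + fX * b0 * b3 = 0"
      by (rule h[THEN two_mult_0])+
  qed
  have m: "a2 * b3 - a3 * b2 = 0" "a1 * b3 - a3 * b1 = 0" "a1 * b2 - a2 * b1 = 0"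
  proof -
    have h: "2 * (a2 * b3 - a3 * b2) = 0" "2 * (fX * (a1 * b3 - a3 * b1)) = 0" "2 * (a1 * b2 - a2 * b1) = 0"
      using fun_cong[OF assms, of QI] fun_cong[OF assms, of QJ] fun_cong[OF assms, of QIJ]
      by (simp_all add: ab qm_def algebra_simps)
    show "a2 * b3 - a3 * b2 = 0" "a1 * b2 - a2 * b1 = 0" by (rule h[THEN two_mult_0])+
    show "a1 * b3 - a3 * b1 = 0" using two_mult_0[OF h(2)] by simp
  qed
  have E: "a0\<^sup>2 + fX * a1\<^sup>2 - a2\<^sup>2 + fX * a3\<^sup>2 + fX * (b0\<^sup>2 + fX * b1\<^sup>2 - b2\<^sup>2 + fX * b3\<^sup>2) = fY"
    using fun_cong[OF eq, of Q1] by (simp add: ab qm_def unit_vec_def power2_eq_square algebra_simps)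
  define A where "A = a0\<^sup>2 + a2\<^sup>2 + (fX * b1)\<^sup>2 + (fX * b3)\<^sup>2"
  define B where "B = a1\<^sup>2 + a3\<^sup>2 + b0\<^sup>2 + b2\<^sup>2"
  define Q where "Q = 2 * (a0 * b0 - fX * a1 * b1 + a2 * b2 - fX * a3 * b3)"
  \<comment> \<open>Multiplicativity of the reduced norm, written out in coordinates: A - X B and Q
    are the components of Nrd(z) at 1 and i, and the correction terms on the right vanish by
    \<open>w\<close> and \<open>m\<close>.\<close>
  have "(A - fX * B)\<^sup>2 + fX * Q\<^sup>2 =
    (a0\<^sup>2 + fX * a1\<^sup>2 - a2\<^sup>2 + fX * a3\<^sup>2 + fX * (b0\<^sup>2 + fX * b1\<^sup>2 - b2\<^sup>2 + fX * b3\<^sup>2))\<^sup>2 +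
    4 * (- fX * (a0 * a1 + fX * b0 * b1)\<^sup>2 + (a0 * a2 + fX * b0 * b2)\<^sup>2 - fX * (a0 * a3 + fX * b0 * b3)\<^sup>2) -
    4 * fX * (- fX * (a1 * b2 - a2 * b1)\<^sup>2 + fX\<^sup>2 * (a1 * b3 - a3 * b1)\<^sup>2 - fX * (a2 * b3 - a3 * b2)\<^sup>2)"
    unfolding A_def B_def Q_def by (simp add: power2_eq_square algebra_simps)
  then have "(A - fX * B)\<^sup>2 + fX * Q\<^sup>2 = fY\<^sup>2" unfolding w m E by simp
  moreover have "A + B + Q = (a0 + b0)\<^sup>2 + (a2 + b2)\<^sup>2 + (a1 - fX * b1)\<^sup>2 + (a3 - fX * b3)\<^sup>2"
    "A + B - Q = (a0 - b0)\<^sup>2 + (a2 - b2)\<^sup>2 + (a1 + fX * b1)\<^sup>2 + (a3 + fX * b3)\<^sup>2"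
    unfolding A_def B_def Q_def by (simp_all add: power2_eq_square algebra_simps)
  then have "ev (A + B + Q)" "ev (A + B - Q)" by (simp_all only: ev_add ev_square)
  moreover have "ev A" "ev B" unfolding A_def B_def by (intro ev_add ev_square)+
  ultimately show False using norm_not_Y2 by blast
qed

text \<open>The elements of D1 with the central square root of -X adjoined, the division ring
  between the two doublings.\<close>

definition e2 :: "(quat_basis \<Rightarrow> rxy) \<Rightarrow> (quat_basis \<Rightarrow> rxy) \<Rightarrow> bq" where
  "e2 a b = of_rows (\<lambda>j. if j = Q1 then a else if j = QI then b else (\<lambda>_. 0))"

lemma row_e2: "row (e2 a b) = (\<lambda>j. if j = Q1 then a else if j = QI then b else (\<lambda>_. 0))"
  by (simp add: e2_def)

lemma qm_minus: "qm u (\<lambda>k. - v k) = (\<lambda>k. - qm u v k)" "qm (\<lambda>k. - u k) v = (\<lambda>k. - qm u v k)"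
  by (rule ext, rename_tac k, case_tac k; simp add: qm_def)+

lemma e2_eq: "emb a + emb b * i2 = e2 a b"
  by (rule bq_eqI) (simp add: row_e2 row_mult rows split: quat_basis.split)

lemma e2_mult: "e2 a b * e2 c d = e2 (\<lambda>k. qm a c k - fX * qm b d k) (\<lambda>k. qm a d k + qm b c k)"
  by (rule bq_eqI) (simp add: row_e2 row_mult split: quat_basis.split)

lemma e2_diff: "e2 a b - e2 c d = e2 (\<lambda>k. a k - c k) (\<lambda>k. b k - d k)"
  by (rule bq_eqI) (simp add: row_e2)

lemma e2_zero: "e2 (\<lambda>_. 0) (\<lambda>_. 0) = 0"
  by (rule bq_eqI) (simp add: row_e2)

lemma e2_j2: "j2 * e2 a b = e2 a (\<lambda>k. - b k) * j2" "j2 * j2 = e2 (\<lambda>k. fY * unit_vec Q1 k) (\<lambda>_. 0)"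
  by (rule bq_eqI; simp add: row_e2 row_mult rows split: quat_basis.split)+

lemma e2_inj: "e2 a b = e2 c d \<longleftrightarrow> a = c \<and> b = d"
proof
  assume "e2 a b = e2 c d"
  then have "row (e2 a b) Q1 = row (e2 c d) Q1" "row (e2 a b) QI = row (e2 c d) QI" by simp_all
  then show "a = c \<and> b = d" by (simp add: row_e2)
qed simp

theorem bq_right_inverse: assumes "(x :: bq) \<noteq> 0" shows "\<exists>y. x * y = 1"
proof -
  let ?S = "range emb"
  have S: "\<And>a b. a \<in> ?S \<Longrightarrow> b \<in> ?S \<Longrightarrow> a * b \<in> ?S" "\<And>a b. a \<in> ?S \<Longrightarrow> b \<in> ?S \<Longrightarrow> a - b \<in> ?S" "0 \<in> ?S"
    using emb_zero by (auto simp: emb_mult emb_diff)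
  have inv: "\<exists>b\<in>?S. a * b = 1" if a: "a \<in> ?S" "a \<noteq> 0" for a
  proof -
    obtain a' where a': "a = emb a'" using a by blast
    then have "a' \<noteq> (\<lambda>_. 0)" using a(2) emb_zero by auto
    then obtain b where "qm a' b = unit_vec Q1" using right_inverse_D1 by blast
    then have "a * emb b = 1" by (simp add: a' emb_mult emb_one)
    then show ?thesis by blast
  qed
  define S' where "S' = range (\<lambda>(a, b). e2 a b)"
  have S'I: "e2 a b \<in> S'" for a b unfolding S'_def by (rule range_eqI[of _ _ "(a, b)"]) simp
  have S'E: "\<exists>a b. x = e2 a b" if "x \<in> S'" for x using that unfolding S'_def by auto
  have inv': "\<exists>b\<in>S'. a * b = 1" if a: "a \<in> S'" "a \<noteq> 0" for a
  proof -
    obtain p q where pq: "a = e2 p q" using S'E[OF a(1)] by blast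
    have "\<exists>r\<in>?S. \<exists>s\<in>?S. (emb p + emb q * i2) * (r + s * i2) = 1"
    proof (rule right_inverse_double[where \<sigma> = "\<lambda>a. a", OF S inv])
      show "i2 * a = a * i2" if "a \<in> ?S" for a using that gens(1) by auto
      show "c * c \<noteq> i2 * i2" if "c \<in> ?S" for c
        using that minus_X_not_square by (auto simp: gens(4) emb_mult emb_inj)
      show "i2 * i2 \<in> ?S" by (simp add: gens(4))
    qed (use a pq in \<open>auto simp: e2_eq\<close>)
    then obtain r s where "e2 p q * e2 r s = 1" by (auto simp: e2_eq)
    then show ?thesis unfolding pq using S'I by blast
  qed
  \<comment> \<open>\<open>j2\<close> commutes with D1 and anticommutes with \<open>i2\<close>, so
    it induces the automorphism that changes the sign of the square root of -X.\<close>
  define \<sigma> where "\<sigma> x = e2 (row x Q1) (\<lambda>k. - row x QI k)" for x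
  have \<sigma>: "\<sigma> (e2 a b) = e2 a (\<lambda>k. - b k)" for a b by (simp add: \<sigma>_def row_e2)
  obtain p q where x: "x = p + q * j2" "p \<in> S'" "q \<in> S'" using bq_decomp[of x] S'I unfolding e2_eq by blast
  have "\<exists>r\<in>S'. \<exists>s\<in>S'. (p + q * j2) * (r + s * j2) = 1"
  proof (rule right_inverse_double[where S = S' and \<sigma> = \<sigma> and u = j2, OF _ _ _ inv'])
    fix a b assume ab0: "a \<in> S'" "b \<in> S'"
    obtain a1 a2 where a: "a = e2 a1 a2" using S'E[OF ab0(1)] by (elim exE)
    obtain b1 b2 where b: "b = e2 b1 b2" using S'E[OF ab0(2)] by (elim exE)
    note ab = a b
    show "a * b \<in> S'" unfolding ab e2_mult by (rule S'I)
    show "a - b \<in> S'" unfolding ab e2_diff by (rule S'I)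
  next
    show "0 \<in> S'" unfolding e2_zero[symmetric] by (rule S'I)
  next
    fix a assume "a \<in> S'"
    then obtain a1 a2 where a: "a = e2 a1 a2" using S'E by blast
    show "\<sigma> a \<in> S'" unfolding a \<sigma> by (rule S'I)
    show "j2 * a = \<sigma> a * j2" unfolding a \<sigma> by (rule e2_j2)
    show "\<sigma> (\<sigma> a) = a" unfolding a \<sigma> by simp
    show "a * \<sigma> a \<noteq> j2 * j2"
    proof
      assume "a * \<sigma> a = j2 * j2"
      then have eq: "(\<lambda>k. qm a1 a1 k + fX * qm a2 a2 k) = (\<lambda>k. fY * unit_vec Q1 k)" "(\<lambda>k. qm a2 a1 k - qm a1 a2 k) = (\<lambda>_. 0)"
        unfolding a \<sigma> e2_mult e2_j2(2) e2_inj qm_minus by simp_all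
      from eq(2) have "qm a1 a2 = qm a2 a1" by (auto simp: fun_eq_iff)
      with eq(1) show False using Y_not_twisted_square by blast
    qed
  next
    show "j2 * j2 \<in> S'" unfolding e2_j2 by (rule S'I)
  qed (use x assms in auto)
  then show ?thesis using x(1) by blast
qed

text \<open>Commuting with \<open>i2\<close> and \<open>j2\<close> kills three of the four rows;
  commuting with the generators of D1 then leaves a scalar.\<close>

theorem bq_center:
  assumes "\<And>y. z * y = y * z"
  shows "\<exists>c. z = emb (\<lambda>k. c * unit_vec Q1 k)"
proof -
  let ?z = "row z"
  have nz: "u = 0" if "u = - u" for u :: rxy
  proof (rule two_mult_0)
    have "u + u = 0" using that by (metis add.right_inverse)
    then show "2 * u = 0" by simp
  qed
  have i: "row (z * i2) l k = row (i2 * z) l k" and j: "row (z * j2) l k = row (j2 * z) l k" for l k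
    by (simp_all only: assms)
  have l: "row (z * i2) QJ k = fX * ?z QIJ k" "row (i2 * z) QIJ k = ?z QJ k" "row (z * j2) QIJ k = ?z QI k" for k
    by (simp_all add: row_mult rows)
  have r: "row (i2 * z) QJ k = - (fX * ?z QIJ k)" "row (z * i2) QIJ k = - ?z QJ k" "row (j2 * z) QIJ k = - ?z QI k" for k
    by (simp_all add: row_mult rows)
  have e: "fX * ?z QIJ k = - (fX * ?z QIJ k)" "?z QJ k = - ?z QJ k" "?z QI k = - ?z QI k" for k
    by (rule i[of QJ k, unfolded l r], rule i[of QIJ k, unfolded l r, symmetric], rule j[of QIJ k, unfolded l r])
  have "?z QIJ k = 0" "?z QJ k = 0" "?z QI k = 0" for k
    using nz[OF e(1)[of k]] nz[OF e(2)[of k]] nz[OF e(3)[of k]] by simp_all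
  note zero = this
  have z: "z = emb (?z Q1)"
  proof (rule bq_eqI)
    fix j k show "?z j k = row (emb (?z Q1)) j k" by (cases j) (simp_all add: zero rows)
  qed
  have comm: "qm (?z Q1) b = qm b (?z Q1)" for b
  proof -
    have "emb (qm (?z Q1) b) = emb (qm b (?z Q1))" unfolding emb_mult[symmetric] z[symmetric] by (rule assms)
    then show ?thesis by (simp only: emb_inj)
  qed
  have "2 * ?z Q1 QJ = 0" "2 * (fX * ?z Q1 QIJ) = 0" "2 * ?z Q1 QI = 0"
    using fun_cong[OF comm[of "vec 0 1 0 0"], of QIJ] fun_cong[OF comm[of "vec 0 1 0 0"], of QJ] fun_cong[OF comm[of "vec 0 0 1 0"], of QIJ]
    by (simp_all add: qm_def eq_neg_iff_add_eq_0 neg_eq_iff_add_eq_0)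
  then have "?z Q1 QJ = 0" "?z Q1 QIJ = 0" "?z Q1 QI = 0" by simp_all
  then have "?z Q1 = (\<lambda>k. ?z Q1 Q1 * unit_vec Q1 k)" unfolding quat_eq_iff by (simp add: unit_vec_def)
  from trans[OF z arg_cong[where f = emb, OF this]] show ?thesis by (rule exI)
qed

lemma ring_DD: "ring DD" using DD_assoc by (simp add: assoc_algebra_def)

lemma co_mult: "co (x * y) = co x \<otimes>\<^bsub>DD\<^esub> co y" by (simp add: times_bq_def)

theorem division_DD: "division_algebra type_field DD"
proof -
  interpret ring DD by (rule ring_DD)
  have ne: "\<one>\<^bsub>DD\<^esub> \<noteq> \<zero>\<^bsub>DD\<^esub>"
  proof
    assume "\<one>\<^bsub>DD\<^esub> = \<zero>\<^bsub>DD\<^esub>"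
    then have "unit_vec (Q1, Q1) (Q1, Q1) = (0 :: rxy)" by (simp add: DD_simps)
    then show False by (simp add: unit_vec_def)
  qed
  have "x \<in> Units DD" if x: "x \<noteq> \<zero>\<^bsub>DD\<^esub>" for x
  proof -
    have "mk x \<noteq> 0" using x unfolding zero_bq_def by (simp add: mk_inject DD_simps)
    then obtain y where y: "mk x * y = 1" using bq_right_inverse by blast
    then have "y \<noteq> 0" by auto
    then obtain z where z: "y * z = 1" using bq_right_inverse by blast
    have "mk x = mk x * (y * z)" using z by simp
    also have "\<dots> = z" unfolding mult.assoc[symmetric] y by simp
    finally have yx: "y * mk x = 1" using z by simp
    have "x \<otimes>\<^bsub>DD\<^esub> co y = \<one>\<^bsub>DD\<^esub>" "co y \<otimes>\<^bsub>DD\<^esub> x = \<one>\<^bsub>DD\<^esub>"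
      using arg_cong[OF y, of co] arg_cong[OF yx, of co] by (simp_all add: co_mult one_bq_def DD_simps)
    then show ?thesis unfolding Units_def by (auto simp: DD_simps)
  qed
  moreover have "\<zero>\<^bsub>DD\<^esub> \<notin> Units DD" using ne Units_l_inv_ex[of "\<zero>\<^bsub>DD\<^esub>"] by auto
  ultimately show ?thesis unfolding division_algebra_def using DD_assoc ne by (auto simp: DD_simps)
qed

theorem center_DD: "ring_center DD = scalars type_field DD"
proof (rule Set.set_eqI, rule iffI)
  fix z assume "z \<in> ring_center DD"
  then have "mk z * y = y * mk z" for y unfolding ring_center_def by (simp add: times_bq_def DD_simps)
  then obtain c where "mk z = emb (\<lambda>k. c * unit_vec Q1 k)" using bq_center by blast
  then have "z = co (emb (\<lambda>k. c * unit_vec Q1 k))" by (metis bq_simps(1))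
  also have "\<dots> = c \<odot>\<^bsub>DD\<^esub> \<one>\<^bsub>DD\<^esub>" by (auto simp: emb_def of_rows_def DD_simps unit_vec_def)
  finally show "z \<in> scalars type_field DD" by (simp add: scalars_def type_field_simps)
next
  interpret ring DD by (rule ring_DD)
  fix z assume "z \<in> scalars type_field DD"
  then obtain c where z: "z = c \<odot>\<^bsub>DD\<^esub> \<one>\<^bsub>DD\<^esub>" by (auto simp: scalars_def)
  have "z \<otimes>\<^bsub>DD\<^esub> x = x \<otimes>\<^bsub>DD\<^esub> z" for x
  proof -
    have "(c \<odot>\<^bsub>DD\<^esub> \<one>\<^bsub>DD\<^esub>) \<otimes>\<^bsub>DD\<^esub> x = c \<odot>\<^bsub>DD\<^esub> (\<one>\<^bsub>DD\<^esub> \<otimes>\<^bsub>DD\<^esub> x)" "x \<otimes>\<^bsub>DD\<^esub> (c \<odot>\<^bsub>DD\<^esub> \<one>\<^bsub>DD\<^esub>) = c \<odot>\<^bsub>DD\<^esub> (x \<otimes>\<^bsub>DD\<^esub> \<one>\<^bsub>DD\<^esub>)"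
      using DD_assoc unfolding assoc_algebra_def by (simp_all add: DD_simps(1) type_field_simps)
    then show ?thesis using l_one[of x] r_one[of x] by (simp add: z DD_simps(1))
  qed
  then show "z \<in> ring_center DD" unfolding ring_center_def by (simp add: DD_simps)
qed

lemma field_type_field: "field type_field"
  by (rule field_from_type_algebra)

lemma one_DD: "\<one>\<^bsub>DD\<^esub> \<noteq> \<zero>\<^bsub>DD\<^esub>"
  using division_DD by (simp add: division_algebra_def)

theorem dimension_DD: "ring.dimension DD 16 (scalars type_field DD) (carrier DD)"
proof -
  obtain m where m: "DD = coord_algebra (unit_vec (Q1, Q1)) m" using DD_coord by blast
  have "card (UNIV :: (quat_basis \<times> quat_basis) set) = 16"
    by (simp add: UNIV_quat_basis UNIV_Times_UNIV[symmetric] card_cartesian_product del: UNIV_Times_UNIV)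
  with dimension_coord_algebra[OF DD_assoc[unfolded m]] show ?thesis unfolding m by simp
qed

lemma dim_DD: "ring.dim DD (scalars type_field DD) (carrier DD) = 16"
proof -
  interpret ring DD by (rule ring_DD)
  show ?thesis
    unfolding dim_def using dimension_DD dimension_is_inj[OF subfield_scalars[OF field_type_field DD_assoc one_DD]]
    by (intro the_equality) auto
qed

section \<open>Cyclic extensions of degree four\<close>

text \<open>Dividing by the square of a monomial of half the valuation leaves a unit with positive
  residue, which has a square root by Hensel's lemma. The summand 4 keeps the sum away from
  0.\<close>

lemma pythagorean:
  fixes q :: rxy
  shows "\<exists>s. s \<noteq> 0 \<and> s\<^sup>2 = 4 + q\<^sup>2"
proof -
  define f where "f = 4 + q\<^sup>2"
  have "ev (2\<^sup>2 + q\<^sup>2)" by (intro ev_add ev_square)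
  moreover have "(4 :: rxy) = 2\<^sup>2" by simp
  ultimately have ev: "ev f" by (simp only: f_def)
  have f0: "f \<noteq> 0"
  proof
    assume "f = 0"
    then have "(2 :: rxy)\<^sup>2 = 0" using ev_add_0(1)[OF ev_square ev_square, of 2 q] by (simp add: f_def)
    then show False by simp
  qed
  then have l: "0 < lc f" "even (vx f)" "even (vy f)" using ev by (auto simp: ev_def)
  define z where "z = mon (vy f div 2) (vx f div 2)"
  have z: "z \<noteq> 0" "vv (z\<^sup>2) = vv f" "lc (z\<^sup>2) = 1"
    using l by (auto simp: z_def power2_eq_square vv_def vx_mult vy_mult)
  define g where "g = f / z\<^sup>2"
  have g: "g \<noteq> 0" "vv g = 0" "lc g = lc f" using f0 z by (simp_all add: g_def vv_divide lc_divide)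
  have gO: "g \<in> O2" "res g = lc f" using g by (auto simp: O2_def res_eq)
  let ?p = "[:- g, 0, 1:]"
  have cO: "coeff ?p i \<in> O2" for i
    using gO(1) by (auto simp: coeff_pCons O2_def split: nat.split)
  have res0: "res 0 = 0" "res 1 = 1" by (simp_all add: res_eq O2_def)
  have resg: "res (- g) = - lc f" using gO g by (simp add: res_eq O2_def)
  have mp: "map_poly res ?p = [:- lc f, 0, 1:]" by (simp add: map_poly_pCons res0 resg)
  have "sqrt (lc f) * sqrt (lc f) = lc f" using l(1) by simp
  then obtain w where w: "w \<in> O2" "res w = sqrt (lc f)" "poly ?p w = 0"
    using hensel[of ?p "sqrt (lc f)"] cO l(1) by (auto simp: mp pderiv_pCons)
  then have "w * w = g" by simp
  then have "(z * w)\<^sup>2 = f" using z(1) by (simp add: g_def power2_eq_square field_simps)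
  moreover have "z * w \<noteq> 0" using calculation f0 by auto
  ultimately show ?thesis unfolding f_def by blast
qed

text \<open>If \<open>\<sigma>\<^sup>2 \<theta> = -\<theta>\<close> then \<open>e = \<sigma>(\<theta>) \<theta>\<close> satisfies \<open>\<sigma> e = -e\<close>, and \<open>\<theta>\<^sup>2 - \<sigma>(\<theta>\<^sup>2) = q e\<close> with \<open>q \<in> F\<close>;
  hence \<open>(4 + q\<^sup>2) e\<^sup>2\<close> is the square of \<open>\<theta>\<^sup>2 + \<sigma>(\<theta>\<^sup>2) \<in> F\<close>, and as \<open>4 + q\<^sup>2\<close> is a nonzero square
  in \<open>F\<close>, this puts \<open>e\<close> into \<open>F\<close>.\<close>

lemma no_cyclic_quartic:
  fixes K (structure)
  assumes cyc: "cyclic_extension (type_field :: rxy ring) K n \<sigma>"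
    and four: "\<And>x. x \<in> carrier K \<Longrightarrow> \<sigma> (\<sigma> (\<sigma> (\<sigma> x))) = x"
    and x: "x \<in> carrier K" "\<sigma> (\<sigma> x) \<noteq> x"
  shows False
proof -
  interpret K: field K using cyc by (simp add: cyclic_extension_def)
  have A: "assoc_algebra (type_field :: rxy ring) K" using cyc by (simp add: cyclic_extension_def)
  have iso: "\<sigma> \<in> ring_iso K K" using cyc by (simp add: cyclic_extension_def algebra_iso_def)
  then have hom: "\<sigma> \<in> ring_hom K K" and inj: "inj_on \<sigma> (carrier K)" by (auto simp: ring_iso_def bij_betw_def)
  interpret h: ring_hom_ring K K \<sigma> by (intro ring_hom_ringI2 K.ring_axioms hom)
  interpret i: ring_hom_ring "type_field :: rxy ring" K "\<lambda>c. c \<odot> \<one>"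
    by (intro ring_hom_ringI2 K.ring_axioms scalars_hom field_type_field A field.is_ring)
  have fixed: "y \<in> scalars type_field K" if y: "y \<in> carrier K" "\<sigma> y = y" for y
  proof -
    have "(\<sigma> ^^ k) y = y" for k by (induction k) (simp_all add: y)
    then have "\<forall>\<tau>\<in>algebra_iso type_field K K. \<tau> y = y" using cyc y(1) unfolding cyclic_extension_def by metis
    then show ?thesis using cyc y(1) unfolding cyclic_extension_def by blast
  qed
  define \<theta> where "\<theta> = x \<ominus> \<sigma> (\<sigma> x)"
  define \<theta>' where "\<theta>' = \<sigma> \<theta>"
  have \<theta>: "\<theta> \<in> carrier K" "\<theta>' \<in> carrier K" using x by (simp_all add: \<theta>_def \<theta>'_def)
  have \<theta>0: "\<theta> \<noteq> \<zero>" using x by (simp add: \<theta>_def)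
  have sub: "\<sigma> (a \<ominus> b) = \<sigma> a \<ominus> \<sigma> b" if "a \<in> carrier K" "b \<in> carrier K" for a b
    using that by (simp add: a_minus_def)
  \<comment> \<open>Here the fourth power of \<sigma> being trivial enters, applied to x.\<close>
  have s\<theta>': "\<sigma> \<theta>' = \<ominus> \<theta>"
    using x four[OF x(1)] by (simp add: \<theta>_def \<theta>'_def sub K.minus_add a_minus_def K.a_comm)
  have \<theta>'0: "\<theta>' \<noteq> \<zero>"
    using \<theta>0 inj \<theta>(1) h.hom_zero unfolding \<theta>'_def inj_on_def by (metis K.zero_closed)
  define e where "e = \<theta>' \<otimes> \<theta>"
  have e: "e \<in> carrier K" "e \<noteq> \<zero>" using \<theta> \<theta>0 \<theta>'0 by (simp_all add: e_def K.integral_iff)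
  have se: "\<sigma> e = \<ominus> e"
    using \<theta> by (simp add: e_def s\<theta>' \<theta>'_def[symmetric] K.l_minus K.r_minus K.m_comm)
  define a where "a = \<theta> \<otimes> \<theta>"
  define b where "b = \<theta>' \<otimes> \<theta>'"
  have ab: "a \<in> carrier K" "b \<in> carrier K" using \<theta> by (simp_all add: a_def b_def)
  have sa: "\<sigma> a = b" using \<theta> by (simp add: a_def b_def \<theta>'_def)
  have sb: "\<sigma> b = a" using \<theta> by (simp add: a_def b_def s\<theta>' K.l_minus K.r_minus)
  have ee: "e \<otimes> e = a \<otimes> b"
    using \<theta> by (simp add: e_def a_def b_def K.m_ac)
  define q' where "q' = (a \<ominus> b) \<otimes> inv e"
  have ie: "inv e \<in> carrier K" "inv e \<otimes> e = \<one>" using e K.field_Units by auto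
  have q': "q' \<in> carrier K" "q' \<otimes> e = a \<ominus> b"
    using ab ie e by (simp_all add: q'_def K.m_assoc)
  have "\<sigma> q' \<otimes> e = q' \<otimes> e"
  proof -
    have "\<sigma> (q' \<otimes> e) = b \<ominus> a" unfolding q'(2) using ab by (simp add: sub sa sb)
    then have "\<ominus> (\<sigma> q' \<otimes> e) = b \<ominus> a" using q'(1) e(1) by (simp add: se K.r_minus)
    then have "\<sigma> q' \<otimes> e = \<ominus> (b \<ominus> a)" using q'(1) e(1) by (metis K.minus_minus K.m_closed h.hom_closed)
    also have "\<dots> = a \<ominus> b" using ab by (simp add: a_minus_def K.minus_add K.a_comm)
    finally show ?thesis by (simp add: q'(2))
  qed
  then have "\<sigma> q' = q'" using K.m_rcancel[OF e(2) e(1) h.hom_closed[OF q'(1)] q'(1)] by simp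
  then obtain q where q: "q' = q \<odot> \<one>" using fixed[OF q'(1)] by (auto simp: scalars_def)
  obtain s where s: "s \<noteq> 0" "s\<^sup>2 = 4 + q\<^sup>2" using pythagorean[of q] by blast
  define S where "S = s \<odot> \<one>"
  have tf: "c \<otimes>\<^bsub>type_field\<^esub> d = c * d" "c \<oplus>\<^bsub>type_field\<^esub> d = c + d" for c d :: rxy
    by (simp_all add: ring_of_type_algebra_def)
  have im: "(c * d) \<odot> \<one> = (c \<odot> \<one>) \<otimes> (d \<odot> \<one>)"
    "(c + d) \<odot> \<one> = (c \<odot> \<one>) \<oplus> (d \<odot> \<one>)" "c \<odot> \<one> \<in> carrier K" for c d
    using i.hom_mult[of c d] i.hom_add[of c d] i.hom_closed[of c] by (simp_all add: type_field_simps tf)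
  have i0: "c \<odot> \<one> \<noteq> \<zero>" if "c \<noteq> 0" for c :: rxy
  proof
    assume z: "c \<odot> \<one> = \<zero>"
    have "\<one> = (c * inverse c) \<odot> \<one>" using i.hom_one that by (simp add: type_field_simps)
    also have "\<dots> = \<zero>" using z im(3)[of "inverse c"] by (simp only: im(1)) simp
    finally show False using K.one_not_zero by simp
  qed
  define T where "T = \<one> \<oplus> \<one>"
  have T2: "2 \<odot> \<one> = T"
  proof -
    have "2 = (1 :: rxy) + 1" by simp
    then show ?thesis using i.hom_one by (simp only: im(2)) (simp add: T_def type_field_simps)
  qed
  have T: "T \<in> carrier K" "T \<noteq> \<zero>" using i0[of 2] im(3)[of 2] by (simp_all add: T2)
  have S: "S \<in> carrier K" "S \<noteq> \<zero>" using i0[OF s(1)] im(3)[of s] by (simp_all add: S_def)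
  have SS: "S \<otimes> S = (T \<otimes> T) \<oplus> (q' \<otimes> q')"
  proof -
    have "s * s = 2 * 2 + q * q" using s(2) by (simp add: power2_eq_square)
    then show ?thesis unfolding S_def q T2[symmetric] im(1)[symmetric] im(2)[symmetric] by simp
  qed
  have sS: "\<sigma> S = S"
  proof -
    have "\<sigma> (s \<odot> \<one>) = s \<odot> \<sigma> \<one>"
      using cyc unfolding cyclic_extension_def algebra_iso_def by (simp add: type_field_simps)
    then show ?thesis by (simp add: S_def)
  qed
  define P where "P = a \<oplus> b"
  have P: "P \<in> carrier K" "\<sigma> P = P" using ab by (simp_all add: P_def sa sb K.a_comm)
  let ?Se = "S \<otimes> e"
  have Se: "?Se \<in> carrier K" "\<sigma> ?Se = \<ominus> ?Se" using S e by (simp_all add: sS se K.r_minus)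
  have "?Se \<otimes> ?Se = (S \<otimes> S) \<otimes> (e \<otimes> e)" using S e by (simp add: K.m_ac)
  also have "\<dots> = (T \<otimes> T) \<otimes> (e \<otimes> e) \<oplus> (q' \<otimes> e) \<otimes> (q' \<otimes> e)"
    unfolding SS using T(1) q'(1) e(1) by algebra
  also have "\<dots> = (T \<otimes> T) \<otimes> (a \<otimes> b) \<oplus> (a \<ominus> b) \<otimes> (a \<ominus> b)" unfolding ee q'(2) ..
  also have "\<dots> = P \<otimes> P" using ab unfolding T_def P_def by algebra
  finally have SeP: "?Se \<otimes> ?Se = P \<otimes> P" .
  have "(?Se \<ominus> P) \<otimes> (?Se \<oplus> P) = ?Se \<otimes> ?Se \<ominus> P \<otimes> P" using Se(1) P(1) by algebra
  also have "\<dots> = \<zero>" unfolding SeP using P by simp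
  finally have "?Se \<ominus> P = \<zero> \<or> ?Se \<oplus> P = \<zero>" using Se P by (simp add: K.integral_iff)
  then have "\<sigma> ?Se = ?Se"
  proof
    assume "?Se \<ominus> P = \<zero>"
    then have "?Se = P" using Se(1) P(1) by simp
    then show ?thesis using P(2) by simp
  next
    assume "?Se \<oplus> P = \<zero>"
    then have "?Se = \<ominus> P" using Se(1) P(1) by (metis K.minus_equality)
    then show ?thesis using P by simp
  qed
  \<comment> \<open>\<open>?Se\<close> is both fixed and negated by \<sigma>, so its double vanishes
    although none of the factors does.\<close>
  then have "T \<otimes> ?Se = \<zero>" using Se unfolding T_def by (metis K.l_distr K.l_neg K.l_one K.one_closed)
  then show False using T S e by (simp add: K.integral_iff)
qed

section \<open>The biquaternion algebra is not cyclic\<close>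

locale cyclic_DD =
  fixes K :: "(rxy, 'k) module" (structure) and n \<sigma> \<alpha> h and A :: "(rxy, nat \<Rightarrow> 'k) module"
  defines "A \<equiv> cyclic_algebra K n \<sigma> \<alpha>"
  assumes cyc: "cyclic_extension (type_field :: rxy ring) K n \<sigma>" and \<alpha>: "\<alpha> \<noteq> 0"
    and h: "h \<in> algebra_iso type_field DD A"
begin

lemma fieldK: "field K" using cyc by (simp add: cyclic_extension_def)

sublocale K: field K by (rule fieldK)

lemma assocK: "assoc_algebra (type_field :: rxy ring) K" using cyc by (simp add: cyclic_extension_def)

sublocale M: module "type_field :: rxy ring" K using assocK by (simp add: assoc_algebra_def)

lemma smult_mult:
  assumes "x \<in> carrier K" "y \<in> carrier K"
  shows "(c \<odot> x) \<otimes> y = c \<odot> (x \<otimes> y)"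
  using assocK assms unfolding assoc_algebra_def by (simp add: type_field_simps)

lemma smultK [simp]: "x \<in> carrier K \<Longrightarrow> c \<odot> x \<in> carrier K"
  using M.smult_closed[of c x] by (simp add: type_field_simps)

lemma smultK_0 [simp]: "c \<odot> \<zero> = \<zero>"
  using M.smult_r_null[of c] by (simp add: type_field_simps)

lemma hom\<sigma>: "\<sigma> \<in> ring_hom K K"
  using cyc by (simp add: cyclic_extension_def algebra_iso_def ring_iso_def)

sublocale s: ring_hom_ring K K \<sigma> by (intro ring_hom_ringI2 K.ring_axioms hom\<sigma>)

lemma pow\<sigma> [simp]:
  "x \<in> carrier K \<Longrightarrow> (\<sigma> ^^ i) x \<in> carrier K" "(\<sigma> ^^ i) \<zero> = \<zero>" "(\<sigma> ^^ i) \<one> = \<one>"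
  by (induction i) simp_all

lemma A_simps:
  "carrier A = {..<n} \<rightarrow>\<^sub>E carrier K" "\<zero>\<^bsub>A\<^esub> = (\<lambda>k\<in>{..<n}. \<zero>)" "f \<oplus>\<^bsub>A\<^esub> g = (\<lambda>k\<in>{..<n}. f k \<oplus> g k)"
  "c \<odot>\<^bsub>A\<^esub> f = (\<lambda>k\<in>{..<n}. c \<odot> f k)" "\<one>\<^bsub>A\<^esub> = (\<lambda>k\<in>{..<n}. if k = 0 then \<one> else \<zero>)"
  by (simp_all add: A_def cyclic_algebra_def)

lemma A_mult:
  "f \<otimes>\<^bsub>A\<^esub> g = (\<lambda>k\<in>{..<n}. \<Oplus>i\<in>{..<n}.
     (if i \<le> k then f i \<otimes> (\<sigma> ^^ i) (g (k - i)) else \<alpha> \<odot> (f i \<otimes> (\<sigma> ^^ i) (g (n + k - i)))))"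
  by (simp add: A_def cyclic_algebra_def)

lemma A_nth: "f \<in> carrier A \<Longrightarrow> k < n \<Longrightarrow> f k \<in> carrier K" by (auto simp: A_simps)

lemma A_eqI: "f \<in> carrier A \<Longrightarrow> g \<in> carrier A \<Longrightarrow> (\<And>k. k < n \<Longrightarrow> f k = g k) \<Longrightarrow> f = g"
  unfolding A_simps by (rule PiE_ext) auto

text \<open>The element \<open>b Z^i\<close> of the cyclic algebra.\<close>

definition mz :: "'k \<Rightarrow> nat \<Rightarrow> nat \<Rightarrow> 'k" where "mz b i = (\<lambda>k\<in>{..<n}. if k = i then b else \<zero>)"

lemma mz_in: "b \<in> carrier K \<Longrightarrow> mz b i \<in> carrier A" by (simp add: mz_def A_simps)

lemma mz_nth: "k < n \<Longrightarrow> mz b i k = (if k = i then b else \<zero>)" by (simp add: mz_def)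

lemma finsum_one:
  assumes "i < n" "t \<in> carrier K" "\<And>j. j < n \<Longrightarrow> F j = (if j = i then t else \<zero>)"
  shows "(\<Oplus>j\<in>{..<n}. F j) = t"
proof -
  have "(\<Oplus>j\<in>{..<n}. F j) = (\<Oplus>j\<in>{..<n}. if i = j then t else \<zero>)"
    using assms(2,3) by (intro K.finsum_cong') auto
  also have "\<dots> = t" using K.finsum_singleton[of i "{..<n}" "\<lambda>_. t"] assms(1,2) by simp
  finally show ?thesis .
qed

lemma mz_mult:
  assumes b: "b \<in> carrier K" and i: "i < n" and g: "g \<in> carrier A" and k: "k < n"
  shows "(mz b i \<otimes>\<^bsub>A\<^esub> g) k =
    (if i \<le> k then b \<otimes> (\<sigma> ^^ i) (g (k - i)) else \<alpha> \<odot> (b \<otimes> (\<sigma> ^^ i) (g (n + k - i))))" (is "_ = ?t")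
proof -
  have g': "g (k - j) \<in> carrier K" "j > k \<Longrightarrow> j < n \<Longrightarrow> g (n + k - j) \<in> carrier K" for j
    using A_nth[OF g] k by simp_all
  have "(mz b i \<otimes>\<^bsub>A\<^esub> g) k = (\<Oplus>j\<in>{..<n}. (if j \<le> k then mz b i j \<otimes> (\<sigma> ^^ j) (g (k - j))
    else \<alpha> \<odot> (mz b i j \<otimes> (\<sigma> ^^ j) (g (n + k - j)))))"
    using k by (simp add: A_mult)
  also have "\<dots> = ?t" by (rule finsum_one[OF i]) (use b i g' in \<open>auto simp: mz_nth\<close>)
  finally show ?thesis .
qed

lemma h_iso: "h \<in> ring_iso DD A" and h_smult: "h (c \<odot>\<^bsub>DD\<^esub> x) = c \<odot>\<^bsub>A\<^esub> h x"
  using h by (auto simp: algebra_iso_def type_field_simps DD_simps(1))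

lemma h_props:
  "h x \<in> carrier A" "h (x \<otimes>\<^bsub>DD\<^esub> y) = h x \<otimes>\<^bsub>A\<^esub> h y" "h (x \<oplus>\<^bsub>DD\<^esub> y) = h x \<oplus>\<^bsub>A\<^esub> h y" "h \<one>\<^bsub>DD\<^esub> = \<one>\<^bsub>A\<^esub>"
  "inj h" "range h = carrier A"
  using h_iso by (auto simp: ring_iso_def ring_hom_def DD_simps(1) bij_betw_def)

lemma h_zero: "h \<zero>\<^bsub>DD\<^esub> = \<zero>\<^bsub>A\<^esub>"
proof (rule A_eqI[OF h_props(1)])
  show "\<zero>\<^bsub>A\<^esub> \<in> carrier A" by (simp add: A_simps)
  fix k assume k: "k < n"
  have "h \<zero>\<^bsub>DD\<^esub> \<oplus>\<^bsub>A\<^esub> h \<zero>\<^bsub>DD\<^esub> = h \<zero>\<^bsub>DD\<^esub>" unfolding h_props(3)[symmetric] by (simp add: DD_simps)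
  from fun_cong[OF this, of k] have "h \<zero>\<^bsub>DD\<^esub> k \<oplus> h \<zero>\<^bsub>DD\<^esub> k = h \<zero>\<^bsub>DD\<^esub> k" using k by (simp add: A_simps)
  then show "h \<zero>\<^bsub>DD\<^esub> k = \<zero>\<^bsub>A\<^esub> k" using k A_nth[OF h_props(1) k, of "\<zero>\<^bsub>DD\<^esub>"] by (simp add: A_simps)
qed

text \<open>The ring axioms of the cyclic algebra are transported from D instead of being derived
  from properties of \<sigma>; conversely, its associativity later yields information on
  \<sigma>.\<close>

lemma ringA: "ring A"
proof -
  interpret D: ring DD by (rule ring_DD)
  from D.ring_iso_imp_img_ring[OF h_iso] show ?thesis by (simp add: h_zero)
qed

sublocale A: ring A by (rule ringA)

lemma hom_h: "ring_hom_ring DD A h"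
  by (intro ring_hom_ringI2 ring_DD A.ring_axioms) (use h_iso in \<open>simp add: ring_iso_def\<close>)

lemma n_pos: "0 < n"
proof (rule ccontr)
  assume "\<not> 0 < n"
  then have "h \<one>\<^bsub>DD\<^esub> = h \<zero>\<^bsub>DD\<^esub>" by (simp add: h_zero h_props(4) A_simps restrict_def)
  then show False using h_props(5) one_DD by (simp add: inj_eq)
qed

lemma oneA: "\<one>\<^bsub>A\<^esub> \<noteq> \<zero>\<^bsub>A\<^esub>"
proof
  assume "\<one>\<^bsub>A\<^esub> = \<zero>\<^bsub>A\<^esub>"
  then have "\<one>\<^bsub>A\<^esub> 0 = \<zero>\<^bsub>A\<^esub> 0" by simp
  then show False using n_pos by (simp add: A_simps)
qed

lemma mz0_mult:
  assumes "b \<in> carrier K" "c \<in> carrier K" shows "mz b 0 \<otimes>\<^bsub>A\<^esub> mz c i = mz (b \<otimes> c) i"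
  by (rule A_eqI) (use assms n_pos in \<open>auto simp: mz_in mz_mult mz_nth\<close>)

lemma hom_mz0: "ring_hom_ring K A (\<lambda>b. mz b 0)"
proof (intro ring_hom_ringI2 K.ring_axioms A.ring_axioms ring_hom_memI)
  fix b c assume bc: "b \<in> carrier K" "c \<in> carrier K"
  show "mz (b \<otimes> c) 0 = mz b 0 \<otimes>\<^bsub>A\<^esub> mz c 0" using mz0_mult[OF bc] by simp
  show "mz (b \<oplus> c) 0 = mz b 0 \<oplus>\<^bsub>A\<^esub> mz c 0" by (auto simp: mz_def A_simps fun_eq_iff restrict_def)
next
  show "mz \<one> 0 = \<one>\<^bsub>A\<^esub>" by (simp add: mz_def A_simps)
qed (rule mz_in)

text \<open>K acts from the left through \<open>mz b 0\<close>, and the powers of Z form a basis,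
  added one at a time.\<close>

lemma dim_over_K: "A.dimension n ((\<lambda>b. mz b 0) ` carrier K) (carrier A)"
proof -
  let ?K = "(\<lambda>b. mz b 0) ` carrier K"
  have "A.dimension m ?K {f \<in> carrier A. \<forall>k. m \<le> k \<longrightarrow> k < n \<longrightarrow> f k = \<zero>}" if "m \<le> n" for m
    using that
  proof (induction m)
    case 0
    have "{f \<in> carrier A. \<forall>k. 0 \<le> k \<longrightarrow> k < n \<longrightarrow> f k = \<zero>} = {\<zero>\<^bsub>A\<^esub>}"
      by (auto intro!: A_eqI) (auto simp: A_simps)
    then show ?case using A.zero_dim by simp
  next
    case (Suc m)
    let ?E = "\<lambda>m. {f \<in> carrier A. \<forall>k. m \<le> k \<longrightarrow> k < n \<longrightarrow> f k = \<zero>}"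
    have m: "m < n" using Suc by simp
    have "A.line_extension ?K (mz \<one> m) (?E m) = ?E (Suc m)"
    proof (rule Set.set_eqI, rule iffI)
      fix f assume "f \<in> A.line_extension ?K (mz \<one> m) (?E m)"
      then obtain b g where f: "b \<in> carrier K" "g \<in> ?E m" "f = mz b 0 \<otimes>\<^bsub>A\<^esub> mz \<one> m \<oplus>\<^bsub>A\<^esub> g"
        unfolding A.line_extension_mem_iff by blast
      then have "f = mz b m \<oplus>\<^bsub>A\<^esub> g" by (simp add: mz0_mult)
      then show "f \<in> ?E (Suc m)" using f(1,2) by (auto simp: mz_in) (simp add: A_simps mz_nth)
    next
      fix f assume f: "f \<in> ?E (Suc m)"
      let ?g = "\<lambda>k\<in>{..<n}. if k = m then \<zero> else f k"
      have g: "?g \<in> ?E m" using f by (auto simp: A_simps)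
      have fm: "f m \<in> carrier K" using f m by (auto intro: A_nth)
      have "f = mz (f m) m \<oplus>\<^bsub>A\<^esub> ?g"
      proof (rule A_eqI)
        show "mz (f m) m \<oplus>\<^bsub>A\<^esub> ?g \<in> carrier A" using g fm by (intro A.a_closed mz_in) auto
        show "f k = (mz (f m) m \<oplus>\<^bsub>A\<^esub> ?g) k" if "k < n" for k
          using that f fm A_nth[of f k] by (auto simp: A_simps(3) mz_nth)
      qed (use f in simp)
      then have "f = mz (f m) 0 \<otimes>\<^bsub>A\<^esub> mz \<one> m \<oplus>\<^bsub>A\<^esub> ?g" using fm by (simp add: mz0_mult)
      then show "f \<in> A.line_extension ?K (mz \<one> m) (?E m)"
        unfolding A.line_extension_mem_iff using g fm by blast
    qed
    moreover have "mz \<one> m \<notin> ?E m" using m by (auto simp: mz_nth)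
    ultimately show ?case using A.Suc_dim[OF mz_in[OF K.one_closed] _ Suc.IH, of m] m by simp
  qed
  from this[of n] show ?thesis by simp
qed

text \<open>The dimension over F is 16 by the isomorphism with D, and the square of n by the tower
  through the copy of K.\<close>

lemma n_eq_4: "n = 4"
proof -
  interpret hh: ring_hom_ring DD A h by (rule hom_h)
  interpret hm: ring_hom_ring K A "\<lambda>b. mz b 0" by (rule hom_mz0)
  let ?F = "scalars type_field A" and ?K = "(\<lambda>b. mz b 0) ` carrier K"
  have sD: "h ` scalars type_field DD = ?F"
    by (auto simp: scalars_def image_image h_smult h_props(4))
  have "c \<odot>\<^bsub>A\<^esub> \<one>\<^bsub>A\<^esub> = mz (c \<odot> \<one>) 0" for c by (auto simp: A_simps mz_def fun_eq_iff)
  then have sK: "(\<lambda>b. mz b 0) ` scalars type_field K = ?F"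
    by (auto simp: scalars_def image_image)
  have subF: "subfield ?F A"
    unfolding sD[symmetric] by (rule hh.img_is_subfield(2)[OF subfield_scalars[OF field_type_field DD_assoc one_DD] oneA])
  have subK: "subfield ?K A" by (rule hm.img_is_subfield(2)[OF K.carrier_is_subfield oneA])
  have "A.dimension 16 (h ` scalars type_field DD) (h ` carrier DD)"
    by (rule hh.inj_hom_dimension[OF subfield_scalars[OF field_type_field DD_assoc one_DD] oneA _ dimension_DD])
       (use h_props(5) in \<open>simp add: DD_simps(1)\<close>)
  then have 16: "A.dimension 16 ?F (carrier A)" unfolding sD by (simp add: DD_simps(1) h_props(6))
  have "inj_on (\<lambda>b. mz b 0) (carrier K)"
    by (rule inj_onI) (metis mz_nth n_pos)
  moreover have "ring.dimension K n (scalars type_field K) (carrier K)" using cyc by (simp add: cyclic_extension_def)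
  ultimately have "A.dimension n ?F ?K"
    using hm.inj_hom_dimension[OF subfield_scalars[OF field_type_field assocK K.one_not_zero] oneA] sK by auto
  from A.telescopic_base[OF subF subK this dim_over_K] have "n * n = 16"
    using A.dimension_is_inj[OF subF _ 16] by blast
  then show ?thesis using mult_le_mono[of n 3 n 3] mult_le_mono[of 5 n 5 n] by (cases n "4 :: nat" rule: linorder_cases) auto
qed

lemma less_n: "k < n \<longleftrightarrow> k < 4" by (simp add: n_eq_4)

lemma mz_nth4: "m < 4 \<Longrightarrow> mz b i m = (if m = i then b else \<zero>)"
  by (rule mz_nth) (simp add: less_n)

lemma Z_mult:
  assumes g: "g \<in> carrier A" and k: "k < n"
  shows "(mz \<one> 2 \<otimes>\<^bsub>A\<^esub> g) k = (if 2 \<le> k then \<sigma> (\<sigma> (g (k - 2))) else \<alpha> \<odot> \<sigma> (\<sigma> (g (k + 2))))"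
proof -
  have "n + k - 2 = k + 2" by (simp add: n_eq_4)
  moreover have "g (k - 2) \<in> carrier K" "\<not> 2 \<le> k \<Longrightarrow> g (k + 2) \<in> carrier K"
    using A_nth[OF g, of "k - 2"] A_nth[OF g, of "k + 2"] k by (simp_all add: less_n)
  ultimately show ?thesis
    using mz_mult[OF K.one_closed _ g k, of 2] by (simp add: less_n numeral_2_eq_2 del: add_2_eq_Suc add_2_eq_Suc')
qed

text \<open>Otherwise \<open>Z^2\<close> would commute with everything; but the centre is F, and
  \<open>Z^2\<close> is not a scalar since 2 < n.\<close>

lemma sigma_2: "\<exists>x\<in>carrier K. \<sigma> (\<sigma> x) \<noteq> x"
proof (rule ccontr)
  assume "\<not> ?thesis"
  then have 2: "\<sigma> (\<sigma> x) = x" if "x \<in> carrier K" for x using that by blast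
  let ?Z = "mz \<one> 2"
  have Z: "?Z \<in> carrier A" by (rule mz_in) simp
  have comm: "?Z \<otimes>\<^bsub>A\<^esub> f = f \<otimes>\<^bsub>A\<^esub> ?Z" if f: "f \<in> carrier A" for f
  proof (rule A_eqI)
    fix k assume k: "k < n"
    have fk: "f j \<in> carrier K" if "j < n" for j using A_nth[OF f that] .
    have l: "(?Z \<otimes>\<^bsub>A\<^esub> f) k = (if 2 \<le> k then f (k - 2) else \<alpha> \<odot> f (k + 2))"
      using Z_mult[OF f k] fk[of "k - 2"] fk[of "k + 2"] k by (simp add: 2 less_n)
    have "(f \<otimes>\<^bsub>A\<^esub> ?Z) k = (if 2 \<le> k then f (k - 2) else \<alpha> \<odot> f (k + 2))"
    proof -
      \<comment> \<open>The one index j at which the factor \<open>Z^2\<close> contributes: j + 2 is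
        k or k + 4.\<close>
      let ?i = "if 2 \<le> k then k - 2 else k + 2"
      let ?t = "if 2 \<le> k then f (k - 2) else \<alpha> \<odot> f (k + 2)"
      have i: "?i < n" using k n_eq_4 by auto
      have t: "?t \<in> carrier K" using fk[of "k - 2"] fk[of "k + 2"] k n_eq_4 by auto
      have "(f \<otimes>\<^bsub>A\<^esub> ?Z) k = (\<Oplus>j\<in>{..<n}. if j \<le> k then f j \<otimes> (\<sigma> ^^ j) (?Z (k - j))
        else \<alpha> \<odot> (f j \<otimes> (\<sigma> ^^ j) (?Z (n + k - j))))"
        using k by (simp add: A_mult)
      also have "\<dots> = ?t"
      proof (rule finsum_one[OF i t])
        fix j assume j: "j < n"
        have "n + k - j = 4 + k - j" by (simp add: n_eq_4)
        moreover have "?Z (k - j) = (if k - j = 2 then \<one> else \<zero>)"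
          "k < j \<Longrightarrow> ?Z (4 + k - j) = (if 4 + k - j = 2 then \<one> else \<zero>)"
          using k by (simp_all add: mz_nth4 less_n)
        ultimately show "(if j \<le> k then f j \<otimes> (\<sigma> ^^ j) (?Z (k - j))
          else \<alpha> \<odot> (f j \<otimes> (\<sigma> ^^ j) (?Z (n + k - j)))) = (if j = ?i then ?t else \<zero>)"
          using j k fk[OF j] by (auto simp: less_n)
      qed
      finally show ?thesis .
    qed
    then show "(?Z \<otimes>\<^bsub>A\<^esub> f) k = (f \<otimes>\<^bsub>A\<^esub> ?Z) k" using l by simp
  qed (use f Z in simp_all)
  obtain z where z: "h z = ?Z" using h_props(6) Z by (metis rangeE)
  have "z \<in> ring_center DD"
  proof -
    have "z \<otimes>\<^bsub>DD\<^esub> x = x \<otimes>\<^bsub>DD\<^esub> z" for x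
      using comm[OF h_props(1)[of x]] h_props(5) by (metis h_props(2) injD z)
    then show ?thesis by (simp add: ring_center_def DD_simps(1))
  qed
  then obtain c where "z = c \<odot>\<^bsub>DD\<^esub> \<one>\<^bsub>DD\<^esub>" unfolding center_DD by (auto simp: scalars_def)
  then have "?Z = c \<odot>\<^bsub>A\<^esub> \<one>\<^bsub>A\<^esub>" using z by (simp add: h_smult h_props(4))
  from fun_cong[OF this, of 2] have "\<one> = c \<odot> \<zero>" by (simp add: mz_nth4 A_simps less_n)
  then show False by simp
qed

text \<open>Multiply x by \<open>Z^4\<close> in two ways: it acts as the scalar \<alpha>, and moving
  x through \<open>Z^2\<close> twice applies \<sigma> four times.\<close>

lemma sigma_4: assumes x: "x \<in> carrier K" shows "\<sigma> (\<sigma> (\<sigma> (\<sigma> x))) = x"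
proof -
  let ?Z = "mz \<one> 2"
  have Z: "?Z \<in> carrier A" by (rule mz_in) simp
  have Z2: "?Z \<otimes>\<^bsub>A\<^esub> mz c 2 = mz (\<alpha> \<odot> \<sigma> (\<sigma> c)) 0" if c: "c \<in> carrier K" for c
    by (rule A_eqI) (use c in \<open>auto simp: mz_in Z_mult Z less_n mz_nth4\<close>)
  have Z0: "?Z \<otimes>\<^bsub>A\<^esub> mz c 0 = mz (\<sigma> (\<sigma> c)) 2" if c: "c \<in> carrier K" for c
    by (rule A_eqI) (use c in \<open>auto simp: mz_in Z_mult Z less_n mz_nth4\<close>)
  have "(?Z \<otimes>\<^bsub>A\<^esub> ?Z) \<otimes>\<^bsub>A\<^esub> mz x 0 = ?Z \<otimes>\<^bsub>A\<^esub> (?Z \<otimes>\<^bsub>A\<^esub> mz x 0)"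
    by (rule A.m_assoc[OF Z Z mz_in[OF x]])
  then have "mz ((\<alpha> \<odot> \<one>) \<otimes> x) 0 = mz (\<alpha> \<odot> \<sigma> (\<sigma> (\<sigma> (\<sigma> x)))) 0"
    using x by (simp add: Z0 Z2 mz0_mult)
  from fun_cong[OF this, of 0] have "\<alpha> \<odot> x = \<alpha> \<odot> \<sigma> (\<sigma> (\<sigma> (\<sigma> x)))"
    using x n_pos by (simp add: mz_nth smult_mult)
  then have "inverse \<alpha> \<odot> (\<alpha> \<odot> x) = inverse \<alpha> \<odot> (\<alpha> \<odot> \<sigma> (\<sigma> (\<sigma> (\<sigma> x))))" by simp
  moreover have "inverse \<alpha> \<odot> (\<alpha> \<odot> y) = y" if "y \<in> carrier K" for y
    using M.smult_assoc1[of "inverse \<alpha>" \<alpha> y] M.smult_one[of y] that \<alpha> by (simp add: ring_of_type_algebra_def)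
  ultimately show ?thesis using x by simp
qed

lemma impossible: False
  using sigma_2 no_cyclic_quartic[OF cyc sigma_4] by blast

end

theorem noncyclic_DD: "noncyclic_algebra TYPE('k) type_field DD"
proof -
  have False if "cyclic_extension type_field (K :: (rxy, 'k) module) n \<sigma>" "\<alpha> \<noteq> 0"
    "h \<in> algebra_iso type_field DD (cyclic_algebra K n \<sigma> \<alpha>)" for K n \<sigma> \<alpha> h
    by (rule cyclic_DD.impossible[of K n \<sigma> \<alpha> h]) (use that in \<open>simp add: cyclic_DD_def\<close>)
  then show ?thesis
    unfolding noncyclic_algebra_def is_cyclic_algebra_def center_DD by (auto simp: type_field_simps)
qed

unbundle no fps_syntax

theorem theorem4p3:
  fixes x y :: "real fls fls"
  defines "x \<equiv> fls_const fls_X" and "y \<equiv> fls_X"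
  defines "F \<equiv> ring_of_type_algebra :: real fls fls ring"
  defines "D1 \<equiv> quaternion_algebra x (- 1)" and "D2 \<equiv> quaternion_algebra (- x) y"
  defines "D \<equiv> tensor_algebra D1 D2"
  shows "division_algebra F D \<and> noncyclic_algebra TYPE('k) F D \<and>
    ring.dimension D 16 (scalars F D) (carrier D) \<and> algebra_dp_rank TYPE('n) F D = 16"
proof -
  have xy: "x = fX" "y = fY" by (simp_all add: x_def y_def fX_def fY_def)
  have D: "D = DD" by (simp add: D_def D1_def D2_def xy)
  have "algebra_dp_rank TYPE('n) F D = 16"
    unfolding algebra_dp_rank_def D F_def dim_DD dp_rank_affine by (simp add: numeral_eq_enat)
  then show ?thesis
    unfolding D F_def using division_DD noncyclic_DD dimension_DD by simp
qed

end
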